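(* Suppose $u \in \mathcal{U}$. Then the following are equivalent: (a) $\displaystyle\lim_{z \to \partial D} \bigl(\tilde{u}(z) - u(z)\bigr) = 0$; (b) $\tilde{u} = u$ on $\mathcal{M} \setminus D$; (c) $u \in \mathrm{HOP}$; (d) $\tilde{u} \in \mathrm{HOP}$; (e) $T_{\tilde{u}} - T_u$ is a compact operator; (f) $\displaystyle\lim_{z \to \partial D} \int_D (u \circ \phi_z)(w)\,(2|w|^2 - 1)\,dA(w) = 0$; (g) $\displaystyle\lim_{z \to \partial D} (1 - |z|^2)^2 (\Delta \tilde{u})(z) = 0$. If $u$ is a finite sum of functions of the form $u_1 \cdots u_n$, where each $u_j$ is a bounded harmonic function on $D$, then the conditions above are also equivalent to the condition: (h) $\displaystyle\lim_{z \to \partial D} (1 - |z|^2)^2 (\Delta u)(z) = 0$.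
   Context: $D$ is the open unit disk in $\mathbb{C}$ and $dA$ is area measure on $D$ normalized so that $D$ has measure $1$. The Bergman space $L^2_a$ is the Hilbert space of analytic functions on $D$ lying in $L^2(D,dA)$. For $u\in L^\infty(D,dA)$, $T_u$ is the Toeplitz operator on $L^2_a$, $T_uf=P(uf)$, with $P$ the orthogonal projection of $L^2(D,dA)$ onto $L^2_a$. For $z\in D$, $k_z(w)=(1-|z|^2)/(1-\bar z w)^2$ is the normalized Bergman reproducing kernel. The Berezin transform of $u\in L^\infty(D,dA)$ is the function on $D$ given by $\tilde u(z)=\int_D u(w)|k_z(w)|^2\,dA(w)$; it is real analytic on $D$. $\Delta$ is the usual Laplacian, $\Delta=4\,\partial^2/\partial z\,\partial\bar z$. $\lim_{z\to\partial D}$ means the limit as $|z|\to1$, $z\in D$. $H^\infty$ is the algebra of bounded analytic functions on $D$. $\mathcal{U}$ is the $C^*$-subalgebra of $L^\infty(D,dA)$ generated by $H^\infty$ (it equals the closed subalgebra generated by the bounded harmonic functions on $D$). $\mathcal{M}$ is the maximal ideal space of $H^\infty$: the set of multiplicative linear maps of $H^\infty$ onto $\mathbb{C}$, with the weak-star topology (a compact Hausdorff space). $D$ is regarded as a subset of $\mathcal{M}$ via point evaluations, and is dense in $\mathcal{M}$ (corona theorem). Via the Gelfand transform, $\mathcal{U}$ is identified with $C(\mathcal{M})$: each $u\in\mathcal{U}$ is a continuous function on $D$ that extends uniquely to a continuous function on $\mathcal{M}$, also denoted $u$. The Berezin transform maps $\mathcal{U}$ into $\mathcal{U}$, so $\tilde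 u$ is also regarded as a continuous function on $\mathcal{M}$. For $z\in D$ let $\phi_z(w)=\frac{z-w}{1-\bar z w}$. For $m\in\mathcal{M}$, the Hoffman map $\phi_m\colon D\to\mathcal{M}$ is $\phi_m(w)=\lim_{z\to m}\phi_z(w)$ (limit in $\mathcal{M}$ along $z\in D$; it exists, and $\phi_m$ is continuous, by Hoffman). $\mathrm{HOP}$ ("harmonic on parts") is the set of functions $u\in\mathcal{U}$ such that $u\circ\phi_m$ is harmonic on $D$ for every $m\in\mathcal{M}\setminus D$. *)

theory Defs
  imports "HOL-Analysis.Analysis" "HOL-Probability.Probability"
    "HOL-Complex_Analysis.Complex_Analysis" "HOL-Library.Going_To_Filter"
begin

text \<open>
  Functions on the open unit disk are modelled as total functions on the complex plane.
  Where a function on the disk has to be a single object (members of the Bergman space and of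
  the algebra of bounded analytic functions), it is normalised to be 0 off the disk; everywhere
  else the values off the disk are irrelevant.
\<close>

abbreviation disk :: "complex set" where
  "disk \<equiv> ball 0 1"

definition dA :: "complex measure" where
  "dA = uniform_measure (restrict_space lborel disk) disk"

text \<open>The filter of points of the disk approaching its boundary.\<close>

definition to_boundary :: "complex filter" where
  "to_boundary = cmod going_to (nhds 1) within disk"

subsection \<open>Wirtinger derivatives, Laplacian, harmonic functions\<close>

definition partial_x :: "(complex \<Rightarrow> complex) \<Rightarrow> complex \<Rightarrow> complex" where
  "partial_x f z = vector_derivative (\<lambda>t. f (z + complex_of_real t)) (at 0)"

definition partial_y :: "(complex \<Rightarrow> complex) \<Rightarrow> complex \<Rightarrow> complex" where
  "partial_y f z = vector_derivative (\<lambda>t. f (z + \<i> * complex_of_real t)) (at 0)"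

definition wirtinger :: "(complex \<Rightarrow> complex) \<Rightarrow> complex \<Rightarrow> complex" where
  "wirtinger f z = (partial_x f z - \<i> * partial_y f z) / 2"

definition wirtinger_bar :: "(complex \<Rightarrow> complex) \<Rightarrow> complex \<Rightarrow> complex" where
  "wirtinger_bar f z = (partial_x f z + \<i> * partial_y f z) / 2"

definition laplacian :: "(complex \<Rightarrow> complex) \<Rightarrow> complex \<Rightarrow> complex" where
  "laplacian f z = 4 * wirtinger (wirtinger_bar f) z"

text \<open>Twice continuously differentiable in the real sense; the derivatives are Frechet
  derivatives of maps between real normed spaces.\<close>

definition C2_on :: "(complex \<Rightarrow> complex) \<Rightarrow> complex set \<Rightarrow> bool" where
  "C2_on f S \<longleftrightarrow>
    (\<exists>(f' :: complex \<Rightarrow> complex \<Rightarrow>\<^sub>L complex) (f'' :: complex \<Rightarrow> complex \<Rightarrow>\<^sub>L complex \<Rightarrow>\<^sub>L complex).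
      (\<forall>z\<in>S. (f has_derivative blinfun_apply (f' z)) (at z)) \<and>
      (\<forall>z\<in>S. (f' has_derivative blinfun_apply (f'' z)) (at z)) \<and>
      continuous_on S f'')"

definition harmonic_on_disk :: "(complex \<Rightarrow> complex) \<Rightarrow> bool" where
  "harmonic_on_disk f \<longleftrightarrow> C2_on f disk \<and> (\<forall>z\<in>disk. laplacian f z = 0)"

definition bounded_harmonic :: "(complex \<Rightarrow> complex) \<Rightarrow> bool" where
  "bounded_harmonic f \<longleftrightarrow> harmonic_on_disk f \<and> bounded (f ` disk)"

definition sum_of_products_of_bounded_harmonic :: "(complex \<Rightarrow> complex) \<Rightarrow> bool" where
  "sum_of_products_of_bounded_harmonic u \<longleftrightarrow>
    (\<exists>vss :: (complex \<Rightarrow> complex) list list.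
      (\<forall>vs\<in>set vss. vs \<noteq> [] \<and> (\<forall>v\<in>set vs. bounded_harmonic v)) \<and>
      (\<forall>z\<in>disk. u z = (\<Sum>vs\<leftarrow>vss. \<Prod>v\<leftarrow>vs. v z)))"

subsection \<open>Bergman space, Toeplitz operators, Berezin transform\<close>

definition L2_inner :: "(complex \<Rightarrow> complex) \<Rightarrow> (complex \<Rightarrow> complex) \<Rightarrow> complex" where
  "L2_inner f g = (LINT z|dA. f z * cnj (g z))"

definition L2_norm :: "(complex \<Rightarrow> complex) \<Rightarrow> real" where
  "L2_norm f = sqrt (LINT z|dA. (cmod (f z))\<^sup>2)"

definition bergman_space :: "(complex \<Rightarrow> complex) set" where
  "bergman_space = {f. f holomorphic_on disk \<and> integrable dA (\<lambda>z. (cmod (f z))\<^sup>2) \<and>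
     (\<forall>z. z \<notin> disk \<longrightarrow> f z = 0)}"

text \<open>Orthogonal projection onto the Bergman space, meaningful for square-integrable arguments.\<close>

definition bergman_proj :: "(complex \<Rightarrow> complex) \<Rightarrow> complex \<Rightarrow> complex" where
  "bergman_proj g = (THE h. h \<in> bergman_space \<and>
     (\<forall>f\<in>bergman_space. L2_inner (\<lambda>z. g z - h z) f = 0))"

definition toeplitz :: "(complex \<Rightarrow> complex) \<Rightarrow> (complex \<Rightarrow> complex) \<Rightarrow> complex \<Rightarrow> complex" where
  "toeplitz u f = bergman_proj (\<lambda>w. u w * f w)"

text \<open>Compactness of a linear operator on the Bergman space: the image of every norm-bounded
  sequence has a norm-convergent subsequence.\<close>

definition compact_on_bergman ::
    "((complex \<Rightarrow> complex) \<Rightarrow> complex \<Rightarrow> complex) \<Rightarrow> bool" where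
  "compact_on_bergman T \<longleftrightarrow>
    (\<forall>f :: nat \<Rightarrow> complex \<Rightarrow> complex.
      (\<forall>n. f n \<in> bergman_space) \<and> (\<exists>C. \<forall>n. L2_norm (f n) \<le> C) \<longrightarrow>
      (\<exists>r g. strict_mono (r :: nat \<Rightarrow> nat) \<and> g \<in> bergman_space \<and>
        (\<lambda>n. L2_norm (\<lambda>z. T (f (r n)) z - g z)) \<longlonglongrightarrow> 0))"

definition bergman_kernel :: "complex \<Rightarrow> complex \<Rightarrow> complex" where
  "bergman_kernel z w = complex_of_real (1 - (cmod z)\<^sup>2) / (1 - cnj z * w)\<^sup>2"

definition berezin :: "(complex \<Rightarrow> complex) \<Rightarrow> complex \<Rightarrow> complex" where
  "berezin u z = (LINT w|dA. u w * complex_of_real ((cmod (bergman_kernel z w))\<^sup>2))"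

subsection \<open>Bounded analytic functions and the C*-algebra they generate\<close>

definition Hinf :: "(complex \<Rightarrow> complex) set" where
  "Hinf = {f. f holomorphic_on disk \<and> bounded (f ` disk) \<and> (\<forall>z. z \<notin> disk \<longrightarrow> f z = 0)}"

definition Linf :: "(complex \<Rightarrow> complex) set" where
  "Linf = {u \<in> borel_measurable dA. esssup dA (\<lambda>z. ereal (cmod (u z))) < \<infinity>}"

text \<open>
  The elements of the Lebesgue space are represented by functions rather than by classes. The
  closure condition, applied to constant sequences, makes a subalgebra invariant under changes
  on null sets, so that it is a union of classes.
\<close>

definition cstar_subalgebra :: "(complex \<Rightarrow> complex) set \<Rightarrow> bool" where
  "cstar_subalgebra A \<longleftrightarrow> A \<subseteq> Linf \<and>
     (\<forall>f\<in>A. \<forall>g\<in>A. (\<lambda>z. f z + g z) \<in> A) \<and>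
     (\<forall>f\<in>A. \<forall>g\<in>A. (\<lambda>z. f z * g z) \<in> A) \<and>
     (\<forall>c. \<forall>f\<in>A. (\<lambda>z. c * f z) \<in> A) \<and>
     (\<forall>f\<in>A. (\<lambda>z. cnj (f z)) \<in> A) \<and>
     (\<forall>f u. (\<forall>n. f n \<in> A) \<and> u \<in> Linf \<and>
        (\<lambda>n::nat. esssup dA (\<lambda>z. ereal (cmod (f n z - u z)))) \<longlonglongrightarrow> 0 \<longrightarrow> u \<in> A)"

definition cstar_generated :: "(complex \<Rightarrow> complex) set \<Rightarrow> (complex \<Rightarrow> complex) set" where
  "cstar_generated S = \<Inter>{A. cstar_subalgebra A \<and> S \<subseteq> A}"

text \<open>Every class in the generated algebra has a representative continuous on the disk, unique up to
  its values off the disk; that representative is the one meant by a member of the algebra.\<close>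

definition algU :: "(complex \<Rightarrow> complex) set" where
  "algU = {u \<in> cstar_generated Hinf. continuous_on disk u}"

subsection \<open>Maximal ideal space and Hoffman maps\<close>

definition maxideals :: "((complex \<Rightarrow> complex) \<Rightarrow> complex) set" where
  "maxideals = {m \<in> extensional Hinf.
     (\<forall>f\<in>Hinf. \<forall>g\<in>Hinf. m (\<lambda>z. f z + g z) = m f + m g) \<and>
     (\<forall>c. \<forall>f\<in>Hinf. m (\<lambda>z. c * f z) = c * m f) \<and>
     (\<forall>f\<in>Hinf. \<forall>g\<in>Hinf. m (\<lambda>z. f z * g z) = m f * m g) \<and>
     m ` Hinf = UNIV}"

text \<open>The weak-star topology is that of pointwise convergence on the bounded analytic functions.\<close>

definition weak_star :: "((complex \<Rightarrow> complex) \<Rightarrow> complex) topology" where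
  "weak_star = subtopology (product_topology (\<lambda>_. euclidean) Hinf) maxideals"

definition point_eval :: "complex \<Rightarrow> (complex \<Rightarrow> complex) \<Rightarrow> complex" where
  "point_eval z = (\<lambda>f\<in>Hinf. f z)"

text \<open>The filter of points \<open>z\<close> of the disk tending to \<open>m\<close> in the maximal ideal space.\<close>

definition disk_to :: "((complex \<Rightarrow> complex) \<Rightarrow> complex) \<Rightarrow> complex filter" where
  "disk_to m = point_eval going_to (nhdsin weak_star m) within disk"

text \<open>
  By the corona theorem \<open>disk_to m\<close> is a proper filter for every \<open>m\<close> in \<open>maxideals\<close>; so the
  values of the continuous extension of a member of \<open>algU\<close> are its limits along these filters.
\<close>

definition extend :: "(complex \<Rightarrow> complex) \<Rightarrow> ((complex \<Rightarrow> complex) \<Rightarrow> complex) \<Rightarrow> complex" where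
  "extend u m = Lim (disk_to m) u"

definition disk_involution :: "complex \<Rightarrow> complex \<Rightarrow> complex" where
  "disk_involution z w = (z - w) / (1 - cnj z * w)"

definition hoffman ::
    "((complex \<Rightarrow> complex) \<Rightarrow> complex) \<Rightarrow> complex \<Rightarrow> ((complex \<Rightarrow> complex) \<Rightarrow> complex)" where
  "hoffman m w = (THE p. limitin weak_star (\<lambda>z. point_eval (disk_involution z w)) p (disk_to m))"

definition HOP :: "(complex \<Rightarrow> complex) set" where
  "HOP = {u \<in> algU. \<forall>m \<in> maxideals - point_eval ` disk.
     harmonic_on_disk (\<lambda>w. extend u (hoffman m w))}"

end

theory Submission
  imports Defs
begin

text \<open>
  For \<open>m\<close> in the maximal ideal space outside the disk, let \<open>v\<^sub>m w\<close> be the limit of \<open>u (phi z w)\<close> as \<open>z\<close>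
  tends to \<open>m\<close>; this is the restriction of \<open>u\<close> to the part of \<open>m\<close>. The Berezin transform \<open>B\<close> and
  the operator in (f) commute with the automorphisms \<open>phi z\<close> and are integrals against fixed kernels,
  so they pass to the limit. As limits at the boundary of the disk can be tested along the filters of
  points tending to such \<open>m\<close>, each condition says that all \<open>v\<^sub>m\<close> satisfy a corresponding condition
  on the disk: \<open>B v\<^sub>m = v\<^sub>m\<close> for (a), \<open>v\<^sub>m\<close> is harmonic for (c), \<open>B v\<^sub>m\<close> is harmonic for (d), \<open>laplace_op v\<^sub>m = 0\<close>
  for (f) and (g). The mean value property, the injectivity of \<open>B\<close>, and the fact that a bounded
  function fixed by \<open>B\<close> is harmonic make these conditions on \<open>v\<^sub>m\<close> equivalent. For (e), the difference
  of the operators has symbol \<open>B u - u\<close>, and a compact Toeplitz operator has a symbol whose Berezin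
  transform vanishes at the boundary. For (h), bounded harmonic functions are integrals of themselves against
  the Berezin kernel, which makes the derivatives of \<open>u (phi z w)\<close> in \<open>w\<close> converge to those of \<open>v\<^sub>m\<close>.

  The corona theorem is not needed: all statements about \<open>m\<close> are trivial when \<open>m\<close> is not in the closure
  of the disk.
\<close>

section \<open>Automorphisms of the disk\<close>


text \<open>The notion that carries the proof is \<open>star_approximable\<close>. It describes
  \<open>algU\<close>, and it amounts to boundedness together with the existence of limits along
  every \<open>disk_to m\<close>. Limits can be checked for functions given by integrals, and this
  is how the Berezin transform and the operator in (f) are seen to stay in the algebra. Both
  operators are averages over automorphisms with a radial weight. Such averages commute with
  \<open>B\<close>, so the operator in (f) maps fixed points of \<open>B\<close> to fixed points;
  this drives the proof that these are harmonic. The weight 2 |w|^2 - 1 arises from two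
  differentiations of the Berezin kernel, which yield the invariant Laplacian of \<open>B v\<close>.
  The main obstacle is that the limits on parts exist at all. For bounded analytic \<open>f\<close>
  with limit 0 at \<open>m\<close>, a Blaschke product is attached to the zeros of \<open>f\<close>
  near the points where \<open>f (phi z w)\<close> is close to a given nonzero value, and its own
  limit at \<open>m\<close> controls these points. A second obstacle is that
  \<open>disk_to m\<close> need not have a countable base; equicontinuity in the pseudohyperbolic
  metric compensates for it.\<close>

abbreviation phi :: "complex \<Rightarrow> complex \<Rightarrow> complex" where
  "phi \<equiv> disk_involution"

text \<open>The pseudohyperbolic distance. The maps \<open>phi z\<close> are isometries for it, so a
  modulus of continuity in \<open>rho\<close> is uniform up to the boundary and survives limits
  along \<open>disk_to m\<close>.\<close>

definition rho :: "complex \<Rightarrow> complex \<Rightarrow> real" where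
  "rho z w = cmod (phi z w)"

lemma one_minus_cnj_mult_nonzero:
  assumes "cmod z \<le> 1" "cmod w < 1"
  shows "1 - cnj z * w \<noteq> 0"
proof
  assume "1 - cnj z * w = 0"
  then have "cmod z * cmod w = 1"
    by (metis complex_mod_cnj eq_iff_diff_eq_0 norm_mult norm_one)
  moreover have "cmod z * cmod w \<le> 1 * cmod w"
    using assms by (intro mult_right_mono) auto
  ultimately show False using assms by auto
qed

lemma one_minus_mult_cnj_nonzero:
  assumes "cmod z \<le> 1" "cmod w < 1"
  shows "1 - z * cnj w \<noteq> 0"
  using one_minus_cnj_mult_nonzero[of "cnj z" "cnj w"] assms by simp

lemma cmod_one_minus_ge:
  assumes "cmod z \<le> 1" "cmod w < 1"
  shows "1 - cmod z \<le> cmod (1 - cnj z * w)" "1 - cmod w \<le> cmod (1 - cnj z * w)"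
proof -
  have "cmod (cnj z * w) \<le> cmod z * 1" "cmod (cnj z * w) \<le> 1 * cmod w"
    using assms by (auto simp: norm_mult intro!: mult_left_le mult_right_le_one_le mult_left_le_one_le)
  moreover have "1 - cmod (cnj z * w) \<le> cmod (1 - cnj z * w)"
    by (metis norm_one norm_triangle_ineq2)
  ultimately show "1 - cmod z \<le> cmod (1 - cnj z * w)" "1 - cmod w \<le> cmod (1 - cnj z * w)"
    by auto
qed

lemma one_minus_phi_norm:
  assumes "cmod z \<le> 1" "cmod w < 1"
  shows "1 - (cmod (phi z w))\<^sup>2 = (1 - (cmod z)\<^sup>2) * (1 - (cmod w)\<^sup>2) / (cmod (1 - cnj z * w))\<^sup>2"
proof -
  have nz: "cmod (1 - cnj z * w) \<noteq> 0" using one_minus_cnj_mult_nonzero[OF assms] by simp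
  have "(cmod (1 - cnj z * w))\<^sup>2 - (cmod (z - w))\<^sup>2 = (1 - (cmod z)\<^sup>2) * (1 - (cmod w)\<^sup>2)"
    unfolding cmod_power2 by (simp add: power2_eq_square) algebra
  with nz show ?thesis
    by (simp add: disk_involution_def norm_divide field_simps)
qed

lemma phi_in_disk [simp]:
  assumes "cmod z < 1" "cmod w < 1"
  shows "cmod (phi z w) < 1"
proof -
  have "1 - (cmod (phi z w))\<^sup>2 > 0"
    using assms one_minus_cnj_mult_nonzero[of z w]
    by (auto simp: one_minus_phi_norm power_less_one_iff abs_square_less_1 intro!: divide_pos_pos mult_pos_pos)
  then show ?thesis by (simp add: abs_square_less_1 power_less_one_iff)
qed

lemma phi_phi [simp]:
  assumes "cmod z < 1" "cmod w < 1"
  shows "phi z (phi z w) = w"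
proof -
  have 1: "1 - cnj z * w \<noteq> 0" "1 - cnj z * z \<noteq> 0"
    using one_minus_cnj_mult_nonzero assms by auto
  have a: "z - phi z w = w * (1 - cnj z * z) / (1 - cnj z * w)"
    using 1 by (simp add: disk_involution_def field_simps)
  have b: "1 - cnj z * phi z w = (1 - cnj z * z) / (1 - cnj z * w)"
    using 1 by (simp add: disk_involution_def field_simps)
  show ?thesis unfolding disk_involution_def[of z "phi z w"] a b using 1 by simp
qed

lemma phi_0 [simp]: "phi z 0 = z" "phi z z = 0" "phi 0 w = - w"
  by (auto simp: disk_involution_def)

lemma rho_commute: "rho z w = rho w z"
proof -
  have "cmod (1 - cnj z * w) = cmod (1 - cnj w * z)"
    by (metis complex_cnj_cnj complex_cnj_diff complex_cnj_mult complex_cnj_one complex_mod_cnj mult.commute)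
  then show ?thesis by (simp add: rho_def disk_involution_def norm_divide norm_minus_commute)
qed

text \<open>Under \<open>phi z\<close> both \<open>a - b\<close> and \<open>1 - cnj a * b\<close>
  are multiplied by \<open>1 - cnj z * z\<close>, up to sign, and divided by factors of equal
  modulus, so the quotient keeps its modulus.\<close>

lemma rho_invariant:
  assumes "cmod z < 1" "cmod a < 1" "cmod b < 1"
  shows "rho (phi z a) (phi z b) = rho a b"
proof -
  have nz: "1 - cnj z * a \<noteq> 0" "1 - cnj z * b \<noteq> 0" "1 - cnj a * b \<noteq> 0" "1 - cnj z * z \<noteq> 0" "1 - z * cnj a \<noteq> 0"
    using one_minus_cnj_mult_nonzero one_minus_mult_cnj_nonzero assms by auto
  have "phi z a - phi z b = (b - a) * (1 - cnj z * z) / ((1 - cnj z * a) * (1 - cnj z * b))"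
    using nz by (simp add: disk_involution_def field_simps)
  moreover have "1 - cnj (phi z a) * phi z b
     = ((1 - z * cnj a) * (1 - cnj z * b) - (cnj z - cnj a) * (z - b)) / ((1 - z * cnj a) * (1 - cnj z * b))"
    using nz by (simp add: disk_involution_def diff_divide_distrib[symmetric] divide_simps)
  then have "1 - cnj (phi z a) * phi z b
     = (1 - cnj a * b) * (1 - cnj z * z) / ((1 - z * cnj a) * (1 - cnj z * b))"
    by (simp add: algebra_simps)
  moreover have "cmod (1 - z * cnj a) = cmod (1 - cnj z * a)"
    by (metis complex_cnj_cnj complex_cnj_diff complex_cnj_mult complex_cnj_one complex_mod_cnj)
  ultimately have "rho (phi z a) (phi z b) = cmod (b - a) / cmod (1 - cnj a * b)"
    using nz by (simp add: rho_def disk_involution_def[of "phi z a"] norm_divide norm_mult)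
  then show ?thesis by (simp add: rho_def disk_involution_def norm_divide norm_minus_commute)
qed

lemma rho_phi_left:
  assumes "cmod z < 1" "cmod a < 1" "cmod b < 1"
  shows "rho (phi z a) b = rho a (phi z b)"
  using rho_invariant[of z a "phi z b"] assms by simp

text \<open>The sharper bound (s + t) / (1 + s t), with s = |a| and t = |b|, follows from the
  formula for 1 - rho^2 when |1 - cnj a b| is replaced by its upper bound 1 + s t.\<close>

lemma rho_0_le_sum:
  assumes "cmod a < 1" "cmod b < 1"
  shows "rho a b \<le> cmod a + cmod b"
proof -
  let ?s = "cmod a" and ?t = "cmod b"
  have nz: "1 - cnj a * b \<noteq> 0" using one_minus_cnj_mult_nonzero assms by auto
  have le: "cmod (1 - cnj a * b) \<le> 1 + ?s * ?t"
    by (metis complex_mod_cnj norm_mult norm_one norm_triangle_ineq4)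
  have pos: "(1 - ?s\<^sup>2) * (1 - ?t\<^sup>2) \<ge> 0"
    using assms by (intro mult_nonneg_nonneg) (auto simp: power_le_one)
  have st: "1 + ?s * ?t > 0" by (simp add: add_pos_nonneg)
  have "1 - ((?s + ?t) / (1 + ?s * ?t))\<^sup>2 = (1 - ?s\<^sup>2) * (1 - ?t\<^sup>2) / (1 + ?s * ?t)\<^sup>2"
  proof -
    have "(1 + ?s * ?t)\<^sup>2 - (?s + ?t)\<^sup>2 = (1 - ?s\<^sup>2) * (1 - ?t\<^sup>2)"
      by (simp add: power2_eq_square algebra_simps)
    then have "(1 - ?s\<^sup>2) * (1 - ?t\<^sup>2) / (1 + ?s * ?t)\<^sup>2
      = (1 + ?s * ?t)\<^sup>2 / (1 + ?s * ?t)\<^sup>2 - (?s + ?t)\<^sup>2 / (1 + ?s * ?t)\<^sup>2"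
      by (metis diff_divide_distrib)
    then show ?thesis using st by (simp only: power_divide) simp
  qed
  also have "\<dots> \<le> (1 - ?s\<^sup>2) * (1 - ?t\<^sup>2) / (cmod (1 - cnj a * b))\<^sup>2"
    using le nz pos by (intro divide_left_mono power_mono mult_pos_pos) (auto simp: st)
  also have "\<dots> = 1 - (rho a b)\<^sup>2" using one_minus_phi_norm[of a b] assms by (simp add: rho_def)
  finally have "(rho a b)\<^sup>2 \<le> ((?s + ?t) / (1 + ?s * ?t))\<^sup>2" by simp
  then have "rho a b \<le> (?s + ?t) / (1 + ?s * ?t)"
    using st by (intro power2_le_imp_le[of "rho a b"]) auto
  also have "\<dots> \<le> (?s + ?t) / 1"
    by (intro divide_left_mono) (auto simp: st)
  finally show ?thesis by simp
qed

text \<open>An automorphism moves the middle point \<open>b\<close> to 0, where distances become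
  moduli.\<close>

lemma rho_triangle:
  assumes "cmod a < 1" "cmod b < 1" "cmod c < 1"
  shows "rho a c \<le> rho a b + rho b c"
proof -
  have "rho a c = rho (phi b a) (phi b c)" using rho_invariant assms by simp
  also have "\<dots> \<le> cmod (phi b a) + cmod (phi b c)"
    using assms by (intro rho_0_le_sum) auto
  finally show ?thesis using rho_commute[of a b] by (simp add: rho_def)
qed

lemma rho_nonneg [simp]: "rho a b \<ge> 0" by (simp add: rho_def)

lemma rho_lt_1: "cmod a < 1 \<Longrightarrow> cmod b < 1 \<Longrightarrow> rho a b < 1" by (simp add: rho_def)

lemma rho_same [simp]: "rho a a = 0" by (simp add: rho_def)

lemma holomorphic_phi: "cmod z < 1 \<Longrightarrow> phi z holomorphic_on disk"
  unfolding disk_involution_def using one_minus_cnj_mult_nonzero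
  by (auto intro!: holomorphic_intros)

lemma phi_image: "cmod z < 1 \<Longrightarrow> phi z ` disk = disk"
proof (intro equalityI subsetI)
  fix w assume z: "cmod z < 1" and "w \<in> disk"
  then show "w \<in> phi z ` disk" by (intro image_eqI[of _ _ "phi z w"]) auto
qed auto

lemma inj_on_phi: "cmod z < 1 \<Longrightarrow> inj_on (phi z) disk"
  by (rule inj_on_inverseI[where g = "phi z"]) auto

lemma has_field_derivative_phi:
  assumes "cmod z < 1" "cmod w < 1"
  shows "(phi z has_field_derivative - (1 - (cmod z)\<^sup>2) / (1 - cnj z * w)\<^sup>2) (at w)"
proof -
  have nz: "1 - cnj z * w \<noteq> 0" using one_minus_cnj_mult_nonzero assms by auto
  have "complex_of_real ((cmod z)\<^sup>2) = cnj z * z" by (metis complex_norm_square mult.commute)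
  then show ?thesis
    unfolding disk_involution_def
    using nz by (auto intro!: derivative_eq_intros simp: field_simps power2_eq_square)
qed

text \<open>The Schwarz lemma for \<open>f o phi a\<close>, pulled back: since \<open>phi a\<close>
  is an involution exchanging \<open>a\<close> and 0, a zero at \<open>a\<close> splits off the
  factor \<open>phi a\<close> without increasing the bound. This allows zeros to be removed one at a
  time.\<close>

lemma Schwarz_factor:
  assumes hol: "f holomorphic_on disk" and le: "\<And>z. cmod z < 1 \<Longrightarrow> cmod (f z) \<le> 1"
    and a: "cmod a < 1" "f a = 0"
  obtains g where "g holomorphic_on disk" "\<And>z. cmod z < 1 \<Longrightarrow> f z = phi a z * g z"
    "\<And>z. cmod z < 1 \<Longrightarrow> cmod (g z) \<le> 1"
proof (cases "f constant_on disk")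
  case True
  then have "\<And>z. cmod z < 1 \<Longrightarrow> f z = 0" using a by (auto simp: constant_on_def)
  then show ?thesis using that[of "\<lambda>_. 0"] by auto
next
  case False
  \<comment> \<open>The Schwarz lemma is applied with a strict bound; equality at one point would
    make \<open>f\<close> constant by the maximum principle, which this case excludes.\<close>
  have lt: "cmod (f z) < 1" if "cmod z < 1" for z
  proof (rule ccontr)
    assume "\<not> cmod (f z) < 1"
    then have "cmod (f w) \<le> cmod (f z)" if "w \<in> disk" for w using le[of w] le[of z] that by auto
    then have "f constant_on disk" using \<open>cmod z < 1\<close>
      by (intro maximum_modulus_principle[OF hol, of disk z]) auto
    then show False using False by simp
  qed
  define F where "F = f \<circ> phi a"
  have holF: "F holomorphic_on ball 0 1" unfolding F_def
    by (rule holomorphic_on_compose_gen[OF holomorphic_phi[OF a(1)] hol])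
      (simp add: phi_image[OF a(1)])
  have F0: "F 0 = 0" by (simp add: F_def a)
  have Flt: "cmod (F z) < 1" if "cmod z < 1" for z using lt a that by (simp add: F_def)
  obtain h where h: "h holomorphic_on ball 0 1" "\<And>z. norm z < 1 \<Longrightarrow> F z = z * h z" "deriv F 0 = h 0"
    using Schwarz3[OF holF F0] by blast
  have hle: "cmod (h z) \<le> 1" if "cmod z < 1" for z
  proof (cases "z = 0")
    case True
    then show ?thesis using h(3) Schwarz_Lemma(2)[OF holF F0 Flt, of 0] by simp
  next
    case False
    then show ?thesis using Schwarz_Lemma(1)[OF holF F0 Flt that] h(2)[OF that]
      by (simp add: norm_mult)
  qed
  show ?thesis
  proof (rule that[of "h \<circ> phi a"])
    show "h \<circ> phi a holomorphic_on disk"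
      by (rule holomorphic_on_compose_gen[OF holomorphic_phi[OF a(1)] h(1)])
        (simp add: phi_image[OF a(1)])
    show "f z = phi a z * (h \<circ> phi a) z" if "cmod z < 1" for z
      using h(2)[OF phi_in_disk[OF a(1) that]] phi_phi[OF a(1) that] by (simp add: F_def)
    show "cmod ((h \<circ> phi a) z) \<le> 1" if "cmod z < 1" for z
      using hle a that by simp
  qed
qed

lemma Schwarz_zero:
  assumes hol: "f holomorphic_on disk" and le: "\<And>z. cmod z < 1 \<Longrightarrow> cmod (f z) \<le> 1"
    and a: "cmod a < 1" "f a = 0" and z: "cmod z < 1"
  shows "cmod (f z) \<le> rho a z"
proof -
  show ?thesis
  proof (rule Schwarz_factor[OF hol le a])
    fix g assume "\<And>z. cmod z < 1 \<Longrightarrow> f z = phi a z * g z"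
      "\<And>z. cmod z < 1 \<Longrightarrow> cmod (g z) \<le> 1"
    from this[OF z] show ?thesis by (simp add: rho_def norm_mult mult_left_le)
  qed
qed

text \<open>The quotient \<open>(f - f a) / (2 * C)\<close> is bounded by 1 and vanishes at
  \<open>a\<close>, so it is dominated by \<open>rho a\<close>. The factor 2 is the price for not
  composing with an automorphism of the target disk.\<close>

lemma Schwarz_Pick_Lipschitz:
  assumes hol: "f holomorphic_on disk" and le: "\<And>z. cmod z < 1 \<Longrightarrow> cmod (f z) \<le> C"
    and a: "cmod a < 1" and z: "cmod z < 1"
  shows "cmod (f z - f a) \<le> 2 * C * rho a z"
proof -
  have C: "C \<ge> 0" using le[of 0] by (auto intro: order_trans[OF norm_ge_zero])
  show ?thesis
  proof (cases "C = 0")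
    case True
    then show ?thesis using le[OF a] le[OF z] by simp
  next
    case False
    define g where "g w = (f w - f a) / of_real (2 * C)" for w
    have "cmod (g z) \<le> rho a z"
    proof (rule Schwarz_zero[of g a z])
      show "g holomorphic_on disk" unfolding g_def using False
        by (intro holomorphic_intros hol) auto
      show "cmod (g w) \<le> 1" if "cmod w < 1" for w
      proof -
        have "cmod (f w - f a) \<le> 2 * C"
          using norm_triangle_ineq4[of "f w" "f a"] le[OF that] le[OF a] by linarith
        then show ?thesis using C False by (simp add: g_def norm_divide norm_mult)
      qed
    qed (use a z in \<open>auto simp: g_def\<close>)
    then have "2 * C * cmod (g z) \<le> 2 * C * rho a z"
      using C by (intro mult_left_mono) auto
    moreover have "2 * C * cmod (g z) = cmod (f z - f a)"
      using C False by (simp add: g_def norm_divide norm_mult)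
    ultimately show ?thesis by simp
  qed
qed

section \<open>Change of variables and area measure\<close>


text \<open>The change of variables formula is applied to maps of \<open>real^2\<close>; this map
  and its inverse carry Lebesgue measure and derivatives across.\<close>

definition complex_of_vec :: "real^2 \<Rightarrow> complex" where
  "complex_of_vec x = Complex (vec_nth x 1) (vec_nth x 2)"

definition vec_of_complex :: "complex \<Rightarrow> real^2" where
  "vec_of_complex c = (\<chi> i. if i = 1 then Re c else Im c)"

lemma vec_of_complex_nth [simp]:
  "vec_nth (vec_of_complex c) 1 = Re c" "vec_nth (vec_of_complex c) 2 = Im c"
  by (auto simp: vec_of_complex_def)

lemma complex_of_vec_inverse [simp]:
  "vec_of_complex (complex_of_vec x) = x" "complex_of_vec (vec_of_complex c) = c"
  by (auto simp: complex_of_vec_def vec_eq_iff forall_2)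

lemma vec_of_complex_image: "vec_of_complex ` A = complex_of_vec -` A"
  by (auto intro: image_eqI[of x vec_of_complex "complex_of_vec x" for x])

lemma bounded_linear_complex_of_vec: "bounded_linear complex_of_vec"
  by (rule linear_conv_bounded_linear[THEN iffD1])
    (auto simp: linear_iff complex_of_vec_def complex_eq_iff)

lemma bounded_linear_vec_of_complex: "bounded_linear vec_of_complex"
  by (rule linear_conv_bounded_linear[THEN iffD1])
    (auto simp: linear_iff vec_eq_iff forall_2)

lemma borel_measurable_complex_of_vec [measurable]: "complex_of_vec \<in> borel_measurable borel"
  by (intro borel_measurable_continuous_onI linear_continuous_on bounded_linear_complex_of_vec)

text \<open>Lebesgue measure is determined by its values on boxes, and \<open>complex_of_vec\<close>
  preserves boxes and their side lengths.\<close>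

lemma lborel_complex_eq_distr: "(lborel :: complex measure) = distr lborel borel complex_of_vec"
proof (rule lborel_eqI)
  fix l u :: complex assume le: "\<And>b. b \<in> Basis \<Longrightarrow> l \<bullet> b \<le> u \<bullet> b"
  have le': "Re l \<le> Re u" "Im l \<le> Im u"
    using le[of 1] le[of \<i>] by (auto simp: Basis_complex_def inner_complex_def)
  have B: "(Basis :: (real^2) set) = {axis 1 1, axis 2 1}"
    by (auto simp: Basis_vec_def axis_eq_axis UNIV_2)
  have "complex_of_vec -` box l u = box (vec_of_complex l) (vec_of_complex u)"
    by (auto simp: mem_box B Basis_complex_def inner_axis complex_of_vec_def)
  moreover have "emeasure lborel (box (vec_of_complex l) (vec_of_complex u))
     = (\<Prod>b\<in>Basis. (vec_of_complex u - vec_of_complex l) \<bullet> b)"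
    using le' by (intro emeasure_lborel_box) (auto simp: B inner_axis)
  moreover have "(\<Prod>b\<in>Basis. (vec_of_complex u - vec_of_complex l) \<bullet> b) = (\<Prod>b\<in>Basis. (u - l) \<bullet> b)"
    by (simp add: B axis_eq_axis Basis_complex_def inner_axis)
  ultimately show "emeasure (distr lborel borel complex_of_vec) (box l u)
     = ennreal (\<Prod>b\<in>Basis. (u - l) \<bullet> b)"
    by (simp add: emeasure_distr)
qed simp

lemma det_matrix_complex_mult:
  "det (matrix (\<lambda>h. vec_of_complex (d * complex_of_vec h))) = (cmod d)\<^sup>2"
  by (simp add: det_2 matrix_def complex_of_vec_def axis_def cmod_power2)
    (simp add: power2_eq_square)

text \<open>The real Jacobian of a holomorphic map is the determinant of multiplication by
  \<open>f' x\<close>, which is |f' x|^2. Boundedness of the image makes its measure finite, as the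
  integral formula for measures of images requires.\<close>

lemma emeasure_holomorphic_image:
  assumes S: "S \<in> sets borel" and fS: "f ` S \<in> sets borel" "bounded (f ` S)"
    and der: "\<And>x. x \<in> S \<Longrightarrow> (f has_field_derivative f' x) (at x)" and inj: "inj_on f S"
    and [measurable]: "f' \<in> borel_measurable borel"
  shows "emeasure lborel (f ` S) = (\<integral>\<^sup>+x. ennreal (indicator S x * (cmod (f' x))\<^sup>2) \<partial>lborel)"
proof -
  note [measurable] = S
  define S' where "S' = vec_of_complex ` S"
  define g where "g = vec_of_complex \<circ> f \<circ> complex_of_vec"
  have S'_eq: "S' = complex_of_vec -` S" unfolding S'_def
    by (rule vec_of_complex_image)
  have gS': "g ` S' = complex_of_vec -` (f ` S)" 
    by (simp add: g_def S'_def image_image flip: vec_of_complex_image)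
  have S'_meas: "S' \<in> sets borel" unfolding S'_eq
    using measurable_sets[OF borel_measurable_complex_of_vec S] by simp
  then have S'_leb: "S' \<in> sets lebesgue" by auto
  have gS'_meas: "g ` S' \<in> sets borel" unfolding gS'
    using measurable_sets[OF borel_measurable_complex_of_vec fS(1)] by simp
  have "bounded (g ` S')"
  proof -
    have "g ` S' = vec_of_complex ` (f ` S)" by (simp add: g_def S'_def image_image)
    then show ?thesis using bounded_linear_image[OF fS(2) bounded_linear_vec_of_complex] by simp
  qed
  then have lm: "g ` S' \<in> lmeasurable"
    using gS'_meas by (intro bounded_set_imp_lmeasurable) auto
  have der_g: "(g has_derivative (\<lambda>h. vec_of_complex (f' (complex_of_vec x) * complex_of_vec h))) (at x within S')"
    if "x \<in> S'" for x
  proof -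
    have "(f has_derivative (\<lambda>h. f' (complex_of_vec x) * h)) (at (complex_of_vec x))"
      using der[of "complex_of_vec x"] that by (simp add: S'_eq has_field_derivative_def)
    from has_derivative_compose[OF bounded_linear_imp_has_derivative[OF bounded_linear_complex_of_vec] this]
    have "((\<lambda>x. f (complex_of_vec x)) has_derivative (\<lambda>h. f' (complex_of_vec x) * complex_of_vec h)) (at x)" .
    from bounded_linear.has_derivative[OF bounded_linear_vec_of_complex this]
    show ?thesis by (simp add: g_def o_def has_derivative_at_withinI)
  qed
  have inj_g: "inj_on g S'"
  proof (rule inj_onI)
    fix x y assume "x \<in> S'" "y \<in> S'" "g x = g y"
    then have "complex_of_vec (g x) = complex_of_vec (g y)" by simp
    then have "f (complex_of_vec x) = f (complex_of_vec y)" by (simp add: g_def)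
    then have "complex_of_vec x = complex_of_vec y"
      using inj_onD[OF inj] \<open>x \<in> S'\<close> \<open>y \<in> S'\<close> by (simp add: S'_eq)
    then have "vec_of_complex (complex_of_vec x) = vec_of_complex (complex_of_vec y)" by simp
    then show "x = y" by simp
  qed
  have "((\<lambda>x. \<bar>det (matrix (\<lambda>h. vec_of_complex (f' (complex_of_vec x) * complex_of_vec h)))\<bar>)
     has_integral measure lebesgue (g ` S')) S'"
    using lm by (intro has_measure_differentiable_image[THEN iffD1, OF S'_leb der_g inj_g]) auto
  then have "((\<lambda>x. (cmod (f' (complex_of_vec x)))\<^sup>2) has_integral measure lebesgue (g ` S')) S'"
    by (simp add: det_matrix_complex_mult)
  then have "(\<integral>\<^sup>+x. ennreal (indicator S' x * (cmod (f' (complex_of_vec x)))\<^sup>2) \<partial>lborel)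
     = ennreal (measure lebesgue (g ` S'))"
    by (intro nn_integral_has_integral_lebesgue) auto
  also have "\<dots> = emeasure lebesgue (g ` S')"
    using lm by (simp add: emeasure_eq_measure2 fmeasurableD fmeasurableD2)
  also have "\<dots> = emeasure lborel (g ` S')" using gS'_meas by simp
  also have "\<dots> = emeasure lborel (f ` S)"
    using fS(1) by (subst lborel_complex_eq_distr) (simp add: emeasure_distr gS')
  also have "(\<integral>\<^sup>+x. ennreal (indicator S' x * (cmod (f' (complex_of_vec x)))\<^sup>2) \<partial>lborel)
    = (\<integral>\<^sup>+x. ennreal (indicator S x * (cmod (f' x))\<^sup>2) \<partial>lborel)"
    by (subst lborel_complex_eq_distr) (simp add: nn_integral_distr S'_eq indicator_def)
  finally show ?thesis by simp
qed


section \<open>Normalized area measure on the disk and its transformation under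
  automorphisms\<close>

lemma space_dA [simp]: "space dA = disk"
  by (simp add: dA_def space_restrict_space)

lemma sets_dA: "sets dA = sets (restrict_space borel disk)"
  by (simp add: dA_def cong: sets_restrict_space_cong)

lemma sets_dA_iff: "A \<in> sets dA \<longleftrightarrow> A \<in> sets borel \<and> A \<subseteq> disk"
  by (auto simp: sets_dA sets_restrict_space_iff)

lemma measurable_dA_eq: "measurable dA M = measurable (restrict_space borel disk) M"
  by (rule measurable_cong_sets[OF sets_dA refl])

lemma borel_measurable_dA_of_borel:
  "f \<in> borel_measurable borel \<Longrightarrow> f \<in> borel_measurable dA"
  unfolding measurable_dA_eq by (rule measurable_restrict_space1)

lemma measurable_ident_dA [measurable]: "(\<lambda>w. w) \<in> borel_measurable dA"
  by (rule borel_measurable_dA_of_borel) simp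

lemma borel_measurable_fst_dA [measurable]: "fst \<in> borel_measurable (dA \<Otimes>\<^sub>M N)"
  using measurable_compose[OF measurable_fst measurable_ident_dA] by simp

lemma borel_measurable_snd_dA [measurable]: "snd \<in> borel_measurable (N \<Otimes>\<^sub>M dA)"
  using measurable_compose[OF measurable_snd measurable_ident_dA] by simp

lemma borel_measurable_dA_continuous:
  "continuous_on disk f \<Longrightarrow> f \<in> borel_measurable dA"
  unfolding measurable_dA_eq by (rule borel_measurable_continuous_on_restrict)

lemma measurable_into_dA:
  assumes "f \<in> borel_measurable M" "\<And>x. x \<in> space M \<Longrightarrow> f x \<in> disk"
  shows "f \<in> measurable M dA"
proof -
  have "f \<in> measurable M (restrict_space borel disk)"
    using assms by (intro measurable_restrict_space2) auto
  then show ?thesis by (simp add: measurable_cong_sets[OF refl sets_dA])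
qed

lemma emeasure_disk: "emeasure lborel disk \<noteq> 0" "emeasure lborel disk \<noteq> \<infinity>"
proof -
  have pos: "unit_ball_vol (2::real) > 0" by (rule unit_ball_vol_pos) simp
  show "emeasure lborel disk \<noteq> 0"
  proof
    assume "emeasure lborel disk = 0"
    then have "unit_ball_vol (2::real) = 0" by (simp add: emeasure_ball)
    with pos show False by linarith
  qed
  show "emeasure lborel disk \<noteq> \<infinity>"
    using emeasure_lborel_ball_finite[of "0::complex" 1] by auto
qed

lemma nn_integral_dA:
  assumes "f \<in> borel_measurable dA"
  shows "(\<integral>\<^sup>+w. f w \<partial>dA) = (\<integral>\<^sup>+w. f w * indicator disk w \<partial>lborel) / emeasure lborel disk"
proof -
  have f: "f \<in> borel_measurable (restrict_space lborel disk)"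
    using assms by (simp add: measurable_dA_eq cong: measurable_cong_sets)
  have "(\<integral>\<^sup>+w. f w \<partial>dA)
    = (\<integral>\<^sup>+w. f w * indicator disk w \<partial>restrict_space lborel disk) / emeasure (restrict_space lborel disk) disk"
    unfolding dA_def using f
    by (intro nn_integral_uniform_measure) (auto simp: sets_restrict_space_iff emeasure_restrict_space)
  also have "\<dots> = (\<integral>\<^sup>+w. f w * indicator disk w \<partial>lborel) / emeasure lborel disk"
    by (simp add: nn_integral_restrict_space emeasure_restrict_space mult.assoc flip: indicator_inter_arith)
  finally show ?thesis .
qed

lemma emeasure_dA:
  assumes "A \<in> sets dA"
  shows "emeasure dA A = emeasure lborel A / emeasure lborel disk"
proof -
  have A: "A \<in> sets borel" "A \<subseteq> disk" using assms by (auto simp: sets_dA_iff)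
  have "emeasure dA A = (\<integral>\<^sup>+w. indicator A w \<partial>dA)" using assms by simp
  also have "\<dots> = (\<integral>\<^sup>+w. indicator A w * indicator disk w \<partial>lborel) / emeasure lborel disk"
    using assms by (intro nn_integral_dA) simp
  also have "(\<integral>\<^sup>+w. indicator A w * indicator disk w \<partial>lborel) = (\<integral>\<^sup>+w. indicator A w \<partial>(lborel::complex measure))"
    using A by (intro nn_integral_cong) (auto simp: indicator_def)
  finally show ?thesis using A by simp
qed

interpretation dA: prob_space dA
proof
  have "disk \<in> sets dA" by (simp add: sets_dA_iff)
  then show "emeasure dA (space dA) = 1"
    using emeasure_disk by (simp add: emeasure_dA ennreal_divide_self less_top)
qed

text \<open>On a set \<open>A\<close> the push-forward integrates the Jacobian over the preimage of
  \<open>A\<close>; the area formula turns this into the area of \<open>A\<close> because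
  \<open>f\<close> is a bijection of the disk. The normalizing constant is the same on both
  sides.\<close>

lemma dA_holomorphic_automorphism:
  assumes f: "f ` disk = disk" "inj_on f disk" "f \<in> borel_measurable dA"
    and der: "\<And>x. x \<in> disk \<Longrightarrow> (f has_field_derivative f' x) (at x)"
    and [measurable]: "f' \<in> borel_measurable borel"
  shows "distr (density dA (\<lambda>w. ennreal ((cmod (f' w))\<^sup>2))) dA f = dA" (is "?M = dA")
proof (rule measure_eqI)
  have f_meas [measurable]: "f \<in> measurable dA dA"
    using f by (intro measurable_into_dA) auto
  show "sets ?M = sets dA" by simp
  fix A assume "A \<in> sets ?M"
  then have A: "A \<in> sets dA" by simp
  then have A': "A \<in> sets borel" "A \<subseteq> disk" by (auto simp: sets_dA_iff)
  define S where "S = f -` A \<inter> disk"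
  have S_dA: "S \<in> sets dA" using measurable_sets[OF f_meas A] by (simp add: S_def)
  then have S: "S \<in> sets borel" "S \<subseteq> disk" by (auto simp: sets_dA_iff)
  have "f ` (f -` A \<inter> disk) = A \<inter> f ` disk" by auto
  then have fS: "f ` S = A" using f(1) A'(2) by (simp add: S_def Int_absorb2)
  have "emeasure ?M A = (\<integral>\<^sup>+w. ennreal ((cmod (f' w))\<^sup>2) * indicator S w \<partial>dA)"
    using A S_dA by (simp add: emeasure_distr emeasure_density S_def)
  also have "\<dots> = (\<integral>\<^sup>+w. ennreal ((cmod (f' w))\<^sup>2) * indicator S w * indicator disk w \<partial>lborel) / emeasure lborel disk"
    using S_dA by (intro nn_integral_dA) simp
  also have "(\<integral>\<^sup>+w. ennreal ((cmod (f' w))\<^sup>2) * indicator S w * indicator disk w \<partial>lborel)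
    = (\<integral>\<^sup>+w. ennreal (indicator S w * (cmod (f' w))\<^sup>2) \<partial>lborel)"
    using S by (intro nn_integral_cong) (auto simp: indicator_def)
  also have "\<dots> = emeasure lborel (f ` S)"
  proof (rule emeasure_holomorphic_image[symmetric])
    show "f ` S \<in> sets borel" "bounded (f ` S)" using A' by (auto simp: fS intro: bounded_subset)
    show "inj_on f S" using f(2) S(2) by (rule inj_on_subset)
  qed (use S der in auto)
  also have "\<dots> = emeasure lborel A" by (simp add: fS)
  finally show "emeasure ?M A = emeasure dA A" using A by (simp add: emeasure_dA)
qed

lemma
  fixes g :: "complex \<Rightarrow> complex"
  assumes f: "f ` disk = disk" "inj_on f disk" "f \<in> borel_measurable dA"
    and der: "\<And>x. x \<in> disk \<Longrightarrow> (f has_field_derivative f' x) (at x)"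
    and f' [measurable]: "f' \<in> borel_measurable borel" and g [measurable]: "g \<in> borel_measurable dA"
  shows integral_dA_automorphism:
      "(LINT w|dA. g (f w) * of_real ((cmod (f' w))\<^sup>2)) = (LINT w|dA. g w)"
    and integrable_dA_automorphism:
      "integrable dA (\<lambda>w. g (f w) * of_real ((cmod (f' w))\<^sup>2)) \<longleftrightarrow> integrable dA g"
proof -
  let ?D = "density dA (\<lambda>w. ennreal ((cmod (f' w))\<^sup>2))"
  have f_meas [measurable]: "f \<in> measurable dA dA"
    using f by (intro measurable_into_dA) auto
  then have fD [measurable]: "f \<in> measurable ?D dA" by simp
  have "(LINT w|dA. g w) = (LINT w|distr ?D dA f. g w)"
    by (subst dA_holomorphic_automorphism[OF f der f']) auto
  also have "\<dots> = (LINT w|?D. g (f w))" by (rule integral_distr) auto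
  also have "\<dots> = (LINT w|dA. (cmod (f' w))\<^sup>2 *\<^sub>R g (f w))"
    by (rule integral_density) auto
  finally show "(LINT w|dA. g (f w) * of_real ((cmod (f' w))\<^sup>2)) = (LINT w|dA. g w)"
    by (simp add: scaleR_conv_of_real mult.commute)
  have "integrable dA g \<longleftrightarrow> integrable (distr ?D dA f) g"
    by (subst dA_holomorphic_automorphism[OF f der f']) auto
  also have "\<dots> \<longleftrightarrow> integrable ?D (\<lambda>w. g (f w))" by (rule integrable_distr_eq) auto
  also have "\<dots> \<longleftrightarrow> integrable dA (\<lambda>w. (cmod (f' w))\<^sup>2 *\<^sub>R g (f w))"
    by (rule integrable_density) auto
  finally show "integrable dA (\<lambda>w. g (f w) * of_real ((cmod (f' w))\<^sup>2)) \<longleftrightarrow> integrable dA g"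
    by (simp add: scaleR_conv_of_real mult.commute)
qed

text \<open>Two objects coincide in this formula: |k_z(w)|^2 and the Jacobian of
  \<open>phi z\<close> at \<open>w\<close>. Hence the Berezin transform at \<open>z\<close> is the
  mean of \<open>u o phi z\<close>.\<close>

definition berezin_kernel :: "complex \<Rightarrow> complex \<Rightarrow> real" where
  "berezin_kernel z w = (1 - (cmod z)\<^sup>2)\<^sup>2 / (cmod (1 - cnj z * w)) ^ 4"

lemma cmod_of_real_one_minus_square:
  "cmod (1 - (complex_of_real (cmod z))\<^sup>2) = \<bar>1 - (cmod z)\<^sup>2\<bar>"
  by (metis norm_of_real of_real_1 of_real_diff of_real_power)

lemma cmod_bergman_kernel:
  "(cmod (bergman_kernel z w))\<^sup>2 = berezin_kernel z w"
  by (simp add: bergman_kernel_def berezin_kernel_def norm_divide norm_power power_divide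
      cmod_of_real_one_minus_square)

lemma berezin_kernel_nonneg [simp]: "0 \<le> berezin_kernel z w"
  by (simp add: berezin_kernel_def)

lemma borel_measurable_cnj [measurable (raw)]:
  assumes "f \<in> borel_measurable M"
  shows "(\<lambda>x. cnj (f x)) \<in> borel_measurable M"
proof -
  have "cnj \<in> borel_measurable borel"
    by (intro borel_measurable_continuous_onI continuous_intros)
  from measurable_compose[OF assms this] show ?thesis .
qed

lemma borel_measurable_berezin_kernel2 [measurable (raw)]:
  assumes [measurable]: "f \<in> borel_measurable M" "g \<in> borel_measurable M"
  shows "(\<lambda>x. berezin_kernel (f x) (g x)) \<in> borel_measurable M"
  unfolding berezin_kernel_def by measurable

lemma borel_measurable_phi2 [measurable (raw)]:
  assumes [measurable]: "f \<in> borel_measurable M" "g \<in> borel_measurable M"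
  shows "(\<lambda>x. phi (f x) (g x)) \<in> borel_measurable M"
  unfolding disk_involution_def by measurable

lemma borel_measurable_rho2 [measurable (raw)]:
  assumes [measurable]: "f \<in> borel_measurable M" "g \<in> borel_measurable M"
  shows "(\<lambda>x. rho (f x) (g x)) \<in> borel_measurable M"
  unfolding rho_def by measurable

lemma measurable_phi_dA [measurable]: "cmod z < 1 \<Longrightarrow> phi z \<in> measurable dA dA"
  by (intro measurable_into_dA) auto

lemma
  fixes g :: "complex \<Rightarrow> complex"
  assumes z: "cmod z < 1" and g: "g \<in> borel_measurable dA"
  shows integral_phi_kernel:
      "(LINT w|dA. g (phi z w) * of_real (berezin_kernel z w)) = (LINT w|dA. g w)"
    and integrable_phi_kernel:
      "integrable dA (\<lambda>w. g (phi z w) * of_real (berezin_kernel z w)) \<longleftrightarrow> integrable dA g"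
proof -
  let ?f' = "\<lambda>w. - (1 - (cmod z)\<^sup>2) / (1 - cnj z * w)\<^sup>2"
  have k: "(cmod (?f' w))\<^sup>2 = berezin_kernel z w" for w
    by (simp add: berezin_kernel_def norm_divide norm_power power_divide norm_minus_commute
        cmod_of_real_one_minus_square)
  have *: "phi z \<in> borel_measurable dA" "?f' \<in> borel_measurable borel" by measurable
  have der: "(phi z has_field_derivative ?f' x) (at x)" if "x \<in> disk" for x
    using has_field_derivative_phi[OF z] that by simp
  show "(LINT w|dA. g (phi z w) * of_real (berezin_kernel z w)) = (LINT w|dA. g w)"
    using integral_dA_automorphism[OF phi_image[OF z] inj_on_phi[OF z] *(1) der *(2) g] by (simp only: k)
  show "integrable dA (\<lambda>w. g (phi z w) * of_real (berezin_kernel z w)) \<longleftrightarrow> integrable dA g"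
    using integrable_dA_automorphism[OF phi_image[OF z] inj_on_phi[OF z] *(1) der *(2) g] by (simp only: k)
qed

text \<open>The rule \<open>integral_phi_kernel\<close> is applied to \<open>g\<close> times the
  kernel; the two Jacobians cancel since \<open>phi z\<close> is its own inverse.\<close>

lemma integral_phi:
  fixes g :: "complex \<Rightarrow> complex"
  assumes z: "cmod z < 1" and g [measurable]: "g \<in> borel_measurable dA"
  shows "(LINT w|dA. g (phi z w)) = (LINT w|dA. g w * of_real (berezin_kernel z w))"
proof -
  have k: "berezin_kernel z (phi z w) * berezin_kernel z w = 1" if "w \<in> disk" for w
  proof -
    have nz: "1 - cnj z * w \<noteq> 0" "1 - cnj z * z \<noteq> 0"
      using that one_minus_cnj_mult_nonzero z by auto
    have "1 - cnj z * phi z w = (1 - cnj z * z) / (1 - cnj z * w)"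
      using nz by (simp add: disk_involution_def field_simps)
    moreover have pos: "1 - (cmod z)\<^sup>2 > 0" using z by (simp add: power_less_one_iff abs_square_less_1)
    moreover have "cmod (1 - cnj z * z) = 1 - (cmod z)\<^sup>2"
    proof -
      have "1 - cnj z * z = of_real (1 - (cmod z)\<^sup>2)"
        by (metis complex_norm_square mult.commute of_real_1 of_real_diff of_real_power)
      then show ?thesis using pos by (metis abs_of_pos norm_of_real)
    qed
    ultimately have "cmod (1 - cnj z * phi z w) = (1 - (cmod z)\<^sup>2) / cmod (1 - cnj z * w)"
      by (simp add: norm_divide)
    then have "berezin_kernel z (phi z w) * berezin_kernel z w
      = ((1 - (cmod z)\<^sup>2)\<^sup>2)\<^sup>2 / (1 - (cmod z)\<^sup>2) ^ 4"
      using nz by (simp add: berezin_kernel_def power_divide power2_eq_square)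
    also have "\<dots> = 1" using pos by (simp flip: power_mult)
    finally show ?thesis .
  qed
  have "(LINT w|dA. g w * of_real (berezin_kernel z w))
    = (LINT w|dA. g (phi z w) * of_real (berezin_kernel z (phi z w)) * of_real (berezin_kernel z w))"
    by (rule integral_phi_kernel[OF z, symmetric]) measurable
  also have "\<dots> = (LINT w|dA. g (phi z w))"
  proof (rule Bochner_Integration.integral_cong)
    fix w assume "w \<in> space dA"
    then have "of_real (berezin_kernel z (phi z w)) * of_real (berezin_kernel z w) = (1::complex)"
      using k[of w] by (simp flip: of_real_mult)
    then show "g (phi z w) * of_real (berezin_kernel z (phi z w)) * of_real (berezin_kernel z w) = g (phi z w)"
      by (simp add: mult.assoc)
  qed simp
  finally show ?thesis by simp
qed

lemma integral_rotate:
  fixes g :: "complex \<Rightarrow> complex"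
  assumes c: "cmod c = 1" and g [measurable]: "g \<in> borel_measurable dA"
  shows "(LINT w|dA. g (c * w)) = (LINT w|dA. g w)"
proof -
  have 1: "(\<lambda>w. c * w) ` disk = disk"
  proof (intro equalityI subsetI)
    fix w assume "w \<in> disk"
    then show "w \<in> (\<lambda>w. c * w) ` disk"
      using c by (intro image_eqI[of _ _ "w / c"]) (auto simp: norm_divide)
  qed (use c in \<open>auto simp: norm_mult\<close>)
  have "c \<noteq> 0" using c by auto
  then have 2: "inj_on (\<lambda>w. c * w) disk" by (auto simp: inj_on_def)
  have "(LINT w|dA. g (c * w) * of_real ((cmod c)\<^sup>2)) = (LINT w|dA. g w)"
    by (rule integral_dA_automorphism[OF 1 2, where f' = "\<lambda>_. c"])
      (auto intro!: derivative_eq_intros)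
  then show ?thesis using c by simp
qed

lemma berezin_eq_integral_phi:
  assumes "cmod z < 1" "u \<in> borel_measurable dA"
  shows "berezin u z = (LINT w|dA. u (phi z w))"
  by (simp add: berezin_def cmod_bergman_kernel integral_phi[OF assms])

section \<open>Invariant radial operators\<close>


text \<open>The bound holds at every point of the disk and not just almost everywhere, so it passes
  to compositions with \<open>phi z\<close> and to pointwise estimates.\<close>

definition bounded_measurable :: "(complex \<Rightarrow> complex) \<Rightarrow> bool" where
  "bounded_measurable v \<longleftrightarrow> v \<in> borel_measurable dA \<and> bounded (v ` disk)"

lemma bounded_measurableI:
  assumes "v \<in> borel_measurable dA" "\<And>z. cmod z < 1 \<Longrightarrow> cmod (v z) \<le> C"
  shows "bounded_measurable v"
  unfolding bounded_measurable_def bounded_iff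
proof (intro conjI exI ballI)
  show "v \<in> borel_measurable dA" by fact
  fix x assume "x \<in> v ` disk"
  then show "cmod x \<le> C" using assms(2) by auto
qed

lemma bounded_measurableE:
  assumes "bounded_measurable v"
  obtains C where "0 \<le> C" "\<And>z. cmod z < 1 \<Longrightarrow> cmod (v z) \<le> C"
proof -
  obtain C where C: "\<forall>z\<in>disk. cmod (v z) \<le> C"
    using assms by (auto simp: bounded_measurable_def bounded_iff)
  show ?thesis
  proof (rule that[of "\<bar>C\<bar>"])
    fix z :: complex assume "cmod z < 1"
    then show "cmod (v z) \<le> \<bar>C\<bar>" using C[rule_format, of z] by simp
  qed simp
qed

lemma bounded_measurable_imp_measurable [measurable_dest]:
  "bounded_measurable v \<Longrightarrow> v \<in> borel_measurable dA"
  by (simp add: bounded_measurable_def)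

lemma measure_dA_disk [simp]: "measure dA disk = 1"
  using dA.prob_space by simp

lemma bounded_measurable_integrable:
  fixes v :: "complex \<Rightarrow> complex"
  assumes "bounded_measurable v"
  shows "integrable dA v"
proof -
  obtain C where "\<And>z. cmod z < 1 \<Longrightarrow> cmod (v z) \<le> C" using bounded_measurableE[OF assms] by metis
  then show ?thesis using bounded_measurable_imp_measurable[OF assms]
    by (intro dA.integrable_const_bound[of _ C] AE_I2) auto
qed

lemma integrable_dA_bounded:
  fixes v :: "complex \<Rightarrow> 'b::{banach, second_countable_topology}"
  assumes "v \<in> borel_measurable dA" "\<And>z. cmod z < 1 \<Longrightarrow> norm (v z) \<le> C"
  shows "integrable dA v"
  using assms by (intro dA.integrable_const_bound[of _ C]) (auto simp: AE_I2)

lemma bounded_measurable_phi: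
  assumes v: "bounded_measurable v" and z: "cmod z < 1"
  shows "bounded_measurable (\<lambda>w. v (phi z w))"
proof -
  obtain C where C: "\<And>z. cmod z < 1 \<Longrightarrow> cmod (v z) \<le> C" using bounded_measurableE[OF v] by metis
  have [measurable]: "v \<in> borel_measurable dA" using v by measurable
  note [measurable] = measurable_phi_dA[OF z]
  show ?thesis by (rule bounded_measurableI[of _ C]) (use C z in auto)
qed

lemma one_minus_square_pos: "cmod z < 1 \<Longrightarrow> 0 < 1 - (cmod z)\<^sup>2"
  by (simp add: abs_square_less_1)

lemma one_minus_rho:
  assumes "cmod z < 1" "cmod w < 1"
  shows "1 - (rho z w)\<^sup>2 = (1 - (cmod z)\<^sup>2) * (1 - (cmod w)\<^sup>2) / (cmod (1 - cnj z * w))\<^sup>2"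
  using assms one_minus_phi_norm[of z w] by (simp add: rho_def)

text \<open>Displays the kernel as a function of \<open>rho z w\<close> times the density (1 -
  |w|^2)^(-2) of the invariant measure. This is the source of the invariance of all radial
  operators.\<close>

lemma berezin_kernel_rho:
  assumes "cmod z < 1" "cmod w < 1"
  shows "berezin_kernel z w = (1 - (rho z w)\<^sup>2)\<^sup>2 / (1 - (cmod w)\<^sup>2)\<^sup>2"
  using one_minus_square_pos[OF assms(2)] one_minus_cnj_mult_nonzero[of z w] assms
  unfolding one_minus_rho[OF assms] berezin_kernel_def
  by (simp add: power_divide power_mult_distrib flip: power_mult)

text \<open>The chain rule for Jacobians, since \<open>phi a o phi z\<close> and
  \<open>phi (phi z a)\<close> differ by a rotation; here it is read off from the invariance of
  \<open>rho\<close>.\<close>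

lemma berezin_kernel_phi:
  assumes "cmod a < 1" "cmod z < 1" "cmod w < 1"
  shows "berezin_kernel a (phi z w) * berezin_kernel z w = berezin_kernel (phi z a) w"
proof -
  have "1 - (cmod (phi z w))\<^sup>2 > 0" using one_minus_square_pos assms by simp
  then show ?thesis
    using assms one_minus_square_pos[OF assms(3)]
    by (simp add: berezin_kernel_rho rho_phi_left) (simp add: rho_def)
qed

lemma berezin_kernel_0 [simp]: "berezin_kernel 0 w = 1"
  by (simp add: berezin_kernel_def)

lemma rho_0 [simp]: "rho 0 w = cmod w"
  by (simp add: rho_def)

lemma berezin_kernel_bounded:
  assumes "cmod z < 1" "cmod w < 1"
  shows "berezin_kernel z w \<le> (1 - (cmod z)\<^sup>2)\<^sup>2 / (1 - cmod z) ^ 4"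
  unfolding berezin_kernel_def
  using assms cmod_one_minus_ge[of z w] one_minus_cnj_mult_nonzero[of z w]
  by (intro divide_left_mono power_mono) auto

lemma integral_phi_real:
  fixes g :: "complex \<Rightarrow> real"
  assumes z: "cmod z < 1" and g [measurable]: "g \<in> borel_measurable dA"
  shows "(LINT w|dA. g (phi z w)) = (LINT w|dA. g w * berezin_kernel z w)"
proof -
  have "complex_of_real (LINT w|dA. g (phi z w)) = (LINT w|dA. complex_of_real (g (phi z w)))"
    by simp
  also have "\<dots> = (LINT w|dA. complex_of_real (g w) * of_real (berezin_kernel z w))"
    using z by (intro integral_phi) auto
  also have "\<dots> = complex_of_real (LINT w|dA. g w * berezin_kernel z w)"
    by (simp flip: of_real_mult)
  finally show ?thesis using of_real_eq_iff by blast
qed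

lemma integrable_berezin_kernel: "cmod z < 1 \<Longrightarrow> integrable dA (berezin_kernel z)"
  by (rule integrable_dA_bounded[where C = "(1 - (cmod z)\<^sup>2)\<^sup>2 / (1 - cmod z) ^ 4"])
    (auto simp: berezin_kernel_bounded)

lemma integral_berezin_kernel: "cmod z < 1 \<Longrightarrow> (LINT w|dA. berezin_kernel z w) = 1"
  using integral_phi_real[of z "\<lambda>_. 1"] by simp

text \<open>Convolution with a radial kernel for the Moebius group: by \<open>radial_op_eq\<close>
  it is the average of \<open>v o phi z\<close> with weight \<open>\<kappa> (cmod w)\<close>. The
  weight 1 gives the Berezin transform, and 2 r^2 - 1 gives the operator in (f).\<close>

definition radial_op :: "(real \<Rightarrow> real) \<Rightarrow> (complex \<Rightarrow> complex) \<Rightarrow> complex \<Rightarrow> complex" where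
  "radial_op \<kappa> v z = (LINT w|dA. v w * of_real (\<kappa> (rho z w) * berezin_kernel z w))"

lemma berezin_eq_radial_op: "berezin v = radial_op (\<lambda>_. 1) v"
  by (simp add: fun_eq_iff berezin_def radial_op_def cmod_bergman_kernel)

lemma radial_op_eq:
  assumes [measurable]: "\<kappa> \<in> borel_measurable borel" "v \<in> borel_measurable dA" and z: "cmod z < 1"
  shows "radial_op \<kappa> v z = (LINT w|dA. v (phi z w) * of_real (\<kappa> (cmod w)))"
proof -
  have "(LINT w|dA. v (phi z w) * of_real (\<kappa> (cmod w)))
    = (LINT w|dA. v (phi z w) * of_real (\<kappa> (rho z (phi z w))))"
    using z by (intro Bochner_Integration.integral_cong) (auto simp: rho_def)
  also have "\<dots> = (LINT w|dA. v w * of_real (\<kappa> (rho z w)) * of_real (berezin_kernel z w))"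
    using z by (intro integral_phi) auto
  finally show ?thesis by (simp add: radial_op_def mult.assoc)
qed

text \<open>After the substitution \<open>phi z\<close>, the distance is transformed by
  \<open>rho_phi_left\<close> and the density by the cocycle identity
  \<open>berezin_kernel_phi\<close>.\<close>

lemma radial_op_phi:
  assumes [measurable]: "\<kappa> \<in> borel_measurable borel" "v \<in> borel_measurable dA"
    and z: "cmod z < 1" and a: "cmod a < 1"
  shows "radial_op \<kappa> (\<lambda>w. v (phi z w)) a = radial_op \<kappa> v (phi z a)"
proof -
  have "radial_op \<kappa> (\<lambda>w. v (phi z w)) a
    = (LINT w|dA. v (phi z w) * of_real (\<kappa> (rho a (phi z (phi z w))) * berezin_kernel a (phi z (phi z w))))"
    using z unfolding radial_op_def by (intro Bochner_Integration.integral_cong) auto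
  also have "\<dots> = (LINT w|dA. v w * of_real (\<kappa> (rho a (phi z w)) * berezin_kernel a (phi z w)) * of_real (berezin_kernel z w))"
    using z by (intro integral_phi) auto
  also have "\<dots> = (LINT w|dA. v w * of_real (\<kappa> (rho (phi z a) w) * berezin_kernel (phi z a) w))"
    using z a by (intro Bochner_Integration.integral_cong)
      (auto simp: rho_phi_left berezin_kernel_phi[symmetric] mult.assoc)
  finally show ?thesis by (simp add: radial_op_def)
qed

lemma radial_op_bound:
  assumes [measurable]: "\<kappa> \<in> borel_measurable borel" "v \<in> borel_measurable dA"
    and z: "cmod z < 1" and v: "\<And>w. cmod w < 1 \<Longrightarrow> cmod (v w) \<le> C"
    and k: "\<And>r. 0 \<le> r \<Longrightarrow> r < 1 \<Longrightarrow> \<bar>\<kappa> r\<bar> \<le> M"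
  shows "cmod (radial_op \<kappa> v z) \<le> C * M"
proof -
  have "C \<ge> 0" using order_trans[OF norm_ge_zero v[of 0]] by simp
  have b: "cmod (v (phi z w) * of_real (\<kappa> (cmod w))) \<le> C * M" if "cmod w < 1" for w
    unfolding norm_mult norm_of_real using that z v k \<open>C \<ge> 0\<close> by (intro mult_mono) auto
  have "M \<ge> 0" using k[of 0] by simp
  note [measurable] = measurable_phi_dA[OF z]
  have "cmod (LINT w|dA. v (phi z w) * of_real (\<kappa> (cmod w))) \<le> (LINT w|dA. C * M)"
    using b \<open>0 \<le> M\<close> \<open>0 \<le> C\<close>
    by (intro Bochner_Integration.integral_norm_bound_integral integrable_dA_bounded[of _ "C * M"]) auto
  also have "\<dots> = C * M" by simp
  finally show ?thesis using radial_op_eq[OF assms(1,2) z] by simp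
qed

lemma radial_op_measurable [measurable (raw)]:
  assumes [measurable]: "\<kappa> \<in> borel_measurable borel" "v \<in> borel_measurable dA"
  shows "radial_op \<kappa> v \<in> borel_measurable dA"
  unfolding radial_op_def[abs_def] by measurable

lemma bounded_measurable_radial_op:
  assumes "\<kappa> \<in> borel_measurable borel" "bounded_measurable v"
    and "\<And>r. 0 \<le> r \<Longrightarrow> r < 1 \<Longrightarrow> \<bar>\<kappa> r\<bar> \<le> M"
  shows "bounded_measurable (radial_op \<kappa> v)"
proof -
  obtain C where C: "\<And>z. cmod z < 1 \<Longrightarrow> cmod (v z) \<le> C" using bounded_measurableE[OF assms(2)] by metis
  show ?thesis
    by (rule bounded_measurableI[of _ "C * M"])
      (use assms C in \<open>auto intro!: radial_op_bound radial_op_measurable dest: bounded_measurable_imp_measurable\<close>)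
qed

text \<open>Exchanging the arguments of the kernel costs the ratio of the invariant densities at
  \<open>z\<close> and \<open>y\<close>; the substitution \<open>phi y\<close> then turns
  \<open>rho y z\<close> into a modulus. This is the symmetry behind the commutation of radial
  operators with the Berezin transform.\<close>

lemma radial_kernel_swap:
  assumes [measurable]: "\<kappa> \<in> borel_measurable borel" and y: "cmod y < 1"
  shows "(LINT z|dA. \<kappa> (rho z y) * berezin_kernel z y) = (LINT z|dA. \<kappa> (cmod z) * berezin_kernel z y)"
proof -
  have py: "1 - (cmod y)\<^sup>2 > 0" using one_minus_square_pos[OF y] .
  have sw: "berezin_kernel z y = (1 - (cmod z)\<^sup>2)\<^sup>2 / (1 - (cmod y)\<^sup>2)\<^sup>2 * berezin_kernel y z" if "cmod z < 1" for z
    using one_minus_square_pos[OF that] py that y by (simp add: berezin_kernel_rho rho_commute[of z y])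
  have "(LINT z|dA. \<kappa> (rho z y) * berezin_kernel z y)
    = (LINT z|dA. \<kappa> (rho y z) * ((1 - (cmod z)\<^sup>2)\<^sup>2 / (1 - (cmod y)\<^sup>2)\<^sup>2) * berezin_kernel y z)"
    by (intro Bochner_Integration.integral_cong) (auto simp: sw rho_commute)
  also have "\<dots> = (LINT z|dA. \<kappa> (rho y (phi y z)) * ((1 - (cmod (phi y z))\<^sup>2)\<^sup>2 / (1 - (cmod y)\<^sup>2)\<^sup>2))"
    by (rule integral_phi_real[OF y, symmetric]) measurable
  also have "\<dots> = (LINT z|dA. \<kappa> (cmod z) * berezin_kernel z y)"
    using y by (intro Bochner_Integration.integral_cong)
      (auto simp: berezin_kernel_rho rho_def[of y "phi y z" for z] rho_commute[of _ y] simp flip: rho_def[of y])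
  finally show ?thesis .
qed

interpretation dA2: pair_sigma_finite dA dA ..

text \<open>By Fubini both sides are integrals of \<open>v\<close> against one function of
  \<open>y\<close>, the average of \<kappa> (cmod z) or of \<kappa> (rho z y) against
  \<open>berezin_kernel z y\<close>; \<open>radial_kernel_swap\<close> identifies the two
  averages.\<close>

lemma radial_op_berezin_commute_0:
  assumes k [measurable]: "\<kappa> \<in> borel_measurable borel" and v: "bounded_measurable v"
    and M: "\<And>r. 0 \<le> r \<Longrightarrow> r < 1 \<Longrightarrow> \<bar>\<kappa> r\<bar> \<le> M"
  shows "radial_op \<kappa> (berezin v) 0 = berezin (radial_op \<kappa> v) 0"
proof -
  obtain C where C: "0 \<le> C" "\<And>z. cmod z < 1 \<Longrightarrow> cmod (v z) \<le> C" using bounded_measurableE[OF v] by metis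
  have [measurable]: "v \<in> borel_measurable dA" using v by measurable
  \<comment> \<open>Stated for a general weight \<open>l\<close>, because the exchange is made once
    with \<kappa> (cmod z) and once with \<kappa> (rho z y).\<close>
  have Fub: "(LINT z|dA. LINT y|dA. v y * of_real (l z y * berezin_kernel z y))
      = (LINT y|dA. v y * of_real (LINT z|dA. l z y * berezin_kernel z y))"
    if [measurable]: "(\<lambda>p. l (fst p) (snd p)) \<in> borel_measurable (dA \<Otimes>\<^sub>M dA)"
      and l: "\<And>z y. cmod z < 1 \<Longrightarrow> cmod y < 1 \<Longrightarrow> \<bar>l z y\<bar> \<le> M" for l :: "complex \<Rightarrow> complex \<Rightarrow> real"
  proof -
    have M: "M \<ge> 0" using l[of 0 0] by auto
    have b: "cmod (v y * of_real (l z y * berezin_kernel z y)) \<le> C * M * berezin_kernel z y"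
      if "cmod z < 1" "cmod y < 1" for z y
      unfolding norm_mult norm_of_real abs_mult mult.assoc[symmetric] abs_of_nonneg[OF berezin_kernel_nonneg]
      using C l that by (intro mult_right_mono mult_mono) auto
    have m2: "(\<lambda>(z,y). v y * of_real (l z y * berezin_kernel z y)) \<in> borel_measurable (dA \<Otimes>\<^sub>M dA)"
      unfolding split_beta by measurable
    have m1: "(\<lambda>y. v y * of_real (l z y * berezin_kernel z y)) \<in> borel_measurable dA" if "z \<in> disk" for z
    proof -
      have "Pair z \<in> measurable dA (dA \<Otimes>\<^sub>M dA)" using that by (intro measurable_Pair1') auto
      note measurable_compose[OF this m2]
      then show ?thesis
        by (simp only: prod.case)
    qed
    have int1: "integrable dA (\<lambda>y. v y * of_real (l z y * berezin_kernel z y))" if "z \<in> disk" for z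
    proof (rule Bochner_Integration.integrable_bound)
      show "integrable dA (\<lambda>y. C * M * berezin_kernel z y)"
        using that integrable_berezin_kernel[of z] by simp
      show "AE y in dA. cmod (v y * of_real (l z y * berezin_kernel z y)) \<le> norm (C * M * berezin_kernel z y)"
      proof (rule AE_I2)
        fix y assume "y \<in> space dA"
        then have "cmod (v y * of_real (l z y * berezin_kernel z y)) \<le> C * M * berezin_kernel z y"
          using b[of z y] that by simp
        then show "cmod (v y * of_real (l z y * berezin_kernel z y)) \<le> norm (C * M * berezin_kernel z y)"
          using abs_ge_self order_trans unfolding real_norm_def by blast
      qed
    qed (rule m1[OF that])
    have int2: "integrable (dA \<Otimes>\<^sub>M dA) (\<lambda>(z,y). v y * of_real (l z y * berezin_kernel z y))"
    proof (rule dA2.Fubini_integrable[OF m2])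
      have "(LINT y|dA. cmod (v y * of_real (l z y * berezin_kernel z y))) \<le> C * M" if "z \<in> disk" for z
      proof -
        have "(LINT y|dA. cmod (v y * of_real (l z y * berezin_kernel z y)))
           \<le> (LINT y|dA. C * M * berezin_kernel z y)"
          using that b integrable_berezin_kernel[of z] int1[OF that]
          by (intro integral_mono integrable_norm) auto
        then show ?thesis using integral_berezin_kernel[of z] that by simp
      qed
      moreover have "(\<lambda>z. LINT y|dA. cmod (case (z, y) of (z, y) \<Rightarrow> v y * of_real (l z y * berezin_kernel z y))) \<in> borel_measurable dA"
        using m2 by measurable
      ultimately show "integrable dA (\<lambda>z. LINT y|dA. cmod (case (z, y) of (z, y) \<Rightarrow> v y * of_real (l z y * berezin_kernel z y)))"
        by (intro integrable_dA_bounded[of _ "C * M"]) (auto simp: integral_nonneg_AE)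
      show "AE z in dA. integrable dA (\<lambda>y. case (z, y) of (z, y) \<Rightarrow> v y * of_real (l z y * berezin_kernel z y))"
        using int1 by (auto simp: AE_I2)
    qed
    have "(LINT z|dA. LINT y|dA. v y * of_real (l z y * berezin_kernel z y))
      = (LINT y|dA. LINT z|dA. v y * of_real (l z y * berezin_kernel z y))"
      using dA2.Fubini_integral[OF int2] by simp
    then show ?thesis by (simp only: integral_mult_right_zero integral_complex_of_real)
  qed
  have "radial_op \<kappa> (berezin v) 0
    = (LINT z|dA. (LINT y|dA. v y * of_real (berezin_kernel z y)) * of_real (\<kappa> (cmod z)))"
    by (simp add: radial_op_def berezin_def cmod_bergman_kernel)
  also have "\<dots> = (LINT z|dA. LINT y|dA. v y * of_real (\<kappa> (cmod z) * berezin_kernel z y))"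
    by (intro Bochner_Integration.integral_cong refl, subst integral_mult_left_zero[symmetric])
      (simp add: mult_ac)
  also have "\<dots> = (LINT y|dA. v y * of_real (LINT z|dA. \<kappa> (cmod z) * berezin_kernel z y))"
    by (rule Fub) (use M in auto)
  also have "\<dots> = (LINT y|dA. v y * of_real (LINT z|dA. \<kappa> (rho z y) * berezin_kernel z y))"
    by (intro Bochner_Integration.integral_cong) (auto simp: radial_kernel_swap)
  also have "\<dots> = (LINT z|dA. LINT y|dA. v y * of_real (\<kappa> (rho z y) * berezin_kernel z y))"
    by (rule Fub[symmetric]) (use M rho_lt_1 in auto)
  also have "\<dots> = berezin (radial_op \<kappa> v) 0"
    by (simp add: radial_op_def berezin_def cmod_bergman_kernel)
  finally show ?thesis .
qed

text \<open>The case of the point 0, applied to \<open>v o phi z\<close> and carried back by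
  invariance.\<close>

lemma radial_op_berezin_commute:
  assumes k [measurable]: "\<kappa> \<in> borel_measurable borel" and v: "bounded_measurable v"
    and M: "\<And>r. 0 \<le> r \<Longrightarrow> r < 1 \<Longrightarrow> \<bar>\<kappa> r\<bar> \<le> M" and z: "cmod z < 1"
  shows "radial_op \<kappa> (berezin v) z = berezin (radial_op \<kappa> v) z"
proof -
  have [measurable]: "v \<in> borel_measurable dA" using v by measurable
  have [measurable]: "berezin v \<in> borel_measurable dA" unfolding berezin_eq_radial_op by measurable
  have c: "radial_op \<kappa> f a = radial_op \<kappa> g a" if "\<And>w. cmod w < 1 \<Longrightarrow> f w = g w" for f g \<kappa> a
    unfolding radial_op_def using that by (intro Bochner_Integration.integral_cong) auto
  have "radial_op \<kappa> (berezin v) z = radial_op \<kappa> (\<lambda>w. berezin v (phi z w)) 0"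
    using radial_op_phi[of \<kappa> "berezin v" z 0] z by simp
  also have "\<dots> = radial_op \<kappa> (berezin (\<lambda>w. v (phi z w))) 0"
    unfolding berezin_eq_radial_op using z by (intro c radial_op_phi[symmetric]) auto
  also have "\<dots> = berezin (radial_op \<kappa> (\<lambda>w. v (phi z w))) 0"
    by (rule radial_op_berezin_commute_0[OF k bounded_measurable_phi[OF v z] M])
  also have "\<dots> = berezin (\<lambda>w. radial_op \<kappa> v (phi z w)) 0"
    unfolding berezin_eq_radial_op using z by (intro c radial_op_phi) auto
  also have "\<dots> = berezin (radial_op \<kappa> v) z"
    unfolding berezin_eq_radial_op using radial_op_phi[of "\<lambda>_. 1" "radial_op \<kappa> v" z 0] z by simp
  finally show ?thesis .
qed

section \<open>Wirtinger calculus and the Berezin transform\<close>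


text \<open>Real differentiability together with both Wirtinger derivatives: every real-linear map
  sends h to a h + b cnj h for unique a and b. Sum, product and chain rules then deliver
  differentiability and derivatives at the same time.\<close>

definition has_wirtinger :: "(complex \<Rightarrow> complex) \<Rightarrow> complex \<Rightarrow> complex \<Rightarrow> complex \<Rightarrow> bool" where
  "has_wirtinger f a b z \<longleftrightarrow> (f has_derivative (\<lambda>h. a * h + b * cnj h)) (at z)"

lemma has_wirtinger_partial:
  assumes "has_wirtinger f a b z"
  shows "partial_x f z = a + b" "partial_y f z = \<i> * (a - b)"
proof -
  have d: "(f has_derivative (\<lambda>h. a * h + b * cnj h)) (at z)" using assms by (simp add: has_wirtinger_def)
  have "((\<lambda>t. f (z + of_real t)) has_derivative (\<lambda>h. a * of_real h + b * cnj (of_real h))) (at 0)"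
    by (rule has_derivative_compose[of "\<lambda>t. z + of_real t" of_real 0 UNIV f])
      (use d in \<open>auto intro!: derivative_eq_intros\<close>)
  then have "((\<lambda>t. f (z + of_real t)) has_vector_derivative (a + b)) (at 0)"
    by (simp add: has_vector_derivative_def scaleR_conv_of_real algebra_simps)
  then show "partial_x f z = a + b" by (simp add: partial_x_def vector_derivative_at)
  have "((\<lambda>t. f (z + \<i> * of_real t)) has_derivative (\<lambda>h. a * (\<i> * of_real h) + b * cnj (\<i> * of_real h))) (at 0)"
    by (rule has_derivative_compose[of "\<lambda>t. z + \<i> * of_real t" "\<lambda>h. \<i> * of_real h" 0 UNIV f])
      (use d in \<open>auto intro!: derivative_eq_intros\<close>)
  then have "((\<lambda>t. f (z + \<i> * of_real t)) has_vector_derivative \<i> * (a - b)) (at 0)"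
    by (simp add: has_vector_derivative_def scaleR_conv_of_real algebra_simps)
  then show "partial_y f z = \<i> * (a - b)" by (simp add: partial_y_def vector_derivative_at)
qed

lemma has_wirtinger_imp:
  assumes "has_wirtinger f a b z"
  shows "wirtinger f z = a" "wirtinger_bar f z = b"
  by (simp_all only: wirtinger_def wirtinger_bar_def has_wirtinger_partial[OF assms])
    (simp_all add: algebra_simps)

lemma has_wirtinger_add:
  "has_wirtinger f a b z \<Longrightarrow> has_wirtinger g c d z \<Longrightarrow> has_wirtinger (\<lambda>z. f z + g z) (a + c) (b + d) z"
  unfolding has_wirtinger_def
  by (drule (1) has_derivative_add) (simp add: algebra_simps)

lemma has_wirtinger_mult:
  "has_wirtinger f a b z \<Longrightarrow> has_wirtinger g c d z \<Longrightarrow>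
    has_wirtinger (\<lambda>z. f z * g z) (f z * c + a * g z) (f z * d + b * g z) z"
  unfolding has_wirtinger_def
  by (drule (1) has_derivative_mult) (simp add: algebra_simps)

lemma has_wirtinger_const [simp]: "has_wirtinger (\<lambda>_. c) 0 0 z"
  by (simp add: has_wirtinger_def)

lemma has_wirtinger_field_derivative:
  "(f has_field_derivative d) (at z) \<Longrightarrow> has_wirtinger f d 0 z"
  by (simp add: has_wirtinger_def has_field_derivative_def)

lemma has_wirtinger_id [simp]: "has_wirtinger (\<lambda>z. z) 1 0 z"
  by (intro has_wirtinger_field_derivative DERIV_ident)

lemma has_wirtinger_cnj:
  "has_wirtinger f a b z \<Longrightarrow> has_wirtinger (\<lambda>z. cnj (f z)) (cnj b) (cnj a) z"
  unfolding has_wirtinger_def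
  by (drule has_derivative_cnj, erule has_derivative_eq_rhs) (auto simp: fun_eq_iff)

lemma has_wirtinger_compose:
  assumes "has_wirtinger f a b (g z)" "(g has_field_derivative d) (at z)"
  shows "has_wirtinger (\<lambda>z. f (g z)) (a * d) (b * cnj d) z"
proof -
  have "((\<lambda>z. f (g z)) has_derivative (\<lambda>h. a * (d * h) + b * cnj (d * h))) (at z)"
    using assms unfolding has_wirtinger_def has_field_derivative_def
    by (rule has_derivative_compose[of g "(*) d" z UNIV f "\<lambda>h. a * h + b * cnj h", rotated]) 
  then show ?thesis unfolding has_wirtinger_def
    by (rule has_derivative_eq_rhs) (simp add: mult.assoc)
qed

lemma has_wirtinger_cong:
  assumes "has_wirtinger f a b z" "open S" "z \<in> S" "\<And>x. x \<in> S \<Longrightarrow> f x = g x"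
  shows "has_wirtinger g a b z"
  using assms(1) unfolding has_wirtinger_def
  by (rule has_derivative_transform_within_open) (use assms in auto)

lemma has_wirtinger_isCont: "has_wirtinger f a b z \<Longrightarrow> isCont f z"
  unfolding has_wirtinger_def by (rule has_derivative_continuous)

lemma has_wirtinger_continuous_on:
  "(\<And>z. z \<in> S \<Longrightarrow> has_wirtinger f (a z) (b z) z) \<Longrightarrow> continuous_on S f"
  by (meson continuous_at_imp_continuous_on has_wirtinger_isCont)

lemma has_wirtinger_0_imp:
  "has_wirtinger f a 0 z \<Longrightarrow> (f has_field_derivative a) (at z)"
  by (simp add: has_wirtinger_def has_field_derivative_def)

lemma wirtinger_cong:
  assumes "open S" "z \<in> S" "\<And>x. x \<in> S \<Longrightarrow> f x = g x" "has_wirtinger g a b z"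
  shows "wirtinger f z = a" "wirtinger_bar f z = b"
proof -
  have "has_wirtinger f a b z" by (rule has_wirtinger_cong[OF assms(4,1,2)]) (simp add: assms(3))
  then show "wirtinger f z = a" "wirtinger_bar f z = b" by (rule has_wirtinger_imp)+
qed

text \<open>As \<open>wirtinger_bar f\<close> is differentiated once more, the first derivatives
  must be known on a neighbourhood of \<open>z\<close>, the second ones only at
  \<open>z\<close>.\<close>

lemma laplacian_eq:
  assumes "open S" "z \<in> S" "\<And>x. x \<in> S \<Longrightarrow> has_wirtinger f (a x) (b x) x" "has_wirtinger b c d z"
  shows "laplacian f z = 4 * c"
  unfolding laplacian_def
  by (subst wirtinger_cong(1)[OF assms(1,2) has_wirtinger_imp(2)[OF assms(3)] assms(4)]) auto

text \<open>The antilinear half of a real-linear map, as an element of the space of bounded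
  operators in which \<open>C2_on\<close> places its derivatives.\<close>

definition blinfun_mult_cnj :: "complex \<Rightarrow> complex \<Rightarrow>\<^sub>L complex" where
  "blinfun_mult_cnj b = blinfun_mult_right b o\<^sub>L Blinfun cnj"

lemma blinfun_mult_cnj_apply [simp]: "blinfun_apply (blinfun_mult_cnj b) h = b * cnj h"
  by (simp add: blinfun_mult_cnj_def bounded_linear_Blinfun_apply bounded_linear_cnj)

lemma bounded_linear_blinfun_mult_cnj: "bounded_linear blinfun_mult_cnj"
  unfolding blinfun_mult_cnj_def[abs_def]
  by (intro bounded_linear_intros)

lemma C2_onI:
  assumes f: "\<And>z. z \<in> S \<Longrightarrow> has_wirtinger f (a z) (b z) z"
    and a: "\<And>z. z \<in> S \<Longrightarrow> has_wirtinger a (aa z) (ab z) z"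
    and b: "\<And>z. z \<in> S \<Longrightarrow> has_wirtinger b (ba z) (bb z) z"
    and c: "continuous_on S aa" "continuous_on S ab" "continuous_on S ba" "continuous_on S bb"
  shows "C2_on f S"
  unfolding C2_on_def
proof (intro exI conjI ballI)
  let ?M = "Blinfun blinfun_mult_right :: complex \<Rightarrow>\<^sub>L complex \<Rightarrow>\<^sub>L complex"
  let ?N = "Blinfun blinfun_mult_cnj"
  let ?f' = "\<lambda>z. blinfun_mult_right (a z) + blinfun_mult_cnj (b z)"
  let ?f'' = "\<lambda>z. (?M o\<^sub>L blinfun_mult_right (aa z)) + (?M o\<^sub>L blinfun_mult_cnj (ab z))
     + ((?N o\<^sub>L blinfun_mult_right (ba z)) + (?N o\<^sub>L blinfun_mult_cnj (bb z)))"
  fix z assume z: "z \<in> S"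
  have "blinfun_apply (?f' z) = (\<lambda>h. a z * h + b z * cnj h)" by (auto simp: blinfun.add_left)
  then show "(f has_derivative blinfun_apply (?f' z)) (at z)"
    using f[OF z] by (simp only: has_wirtinger_def)
  have M: "blinfun_apply ?M = blinfun_mult_right"
    by (simp add: bounded_linear_Blinfun_apply bounded_linear_blinfun_mult_right)
  have N: "blinfun_apply ?N = blinfun_mult_cnj"
    by (simp add: bounded_linear_Blinfun_apply bounded_linear_blinfun_mult_cnj)
  have 1: "((\<lambda>z. blinfun_mult_right (a z)) has_derivative (\<lambda>h. blinfun_mult_right (aa z * h + ab z * cnj h))) (at z)"
    using a[OF z] unfolding has_wirtinger_def
    by (rule bounded_linear.has_derivative[OF bounded_linear_blinfun_mult_right])
  have 2: "((\<lambda>z. blinfun_mult_cnj (b z)) has_derivative (\<lambda>h. blinfun_mult_cnj (ba z * h + bb z * cnj h))) (at z)"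
    using b[OF z] unfolding has_wirtinger_def
    by (rule bounded_linear.has_derivative[OF bounded_linear_blinfun_mult_cnj])
  have "blinfun_apply (?f'' z) = (\<lambda>h. blinfun_mult_right (aa z * h + ab z * cnj h) + blinfun_mult_cnj (ba z * h + bb z * cnj h))"
    by (auto simp: blinfun.add_left M N fun_eq_iff intro!: blinfun_eqI simp: blinfun.add_left algebra_simps)
  then show "(?f' has_derivative blinfun_apply (?f'' z)) (at z)"
    using has_derivative_add[OF 1 2] by (simp only:)
next
  have cr: "continuous_on S (\<lambda>z. blinfun_mult_right (g z))" "continuous_on S (\<lambda>z. blinfun_mult_cnj (g z))"
    if "continuous_on S g" for g :: "complex \<Rightarrow> complex"
    using bounded_linear.continuous_on[OF bounded_linear_blinfun_mult_right that]
      bounded_linear.continuous_on[OF bounded_linear_blinfun_mult_cnj that] by auto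
  show "continuous_on S (\<lambda>z. (Blinfun blinfun_mult_right o\<^sub>L blinfun_mult_right (aa z)) + (Blinfun blinfun_mult_right o\<^sub>L blinfun_mult_cnj (ab z))
     + ((Blinfun blinfun_mult_cnj o\<^sub>L blinfun_mult_right (ba z)) + (Blinfun blinfun_mult_cnj o\<^sub>L blinfun_mult_cnj (bb z))))"
    by (intro continuous_on_add bounded_bilinear.continuous_on[OF bounded_bilinear_blinfun_compose]
        continuous_on_const cr c)
qed

lemma real_linear_complex_decomp:
  assumes "bounded_linear L"
  shows "L h = (L 1 - \<i> * L \<i>) / 2 * h + (L 1 + \<i> * L \<i>) / 2 * cnj h"
proof -
  interpret L: bounded_linear L by fact
  have "h = Re h *\<^sub>R 1 + Im h *\<^sub>R \<i>" by (simp add: complex_eq_iff)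
  then have "L h = Re h *\<^sub>R L 1 + Im h *\<^sub>R L \<i>" by (metis L.add L.scaleR)
  also have "\<dots> = (L 1 - \<i> * L \<i>) / 2 * h + (L 1 + \<i> * L \<i>) / 2 * cnj h"
    by (simp add: complex_eq_iff field_simps)
  finally show ?thesis .
qed

lemma C2_onD:
  assumes "C2_on f S"
  obtains a b aa ab ba bb where "\<And>z. z \<in> S \<Longrightarrow> has_wirtinger f (a z) (b z) z"
    "\<And>z. z \<in> S \<Longrightarrow> has_wirtinger a (aa z) (ab z) z"
    "\<And>z. z \<in> S \<Longrightarrow> has_wirtinger b (ba z) (bb z) z"
proof -
  obtain f' f'' where f': "\<And>z. z \<in> S \<Longrightarrow> (f has_derivative blinfun_apply (f' z)) (at z)"
    and f'': "\<And>z. z \<in> S \<Longrightarrow> (f' has_derivative blinfun_apply (f'' z)) (at z)"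
    using assms unfolding C2_on_def by auto
  define a where "a z = (f' z 1 - \<i> * f' z \<i>) / 2" for z
  define b where "b z = (f' z 1 + \<i> * f' z \<i>) / 2" for z
  have d1: "has_wirtinger f (a z) (b z) z" if "z \<in> S" for z
  proof -
    have "blinfun_apply (f' z) = (\<lambda>h. a z * h + b z * cnj h)"
      unfolding a_def b_def by (rule ext, rule real_linear_complex_decomp) (rule blinfun.bounded_linear_right)
    then show ?thesis using f'[OF that] by (simp only: has_wirtinger_def)
  qed
  have app: "((\<lambda>z. f' z c) has_derivative (\<lambda>h. f'' z h c)) (at z)" if "z \<in> S" for z c
    using bounded_linear.has_derivative[OF blinfun.bounded_linear_left f''[OF that]] .
  have "\<exists>p q. has_wirtinger a p q z" if "z \<in> S" for z
  proof -
    have d: "(a has_derivative (\<lambda>h. (f'' z h 1 - \<i> * f'' z h \<i>) / 2)) (at z)"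
      unfolding a_def[abs_def]
      by (intro bounded_linear.has_derivative[OF bounded_linear_divide]
          has_derivative_diff has_derivative_mult_right app that)
    show ?thesis unfolding has_wirtinger_def
      by (intro exI, rule has_derivative_eq_rhs[OF d], rule ext)
        (rule real_linear_complex_decomp[OF has_derivative_bounded_linear[OF d]])
  qed
  then obtain aa ab where d2: "\<And>z. z \<in> S \<Longrightarrow> has_wirtinger a (aa z) (ab z) z" by metis
  have "\<exists>p q. has_wirtinger b p q z" if "z \<in> S" for z
  proof -
    have d: "(b has_derivative (\<lambda>h. (f'' z h 1 + \<i> * f'' z h \<i>) / 2)) (at z)"
      unfolding b_def[abs_def]
      by (intro bounded_linear.has_derivative[OF bounded_linear_divide]
          has_derivative_add has_derivative_mult_right app that)
    show ?thesis unfolding has_wirtinger_def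
      by (intro exI, rule has_derivative_eq_rhs[OF d], rule ext)
        (rule real_linear_complex_decomp[OF has_derivative_bounded_linear[OF d]])
  qed
  then obtain ba bb where d3: "\<And>z. z \<in> S \<Longrightarrow> has_wirtinger b (ba z) (bb z) z" by metis
  from d1 d2 d3 show ?thesis by (rule that)
qed

section \<open>Differentiation of kernel integrals\<close>

text \<open>A family closed under both Wirtinger derivatives: they raise \<open>q\<close> or
  \<open>p\<close> by one and produce a factor \<open>cnj w\<close> or \<open>w\<close>, which is
  absorbed into the integrated function. Up to (1 - |z|^2)^2 the Berezin kernel is the case p = q =
  2.\<close>

definition power_kernel :: "nat \<Rightarrow> nat \<Rightarrow> complex \<Rightarrow> complex \<Rightarrow> complex" where
  "power_kernel p q z w = inverse ((1 - cnj z * w) ^ p * (1 - z * cnj w) ^ q)"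

definition kernel_integral :: "(complex \<Rightarrow> complex) \<Rightarrow> nat \<Rightarrow> nat \<Rightarrow> complex \<Rightarrow> complex" where
  "kernel_integral v p q z = (LINT w|dA. v w * power_kernel p q z w)"

lemma borel_measurable_power_kernel [measurable]: "power_kernel p q z \<in> borel_measurable dA"
  unfolding power_kernel_def[abs_def] by measurable

lemma cmod_power_kernel_le:
  assumes "cmod z \<le> r" "r < 1" "cmod w < 1"
  shows "cmod (power_kernel p q z w) \<le> inverse (1 - r) ^ (p + q)"
proof -
  have 1: "1 - r \<le> cmod (1 - cnj z * w)" using cmod_one_minus_ge(1)[of z w] assms by auto
  have 2: "1 - r \<le> cmod (1 - z * cnj w)" using cmod_one_minus_ge(1)[of "cnj z" "cnj w"] assms by auto
  have "(1 - r) ^ p * (1 - r) ^ q \<le> cmod (1 - cnj z * w) ^ p * cmod (1 - z * cnj w) ^ q"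
    using 1 2 assms by (intro mult_mono power_mono) auto
  then have "inverse (cmod (1 - cnj z * w) ^ p * cmod (1 - z * cnj w) ^ q) \<le> inverse ((1 - r) ^ p * (1 - r) ^ q)"
    using assms by (intro le_imp_inverse_le) auto
  then show ?thesis
    by (simp add: power_kernel_def norm_inverse norm_mult norm_power power_add power_inverse)
qed

lemma has_wirtinger_power_kernel:
  assumes "cmod z < 1" "cmod w < 1"
  shows "has_wirtinger (\<lambda>z. power_kernel p q z w) (of_nat q * cnj w * power_kernel p (Suc q) z w)
    (of_nat p * w * power_kernel (Suc p) q z w) z"
proof -
  have nz: "1 - cnj z * w \<noteq> 0" "1 - z * cnj w \<noteq> 0"
    using one_minus_cnj_mult_nonzero one_minus_mult_cnj_nonzero assms by auto
  have d: "((\<lambda>x. inverse ((1 - x * c) ^ n)) has_field_derivative of_nat n * c * inverse ((1 - x * c) ^ Suc n)) (at x)"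
    if "1 - x * c \<noteq> 0" for x c :: complex and n
  proof -
    have "((\<lambda>x. inverse (1 - x * c)) has_field_derivative c * inverse (1 - x * c) ^ 2) (at x)"
      using that by (auto intro!: derivative_eq_intros simp: field_simps power2_eq_square)
    from DERIV_power[OF this, of n]
    have "((\<lambda>x. inverse (1 - x * c) ^ n) has_field_derivative
      of_nat n * (c * inverse (1 - x * c) ^ 2 * inverse (1 - x * c) ^ (n - Suc 0))) (at x)" .
    moreover have "of_nat n * (c * inverse (1 - x * c) ^ 2 * inverse (1 - x * c) ^ (n - Suc 0))
      = of_nat n * c * inverse (1 - x * c) ^ Suc n"
      by (cases n) (auto simp: power2_eq_square)
    ultimately show ?thesis by (simp only: power_inverse)
  qed
  have 1: "has_wirtinger (\<lambda>z. inverse ((1 - z * cnj w) ^ q)) (of_nat q * cnj w * inverse ((1 - z * cnj w) ^ Suc q)) 0 z"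
    by (rule has_wirtinger_field_derivative, rule d) (use nz in auto)
  have 2: "has_wirtinger (\<lambda>z. inverse ((1 - z * cnj w) ^ p)) (of_nat p * cnj w * inverse ((1 - z * cnj w) ^ Suc p)) 0 z"
    by (rule has_wirtinger_field_derivative, rule d) (use nz in auto)
  have 3: "has_wirtinger (\<lambda>z. inverse ((1 - cnj z * w) ^ p)) 0 (of_nat p * w * inverse ((1 - cnj z * w) ^ Suc p)) z"
    using has_wirtinger_cnj[OF 2] by simp
  show ?thesis using has_wirtinger_mult[OF 3 1] unfolding power_kernel_def
    by (simp add: inverse_mult_distrib mult_ac)
qed

text \<open>Dominated convergence for the remainder of the first-order expansion: the kernel and its
  derivatives are bounded on \<open>cball 0 r\<close> for |z| < r < 1, uniformly in
  \<open>w\<close>.\<close>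

lemma has_wirtinger_kernel_integral:
  assumes v: "bounded_measurable v" and z: "cmod z < 1"
  shows "has_wirtinger (kernel_integral v p q)
    (of_nat q * kernel_integral (\<lambda>w. v w * cnj w) p (Suc q) z)
    (of_nat p * kernel_integral (\<lambda>w. v w * w) (Suc p) q z) z"
proof -
  have [measurable]: "v \<in> borel_measurable dA" using v by measurable
  obtain C where C: "0 \<le> C" "\<And>z. cmod z < 1 \<Longrightarrow> cmod (v z) \<le> C" using bounded_measurableE[OF v] by metis
  define A where "A z w = of_nat q * cnj w * power_kernel p (Suc q) z w" for z w
  define B where "B z w = of_nat p * w * power_kernel (Suc p) q z w" for z w
  have [measurable]: "A z \<in> borel_measurable dA" "B z \<in> borel_measurable dA" for z
    unfolding A_def[abs_def] B_def[abs_def] by measurable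
  obtain r where r: "cmod z < r" "r < 1" using z dense by blast
  \<comment> \<open>Bounds the sum of both derivatives of the kernel on \<open>cball 0 r\<close>; by
    the mean value inequality it is also a Lipschitz constant there, so the remainder quotient is at
    most 2 M.\<close>
  define M where "M = real (p + q) * inverse (1 - r) ^ Suc (p + q)"
  have invpos: "inverse (1 - r) > 0" using r by simp
  have AB: "cmod (A x w) + cmod (B x w) \<le> M" if "cmod x \<le> r" "cmod w < 1" for x w
  proof -
    have "cmod (A x w) \<le> real q * 1 * inverse (1 - r) ^ (p + Suc q)"
      unfolding A_def norm_mult using that cmod_power_kernel_le[OF that(1) r(2) that(2), of p "Suc q"] r
      by (intro mult_mono) auto
    moreover have "cmod (B x w) \<le> real p * 1 * inverse (1 - r) ^ (Suc p + q)"
      unfolding B_def norm_mult using that cmod_power_kernel_le[OF that(1) r(2) that(2), of "Suc p" q] r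
      by (intro mult_mono) auto
    ultimately show ?thesis by (simp add: M_def algebra_simps)
  qed
  have bl: "bounded_linear (\<lambda>h. A x w * h + B x w * cnj h)" for x w
    by (intro bounded_linear_intros bounded_linear_cnj)
  have lin: "cmod (A x w * h + B x w * cnj h) \<le> M * cmod h" if "cmod x \<le> r" "cmod w < 1" for x w h
  proof -
    have "cmod (A x w * h + B x w * cnj h) \<le> (cmod (A x w) + cmod (B x w)) * cmod h"
      by (rule norm_triangle_le) (simp add: norm_mult algebra_simps)
    also have "\<dots> \<le> M * cmod h" using AB[OF that] by (intro mult_right_mono) auto
    finally show ?thesis .
  qed
  have Lip: "cmod (power_kernel p q x w - power_kernel p q z w) \<le> M * cmod (x - z)"
    if "cmod x \<le> r" "cmod w < 1" for x w
  proof (rule differentiable_bound[of "cball 0 r" _ "\<lambda>x h. A x w * h + B x w * cnj h"])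
    show "((\<lambda>x. power_kernel p q x w) has_derivative (\<lambda>h. A y w * h + B y w * cnj h)) (at y within cball 0 r)"
      if "y \<in> cball 0 r" for y
      using has_wirtinger_power_kernel[of y w p q] that r \<open>cmod w < 1\<close>
      unfolding has_wirtinger_def A_def B_def by (auto intro: has_derivative_at_withinI)
    show "onorm (\<lambda>h. A y w * h + B y w * cnj h) \<le> M" if "y \<in> cball 0 r" for y
      using lin that \<open>cmod w < 1\<close> by (intro onorm_le) auto
  qed (use that r in auto)
  let ?R = "\<lambda>y w. (power_kernel p q y w - power_kernel p q z w - (A z w * (y - z) + B z w * cnj (y - z)))
     / of_real (cmod (y - z))"
  have Rbound: "cmod (?R y w) \<le> 2 * M" if "cmod y \<le> r" "cmod w < 1" "y \<noteq> z" for y w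
  proof -
    have "cmod (power_kernel p q y w - power_kernel p q z w - (A z w * (y - z) + B z w * cnj (y - z))) \<le> 2 * M * cmod (y - z)"
      using norm_triangle_ineq4[of "power_kernel p q y w - power_kernel p q z w" "A z w * (y - z) + B z w * cnj (y - z)"]
        Lip[OF that(1,2)] lin[of z w "y - z"] that r by simp
    then show ?thesis using that by (simp add: norm_divide divide_le_eq)
  qed
  have Rlim: "((\<lambda>y. ?R y w) \<longlongrightarrow> 0) (at z)" if "cmod w < 1" for w
  proof -
    have "((\<lambda>y. power_kernel p q y w) has_derivative (\<lambda>h. A z w * h + B z w * cnj h)) (at z)"
      using has_wirtinger_power_kernel[OF z that, of p q] unfolding has_wirtinger_def A_def B_def .
    then have "((\<lambda>y. norm (?R y w)) \<longlongrightarrow> 0) (at z)"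
      by (simp add: has_derivative_iff_norm norm_divide)
    then show ?thesis by (rule tendsto_norm_zero_cancel)
  qed
  have intk: "integrable dA (\<lambda>w. v w * power_kernel p q y w)" if "cmod y \<le> r" for y
    using C that r cmod_power_kernel_le[OF that r(2)]
    by (intro integrable_dA_bounded[of _ "C * inverse (1 - r) ^ (p + q)"])
      (auto simp: norm_mult intro!: mult_mono)
  have M: "M \<ge> 0" using r by (simp add: M_def)
  have intA: "integrable dA (\<lambda>w. v w * A z w)" "integrable dA (\<lambda>w. v w * B z w)"
  proof -
    have "cmod (A z w) \<le> M" "cmod (B z w) \<le> M" if "cmod w < 1" for w
      using AB[OF less_imp_le[OF r(1)] that] norm_ge_zero[of "A z w"] norm_ge_zero[of "B z w"] by linarith+
    then show "integrable dA (\<lambda>w. v w * A z w)" "integrable dA (\<lambda>w. v w * B z w)"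
      using C by (auto intro!: integrable_dA_bounded[of _ "C * M"] mult_mono simp: norm_mult)
  qed
  let ?a = "LINT w|dA. v w * A z w" and ?b = "LINT w|dA. v w * B z w"
  define Q where "Q y = (kernel_integral v p q y - kernel_integral v p q z - (?a * (y - z) + ?b * cnj (y - z))) / of_real (cmod (y - z))" for y
  define I where "I y = (LINT w|dA. v w * ?R y w)" for y
  have eq: "Q y = I y" if "cmod y \<le> r" for y
  proof -
    have "(LINT w|dA. v w * ?R y w) = (LINT w|dA. (v w * power_kernel p q y w - v w * power_kernel p q z w
       - ((v w * A z w) * (y - z) + (v w * B z w) * cnj (y - z))) / of_real (cmod (y - z)))"
      by (simp add: algebra_simps diff_divide_distrib add_divide_distrib)
    also have "\<dots> = (LINT w|dA. v w * power_kernel p q y w - v w * power_kernel p q z w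
       - ((v w * A z w) * (y - z) + (v w * B z w) * cnj (y - z))) / of_real (cmod (y - z))"
      by simp
    also have "(LINT w|dA. v w * power_kernel p q y w - v w * power_kernel p q z w
       - ((v w * A z w) * (y - z) + (v w * B z w) * cnj (y - z)))
      = kernel_integral v p q y - kernel_integral v p q z - (?a * (y - z) + ?b * cnj (y - z))"
      using intA intk[OF that] intk[of z] r unfolding kernel_integral_def
      by (simp add: Bochner_Integration.integral_diff Bochner_Integration.integral_add)
    finally show ?thesis unfolding Q_def I_def by (rule sym)
  qed
  have lim: "(Q \<longlongrightarrow> 0) (at z)"
    unfolding tendsto_at_iff_sequentially
  proof (intro allI impI)
    fix X :: "nat \<Rightarrow> complex" assume X: "\<forall>i. X i \<in> UNIV - {z}" "X \<longlonglongrightarrow> z"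
    have "\<forall>\<^sub>F n in sequentially. cmod (X n) < r"
      using tendsto_norm[OF X(2)] r(1) by (rule order_tendstoD)
    \<comment> \<open>The sequence is shifted by \<open>N\<close> so that all its terms lie in
      \<open>cball 0 r\<close>, where the domination holds.\<close>
    then obtain N where N: "\<And>n. n \<ge> N \<Longrightarrow> cmod (X n) < r" by (auto simp: eventually_sequentially)
    have "(\<lambda>n. LINT w|dA. v w * ?R (X (n + N)) w) \<longlonglongrightarrow> (LINT w|dA. 0)"
    proof (rule integral_dominated_convergence[where w = "\<lambda>_. C * (2 * M)"])
      show "(\<lambda>w. v w * ?R (X (n + N)) w) \<in> borel_measurable dA" for n by measurable
      show "AE w in dA. (\<lambda>n. v w * ?R (X (n + N)) w) \<longlonglongrightarrow> 0"
      proof (rule AE_I2)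
        fix w assume "w \<in> space dA"
        then have "((\<lambda>y. ?R y w) \<longlongrightarrow> 0) (at z)" using Rlim by simp
        then have "(\<lambda>n. ?R (X n) w) \<longlonglongrightarrow> 0"
          using X unfolding tendsto_at_iff_sequentially o_def by blast
        then have "(\<lambda>n. ?R (X (n + N)) w) \<longlonglongrightarrow> 0" by (rule LIMSEQ_ignore_initial_segment)
        then show "(\<lambda>n. v w * ?R (X (n + N)) w) \<longlonglongrightarrow> 0" by (rule tendsto_mult_right_zero)
      qed
      show "AE w in dA. norm (v w * ?R (X (n + N)) w) \<le> C * (2 * M)" for n
      proof (rule AE_I2)
        fix w assume w: "w \<in> space dA"
        have "cmod (?R (X (n + N)) w) \<le> 2 * M"
          using w N[of "n + N"] X by (intro Rbound) auto
        then show "norm (v w * ?R (X (n + N)) w) \<le> C * (2 * M)"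
          unfolding norm_mult using C w M by (intro mult_mono) auto
      qed
    qed auto
    then have "(\<lambda>n. I (X (n + N))) \<longlonglongrightarrow> 0" by (simp only: I_def integral_zero)
    moreover have "Q (X (n + N)) = I (X (n + N))" for n
      by (rule eq) (use less_imp_le[OF N[of "n + N"]] in simp)
    ultimately have "(\<lambda>n. Q (X (n + N))) \<longlonglongrightarrow> 0" by (simp only:)
    then show "(Q \<circ> X) \<longlonglongrightarrow> 0"
      unfolding o_def by (rule LIMSEQ_offset)
  qed
  have "(kernel_integral v p q has_derivative (\<lambda>h. ?a * h + ?b * cnj h)) (at z)"
    unfolding has_derivative_iff_norm
  proof
    show "bounded_linear (\<lambda>h. ?a * h + ?b * cnj h)" by (intro bounded_linear_intros bounded_linear_cnj)
    show "((\<lambda>y. norm (kernel_integral v p q y - kernel_integral v p q z - (?a * (y - z) + ?b * cnj (y - z))) / norm (y - z)) \<longlongrightarrow> 0) (at z)"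
      using tendsto_norm_zero[OF lim] by (simp add: Q_def norm_divide)
  qed
  moreover have "?a = of_nat q * kernel_integral (\<lambda>w. v w * cnj w) p (Suc q) z"
    unfolding kernel_integral_def A_def integral_mult_right_zero[symmetric]
    by (intro Bochner_Integration.integral_cong) (auto simp: mult_ac)
  moreover have "?b = of_nat p * kernel_integral (\<lambda>w. v w * w) (Suc p) q z"
    unfolding kernel_integral_def B_def integral_mult_right_zero[symmetric]
    by (intro Bochner_Integration.integral_cong) (auto simp: mult_ac)
  ultimately show ?thesis by (simp only: has_wirtinger_def)
qed


text \<open>Generated by the coordinates and the kernel integrals, and closed under Wirtinger
  derivatives; membership therefore yields derivatives of every order, all continuous.\<close>

inductive kernel_polynomial :: "(complex \<Rightarrow> complex) \<Rightarrow> bool" where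
  id: "kernel_polynomial (\<lambda>z. z)"
| cnj: "kernel_polynomial cnj"
| const: "kernel_polynomial (\<lambda>_. c)"
| kernel: "bounded_measurable v \<Longrightarrow> kernel_polynomial (kernel_integral v p q)"
| add: "kernel_polynomial f \<Longrightarrow> kernel_polynomial g \<Longrightarrow> kernel_polynomial (\<lambda>z. f z + g z)"
| mult: "kernel_polynomial f \<Longrightarrow> kernel_polynomial g \<Longrightarrow> kernel_polynomial (\<lambda>z. f z * g z)"

lemma bounded_measurable_mult:
  assumes "bounded_measurable v" "bounded_measurable w"
  shows "bounded_measurable (\<lambda>z. v z * w z)"
proof -
  obtain C where C: "0 \<le> C" "\<And>z. cmod z < 1 \<Longrightarrow> cmod (v z) \<le> C" using bounded_measurableE[OF assms(1)] by metis
  obtain D where D: "0 \<le> D" "\<And>z. cmod z < 1 \<Longrightarrow> cmod (w z) \<le> D" using bounded_measurableE[OF assms(2)] by metis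
  have [measurable]: "v \<in> borel_measurable dA" "w \<in> borel_measurable dA" using assms by measurable
  show ?thesis
    by (rule bounded_measurableI[of _ "C * D"]) (auto simp: norm_mult C D intro!: mult_mono)
qed

lemma bounded_measurable_id: "bounded_measurable (\<lambda>w. w)"
  by (rule bounded_measurableI[of _ 1]) auto

lemma bounded_measurable_cnj: "bounded_measurable v \<Longrightarrow> bounded_measurable (\<lambda>w. cnj (v w))"
proof -
  assume v: "bounded_measurable v"
  obtain C where C: "\<And>z. cmod z < 1 \<Longrightarrow> cmod (v z) \<le> C" using bounded_measurableE[OF v] by metis
  have [measurable]: "v \<in> borel_measurable dA" using v by measurable
  show ?thesis by (rule bounded_measurableI[of _ C]) (auto simp: C)
qed

lemma kernel_polynomial_has_wirtinger:
  assumes "kernel_polynomial f"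
  shows "\<exists>a b. kernel_polynomial a \<and> kernel_polynomial b \<and> (\<forall>z\<in>disk. has_wirtinger f (a z) (b z) z)"
  using assms
proof induction
  case id
  show ?case
    by (rule exI[of _ "\<lambda>_. 1"], rule exI[of _ "\<lambda>_. 0"]) (auto intro: kernel_polynomial.intros)
next
  case cnj
  have "has_wirtinger cnj 0 1 z" for z
    using has_wirtinger_cnj[OF has_wirtinger_id, of z] by simp
  then show ?case
    by (intro exI[of _ "\<lambda>_. 0"] exI[of _ "\<lambda>_. 1"]) (auto intro: kernel_polynomial.intros)
next
  case (const c)
  show ?case
    by (rule exI[of _ "\<lambda>_. 0"], rule exI[of _ "\<lambda>_. 0"]) (auto intro: kernel_polynomial.intros)
next
  case (kernel v p q)
  show ?case
  proof (intro exI conjI ballI)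
    show "has_wirtinger (kernel_integral v p q)
      (of_nat q * kernel_integral (\<lambda>w. v w * cnj w) p (Suc q) z)
      (of_nat p * kernel_integral (\<lambda>w. v w * w) (Suc p) q z) z" if "z \<in> disk" for z
      using has_wirtinger_kernel_integral[OF kernel] that by simp
  qed (intro kernel_polynomial.intros bounded_measurable_mult kernel bounded_measurable_cnj bounded_measurable_id)+
next
  case (add f g)
  then obtain a b c d where h: "kernel_polynomial a" "kernel_polynomial b" "kernel_polynomial c" "kernel_polynomial d"
     "\<forall>z\<in>disk. has_wirtinger f (a z) (b z) z" "\<forall>z\<in>disk. has_wirtinger g (c z) (d z) z" by blast
  show ?case
  proof (intro exI conjI ballI)
    show "has_wirtinger (\<lambda>z. f z + g z) (a z + c z) (b z + d z) z" if "z \<in> disk" for z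
      using h that by (intro has_wirtinger_add) auto
  qed (intro kernel_polynomial.intros h)+
next
  case (mult f g)
  then obtain a b c d where h: "kernel_polynomial a" "kernel_polynomial b" "kernel_polynomial c" "kernel_polynomial d"
     "\<forall>z\<in>disk. has_wirtinger f (a z) (b z) z" "\<forall>z\<in>disk. has_wirtinger g (c z) (d z) z" by blast
  show ?case
  proof (intro exI conjI ballI)
    show "has_wirtinger (\<lambda>z. f z * g z) (f z * c z + a z * g z) (f z * d z + b z * g z) z" if "z \<in> disk" for z
      using h that by (intro has_wirtinger_mult) auto
  qed (intro kernel_polynomial.intros h mult)+
qed

lemma kernel_polynomial_continuous: "kernel_polynomial f \<Longrightarrow> continuous_on disk f"
  by (meson has_wirtinger_continuous_on kernel_polynomial_has_wirtinger)

lemma kernel_polynomial_C2: 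
  assumes "kernel_polynomial f"
  shows "C2_on f disk"
proof -
  obtain a b where ab: "kernel_polynomial a" "kernel_polynomial b" "\<forall>z\<in>disk. has_wirtinger f (a z) (b z) z"
    using kernel_polynomial_has_wirtinger[OF assms] by blast
  obtain aa ab' where a: "kernel_polynomial aa" "kernel_polynomial ab'" "\<forall>z\<in>disk. has_wirtinger a (aa z) (ab' z) z"
    using kernel_polynomial_has_wirtinger[OF ab(1)] by blast
  obtain ba bb where b: "kernel_polynomial ba" "kernel_polynomial bb" "\<forall>z\<in>disk. has_wirtinger b (ba z) (bb z) z"
    using kernel_polynomial_has_wirtinger[OF ab(2)] by blast
  show ?thesis
    by (rule C2_onI[of disk f a b aa ab' ba bb])
      (use ab a b in \<open>auto intro: kernel_polynomial_continuous\<close>)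
qed

lemma cmod_one_minus_power4:
  "complex_of_real (cmod (1 - cnj z * w) ^ 4) = (1 - cnj z * w)\<^sup>2 * (1 - z * cnj w)\<^sup>2"
proof -
  have "complex_of_real (cmod (1 - cnj z * w) ^ 4) = (complex_of_real ((cmod (1 - cnj z * w))\<^sup>2))\<^sup>2"
    by (simp flip: power_mult)
  also have "\<dots> = ((1 - cnj z * w) * cnj (1 - cnj z * w))\<^sup>2" by (simp only: complex_norm_square)
  finally show ?thesis by (simp add: power_mult_distrib)
qed

lemma one_minus_square_complex: "complex_of_real (1 - (cmod z)\<^sup>2) = 1 - z * cnj z"
  by (simp only: of_real_diff complex_norm_square of_real_1)

lemma berezin_kernel_complex:
  "complex_of_real (berezin_kernel z w) = (1 - z * cnj z)\<^sup>2 * power_kernel 2 2 z w"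
  by (simp only: berezin_kernel_def of_real_divide cmod_one_minus_power4)
    (simp only: of_real_power one_minus_square_complex power_kernel_def divide_inverse)

lemma berezin_eq_kernel_integral: "berezin v = (\<lambda>z. (1 - z * cnj z)\<^sup>2 * kernel_integral v 2 2 z)"
proof
  fix z
  have "berezin v z = (LINT w|dA. (1 - z * cnj z)\<^sup>2 * (v w * power_kernel 2 2 z w))"
    unfolding berezin_def cmod_bergman_kernel berezin_kernel_complex
    by (intro Bochner_Integration.integral_cong) (auto simp: mult_ac)
  then show "berezin v z = (1 - z * cnj z)\<^sup>2 * kernel_integral v 2 2 z"
    by (simp add: kernel_integral_def)
qed

lemma kernel_polynomial_berezin:
  assumes "bounded_measurable v"
  shows "kernel_polynomial (berezin v)"
proof -
  have "kernel_polynomial (\<lambda>z. ((1 + (-1) * (z * cnj z)) * (1 + (-1) * (z * cnj z))) * kernel_integral v 2 2 z)"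
    by (intro kernel_polynomial.intros assms)
  then show ?thesis by (simp add: berezin_eq_kernel_integral power2_eq_square)
qed

lemma integrable_power_kernel:
  assumes "bounded_measurable v" "cmod z < 1"
  shows "integrable dA (\<lambda>w. v w * power_kernel p q z w)"
proof -
  obtain C where C: "0 \<le> C" "\<And>z. cmod z < 1 \<Longrightarrow> cmod (v z) \<le> C" using bounded_measurableE[OF assms(1)] by metis
  have [measurable]: "v \<in> borel_measurable dA" using assms by measurable
  show ?thesis
  proof (rule integrable_dA_bounded[of _ "C * inverse (1 - cmod z) ^ (p + q)"])
    fix w :: complex assume "cmod w < 1"
    then show "norm (v w * power_kernel p q z w) \<le> C * inverse (1 - cmod z) ^ (p + q)"
      unfolding norm_mult using C assms cmod_power_kernel_le[of z "cmod z" w p q] by (intro mult_mono) auto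
  qed measurable
qed

text \<open>The operator in (f), by \<open>radial_op_eq\<close>; \<open>laplacian_berezin\<close>
  identifies it, up to the factor 8, with the invariant Laplacian of the Berezin transform.\<close>

definition laplace_op :: "(complex \<Rightarrow> complex) \<Rightarrow> complex \<Rightarrow> complex" where
  "laplace_op = radial_op (\<lambda>r. 2 * r\<^sup>2 - 1)"

text \<open>Two differentiations give kernel integrals with exponents 2 and 3. Their combined
  integrand is the kernel with p = q = 2 multiplied by 2 (2 rho^2 - 1). The constant 8 is this 2
  times the 4 in the definition of \<open>laplacian\<close>.\<close>

lemma laplacian_berezin:
  assumes v: "bounded_measurable v" and z: "cmod z < 1"
  shows "complex_of_real ((1 - (cmod z)\<^sup>2)\<^sup>2) * laplacian (berezin v) z = 8 * laplace_op v z"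
proof -
  let ?J = "\<lambda>v p q z. kernel_integral v p q z"
  let ?va = "\<lambda>w. v w * cnj w" and ?vb = "\<lambda>w. v w * w" and ?vab = "\<lambda>w. v w * w * cnj w"
  have bm: "bounded_measurable ?va" "bounded_measurable ?vb" "bounded_measurable ?vab"
    by (intro bounded_measurable_mult v bounded_measurable_cnj bounded_measurable_id)+
  have X: "has_wirtinger (\<lambda>z. 1 - z * cnj z) (- cnj x) (- x) x" for x
    using has_wirtinger_add[OF has_wirtinger_const[of 1]
        has_wirtinger_mult[OF has_wirtinger_const[of "-1"] has_wirtinger_mult[OF has_wirtinger_id has_wirtinger_cnj[OF has_wirtinger_id]]]]
    by simp
  define b where "b x = - 2 * (1 - x * cnj x) * x * ?J v 2 2 x + (1 - x * cnj x) * (1 - x * cnj x) * (2 * ?J ?vb 3 2 x)" for x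
  have w1: "has_wirtinger (berezin v)
     (- 2 * (1 - x * cnj x) * cnj x * ?J v 2 2 x + (1 - x * cnj x) * (1 - x * cnj x) * (2 * ?J ?va 2 3 x)) (b x) x"
    if "x \<in> disk" for x
  proof -
    have "has_wirtinger (?J v 2 2) (2 * ?J ?va 2 3 x) (2 * ?J ?vb 3 2 x) x"
      using has_wirtinger_kernel_integral[OF v, of x 2 2] that by (simp add: eval_nat_numeral)
    from has_wirtinger_mult[OF has_wirtinger_mult[OF X X] this]
    show ?thesis unfolding berezin_eq_kernel_integral b_def power2_eq_square
      by (rule back_subst[of "\<lambda>p. has_wirtinger _ (fst p) (snd p) _" "(_, _)" "(_, _)", simplified]) (simp add: algebra_simps)
  qed
  define ba where "ba = 2 * z * cnj z * ?J v 2 2 z - 2 * (1 - z * cnj z) * ?J v 2 2 z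
      - 4 * (1 - z * cnj z) * z * ?J ?va 2 3 z - 4 * (1 - z * cnj z) * cnj z * ?J ?vb 3 2 z
      + 4 * (1 - z * cnj z) * (1 - z * cnj z) * ?J ?vab 3 3 z"
  have w2: "\<exists>d. has_wirtinger b ba d z"
  proof -
    have 1: "has_wirtinger (?J v 2 2) (2 * ?J ?va 2 3 z) (2 * ?J ?vb 3 2 z) z"
      using has_wirtinger_kernel_integral[OF v, of z 2 2] z by (simp add: eval_nat_numeral)
    have 2: "has_wirtinger (?J ?vb 3 2) (2 * ?J ?vab 3 3 z) (3 * ?J (\<lambda>w. ?vb w * w) 4 2 z) z"
      using has_wirtinger_kernel_integral[OF bm(2), of z 3 2] z by (simp add: eval_nat_numeral)
    note has_wirtinger_add[OF
      has_wirtinger_mult[OF has_wirtinger_mult[OF has_wirtinger_mult[OF has_wirtinger_const[of "-2"] X] has_wirtinger_id] 1]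
      has_wirtinger_mult[OF has_wirtinger_mult[OF X X] has_wirtinger_mult[OF has_wirtinger_const[of 2] 2]]]
    then have "\<exists>d. has_wirtinger b ((- 2 * (1 - z * cnj z) * z) * (2 * ?J ?va 2 3 z) + ((- 2 * (1 - z * cnj z)) * 1 + ((-2) * (- cnj z) + 0 * (1 - z * cnj z)) * z) * ?J v 2 2 z
       + (((1 - z * cnj z) * (1 - z * cnj z)) * (2 * (2 * ?J ?vab 3 3 z) + 0 * ?J ?vb 3 2 z) + ((1 - z * cnj z) * (- cnj z) + (- cnj z) * (1 - z * cnj z)) * (2 * ?J ?vb 3 2 z))) d z"
      unfolding b_def[abs_def] by blast
    moreover have "((- 2 * (1 - z * cnj z) * z) * (2 * ?J ?va 2 3 z) + ((- 2 * (1 - z * cnj z)) * 1 + ((-2) * (- cnj z) + 0 * (1 - z * cnj z)) * z) * ?J v 2 2 z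
       + (((1 - z * cnj z) * (1 - z * cnj z)) * (2 * (2 * ?J ?vab 3 3 z) + 0 * ?J ?vb 3 2 z) + ((1 - z * cnj z) * (- cnj z) + (- cnj z) * (1 - z * cnj z)) * (2 * ?J ?vb 3 2 z))) = ba"
      unfolding ba_def by (simp add: algebra_simps)
    ultimately show ?thesis by simp
  qed
  then obtain d where w2: "has_wirtinger b ba d z" by blast
  have lap: "laplacian (berezin v) z = 4 * ba"
  proof (rule laplacian_eq[where S = disk])
    show "has_wirtinger (berezin v)
     (- 2 * (1 - x * cnj x) * cnj x * ?J v 2 2 x + (1 - x * cnj x) * (1 - x * cnj x) * (2 * ?J ?va 2 3 x)) (b x) x"
      if "x \<in> disk" for x by (rule w1[OF that])
  qed (use z w2 in auto)
  have int: "integrable dA (\<lambda>w. v w * power_kernel 2 2 z w)" "integrable dA (\<lambda>w. ?va w * power_kernel 2 3 z w)"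
    "integrable dA (\<lambda>w. ?vb w * power_kernel 3 2 z w)" "integrable dA (\<lambda>w. ?vab w * power_kernel 3 3 z w)"
    by (intro integrable_power_kernel v bm z)+
  have "ba = (LINT w|dA. 2 * z * cnj z * (v w * power_kernel 2 2 z w) - 2 * (1 - z * cnj z) * (v w * power_kernel 2 2 z w)
      - 4 * (1 - z * cnj z) * z * (?va w * power_kernel 2 3 z w) - 4 * (1 - z * cnj z) * cnj z * (?vb w * power_kernel 3 2 z w)
      + 4 * (1 - z * cnj z) * (1 - z * cnj z) * (?vab w * power_kernel 3 3 z w))"
    unfolding ba_def kernel_integral_def
    using int by (simp only: Bochner_Integration.integral_diff Bochner_Integration.integral_add
        integral_mult_right_zero Bochner_Integration.integrable_diff integrable_mult_right)
  also have "\<dots> = (LINT w|dA. v w * (power_kernel 2 2 z w * (2 * of_real (2 * (rho z w)\<^sup>2 - 1))))"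
  proof (rule Bochner_Integration.integral_cong[OF refl])
    fix w assume "w \<in> space dA"
    then have w: "cmod w < 1" by simp
    \<comment> \<open>From here on \<open>z\<close>, \<open>cnj z\<close>, \<open>w\<close> and
      \<open>cnj w\<close> act as four independent variables, and comparing the integrands becomes
      an identity of rational functions with denominators P and Q.\<close>
    define P Q where "P = 1 - cnj z * w" and "Q = 1 - z * cnj w"
    have nz: "P \<noteq> 0" "Q \<noteq> 0"
      unfolding P_def Q_def using one_minus_cnj_mult_nonzero one_minus_mult_cnj_nonzero w z by auto
    have rho: "complex_of_real ((rho z w)\<^sup>2) = (z - w) * (cnj z - cnj w) / (P * Q)"
      by (simp only: rho_def complex_norm_square) (simp add: disk_involution_def P_def Q_def)
    have k: "power_kernel 2 2 z w = 1 / (P * Q)\<^sup>2" "power_kernel 2 3 z w = 1 / ((P * Q)\<^sup>2 * Q)"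
      "power_kernel 3 2 z w = 1 / ((P * Q)\<^sup>2 * P)" "power_kernel 3 3 z w = 1 / ((P * Q)\<^sup>2 * (P * Q))"
      unfolding power_kernel_def P_def[symmetric] Q_def[symmetric]
      by (simp_all add: divide_inverse power_mult_distrib power2_eq_square power3_eq_cube mult_ac)
    have id: "2 * z * cnj z - 2 * (1 - z * cnj z) - 4 * (1 - z * cnj z) * z * cnj w / Q - 4 * (1 - z * cnj z) * cnj z * w / P
       + 4 * (1 - z * cnj z) * (1 - z * cnj z) * w * cnj w / (P * Q) = 2 * (2 * ((z - w) * (cnj z - cnj w) / (P * Q)) - 1)"
      (is "?l = ?r")
    proof -
      have "?l * (P * Q) = (2 * z * cnj z - 2 * (1 - z * cnj z)) * (P * Q) - 4 * (1 - z * cnj z) * z * cnj w * P - 4 * (1 - z * cnj z) * cnj z * w * Q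
       + 4 * (1 - z * cnj z) * (1 - z * cnj z) * w * cnj w"
        using nz by (simp add: field_simps)
      also have "\<dots> = 4 * ((z - w) * (cnj z - cnj w)) - 2 * (P * Q)"
        unfolding P_def Q_def by algebra
      also have "\<dots> = ?r * (P * Q)" using nz by (simp add: field_simps)
      finally show ?thesis using nz by simp
    qed
    have "2 * z * cnj z * (v w * power_kernel 2 2 z w) - 2 * (1 - z * cnj z) * (v w * power_kernel 2 2 z w)
      - 4 * (1 - z * cnj z) * z * (?va w * power_kernel 2 3 z w) - 4 * (1 - z * cnj z) * cnj z * (?vb w * power_kernel 3 2 z w)
      + 4 * (1 - z * cnj z) * (1 - z * cnj z) * (?vab w * power_kernel 3 3 z w)
      = v w * (1 / (P * Q)\<^sup>2) * (2 * z * cnj z - 2 * (1 - z * cnj z) - 4 * (1 - z * cnj z) * z * cnj w / Q - 4 * (1 - z * cnj z) * cnj z * w / P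
       + 4 * (1 - z * cnj z) * (1 - z * cnj z) * w * cnj w / (P * Q))"
      by (simp only: k divide_inverse inverse_mult_distrib mult_1_left) algebra
    also have "\<dots> = v w * (power_kernel 2 2 z w * (2 * of_real (2 * (rho z w)\<^sup>2 - 1)))"
      unfolding id k(1) of_real_diff of_real_mult rho by simp
    finally show "2 * z * cnj z * (v w * power_kernel 2 2 z w) - 2 * (1 - z * cnj z) * (v w * power_kernel 2 2 z w)
      - 4 * (1 - z * cnj z) * z * (?va w * power_kernel 2 3 z w) - 4 * (1 - z * cnj z) * cnj z * (?vb w * power_kernel 3 2 z w)
      + 4 * (1 - z * cnj z) * (1 - z * cnj z) * (?vab w * power_kernel 3 3 z w)
      = v w * (power_kernel 2 2 z w * (2 * of_real (2 * (rho z w)\<^sup>2 - 1)))" .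
  qed
  finally have ba: "ba = (LINT w|dA. v w * (power_kernel 2 2 z w * (2 * of_real (2 * (rho z w)\<^sup>2 - 1))))" .
  have "8 * laplace_op v z = (LINT w|dA. 8 * (v w * of_real ((2 * (rho z w)\<^sup>2 - 1) * berezin_kernel z w)))"
    by (simp add: laplace_op_def radial_op_def)
  also have "\<dots> = (LINT w|dA. (4 * (1 - z * cnj z)\<^sup>2) * (v w * (power_kernel 2 2 z w * (2 * of_real (2 * (rho z w)\<^sup>2 - 1)))))"
    unfolding of_real_mult[of _ "berezin_kernel _ _"] berezin_kernel_complex
    by (intro Bochner_Integration.integral_cong refl) algebra
  also have "\<dots> = (1 - z * cnj z)\<^sup>2 * (4 * ba)" unfolding ba integral_mult_right_zero by (simp only: mult_ac)
  also have "\<dots> = complex_of_real ((1 - (cmod z)\<^sup>2)\<^sup>2) * laplacian (berezin v) z"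
    unfolding lap of_real_power one_minus_square_complex ..
  finally show ?thesis by simp
qed


section \<open>Bounded fixed points of the Berezin transform\<close>

lemma berezin_cong: "(\<And>w. cmod w < 1 \<Longrightarrow> f w = g w) \<Longrightarrow> berezin f z = berezin g z"
  unfolding berezin_def by (intro Bochner_Integration.integral_cong) auto

lemma radial_op_cong: "(\<And>w. cmod w < 1 \<Longrightarrow> f w = g w) \<Longrightarrow> radial_op \<kappa> f z = radial_op \<kappa> g z"
  unfolding radial_op_def by (intro Bochner_Integration.integral_cong) auto

lemma bounded_measurable_const [simp]: "bounded_measurable (\<lambda>_. c)"
  by (rule bounded_measurableI[of _ "cmod c"]) auto

lemma bounded_measurable_diff:
  assumes "bounded_measurable f" "bounded_measurable g"
  shows "bounded_measurable (\<lambda>z. f z - g z)"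
proof -
  obtain C where C: "\<And>z. cmod z < 1 \<Longrightarrow> cmod (f z) \<le> C" using bounded_measurableE[OF assms(1)] by metis
  obtain D where D: "\<And>z. cmod z < 1 \<Longrightarrow> cmod (g z) \<le> D" using bounded_measurableE[OF assms(2)] by metis
  have [measurable]: "f \<in> borel_measurable dA" "g \<in> borel_measurable dA" using assms by measurable
  show ?thesis
    by (rule bounded_measurableI[of _ "C + D"])
      (use C D in \<open>auto intro: order_trans[OF norm_triangle_ineq4] add_mono\<close>)
qed

lemma radial_op_integrable:
  assumes "\<kappa> \<in> borel_measurable borel" "bounded_measurable v" "cmod z < 1"
    and k: "\<And>r. 0 \<le> r \<Longrightarrow> r < 1 \<Longrightarrow> \<bar>\<kappa> r\<bar> \<le> M"
  shows "integrable dA (\<lambda>w. v w * of_real (\<kappa> (rho z w) * berezin_kernel z w))"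
proof -
  obtain C where C: "0 \<le> C" "\<And>z. cmod z < 1 \<Longrightarrow> cmod (v z) \<le> C" using bounded_measurableE[OF assms(2)] by metis
  have [measurable]: "v \<in> borel_measurable dA" "\<kappa> \<in> borel_measurable borel" using assms by measurable
  let ?B = "(1 - (cmod z)\<^sup>2)\<^sup>2 / (1 - cmod z) ^ 4"
  have "M \<ge> 0" using k[of 0] by simp
  show ?thesis
  proof (rule integrable_dA_bounded[of _ "C * (M * ?B)"])
    fix w :: complex assume w: "cmod w < 1"
    show "norm (v w * of_real (\<kappa> (rho z w) * berezin_kernel z w)) \<le> C * (M * ?B)"
      unfolding norm_mult norm_of_real abs_mult
      using C w assms k[of "rho z w"] rho_lt_1[of z w] berezin_kernel_bounded[of z w] \<open>M \<ge> 0\<close>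
      by (intro mult_mono) auto
  qed measurable
qed

lemma laplace_kappa: "0 \<le> r \<Longrightarrow> r < 1 \<Longrightarrow> \<bar>2 * r\<^sup>2 - 1\<bar> \<le> (1::real)"
  using abs_square_less_1[of r] by (auto simp: abs_le_iff)

lemma berezin_const: "cmod z < 1 \<Longrightarrow> berezin (\<lambda>_. c) z = c"
  by (simp add: berezin_def cmod_bergman_kernel integral_berezin_kernel)

text \<open>In effect 2 |w|^2 - 1 has mean 0. This is read off from
  \<open>laplacian_berezin\<close>, since the Berezin transform fixes constants and their Laplacian
  is 0.\<close>

lemma laplace_op_const:
  assumes "cmod z < 1"
  shows "laplace_op (\<lambda>_. c) z = 0"
proof -
  have "laplacian (berezin (\<lambda>_. c)) z = 4 * 0"
  proof (rule laplacian_eq[where S = disk and a = "\<lambda>_. 0" and b = "\<lambda>_. 0" and d = 0])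
    show "has_wirtinger (berezin (\<lambda>_. c)) 0 0 x" if "x \<in> disk" for x
      by (rule has_wirtinger_cong[OF has_wirtinger_const[of c], of disk])
        (use that in \<open>auto simp: berezin_const\<close>)
  qed (use assms in auto)
  then show ?thesis using laplacian_berezin[of "\<lambda>_. c" z] assms by simp
qed

text \<open>The variance identity for the probability measure \<open>dA\<close>, obtained by
  expanding |f - c|^2 for the mean c of f; the inequality is the nonnegativity of the
  variance.\<close>

lemma norm_integral_square_le:
  assumes f: "bounded_measurable f"
  shows "(cmod (LINT w|dA. f w))\<^sup>2 \<le> (LINT w|dA. (cmod (f w))\<^sup>2)"
    and "(LINT w|dA. (cmod (f w - (LINT w|dA. f w)))\<^sup>2) = (LINT w|dA. (cmod (f w))\<^sup>2) - (cmod (LINT w|dA. f w))\<^sup>2"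
proof -
  define c where "c = (LINT w|dA. f w)"
  obtain C where C: "0 \<le> C" "\<And>z. cmod z < 1 \<Longrightarrow> cmod (f z) \<le> C" using bounded_measurableE[OF f] by metis
  have [measurable]: "f \<in> borel_measurable dA" using f by measurable
  have i1: "integrable dA (\<lambda>w. (cmod (f w))\<^sup>2)"
    by (rule integrable_dA_bounded[of _ "C\<^sup>2"]) (auto simp: C intro!: power_mono)
  have i2: "integrable dA (\<lambda>w. cnj c * f w)"
    using bounded_measurable_integrable[OF f] by simp
  define h where "h w = Re (cnj c * f w)" for w
  have i3: "integrable dA h" unfolding h_def using i2 by (rule integrable_Re)
  have e3: "(LINT w|dA. h w) = (cmod c)\<^sup>2"
  proof -
    have "(LINT w|dA. h w) = Re (LINT w|dA. cnj c * f w)" unfolding h_def using i2 by (rule integral_Re)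
    also have "(LINT w|dA. cnj c * f w) = cnj c * c" by (simp add: c_def)
    also have "Re (cnj c * c) = (cmod c)\<^sup>2" unfolding cmod_power2 by (simp add: power2_eq_square)
    finally show ?thesis .
  qed
  have "(LINT w|dA. (cmod (f w - c))\<^sup>2) = (LINT w|dA. (cmod (f w))\<^sup>2 - 2 * h w + (cmod c)\<^sup>2)"
    unfolding h_def cmod_power2 by (intro Bochner_Integration.integral_cong refl)
      (simp add: power2_eq_square algebra_simps)
  also have "\<dots> = (LINT w|dA. (cmod (f w))\<^sup>2) - 2 * (LINT w|dA. h w) + (cmod c)\<^sup>2"
    using i1 i3 by simp
  also note e3
  finally have eq: "(LINT w|dA. (cmod (f w - c))\<^sup>2) = (LINT w|dA. (cmod (f w))\<^sup>2) - (cmod c)\<^sup>2" by simp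
  then show "(LINT w|dA. (cmod (f w - (LINT w|dA. f w)))\<^sup>2) = (LINT w|dA. (cmod (f w))\<^sup>2) - (cmod (LINT w|dA. f w))\<^sup>2"
    by (simp add: c_def)
  have "0 \<le> (LINT w|dA. (cmod (f w - c))\<^sup>2)" by (intro integral_nonneg_AE) auto
  then show "(cmod (LINT w|dA. f w))\<^sup>2 \<le> (LINT w|dA. (cmod (f w))\<^sup>2)"
    using eq unfolding c_def by linarith
qed

definition berezin_real :: "(complex \<Rightarrow> real) \<Rightarrow> complex \<Rightarrow> real" where
  "berezin_real g z = (LINT w|dA. g w * berezin_kernel z w)"

lemma berezin_real_eq:
  "cmod z < 1 \<Longrightarrow> g \<in> borel_measurable dA \<Longrightarrow> berezin_real g z = (LINT w|dA. g (phi z w))"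
  by (simp add: berezin_real_def integral_phi_real)

lemma berezin_real_measurable [measurable]:
  assumes [measurable]: "g \<in> borel_measurable dA"
  shows "berezin_real g \<in> borel_measurable dA"
  unfolding berezin_real_def[abs_def] by measurable

text \<open>If \<open>B v = v\<close>, then \<open>w = laplace_op v\<close> satisfies \<open>B w = w\<close> and is dominated by the variance
  \<open>D = B |v|\<^sup>2 - |v|\<^sup>2\<close>. Since \<open>|w|\<^sup>2 \<le> B |w|\<^sup>2\<close>, telescoping \<open>D\<close> gives \<open>n |w|\<^sup>2 \<le> B\<^sup>n |v|\<^sup>2 - |v|\<^sup>2\<close>
  for all \<open>n\<close>.\<close>

theorem berezin_fixed_imp_laplace_op_0:
  assumes v: "bounded_measurable v" and fix_v: "\<And>z. cmod z < 1 \<Longrightarrow> berezin v z = v z"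
    and z: "cmod z < 1"
  shows "laplace_op v z = 0"
proof -
  obtain C where C: "0 \<le> C" "\<And>z. cmod z < 1 \<Longrightarrow> cmod (v z) \<le> C" using bounded_measurableE[OF v] by metis
  have [measurable]: "v \<in> borel_measurable dA" using v by measurable
  define w where "w = laplace_op v"
  have w: "bounded_measurable w" unfolding w_def laplace_op_def
    by (rule bounded_measurable_radial_op[of _ _ 1]) (auto simp: v laplace_kappa)
  then have [measurable]: "w \<in> borel_measurable dA" by measurable
  \<comment> \<open>The operator commutes with \<open>B\<close>, so it maps the fixed point
    \<open>v\<close> to a fixed point.\<close>
  have fix_w: "berezin w z = w z" if "cmod z < 1" for z
  proof -
    have "berezin w z = radial_op (\<lambda>r. 2 * r\<^sup>2 - 1) (berezin v) z"
      unfolding w_def laplace_op_def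
      by (rule radial_op_berezin_commute[symmetric, of _ _ 1]) (auto simp: v laplace_kappa that)
    also have "\<dots> = w z" unfolding w_def laplace_op_def by (intro radial_op_cong fix_v)
    finally show ?thesis .
  qed
  define s where "s x = (cmod (v x))\<^sup>2" for x
  define W where "W x = (cmod (w x))\<^sup>2" for x
  obtain K where K: "0 \<le> K" "\<And>z. cmod z < 1 \<Longrightarrow> cmod (w z) \<le> K" using bounded_measurableE[OF w] by metis
  have [measurable]: "s \<in> borel_measurable dA" "W \<in> borel_measurable dA"
    unfolding s_def[abs_def] W_def[abs_def] by measurable
  have W_le: "W z \<le> berezin_real W z" if "cmod z < 1" for z
  proof -
    have "W z = (cmod (LINT x|dA. w (phi z x)))\<^sup>2"
      using berezin_eq_integral_phi[of z w] fix_w that by (simp add: W_def)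
    also have "\<dots> \<le> (LINT x|dA. (cmod (w (phi z x)))\<^sup>2)"
      by (rule norm_integral_square_le) (rule bounded_measurable_phi[OF w that])
    also have "\<dots> = berezin_real W z" using that by (simp add: berezin_real_eq W_def)
    finally show ?thesis .
  qed
  have W_le_D: "W z \<le> berezin_real s z - s z" if z: "cmod z < 1" for z
  proof -
    have bm: "bounded_measurable (\<lambda>x. v (phi z x))" by (rule bounded_measurable_phi[OF v z])
    have [measurable]: "(\<lambda>x. v (phi z x)) \<in> borel_measurable dA" using bm by measurable
    have vz: "(LINT x|dA. v (phi z x)) = v z"
      using berezin_eq_integral_phi[of z v] fix_v z by simp
    define d where "d x = v (phi z x) - v z" for x
    have bmd: "bounded_measurable d" unfolding d_def by (intro bounded_measurable_diff bm) simp
    then have [measurable]: "d \<in> borel_measurable dA" by measurable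
    obtain E where E: "0 \<le> E" "\<And>x. cmod x < 1 \<Longrightarrow> cmod (d x) \<le> E"
      using bounded_measurableE[OF bmd] by metis
    have sq: "bounded_measurable (\<lambda>x. of_real (2 * (cmod x)\<^sup>2 - 1))"
    proof (rule bounded_measurableI[of _ 1])
      fix x :: complex assume "cmod x < 1"
      then show "cmod (of_real (2 * (cmod x)\<^sup>2 - 1)) \<le> 1"
        unfolding norm_of_real by (intro laplace_kappa) auto
    qed measurable
    \<comment> \<open>The weight has mean 0, so \<open>v\<close> may be replaced by its deviation
      \<open>d\<close> from \<open>v z\<close>; as the weight is at most 1 in modulus, |w z|^2 is
      then at most the variance.\<close>
    have c0: "(LINT x|dA. v z * of_real (2 * (cmod x)\<^sup>2 - 1)) = 0"
      using laplace_op_const[OF z, of "v z"] radial_op_eq[of "\<lambda>r. 2 * r\<^sup>2 - 1" "\<lambda>_. v z" z] z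
      by (simp add: laplace_op_def)
    have "w z = (LINT x|dA. v (phi z x) * of_real (2 * (cmod x)\<^sup>2 - 1))"
      unfolding w_def laplace_op_def using z by (intro radial_op_eq) auto
    also have "\<dots> = (LINT x|dA. v (phi z x) * of_real (2 * (cmod x)\<^sup>2 - 1)) - (LINT x|dA. v z * of_real (2 * (cmod x)\<^sup>2 - 1))"
      unfolding c0 by simp
    also have "\<dots> = (LINT x|dA. v (phi z x) * of_real (2 * (cmod x)\<^sup>2 - 1) - v z * of_real (2 * (cmod x)\<^sup>2 - 1))"
      by (intro Bochner_Integration.integral_diff[symmetric] bounded_measurable_integrable bounded_measurable_mult bm sq) simp
    also have "\<dots> = (LINT x|dA. d x * of_real (2 * (cmod x)\<^sup>2 - 1))"
      by (simp only: d_def left_diff_distrib)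
    finally have "W z = (cmod (LINT x|dA. d x * of_real (2 * (cmod x)\<^sup>2 - 1)))\<^sup>2"
      by (simp add: W_def)
    also have "\<dots> \<le> (LINT x|dA. (cmod (d x * of_real (2 * (cmod x)\<^sup>2 - 1)))\<^sup>2)"
      by (intro norm_integral_square_le bounded_measurable_mult bmd sq)
    also have "\<dots> \<le> (LINT x|dA. (cmod (d x))\<^sup>2)"
    proof (rule integral_mono)
      have le: "(cmod (d x * of_real (2 * (cmod x)\<^sup>2 - 1)))\<^sup>2 \<le> (cmod (d x))\<^sup>2"
        if "cmod x < 1" for x
      proof -
        have "cmod (d x) * \<bar>2 * (cmod x)\<^sup>2 - 1\<bar> \<le> cmod (d x) * 1"
          by (rule mult_left_mono[OF laplace_kappa]) (use that in auto)
        then show ?thesis unfolding norm_mult norm_of_real by (intro power_mono) simp_all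
      qed
      then show "x \<in> space dA \<Longrightarrow> (cmod (d x * of_real (2 * (cmod x)\<^sup>2 - 1)))\<^sup>2 \<le> (cmod (d x))\<^sup>2" for x
        by simp
      have E2: "(cmod (d x))\<^sup>2 \<le> E\<^sup>2" if "cmod x < 1" for x
        by (rule power_mono[OF E(2)[OF that]]) simp
      show "integrable dA (\<lambda>x. (cmod (d x))\<^sup>2)"
        by (rule integrable_dA_bounded[of _ "E\<^sup>2"]) (use E2 in auto)
      show "integrable dA (\<lambda>x. (cmod (d x * of_real (2 * (cmod x)\<^sup>2 - 1)))\<^sup>2)"
      proof (rule integrable_dA_bounded[of _ "E\<^sup>2"])
        fix x :: complex assume "cmod x < 1"
        then show "norm ((cmod (d x * of_real (2 * (cmod x)\<^sup>2 - 1)))\<^sup>2) \<le> E\<^sup>2"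
          using order_trans[OF le E2] by simp
      qed measurable
    qed
    also have "\<dots> = (LINT x|dA. (cmod (v (phi z x)))\<^sup>2) - (cmod (v z))\<^sup>2"
      using norm_integral_square_le(2)[OF bm] by (simp only: vz d_def)
    also have "\<dots> = berezin_real s z - s z" using z by (simp add: berezin_real_eq s_def)
    finally show ?thesis .
  qed
  \<comment> \<open>For the step, \<open>B\<close> is applied to n W + s <= g, and W <= B W and W <=
    B s - s are inserted. The upper bound C^2 persists because \<open>B\<close> averages.\<close>
  have ind: "(berezin_real ^^ n) s \<in> borel_measurable dA \<and>
     (\<forall>z. cmod z < 1 \<longrightarrow> real n * W z + s z \<le> (berezin_real ^^ n) s z \<and> (berezin_real ^^ n) s z \<le> C\<^sup>2)" for n
  proof (induction n)
    case 0
    show ?case using C by (auto simp: s_def intro: power_mono)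
  next
    case (Suc n)
    define g where "g = (berezin_real ^^ n) s"
    have g [measurable]: "g \<in> borel_measurable dA" and lo: "\<And>z. cmod z < 1 \<Longrightarrow> real n * W z + s z \<le> g z"
      and up: "\<And>z. cmod z < 1 \<Longrightarrow> g z \<le> C\<^sup>2"
      using Suc.IH by (auto simp: g_def)
    have g_pos: "0 \<le> g z" if "cmod z < 1" for z
      by (rule order_trans[OF _ lo[OF that]]) (simp add: W_def s_def)
    have le: "real (Suc n) * W z + s z \<le> berezin_real g z" "berezin_real g z \<le> C\<^sup>2" if z: "cmod z < 1" for z
    proof -
      note [measurable] = measurable_phi_dA[OF z]
      have ig: "integrable dA (\<lambda>x. g (phi z x))"
        by (rule integrable_dA_bounded[of _ "C\<^sup>2"]) (use g_pos up z in auto)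
      have iW: "integrable dA (\<lambda>x. W (phi z x))"
        by (rule integrable_dA_bounded[of _ "K\<^sup>2"]) (use K z in \<open>auto simp: W_def intro!: power_mono\<close>)
      have isx: "integrable dA (\<lambda>x. s (phi z x))"
        by (rule integrable_dA_bounded[of _ "C\<^sup>2"]) (use C z in \<open>auto simp: s_def intro!: power_mono\<close>)
      have "real (Suc n) * W z + s z \<le> real n * berezin_real W z + berezin_real s z"
        using mult_left_mono[OF W_le[OF z], of "real n"] W_le_D[OF z] by (simp add: algebra_simps)
      also have "\<dots> = (LINT x|dA. real n * W (phi z x) + s (phi z x))"
        using z iW isx by (simp add: berezin_real_eq)
      also have "\<dots> \<le> (LINT x|dA. g (phi z x))"
        using lo z ig iW isx by (intro integral_mono) auto
      also have "\<dots> = berezin_real g z" using z by (simp add: berezin_real_eq)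
      finally show "real (Suc n) * W z + s z \<le> berezin_real g z" .
      have "(LINT x|dA. g (phi z x)) \<le> (LINT x|dA. C\<^sup>2)"
        using up z ig by (intro integral_mono) auto
      then show "berezin_real g z \<le> C\<^sup>2" using z by (simp add: berezin_real_eq)
    qed
    have "(berezin_real ^^ Suc n) s = berezin_real g" by (simp add: g_def)
    then show ?case using le by (simp only:) auto
  qed
  have "W z = 0"
  proof (rule ccontr)
    assume "W z \<noteq> 0"
    then have "W z > 0" by (simp add: W_def)
    then obtain n where "C\<^sup>2 < real n * W z" using reals_Archimedean3 by blast
    moreover have "real n * W z + s z \<le> (berezin_real ^^ n) s z" "(berezin_real ^^ n) s z \<le> C\<^sup>2"
      using conjunct2[OF ind[of n], rule_format, OF z] by simp_all
    moreover have "s z \<ge> 0" by (simp add: s_def)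
    ultimately show False by linarith
  qed
  then show ?thesis by (simp add: W_def w_def)
qed

lemma C2_on_cong:
  assumes S: "open S" and f: "C2_on f S" and eq: "\<And>z. z \<in> S \<Longrightarrow> f z = g z"
  shows "C2_on g S"
proof -
  obtain f' f'' where f': "\<And>z. z \<in> S \<Longrightarrow> (f has_derivative blinfun_apply (f' z)) (at z)"
    and f'': "\<And>z. z \<in> S \<Longrightarrow> (f' has_derivative blinfun_apply (f'' z)) (at z)" "continuous_on S f''"
    using f unfolding C2_on_def by blast
  have "(g has_derivative blinfun_apply (f' z)) (at z)" if "z \<in> S" for z
    by (rule has_derivative_transform_within_open[OF f'[OF that] S that eq])
  then show ?thesis unfolding C2_on_def using f'' by blast
qed

lemma laplacian_cong:
  assumes "open S" "z \<in> S" "\<And>x. x \<in> S \<Longrightarrow> f x = g x"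
    and g: "\<And>x. x \<in> S \<Longrightarrow> has_wirtinger g (a x) (b x) x" "has_wirtinger b c d z"
  shows "laplacian f z = laplacian g z"
proof -
  have "has_wirtinger f (a x) (b x) x" if "x \<in> S" for x
    by (rule has_wirtinger_cong[OF g(1)[OF that] assms(1) that]) (simp add: assms(3))
  from laplacian_eq[OF assms(1,2) this g(2)] laplacian_eq[OF assms(1,2) g] show ?thesis by simp
qed

lemma harmonic_on_disk_cong:
  assumes "harmonic_on_disk f" "\<And>z. cmod z < 1 \<Longrightarrow> f z = g z"
  shows "harmonic_on_disk g"
proof -
  have C2: "C2_on f disk" using assms(1) by (simp add: harmonic_on_disk_def)
  obtain a b aa ab ba bb where w: "\<And>z. z \<in> disk \<Longrightarrow> has_wirtinger f (a z) (b z) z"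
    "\<And>z. z \<in> disk \<Longrightarrow> has_wirtinger b (ba z) (bb z) z"
    using C2_onD[OF C2] by metis
  have "laplacian g z = laplacian f z" if z: "z \<in> disk" for z
    by (rule laplacian_cong[OF open_ball z _ w(1) w(2)[OF z]]) (simp_all add: assms(2))
  moreover have "C2_on g disk" by (rule C2_on_cong[OF open_ball C2]) (simp add: assms(2))
  ultimately show ?thesis using assms(1) by (simp add: harmonic_on_disk_def)
qed

lemma harmonic_berezin:
  assumes "bounded_measurable v" "\<And>z. cmod z < 1 \<Longrightarrow> laplace_op v z = 0"
  shows "harmonic_on_disk (berezin v)"
  unfolding harmonic_on_disk_def
proof (intro conjI ballI)
  show "C2_on (berezin v) disk" by (intro kernel_polynomial_C2 kernel_polynomial_berezin assms)
  fix z assume z: "z \<in> disk"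
  have "(1 - (cmod z)\<^sup>2)\<^sup>2 \<noteq> 0" using one_minus_square_pos[of z] z by simp
  moreover have "complex_of_real ((1 - (cmod z)\<^sup>2)\<^sup>2) * laplacian (berezin v) z = 0"
    using laplacian_berezin[OF assms(1), of z] assms(2)[of z] z by simp
  ultimately show "laplacian (berezin v) z = 0" using of_real_eq_0_iff mult_eq_0_iff by blast
qed

lemma berezin_fixed_imp_harmonic:
  assumes "bounded_measurable v" "\<And>z. cmod z < 1 \<Longrightarrow> berezin v z = v z"
  shows "harmonic_on_disk v"
  using harmonic_on_disk_cong[OF harmonic_berezin[OF assms(1) berezin_fixed_imp_laplace_op_0[OF assms]] assms(2)] .

section \<open>Harmonic functions and injectivity of the Berezin transform\<close>


lemma has_field_derivative_imp_holomorphic: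
  assumes "\<And>z. z \<in> S \<Longrightarrow> (f has_field_derivative d z) (at z)"
  shows "f holomorphic_on S"
  unfolding holomorphic_on_def field_differentiable_def
  using assms DERIV_subset by blast

text \<open>The vanishing Laplacian makes the conjugate of the d-bar derivative of \<open>f\<close>
  holomorphic. The conjugate of its primitive \<open>H\<close> has the same d-bar derivative as
  \<open>f\<close>, so \<open>f - cnj H\<close> is holomorphic.\<close>

lemma harmonic_decomposition:
  assumes "harmonic_on_disk f"
  obtains G H where "G holomorphic_on disk" "H holomorphic_on disk"
    "\<And>z. cmod z < 1 \<Longrightarrow> f z = G z + cnj (H z)"
proof -
  obtain a b aa ab ba bb where w: "\<And>z. z \<in> disk \<Longrightarrow> has_wirtinger f (a z) (b z) z"
    "\<And>z. z \<in> disk \<Longrightarrow> has_wirtinger b (ba z) (bb z) z"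
    using C2_onD assms unfolding harmonic_on_disk_def by metis
  have ba: "ba z = 0" if z: "z \<in> disk" for z
    using laplacian_eq[where S = disk, OF open_ball z w(1) w(2)[OF z]] assms z
    by (simp add: harmonic_on_disk_def)
  have "((\<lambda>z. cnj (b z)) has_field_derivative cnj (bb z)) (at z)" if "z \<in> disk" for z
    using has_wirtinger_cnj[OF w(2)[OF that]] ba[OF that] by (intro has_wirtinger_0_imp) simp
  then have "(\<lambda>z. cnj (b z)) holomorphic_on disk"
    by (rule has_field_derivative_imp_holomorphic)
  from holomorphic_convex_primitive'[OF convex_ball open_ball this]
  obtain H where Hw: "\<And>x. x \<in> disk \<Longrightarrow> (H has_field_derivative cnj (b x)) (at x within disk)"
    by metis
  have H: "(H has_field_derivative cnj (b x)) (at x)" if "x \<in> disk" for x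
    using Hw[OF that] at_within_open[OF that open_ball] by simp
  then have holH: "H holomorphic_on disk"
    by (rule has_field_derivative_imp_holomorphic)
  have "((\<lambda>z. f z + (-1) * cnj (H z)) has_field_derivative a z) (at z)" if "z \<in> disk" for z
    using has_wirtinger_add[OF w(1)[OF that] has_wirtinger_mult[OF has_wirtinger_const[of "-1"]
       has_wirtinger_cnj[OF has_wirtinger_field_derivative[OF H[OF that]]]]]
    by (intro has_wirtinger_0_imp) simp
  then have "(\<lambda>z. f z + (-1) * cnj (H z)) holomorphic_on disk"
    by (rule has_field_derivative_imp_holomorphic)
  then show ?thesis using holH by (rule that) simp
qed

text \<open>The mean value property in discrete form: averaging over the (N+1)-st roots of unity
  annihilates the powers of \<open>w\<close> with exponents from 1 to N, and absolute convergence of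
  the power series lets N tend to infinity termwise. Counting by \<open>Suc N\<close> keeps the
  divisor positive.\<close>

lemma root_of_unity_average:
  assumes hol: "G holomorphic_on disk" and w: "cmod w < 1"
  shows "(\<lambda>N. (\<Sum>j<Suc N. G (cis (2 * pi * real j / real (Suc N)) * w)) / of_nat (Suc N)) \<longlonglongrightarrow> G 0"
proof -
  define c where "c n = (deriv ^^ n) G 0 / fact n * w ^ n" for n
  define \<omega> where "\<omega> N = cis (2 * pi / real (Suc N))" for N
  have pw: "cis (2 * pi * real j / real (Suc N)) = \<omega> N ^ j" for N j
    unfolding \<omega>_def Complex.DeMoivre by (rule arg_cong[of _ _ cis]) simp
  have sums: "(\<lambda>n. c n * x ^ n) sums G (x * w)" if "cmod x = 1" for x
  proof -
    have "x * w \<in> ball 0 1" using that w by (simp add: norm_mult)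
    from holomorphic_power_series[OF hol this] show ?thesis
      unfolding c_def by (simp only: power_mult_distrib diff_zero mult_ac)
  qed
  obtain r where r: "cmod w < r" "r < 1" using dense[OF w] by blast
  have "summable (\<lambda>n. norm (((deriv ^^ n) G 0 / fact n) * w ^ n))"
  proof (rule powser_insidea[of _ "complex_of_real r"])
    have r0: "0 \<le> r" using r(1) norm_ge_zero[of w] by linarith
    then have "complex_of_real r \<in> ball 0 1" using r(2) by (simp add: dist_norm)
    from holomorphic_power_series[OF hol this] show "summable (\<lambda>n. (deriv ^^ n) G 0 / fact n * complex_of_real r ^ n)"
      by (simp add: sums_iff)
    show "cmod w < cmod (complex_of_real r)" using r r0 by simp
  qed
  then have sumc: "summable (\<lambda>n. norm (c n))" by (simp add: c_def)
  define m where "m k N = (\<Sum>j<Suc N. (\<omega> N ^ k) ^ j) / of_nat (Suc N)" for k N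
  have norm_m: "cmod (m k N) \<le> 1" for k N
  proof -
    have "cmod (\<Sum>j<Suc N. (\<omega> N ^ k) ^ j) \<le> (\<Sum>j<Suc N. 1)"
      by (rule sum_norm_le) (simp add: \<omega>_def norm_power)
    then show ?thesis by (simp add: m_def norm_divide norm_of_nat del: sum.lessThan_Suc of_nat_Suc)
  qed
  \<comment> \<open>For these \<open>k\<close> the number \<open>\<omega> N ^ k\<close> is a root of
    unity other than 1, so its geometric sum vanishes.\<close>
  have m0: "m k N = 0" if "0 < k" "k < Suc N" for k N
  proof -
    have ne: "\<omega> N ^ k \<noteq> 1"
    proof
      assume "\<omega> N ^ k = 1"
      then have "cis (2 * pi * real k / real (Suc N)) = cis 0" by (simp only: pw cis_zero)
      from arg_cong[OF this, of Re] have "cos (2 * pi * real k / real (Suc N)) = 1" by simp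
      then obtain i :: int where "2 * pi * real k / real (Suc N) = of_int i * 2 * pi"
        using cos_one_2pi_int by blast
      then have "(2 * pi) * (real k / real (Suc N)) = (2 * pi) * of_int i"
        by (simp only: times_divide_eq_right mult_ac)
      moreover have "2 * pi \<noteq> (0::real)" by simp
      ultimately have "real k / real (Suc N) = of_int i" using mult_left_cancel by blast
      moreover have "real (Suc N) \<noteq> 0" by (simp del: of_nat_Suc)
      ultimately have "real k = of_int i * real (Suc N)" using nonzero_divide_eq_eq by blast
      then have "real_of_int (int k) = real_of_int (i * int (Suc N))" by simp
      then have k: "int k = i * int (Suc N)" by (simp only: of_int_eq_iff)
      then have "0 < i * int (Suc N)" using \<open>0 < k\<close> by linarith
      then have "1 \<le> i" by (simp add: zero_less_mult_iff)
      then have "1 * int (Suc N) \<le> i * int (Suc N)" by (intro mult_right_mono) auto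
      then have "int (Suc N) \<le> int k" by (simp only: k mult_1)
      then show False using that by simp
    qed
    have "(\<omega> N ^ k) ^ Suc N = (\<omega> N ^ Suc N) ^ k" by (simp only: power_mult[symmetric] mult.commute)
    also have "\<omega> N ^ Suc N = 1" unfolding pw[symmetric] by simp
    finally have "(\<omega> N ^ k) ^ Suc N = 1" by simp
    then show ?thesis using ne by (simp add: m_def geometric_sum del: power_Suc sum.lessThan_Suc of_nat_Suc)
  qed
  have m_0: "m 0 N = 1" for N by (simp add: m_def del: sum.lessThan_Suc of_nat_Suc)
  have eq: "(\<Sum>j<Suc N. G (cis (2 * pi * real j / real (Suc N)) * w)) / of_nat (Suc N) = (\<Sum>k. c k * m k N)" for N
  proof -
    have "(\<lambda>k. \<Sum>j<Suc N. c k * (\<omega> N ^ j) ^ k) sums (\<Sum>j<Suc N. G (\<omega> N ^ j * w))"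
      by (intro sums_sum sums) (simp add: \<omega>_def norm_power)
    then have "(\<lambda>k. (\<Sum>j<Suc N. c k * (\<omega> N ^ j) ^ k) / of_nat (Suc N)) sums ((\<Sum>j<Suc N. G (\<omega> N ^ j * w)) / of_nat (Suc N))"
      by (rule sums_divide)
    moreover have "(\<Sum>j<Suc N. c k * (\<omega> N ^ j) ^ k) / of_nat (Suc N) = c k * m k N" for k
      unfolding m_def times_divide_eq_right sum_distrib_left
      by (intro arg_cong2[where f = "(/)"] sum.cong refl) (simp only: power_mult[symmetric] mult.commute)
    ultimately show ?thesis by (simp only: sums_iff pw)
  qed
  have "(\<lambda>N. \<Sum>k. c k * m k N) \<longlonglongrightarrow> (\<Sum>k. if k = 0 then c 0 else 0)"
  proof (rule tannerys_theorem[THEN conjunct2, THEN conjunct2])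
    show "(\<lambda>N. c k * m k N) \<longlonglongrightarrow> (if k = 0 then c 0 else 0)" for k
    proof (rule tendsto_eventually)
      show "\<forall>\<^sub>F N in sequentially. c k * m k N = (if k = 0 then c 0 else 0)"
        using eventually_ge_at_top[of k] by eventually_elim (auto simp: m_0 m0)
    qed
    show "\<forall>\<^sub>F (k, N) in at_top \<times>\<^sub>F sequentially. norm (c k * m k N) \<le> norm (c k)"
      by (intro always_eventually) (auto simp: norm_mult intro!: mult_left_le norm_m)
  qed (use sumc in auto)
  moreover have "(\<Sum>k. if k = 0 then c 0 else 0) = G 0"
  proof -
    have "(\<lambda>k. if k = 0 then c 0 else 0) sums c 0" by (rule sums_single[of 0 "\<lambda>_. c 0", simplified])
    then show ?thesis by (simp add: sums_iff c_def)
  qed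
  ultimately show ?thesis by (simp only: eq)
qed

text \<open>Rotations leave the integral unchanged, while the averages over roots of unity tend
  pointwise to \<open>v 0\<close> times the weight. Boundedness is asked of the product with
  \<kappa>, so a cutoff \<kappa> admits unbounded \<open>v\<close>, as in
  \<open>evaluation_at_0_bound\<close>.\<close>

lemma mean_value_radial:
  assumes G: "G holomorphic_on disk" and H: "H holomorphic_on disk" and k [measurable]: "\<kappa> \<in> borel_measurable borel"
    and v: "\<And>z. cmod z < 1 \<Longrightarrow> v z = G z + cnj (H z)" and bdd: "bounded_measurable (\<lambda>w. v w * of_real (\<kappa> (cmod w)))"
  shows "(LINT w|dA. v w * of_real (\<kappa> (cmod w))) = (LINT w|dA. v 0 * of_real (\<kappa> (cmod w)))"
proof -
  define V where "V w = v w * of_real (\<kappa> (cmod w))" for w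
  have bV: "bounded_measurable V" unfolding V_def[abs_def] by (rule bdd)
  obtain C where C: "0 \<le> C" "\<And>z. cmod z < 1 \<Longrightarrow> cmod (V z) \<le> C" using bounded_measurableE[OF bV] by metis
  have vm [measurable]: "V \<in> borel_measurable dA" using bV by measurable
  define A where "A N w = (\<Sum>j<Suc N. V (cis (2 * pi * real j / real (Suc N)) * w)) / of_nat (Suc N)" for N w
  have rot [measurable]: "(\<lambda>w. cis t * w) \<in> measurable dA dA" for t
    by (rule measurable_into_dA) (auto simp: norm_mult)
  have bmr: "bounded_measurable (\<lambda>w. V (cis t * w))" for t
    by (rule bounded_measurableI[of _ C]) (auto simp: C norm_mult)
  have lim: "(\<lambda>N. A N w) \<longlonglongrightarrow> v 0 * of_real (\<kappa> (cmod w))" if w: "cmod w < 1" for w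
  proof -
    have "(\<lambda>N. ((\<Sum>j<Suc N. G (cis (2 * pi * real j / real (Suc N)) * w)) / of_nat (Suc N)
       + cnj ((\<Sum>j<Suc N. H (cis (2 * pi * real j / real (Suc N)) * w)) / of_nat (Suc N))) * of_real (\<kappa> (cmod w)))
       \<longlonglongrightarrow> (G 0 + cnj (H 0)) * of_real (\<kappa> (cmod w))"
      by (intro tendsto_mult_right tendsto_add tendsto_cnj root_of_unity_average G H w)
    moreover have "A N w = ((\<Sum>j<Suc N. G (cis (2 * pi * real j / real (Suc N)) * w)) / of_nat (Suc N)
       + cnj ((\<Sum>j<Suc N. H (cis (2 * pi * real j / real (Suc N)) * w)) / of_nat (Suc N))) * of_real (\<kappa> (cmod w))" for N
    proof -
      have "(\<Sum>j<Suc N. V (cis (2 * pi * real j / real (Suc N)) * w))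
        = (\<Sum>j<Suc N. (G (cis (2 * pi * real j / real (Suc N)) * w) + cnj (H (cis (2 * pi * real j / real (Suc N)) * w))) * of_real (\<kappa> (cmod w)))"
        by (intro sum.cong refl) (use w in \<open>simp add: norm_mult V_def v\<close>)
      also have "\<dots> = ((\<Sum>j<Suc N. G (cis (2 * pi * real j / real (Suc N)) * w)) + cnj (\<Sum>j<Suc N. H (cis (2 * pi * real j / real (Suc N)) * w))) * of_real (\<kappa> (cmod w))"
        by (simp only: sum_distrib_right[symmetric] sum.distrib cnj_sum)
      finally show ?thesis unfolding A_def
        by (simp only: add_divide_distrib[symmetric] complex_cnj_divide complex_cnj_of_nat times_divide_eq_left)
    qed
    ultimately show ?thesis using v[of 0] by simp
  qed
  have intA: "(LINT w|dA. A N w) = (LINT w|dA. V w)" for N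
  proof -
    have "(LINT w|dA. A N w) = (\<Sum>j<Suc N. LINT w|dA. V (cis (2 * pi * real j / real (Suc N)) * w)) / of_nat (Suc N)"
      unfolding A_def integral_divide_zero
      by (subst Bochner_Integration.integral_sum) (auto intro!: bounded_measurable_integrable bmr)
    also have "\<dots> = (\<Sum>j<Suc N. LINT w|dA. V w) / of_nat (Suc N)"
      by (intro arg_cong2[where f = "(/)"] sum.cong refl integral_rotate vm) simp
    finally show ?thesis by (simp del: sum.lessThan_Suc of_nat_Suc)
  qed
  have "(\<lambda>N. LINT w|dA. A N w) \<longlonglongrightarrow> (LINT w|dA. v 0 * of_real (\<kappa> (cmod w)))"
  proof (rule integral_dominated_convergence[where w = "\<lambda>_. C"])
    show "AE w in dA. (\<lambda>N. A N w) \<longlonglongrightarrow> v 0 * of_real (\<kappa> (cmod w))" using lim by (intro AE_I2) simp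
    show "AE w in dA. norm (A N w) \<le> C" for N
    proof (rule AE_I2)
      fix w assume "w \<in> space dA"
      then have "cmod (\<Sum>j<Suc N. V (cis (2 * pi * real j / real (Suc N)) * w)) \<le> (\<Sum>j<Suc N. C)"
        by (intro sum_norm_le C(2)) (simp add: norm_mult)
      then show "norm (A N w) \<le> C"
        by (simp add: A_def norm_divide divide_le_eq mult.commute del: sum.lessThan_Suc of_nat_Suc)
    qed
    show "A N \<in> borel_measurable dA" for N unfolding A_def[abs_def] by measurable
  qed auto
  then have "(\<lambda>N. LINT w|dA. V w) \<longlonglongrightarrow> (LINT w|dA. v 0 * of_real (\<kappa> (cmod w)))" by (simp only: intA)
  then show ?thesis unfolding V_def by (rule LIMSEQ_unique[OF tendsto_const])
qed

lemma mean_value_disk: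
  assumes G: "G holomorphic_on disk" and H: "H holomorphic_on disk"
    and v: "\<And>z. cmod z < 1 \<Longrightarrow> v z = G z + cnj (H z)" and bdd: "bounded_measurable v"
  shows "(LINT w|dA. v w) = v 0"
  using mean_value_radial[OF G H _ v, of "\<lambda>_. 1"] bdd by simp

lemma bounded_measurable_continuous:
  "continuous_on disk v \<Longrightarrow> bounded (v ` disk) \<Longrightarrow> bounded_measurable v"
  by (simp add: bounded_measurable_def borel_measurable_dA_continuous)

lemma harmonic_continuous: 
  assumes "harmonic_on_disk v"
  shows "continuous_on disk v"
proof -
  obtain a b where "\<And>z. z \<in> disk \<Longrightarrow> has_wirtinger v (a z) (b z) z"
    using C2_onD assms unfolding harmonic_on_disk_def by metis
  then show ?thesis by (rule has_wirtinger_continuous_on)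
qed

lemma bounded_harmonic_measurable: "bounded_harmonic v \<Longrightarrow> bounded_measurable v"
  by (simp add: bounded_harmonic_def harmonic_continuous bounded_measurable_continuous)

text \<open>Composition with \<open>phi z\<close> preserves the splitting into a holomorphic and an
  antiholomorphic part, so the mean value property at 0 applies to \<open>v o phi z\<close>.\<close>

theorem berezin_harmonic:
  assumes v: "bounded_harmonic v" and z: "cmod z < 1"
  shows "berezin v z = v z"
proof -
  have bm: "bounded_measurable v" by (rule bounded_harmonic_measurable[OF v])
  obtain G H where G: "G holomorphic_on disk" "H holomorphic_on disk"
    "\<And>z. cmod z < 1 \<Longrightarrow> v z = G z + cnj (H z)"
    using harmonic_decomposition v unfolding bounded_harmonic_def by metis
  have "(LINT w|dA. v (phi z w)) = v (phi z 0)"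
  proof (rule mean_value_disk)
    show "(\<lambda>w. G (phi z w)) holomorphic_on disk" "(\<lambda>w. H (phi z w)) holomorphic_on disk"
      using holomorphic_on_compose_gen[OF holomorphic_phi[OF z] G(1)]
        holomorphic_on_compose_gen[OF holomorphic_phi[OF z] G(2)] phi_image[OF z] by (auto simp: o_def)
    show "v (phi z w) = G (phi z w) + cnj (H (phi z w))" if "cmod w < 1" for w
      using G(3) z that by simp
  qed (rule bounded_measurable_phi[OF bm z])
  then show ?thesis using berezin_eq_integral_phi[OF z] bm by (simp add: bounded_measurable_def)
qed

section \<open>Injectivity of the Berezin transform\<close>

lemma open_null_dA:
  assumes "open U" "U \<subseteq> disk" "emeasure dA U = 0"
  shows "U = {}"
proof (rule ccontr)
  assume "U \<noteq> {}"
  then obtain x where "x \<in> U" by blast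
  then obtain e where e: "e > 0" "ball x e \<subseteq> U" using assms(1) openE by blast
  have "U \<in> sets dA" using assms by (simp add: sets_dA_iff)
  then have "emeasure lborel U = 0"
    using assms(3) emeasure_disk by (simp add: emeasure_dA ennreal_divide_eq_0_iff)
  then have "emeasure lborel (ball x e) = 0"
    using emeasure_mono[OF e(2), of lborel] assms(1) by simp
  moreover have "emeasure lborel (ball x e) \<noteq> 0"
  proof -
    have pos: "unit_ball_vol (2::real) * e ^ 2 > 0" using e by (intro mult_pos_pos unit_ball_vol_pos) auto
    have "emeasure lborel (ball x e) = ennreal (unit_ball_vol (2::real) * e ^ 2)"
      using e by (simp add: emeasure_ball)
    then show ?thesis using pos by (metis ennreal_eq_0_iff not_le)
  qed
  ultimately show False by contradiction
qed

text \<open>The exceptional set is open by continuity and null by assumption, hence empty. This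
  converts almost-everywhere statements about continuous functions into pointwise ones.\<close>

lemma AE_dA_continuous:
  assumes f: "continuous_on disk f" and C: "closed C" and ae: "AE x in dA. f x \<in> C" and z: "cmod z < 1"
  shows "f z \<in> C"
proof -
  define U where "U = {x \<in> disk. f x \<notin> C}"
  have U_eq: "U = f -` (- C) \<inter> disk" by (auto simp: U_def)
  have "open U" unfolding U_eq using continuous_open_preimage[OF f open_ball open_Compl[OF C]]
    by (simp add: Int_commute)
  moreover have "U \<subseteq> disk" by (auto simp: U_def)
  moreover have "emeasure dA U = 0"
  proof -
    have "U \<in> sets dA" using calculation by (simp add: sets_dA_iff)
    then show ?thesis using ae AE_iff_measurable[of U dA "\<lambda>x. f x \<in> C"] by (auto simp: U_def)
  qed
  ultimately have "U = {}" by (rule open_null_dA)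
  then show ?thesis using z by (auto simp: U_def)
qed

definition vanishing_moments :: "(complex \<Rightarrow> complex) \<Rightarrow> bool" where
  "vanishing_moments v \<longleftrightarrow> bounded_measurable v \<and> (\<forall>j k. (LINT w|dA. v w * w ^ j * cnj w ^ k) = 0)"

lemma bounded_measurable_power: "bounded_measurable v \<Longrightarrow> bounded_measurable (\<lambda>w. v w ^ n)"
  by (induction n) (auto intro: bounded_measurable_mult)

lemma vanishing_moments_integrable:
  "vanishing_moments v \<Longrightarrow> integrable dA (\<lambda>w. v w * w ^ j * cnj w ^ k)"
  unfolding vanishing_moments_def
  by (intro bounded_measurable_integrable bounded_measurable_mult bounded_measurable_power
      bounded_measurable_id bounded_measurable_cnj) auto

lemma bounded_measurable_add:
  "bounded_measurable f \<Longrightarrow> bounded_measurable g \<Longrightarrow> bounded_measurable (\<lambda>z. f z + g z)"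
  using bounded_measurable_diff[of f "\<lambda>z. (-1) * g z"] bounded_measurable_mult[of "\<lambda>_. -1" g] by simp

lemma vanishing_moments_add:
  assumes "vanishing_moments v" "vanishing_moments w"
  shows "vanishing_moments (\<lambda>z. v z + w z)"
  using assms vanishing_moments_integrable[OF assms(1)] vanishing_moments_integrable[OF assms(2)]
  by (auto simp: vanishing_moments_def distrib_right intro: bounded_measurable_add)

lemma vanishing_moments_cmult:
  assumes "vanishing_moments v"
  shows "vanishing_moments (\<lambda>z. v z * c)"
proof -
  have "(LINT w|dA. v w * c * w ^ j * cnj w ^ k) = (LINT w|dA. c * (v w * w ^ j * cnj w ^ k))" for j k
    by (simp add: mult_ac)
  then show ?thesis using assms
    by (auto simp: vanishing_moments_def intro: bounded_measurable_mult)
qed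

lemma vanishing_moments_times_id:
  assumes "vanishing_moments v"
  shows "vanishing_moments (\<lambda>z. v z * z)" "vanishing_moments (\<lambda>z. v z * cnj z)"
proof -
  have "(LINT w|dA. v w * w * w ^ j * cnj w ^ k) = (LINT w|dA. v w * w ^ Suc j * cnj w ^ k)" for j k
    by (simp add: mult_ac)
  then show "vanishing_moments (\<lambda>z. v z * z)" using assms
    by (auto simp: vanishing_moments_def intro: bounded_measurable_mult bounded_measurable_id simp del: power_Suc)
  have "(LINT w|dA. v w * cnj w * w ^ j * cnj w ^ k) = (LINT w|dA. v w * w ^ j * cnj w ^ Suc k)" for j k
    by (simp add: mult_ac)
  then show "vanishing_moments (\<lambda>z. v z * cnj z)" using assms
    by (auto simp: vanishing_moments_def intro!: bounded_measurable_mult bounded_measurable_id bounded_measurable_cnj simp del: power_Suc)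
qed

text \<open>The induction runs over all \<open>v\<close> at once: the product case applies the
  hypothesis for one factor to \<open>v\<close> multiplied by the other. Linear functions are
  combinations of \<open>z\<close> and \<open>cnj z\<close>.\<close>

lemma vanishing_moments_polynomial:
  "real_polynomial_function p \<Longrightarrow> vanishing_moments v \<Longrightarrow> vanishing_moments (\<lambda>z. v z * complex_of_real (p z))"
proof (induction arbitrary: v rule: real_polynomial_function.induct)
  case (linear f)
  have bl: "bounded_linear (\<lambda>z. complex_of_real (f z))"
    by (rule bounded_linear_compose[OF bounded_linear_of_real linear(1)])
  define a b where "a = (complex_of_real (f 1) - \<i> * complex_of_real (f \<i>)) / 2"
    and "b = (complex_of_real (f 1) + \<i> * complex_of_real (f \<i>)) / 2"
  have e: "complex_of_real (f z) = a * z + b * cnj z" for z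
    unfolding a_def b_def by (rule real_linear_complex_decomp[OF bl])
  have "vanishing_moments (\<lambda>z. v z * z * a + v z * cnj z * b)"
    by (intro vanishing_moments_add vanishing_moments_cmult vanishing_moments_times_id linear)
  then show ?case by (simp only: e distrib_left mult.assoc mult.commute[of a] mult.commute[of b])
next
  case (const c)
  then show ?case by (intro vanishing_moments_cmult)
next
  case (add f g)
  have "vanishing_moments (\<lambda>z. v z * complex_of_real (f z) + v z * complex_of_real (g z))"
    by (intro vanishing_moments_add add)
  then show ?case by (simp add: algebra_simps)
next
  case (mult f g)
  have "vanishing_moments (\<lambda>z. v z * complex_of_real (f z) * complex_of_real (g z))"
    by (intro mult)
  then show ?case by (simp add: mult.assoc)
qed

text \<open>Weierstrass approximation is uniform on compact sets, hence the continuity of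
  \<open>g\<close> up to the boundary of the disk.\<close>

lemma vanishing_moments_imp_integral:
  assumes v: "vanishing_moments v" and g: "continuous_on (cball 0 1) g"
  shows "(LINT w|dA. v w * complex_of_real (g w)) = 0"
proof -
  have bm: "bounded_measurable v" using v by (simp add: vanishing_moments_def)
  obtain C where C: "0 \<le> C" "\<And>z. cmod z < 1 \<Longrightarrow> cmod (v z) \<le> C" using bounded_measurableE[OF bm] by metis
  have [measurable]: "v \<in> borel_measurable dA" using bm by measurable
  have "continuous_on disk g" using g by (rule continuous_on_subset) auto
  then have [measurable]: "g \<in> borel_measurable dA" by (rule borel_measurable_dA_continuous)
  have le: "cmod (LINT w|dA. v w * complex_of_real (g w)) \<le> C * e" if "e > 0" for e
  proof -
    obtain p where p: "real_polynomial_function p" "\<And>x. x \<in> cball 0 1 \<Longrightarrow> \<bar>g x - p x\<bar> < e"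
      using Stone_Weierstrass_real_polynomial_function[OF compact_cball g \<open>e > 0\<close>] by metis
    have vp: "vanishing_moments (\<lambda>z. v z * complex_of_real (p z))"
      by (rule vanishing_moments_polynomial[OF p(1) v])
    have i: "integrable dA (\<lambda>w. v w * complex_of_real (p w))"
      using vanishing_moments_integrable[OF vp, of 0 0] by simp
    have b: "cmod (v w * complex_of_real (g w) - v w * complex_of_real (p w)) \<le> C * e" if "cmod w < 1" for w
    proof -
      have "cmod (v w * complex_of_real (g w) - v w * complex_of_real (p w)) = cmod (v w) * \<bar>g w - p w\<bar>"
        by (metis norm_mult norm_of_real of_real_diff right_diff_distrib)
      also have "\<dots> \<le> C * e" using C that p(2)[of w] by (intro mult_mono) auto
      finally show ?thesis .
    qed
    have ig: "integrable dA (\<lambda>w. v w * complex_of_real (g w) - v w * complex_of_real (p w))"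
      by (rule integrable_dA_bounded[of _ "C * e"]) (use b i in auto)
    then have ig': "integrable dA (\<lambda>w. v w * complex_of_real (g w))"
      using Bochner_Integration.integrable_add[OF ig i] by simp
    have "(LINT w|dA. v w * complex_of_real (g w)) = (LINT w|dA. v w * complex_of_real (g w) - v w * complex_of_real (p w))"
      using i ig' vp unfolding vanishing_moments_def by (auto dest!: conjunct2 spec[of _ 0])
    also have "cmod \<dots> \<le> (LINT w|dA. C * e)"
      using b ig by (intro Bochner_Integration.integral_norm_bound_integral) auto
    finally show ?thesis by simp
  qed
  have "cmod (LINT w|dA. v w * complex_of_real (g w)) \<le> 0"
  proof (rule field_le_epsilon)
    fix e :: real assume "e > 0"
    then have "cmod (LINT w|dA. v w * complex_of_real (g w)) \<le> C * (e / (C + 1))"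
      using C by (intro le) auto
    also have "\<dots> \<le> e" using C \<open>e > 0\<close> by (simp add: field_simps)
    finally show "cmod (LINT w|dA. v w * complex_of_real (g w)) \<le> 0 + e" by simp
  qed
  then show ?thesis by simp
qed

lemma vanishing_moments_imp_0:
  assumes v: "vanishing_moments v" and cont: "continuous_on disk v" and z: "cmod z < 1"
  shows "v z = 0"
proof -
  obtain r where r: "cmod z < r" "r < 1" using dense[OF z] by blast
  have *: "R (v z) = 0" if "R = Re \<or> R = Im" for R
  proof -
    have contR: "continuous_on disk (\<lambda>w. R (v w))"
      using that cont by (auto intro: continuous_intros)
    \<comment> \<open>A test function that is continuous on the whole plane, since the factor
      \<open>r - cmod w\<close> glues to 0. The product \<open>R (v w) * g w\<close> is nonnegative
      with integral 0, and r > |z| then forces \<open>R (v z) = 0\<close>.\<close>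
    define g where "g w = (if cmod w \<le> r then R (v w) * (r - cmod w) else 0)" for w
    have "continuous_on (cball 0 r \<union> {w. r \<le> cmod w}) g"
      unfolding g_def
    proof (rule continuous_on_cases)
      show "continuous_on (cball 0 r) (\<lambda>w. R (v w) * (r - cmod w))"
        using r by (intro continuous_intros continuous_on_subset[OF contR]) auto
      show "closed {w::complex. r \<le> cmod w}" by (intro closed_Collect_le continuous_intros)
    qed (auto intro: continuous_intros)
    moreover have "cball 0 r \<union> {w::complex. r \<le> cmod w} = UNIV" by auto
    ultimately have contg: "continuous_on UNIV g" by simp
    have I: "(LINT w|dA. v w * complex_of_real (g w)) = 0"
      by (rule vanishing_moments_imp_integral[OF v continuous_on_subset[OF contg]]) simp
    have bm: "bounded_measurable v" using v by (simp add: vanishing_moments_def)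
    obtain C where C: "0 \<le> C" "\<And>z. cmod z < 1 \<Longrightarrow> cmod (v z) \<le> C" using bounded_measurableE[OF bm] by metis
    have bmg: "bounded_measurable (\<lambda>w. complex_of_real (g w))"
    proof (rule bounded_measurable_continuous)
      show "continuous_on disk (\<lambda>w. complex_of_real (g w))"
        by (rule continuous_on_of_real[OF continuous_on_subset[OF contg]]) simp
      have "compact (g ` cball 0 1)"
        by (intro compact_continuous_image continuous_on_subset[OF contg]) auto
      then have "bounded (g ` disk)" by (meson bounded_subset ball_subset_cball compact_imp_bounded image_mono)
      then show "bounded ((\<lambda>w. complex_of_real (g w)) ` disk)"
        by (auto simp: bounded_iff)
    qed
    have i: "integrable dA (\<lambda>w. v w * complex_of_real (g w))"
      by (intro bounded_measurable_integrable bounded_measurable_mult bm bmg)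
    define h where "h w = R (v w) * g w" for w
    have "(LINT w|dA. h w) = R (LINT w|dA. v w * complex_of_real (g w))" "integrable dA h"
      using that i integral_Re[OF i] integral_Im[OF i] integrable_Re[OF i] integrable_Im[OF i]
      by (auto simp: h_def[abs_def])
    then have int_h: "(LINT w|dA. h w) = 0" "integrable dA h" using I that by auto
    have h_nonneg: "0 \<le> h w" for w
      by (auto simp: h_def g_def mult.assoc[symmetric] intro!: mult_nonneg_nonneg)
    have "AE w in dA. h w = 0"
      using integral_nonneg_eq_0_iff_AE[OF int_h(2)] h_nonneg int_h(1) by simp
    then have "h z \<in> {0}"
      by (intro AE_dA_continuous[OF _ _ _ z])
        (auto simp: h_def intro!: continuous_intros contR continuous_on_subset[OF contg])
    then show ?thesis using r by (auto simp: h_def g_def)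
  qed
  then show ?thesis by (auto simp: complex_eq_iff)
qed

text \<open>A function vanishing on the disk has vanishing Wirtinger derivatives; positivity of
  \<open>p\<close> and \<open>q\<close> lets the numerical factors be cancelled.\<close>

lemma kernel_integral_0_moments:
  assumes "bounded_measurable v" "0 < p" "0 < q" "\<And>z. cmod z < 1 \<Longrightarrow> kernel_integral v p q z = 0" "cmod z < 1"
  shows "kernel_integral (\<lambda>w. v w * cnj w) p (Suc q) z = 0" "kernel_integral (\<lambda>w. v w * w) (Suc p) q z = 0"
proof -
  have "has_wirtinger (kernel_integral v p q) 0 0 z"
    by (rule has_wirtinger_cong[OF has_wirtinger_const[of 0], of disk]) (use assms in auto)
  then have "of_nat q * kernel_integral (\<lambda>w. v w * cnj w) p (Suc q) z = 0"
    "of_nat p * kernel_integral (\<lambda>w. v w * w) (Suc p) q z = 0"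
    using has_wirtinger_imp[OF has_wirtinger_kernel_integral[OF assms(1,5), of p q]] has_wirtinger_imp by metis+
  then show "kernel_integral (\<lambda>w. v w * cnj w) p (Suc q) z = 0" "kernel_integral (\<lambda>w. v w * w) (Suc p) q z = 0"
    using assms by auto
qed

text \<open>Differentiating \<open>\<integral> v w / ((1 - cnj z w)\<^sup>p (1 - z cnj w)\<^sup>q) dA w = 0\<close> in \<open>z\<close> and \<open>cnj z\<close> and setting
  \<open>z = 0\<close> shows that all moments of \<open>v\<close> vanish.\<close>

theorem berezin_injective:
  assumes v: "bounded_measurable v" and cont: "continuous_on disk v"
    and B0: "\<And>z. cmod z < 1 \<Longrightarrow> berezin v z = 0" and z: "cmod z < 1"
  shows "v z = 0"
proof (rule vanishing_moments_imp_0[OF _ cont z])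
  have K0: "kernel_integral v 2 2 z = 0" if "cmod z < 1" for z
  proof -
    have "1 - z * cnj z = of_real (1 - (cmod z)\<^sup>2)" by (rule one_minus_square_complex[symmetric])
    then have "1 - z * cnj z \<noteq> 0" using one_minus_square_pos[OF that] by (simp del: of_real_diff)
    then show ?thesis using B0[OF that] by (simp add: berezin_eq_kernel_integral)
  qed
  have bm: "bounded_measurable (\<lambda>w. v w * w ^ j * cnj w ^ k)" for j k
    by (intro bounded_measurable_mult v bounded_measurable_power bounded_measurable_id bounded_measurable_cnj)
  have 1: "\<forall>z. cmod z < 1 \<longrightarrow> kernel_integral (\<lambda>w. v w * w ^ j * cnj w ^ 0) (2 + j) 2 z = 0" for j
  proof (induction j)
    case (Suc j)
    have "(\<lambda>w. v w * w ^ Suc j * cnj w ^ 0) = (\<lambda>w. v w * w ^ j * cnj w ^ 0 * w)" by (simp add: fun_eq_iff)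
    then show ?case using kernel_integral_0_moments(2)[OF bm, of "2 + j" 2 j 0] Suc.IH by simp
  qed (use K0 in simp)
  have 2: "\<forall>z. cmod z < 1 \<longrightarrow> kernel_integral (\<lambda>w. v w * w ^ j * cnj w ^ k) (2 + j) (2 + k) z = 0" for j k
  proof (induction k)
    case (Suc k)
    have "(\<lambda>w. v w * w ^ j * cnj w ^ Suc k) = (\<lambda>w. v w * w ^ j * cnj w ^ k * cnj w)" by (simp add: fun_eq_iff)
    then show ?case using kernel_integral_0_moments(1)[OF bm, of "2 + j" "2 + k" j k] Suc.IH by simp
  qed (use 1[of j] in simp)
  have "(LINT w|dA. v w * w ^ j * cnj w ^ k) = 0" for j k
    using 2[of j k, rule_format, of 0] by (simp add: kernel_integral_def power_kernel_def)
  then show "vanishing_moments v" using v by (simp add: vanishing_moments_def)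
qed

section \<open>Maximal ideals and polynomials in bounded analytic functions\<close>


text \<open>This and the next two instances make the product topology on functions Hausdorff, one
  coordinate at a time; compact sets of functionals are then closed, as used in
  \<open>star_approximable_criterion\<close>.\<close>

instance "fun" :: (type, t0_space) t0_space
proof
  fix x y :: "'a \<Rightarrow> 'b" assume "x \<noteq> y"
  then obtain i where i: "x i \<noteq> y i" by blast
  then obtain U where U: "open U" "\<not> (x i \<in> U \<longleftrightarrow> y i \<in> U)"
    using t0_space_class.t0_space[OF i] by blast
  have "open ((\<lambda>f. f i) -` U)" using U by (auto intro: open_vimage)
  then show "\<exists>U. open U \<and> \<not> (x \<in> U \<longleftrightarrow> y \<in> U)"
    using U by (intro exI[of _ "(\<lambda>f. f i) -` U"]) auto
qed

instance "fun" :: (type, t1_space) t1_space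
proof
  fix x y :: "'a \<Rightarrow> 'b" assume "x \<noteq> y"
  then obtain i where i: "x i \<noteq> y i" by blast
  then obtain U where U: "open U" "x i \<in> U" "y i \<notin> U"
    using t1_space_class.t1_space[OF i] by blast
  have "open ((\<lambda>f. f i) -` U)" using U by (auto intro: open_vimage)
  then show "\<exists>U. open U \<and> x \<in> U \<and> y \<notin> U"
    using U by (intro exI[of _ "(\<lambda>f. f i) -` U"]) auto
qed

instance "fun" :: (type, t2_space) t2_space
proof
  fix x y :: "'a \<Rightarrow> 'b" assume "x \<noteq> y"
  then obtain i where i: "x i \<noteq> y i" by blast
  then obtain U V where UV: "open U" "open V" "x i \<in> U" "y i \<in> V" "U \<inter> V = {}"
    using hausdorff[OF i] by blast
  have "open ((\<lambda>f. f i) -` U)" "open ((\<lambda>f. f i) -` V)"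
    using UV by (auto intro: open_vimage)
  then show "\<exists>U V. open U \<and> open V \<and> x \<in> U \<and> y \<in> V \<and> U \<inter> V = {}"
    using UV by (intro exI[of _ "(\<lambda>f. f i) -` U"] exI[of _ "(\<lambda>f. f i) -` V"]) auto
qed

text \<open>The constants of the algebra: members of \<open>Hinf\<close> are 0 off the disk, so the
  constant \<open>c\<close> has to be cut off.\<close>

definition disk_indicator :: "complex \<Rightarrow> complex \<Rightarrow> complex" where
  "disk_indicator c z = (if z \<in> disk then c else 0)"

lemma Hinf_restrict:
  assumes "f holomorphic_on disk" "bounded (f ` disk)"
  shows "(\<lambda>z. if z \<in> disk then f z else 0) \<in> Hinf"
proof -
  have "(\<lambda>z. if z \<in> disk then f z else 0) holomorphic_on disk"
    using assms(1) by (rule holomorphic_transform) simp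
  moreover have "(\<lambda>z. if z \<in> disk then f z else 0) ` disk = f ` disk" by auto
  ultimately show ?thesis using assms(2) unfolding Hinf_def by (auto simp del: image_cong_simp)
qed

lemma disk_indicator_Hinf: "disk_indicator c \<in> Hinf"
  using Hinf_restrict[of "\<lambda>_. c"] by (simp add: disk_indicator_def[abs_def] image_constant_conv)

lemma Hinf_holomorphic: "f \<in> Hinf \<Longrightarrow> f holomorphic_on disk"
  by (simp add: Hinf_def)

lemma Hinf_off_disk: "f \<in> Hinf \<Longrightarrow> z \<notin> disk \<Longrightarrow> f z = 0"
  by (simp add: Hinf_def)

lemma Hinf_bound:
  assumes "f \<in> Hinf"
  obtains C where "0 < C" "\<And>z. cmod (f z) \<le> C"
proof -
  obtain C where C: "\<forall>z\<in>disk. cmod (f z) \<le> C" using assms by (auto simp: Hinf_def bounded_iff)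
  show ?thesis
  proof (rule that[of "\<bar>C\<bar> + 1"])
    fix z show "cmod (f z) \<le> \<bar>C\<bar> + 1"
      using C[rule_format, of z] Hinf_off_disk[OF assms, of z] by (cases "z \<in> disk") auto
  qed simp
qed

lemma Hinf_add: "f \<in> Hinf \<Longrightarrow> g \<in> Hinf \<Longrightarrow> (\<lambda>z. f z + g z) \<in> Hinf"
  using bounded_plus_comp[of f disk g] by (auto simp: Hinf_def intro: holomorphic_intros)

lemma Hinf_mult:
  assumes "f \<in> Hinf" "g \<in> Hinf"
  shows "(\<lambda>z. f z * g z) \<in> Hinf"
proof -
  obtain C where C: "0 < C" "\<And>z. cmod (f z) \<le> C" using Hinf_bound[OF assms(1)] by metis
  obtain D where D: "0 < D" "\<And>z. cmod (g z) \<le> D" using Hinf_bound[OF assms(2)] by metis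
  have "cmod (f z * g z) \<le> C * D" for z unfolding norm_mult using C D by (intro mult_mono) auto
  then have "bounded ((\<lambda>z. f z * g z) ` disk)" by (auto simp: bounded_iff)
  then show ?thesis using assms by (auto simp: Hinf_def intro: holomorphic_intros)
qed

lemma Hinf_cmult: "f \<in> Hinf \<Longrightarrow> (\<lambda>z. c * f z) \<in> Hinf"
proof -
  assume f: "f \<in> Hinf"
  have "(\<lambda>z. c * f z) = (\<lambda>z. disk_indicator c z * f z)"
    using Hinf_off_disk[OF f] by (auto simp: disk_indicator_def fun_eq_iff)
  then show ?thesis using Hinf_mult[OF disk_indicator_Hinf f] by simp
qed

text \<open>Reproducing the constants already gives surjectivity onto the complex numbers.\<close>

lemma maxidealsI:
  assumes "m \<in> extensional Hinf"
    and "\<And>f g. f \<in> Hinf \<Longrightarrow> g \<in> Hinf \<Longrightarrow> m (\<lambda>z. f z + g z) = m f + m g"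
    and "\<And>c f. f \<in> Hinf \<Longrightarrow> m (\<lambda>z. c * f z) = c * m f"
    and "\<And>f g. f \<in> Hinf \<Longrightarrow> g \<in> Hinf \<Longrightarrow> m (\<lambda>z. f z * g z) = m f * m g"
    and "\<And>c. m (disk_indicator c) = c"
  shows "m \<in> maxideals"
proof -
  have "m ` Hinf = UNIV"
    using assms(5) disk_indicator_Hinf by (metis UNIV_eq_I image_eqI)
  then show ?thesis using assms by (auto simp: maxideals_def)
qed

lemma point_eval_apply [simp]: "f \<in> Hinf \<Longrightarrow> point_eval z f = f z"
  by (simp add: point_eval_def)

lemma point_eval_maxideals: "z \<in> disk \<Longrightarrow> point_eval z \<in> maxideals"
  by (rule maxidealsI)
    (auto simp: Hinf_add Hinf_cmult Hinf_mult disk_indicator_Hinf, auto simp: point_eval_def disk_indicator_def)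

lemma limitin_weak_star:
  assumes "m \<in> maxideals" "\<forall>\<^sub>F x in F. P x \<in> maxideals"
  shows "limitin weak_star P m F \<longleftrightarrow> (\<forall>f\<in>Hinf. ((\<lambda>x. P x f) \<longlongrightarrow> m f) F)"
proof -
  have "m \<in> extensional Hinf" using assms(1) by (simp add: maxideals_def)
  moreover have "\<forall>\<^sub>F x in F. P x \<in> topspace (product_topology (\<lambda>_. euclidean) Hinf)"
    using assms(2) by eventually_elim (auto simp: maxideals_def PiE_iff)
  ultimately show ?thesis
    using assms by (simp add: weak_star_def limitin_subtopology limitin_componentwise)
qed

lemma topspace_weak_star: "topspace weak_star = maxideals"
  by (auto simp: weak_star_def maxideals_def PiE_iff extensional_def)

lemma limitin_iff_le_nhdsin:
  assumes "l \<in> topspace X"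
  shows "limitin X f l F \<longleftrightarrow> filtermap f F \<le> nhdsin X l"
proof
  assume lim: "limitin X f l F"
  show "filtermap f F \<le> nhdsin X l"
    unfolding le_filter_def eventually_filtermap
  proof (intro allI impI)
    fix P assume "eventually P (nhdsin X l)"
    then obtain S where S: "openin X S" "l \<in> S" "\<And>x. x \<in> S \<Longrightarrow> P x"
      using assms unfolding eventually_nhdsin by blast
    have "\<forall>\<^sub>F x in F. f x \<in> S" using lim S(1,2) by (simp add: limitin_def)
    then show "\<forall>\<^sub>F x in F. P (f x)" by (rule eventually_mono) (rule S(3))
  qed
next
  assume le: "filtermap f F \<le> nhdsin X l"
  show "limitin X f l F"
    unfolding limitin_def
  proof (intro conjI allI impI assms)
    fix U assume U: "openin X U \<and> l \<in> U"
    then have "eventually (\<lambda>x. x \<in> U) (nhdsin X l)" unfolding eventually_nhdsin by blast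
    from filter_leD[OF le this] show "\<forall>\<^sub>F x in F. f x \<in> U" by (simp add: eventually_filtermap)
  qed
qed

text \<open>Characterizes \<open>disk_to m\<close> as the largest filter on the disk along which
  every \<open>f\<close> in \<open>Hinf\<close> tends to \<open>m f\<close>. Convergence along it
  can then be handled without open sets of the weak-star topology.\<close>

lemma le_disk_to:
  assumes "m \<in> maxideals"
  shows "F \<le> disk_to m \<longleftrightarrow> eventually (\<lambda>z. z \<in> disk) F \<and> (\<forall>f\<in>Hinf. (f \<longlongrightarrow> m f) F)"
proof -
  have 1: "F \<le> disk_to m \<longleftrightarrow> eventually (\<lambda>z. z \<in> disk) F \<and> limitin weak_star point_eval m F"
    unfolding disk_to_def going_to_within_def le_inf_iff le_principal
    using limitin_iff_le_nhdsin[of m weak_star point_eval F] assms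
    by (auto simp: filtermap_le_iff_le_filtercomap topspace_weak_star)
  have 2: "limitin weak_star point_eval m F \<longleftrightarrow> (\<forall>f\<in>Hinf. (f \<longlongrightarrow> m f) F)"
    if "eventually (\<lambda>z. z \<in> disk) F"
  proof -
    have "\<forall>\<^sub>F z in F. point_eval z \<in> maxideals"
      using that by eventually_elim (rule point_eval_maxideals)
    from limitin_weak_star[OF assms this] show ?thesis by simp
  qed
  show ?thesis using 1 2 by blast
qed

lemma eventually_disk_to: "m \<in> maxideals \<Longrightarrow> \<forall>\<^sub>F z in disk_to m. z \<in> disk"
  using le_disk_to[of m "disk_to m"] by simp

lemma tendsto_disk_to: "m \<in> maxideals \<Longrightarrow> f \<in> Hinf \<Longrightarrow> (f \<longlongrightarrow> m f) (disk_to m)"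
  using le_disk_to[of m "disk_to m"] by simp

lemma filterlim_disk_to:
  assumes "m \<in> maxideals"
  shows "filterlim g (disk_to m) F \<longleftrightarrow>
    eventually (\<lambda>x. g x \<in> disk) F \<and> (\<forall>f\<in>Hinf. ((\<lambda>x. f (g x)) \<longlongrightarrow> m f) F)"
  unfolding filterlim_def[of g] le_disk_to[OF assms] eventually_filtermap
  by (simp add: filterlim_def filtermap_filtermap)

definition disk_id :: "complex \<Rightarrow> complex" where
  "disk_id z = (if z \<in> disk then z else 0)"

lemma disk_id_Hinf: "disk_id \<in> Hinf"
  unfolding disk_id_def[abs_def] by (rule Hinf_restrict) auto

lemma tendsto_id_disk_to:
  assumes "m \<in> maxideals"
  shows "((\<lambda>z. z) \<longlongrightarrow> m disk_id) (disk_to m)"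
  by (rule Lim_transform_eventually[OF tendsto_disk_to[OF assms disk_id_Hinf]])
    (rule eventually_mono[OF eventually_disk_to[OF assms]], simp add: disk_id_def)

lemma maxideals_ext:
  assumes "m \<in> maxideals" "m' \<in> maxideals" "\<And>f. f \<in> Hinf \<Longrightarrow> m f = m' f"
  shows "m = m'"
  using assms by (intro extensionalityI[of _ Hinf]) (auto simp: maxideals_def)

text \<open>If the coordinate function has its limit inside the disk, the points themselves converge
  there, and continuity of each \<open>f\<close> identifies \<open>m\<close> with an
  evaluation.\<close>

lemma disk_to_interior:
  assumes m: "m \<in> maxideals" and nb: "disk_to m \<noteq> bot" and a: "m disk_id \<in> disk"
  shows "m = point_eval (m disk_id)"
proof (rule maxideals_ext[OF m point_eval_maxideals[OF a]])
  fix f assume f: "f \<in> Hinf"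
  have "isCont f (m disk_id)"
    using holomorphic_on_imp_continuous_on[OF Hinf_holomorphic[OF f]] a
    by (auto simp: continuous_on_eq_continuous_at)
  then have "(f \<longlongrightarrow> f (m disk_id)) (disk_to m)"
    using tendsto_id_disk_to[OF m] by (rule isCont_tendsto_compose)
  then show "m f = point_eval (m disk_id) f"
    using tendsto_unique[OF nb tendsto_disk_to[OF m f]] f by simp
qed

lemma le_to_boundary:
  "F \<le> to_boundary \<longleftrightarrow> eventually (\<lambda>z. z \<in> disk) F \<and> ((\<lambda>z. cmod z) \<longlongrightarrow> 1) F"
  unfolding to_boundary_def going_to_within_def le_inf_iff le_principal filterlim_iff_le_filtercomap by auto

text \<open>Along the filter |z| tends to the modulus of \<open>m disk_id\<close>; a value below 1
  would make \<open>m\<close> a point evaluation.\<close>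

lemma disk_to_le_boundary:
  assumes m: "m \<in> maxideals - point_eval ` disk"
  shows "disk_to m \<le> to_boundary"
proof (cases "disk_to m = bot")
  case False
  have M: "m \<in> maxideals" using m by simp
  have "((\<lambda>z. cmod z) \<longlongrightarrow> cmod (m disk_id)) (disk_to m)"
    by (intro tendsto_norm tendsto_id_disk_to M)
  moreover have "cmod (m disk_id) = 1"
  proof (rule ccontr)
    assume "cmod (m disk_id) \<noteq> 1"
    moreover have "cmod (m disk_id) \<le> 1"
      by (rule tendsto_upperbound[OF \<open>((\<lambda>z. cmod z) \<longlongrightarrow> cmod (m disk_id)) (disk_to m)\<close> _ False])
        (rule eventually_mono[OF eventually_disk_to[OF M]], simp)
    ultimately have "m disk_id \<in> disk" by simp
    then have "m \<in> point_eval ` disk" using disk_to_interior[OF M False] by blast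
    then show False using m by simp
  qed
  ultimately show ?thesis using eventually_disk_to[OF M] by (simp add: le_to_boundary)
qed simp

text \<open>The algebraic identities of evaluations pass to pointwise limits, and properness of
  \<open>F\<close> makes these limits unique.\<close>

lemma character_limit:
  assumes F: "F \<noteq> bot" "eventually (\<lambda>z. z \<in> disk) F" and k: "k \<in> extensional Hinf"
    and lim: "\<And>f. f \<in> Hinf \<Longrightarrow> (f \<longlongrightarrow> k f) F"
  shows "k \<in> maxideals"
proof (rule maxidealsI[OF k])
  show "k (\<lambda>z. f z + g z) = k f + k g" if "f \<in> Hinf" "g \<in> Hinf" for f g
    by (rule tendsto_unique[OF F(1) lim tendsto_add]) (intro Hinf_add lim that)+
  show "k (\<lambda>z. c * f z) = c * k f" if "f \<in> Hinf" for f c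
    by (rule tendsto_unique[OF F(1) lim tendsto_mult_left]) (intro Hinf_cmult lim that)+
  show "k (\<lambda>z. f z * g z) = k f * k g" if "f \<in> Hinf" "g \<in> Hinf" for f g
    by (rule tendsto_unique[OF F(1) lim tendsto_mult]) (intro Hinf_mult lim that)+
  show "k (disk_indicator c) = c" for c
  proof (rule tendsto_unique[OF F(1) lim[OF disk_indicator_Hinf]])
    show "(disk_indicator c \<longlongrightarrow> c) F"
      by (rule tendsto_eventually, rule eventually_mono[OF F(2)]) (simp add: disk_indicator_def)
  qed
qed

text \<open>A Tychonoff product containing all evaluations at points of the disk. Coordinates
  outside \<open>Hinf\<close> are pinned to \<open>undefined\<close>, so that members are
  extensional as \<open>maxideals\<close> demands.\<close>

definition Hinf_box :: "((complex \<Rightarrow> complex) \<Rightarrow> complex) set" where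
  "Hinf_box = PiE UNIV (\<lambda>f. if f \<in> Hinf then closure (f ` disk) else {undefined})"

lemma compact_Hinf_box: "compact Hinf_box"
proof -
  have "compact (if f \<in> Hinf then closure (f ` disk) else {undefined})" for f :: "complex \<Rightarrow> complex"
    by (auto simp: Hinf_def compact_closure)
  then have "compactin (product_topology (\<lambda>_. euclidean) UNIV) Hinf_box"
    unfolding Hinf_box_def compactin_PiE by auto
  then show ?thesis by (simp add: euclidean_product_topology)
qed

lemma Hinf_box_extensional: "k \<in> Hinf_box \<Longrightarrow> k \<in> extensional Hinf"
  unfolding Hinf_box_def by (auto simp: extensional_def PiE_iff split: if_splits)

lemma point_eval_Hinf_box: "z \<in> disk \<Longrightarrow> point_eval z \<in> Hinf_box"
  unfolding Hinf_box_def by (auto simp: PiE_iff point_eval_def closure_def)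

lemma tendsto_coordinate:
  "((\<lambda>k. k f) \<longlongrightarrow> k0 f) (nhds (k0 :: 'a \<Rightarrow> 'b::topological_space))"
proof -
  have "continuous_on UNIV (\<lambda>k::'a \<Rightarrow> 'b. k f)" by (rule continuous_on_product_coordinates)
  then have "((\<lambda>k::'a \<Rightarrow> 'b. k f) \<longlongrightarrow> k0 f) (at k0)" by (simp add: continuous_on_def)
  then show ?thesis using tendsto_at_iff_tendsto_nhds[of "\<lambda>k. k f" k0] by simp
qed

text \<open>Lifts clustering of an image filter to a proper refinement of the filter itself.\<close>

lemma inf_filtercomap_neq_bot:
  assumes "inf G (filtermap g F) \<noteq> bot"
  shows "inf F (filtercomap g G) \<noteq> bot"
proof
  assume "inf F (filtercomap g G) = bot"
  then have "eventually (\<lambda>_. False) (inf F (filtercomap g G))" by simp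
  then obtain P Q where P: "eventually P F" "eventually Q (filtercomap g G)" "\<And>x. P x \<Longrightarrow> Q x \<Longrightarrow> False"
    unfolding eventually_inf by blast
  then obtain R where R: "eventually R G" "\<And>x. R (g x) \<Longrightarrow> Q x" unfolding eventually_filtercomap by blast
  have "eventually (\<lambda>y. \<not> R y) (filtermap g F)"
    unfolding eventually_filtermap using P(1) by eventually_elim (use P(3) R(2) in blast)
  then have "eventually (\<lambda>_. False) (inf G (filtermap g F))"
    unfolding eventually_inf using R(1) by blast
  then show False using assms by (simp add: eventually_False)
qed

text \<open>Compactness of the box gives a cluster point of the evaluations, and
  \<open>character_limit\<close> makes it a character. This is the form in which compactness of the
  maximal ideal space is used.\<close>

lemma exists_maxideal_cluster:
  assumes F: "F \<noteq> bot" "eventually (\<lambda>z. z \<in> disk) F"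
  obtains m where "m \<in> maxideals" "inf F (disk_to m) \<noteq> bot"
proof -
  have "filtermap point_eval F \<noteq> bot" "eventually (\<lambda>k. k \<in> Hinf_box) (filtermap point_eval F)"
    using F by (auto simp: filtermap_bot_iff eventually_filtermap point_eval_Hinf_box elim: eventually_mono)
  then obtain k where k: "k \<in> Hinf_box" "inf (nhds k) (filtermap point_eval F) \<noteq> bot"
    using compact_Hinf_box unfolding compact_filter by blast
  define F1 where "F1 = inf F (filtercomap point_eval (nhds k))"
  have F1: "F1 \<noteq> bot" unfolding F1_def by (rule inf_filtercomap_neq_bot[OF k(2)])
  have F1d: "eventually (\<lambda>z. z \<in> disk) F1" using F(2) unfolding F1_def by (rule filter_leD[OF inf_le1])
  have lim: "(f \<longlongrightarrow> k f) F1" if "f \<in> Hinf" for f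
  proof -
    have "filterlim point_eval (nhds k) F1"
      unfolding F1_def filterlim_iff_le_filtercomap by simp
    from filterlim_compose[OF tendsto_coordinate[of f k] this] show ?thesis using that by simp
  qed
  have m: "k \<in> maxideals" by (rule character_limit[OF F1 F1d Hinf_box_extensional[OF k(1)] lim])
  have "F1 \<le> disk_to k" using le_disk_to[OF m] F1d lim by blast
  then have "F1 \<le> inf F (disk_to k)" by (simp add: F1_def)
  then have "inf F (disk_to k) \<noteq> bot" using F1 by (metis bot.extremum_uniqueI)
  with m show ?thesis by (rule that)
qed

text \<open>When |z| tends to 1 the cluster character is no evaluation, because |z| would also tend
  to the modulus of an interior point.\<close>

lemma exists_boundary_cluster:
  assumes F: "F \<noteq> bot" "F \<le> to_boundary"
  obtains m where "m \<in> maxideals - point_eval ` disk" "inf F (disk_to m) \<noteq> bot"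
proof -
  have Fd: "eventually (\<lambda>z. z \<in> disk) F" "((\<lambda>z. cmod z) \<longlongrightarrow> 1) F" using F(2) by (auto simp: le_to_boundary)
  obtain m where m: "m \<in> maxideals" "inf F (disk_to m) \<noteq> bot" using exists_maxideal_cluster[OF F(1) Fd(1)] by metis
  have "m \<noteq> point_eval a" if a: "a \<in> disk" for a
  proof
    assume "m = point_eval a"
    then have "m disk_id = a" using a by (simp add: disk_id_Hinf) (simp add: disk_id_def)
    then have "((\<lambda>z. cmod z) \<longlongrightarrow> cmod a) (inf F (disk_to m))"
      using tendsto_mono[OF inf_le2 tendsto_norm[OF tendsto_id_disk_to[OF m(1)]]] by simp
    moreover have "((\<lambda>z. cmod z) \<longlongrightarrow> 1) (inf F (disk_to m))" by (rule tendsto_mono[OF inf_le1 Fd(2)])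
    ultimately have "cmod a = 1" by (rule tendsto_unique[OF m(2)])
    then show False using a by simp
  qed
  then show ?thesis using m by (intro that[of m]) blast+
qed

section \<open>Polynomials in bounded analytic functions and their conjugates, and uniform
  approximation by them\<close>

inductive star_polynomial :: "(complex \<Rightarrow> complex) \<Rightarrow> bool" where
  Hinf: "f \<in> Hinf \<Longrightarrow> star_polynomial f"
| cnj: "star_polynomial f \<Longrightarrow> star_polynomial (\<lambda>z. cnj (f z))"
| add: "star_polynomial f \<Longrightarrow> star_polynomial g \<Longrightarrow> star_polynomial (\<lambda>z. f z + g z)"
| mult: "star_polynomial f \<Longrightarrow> star_polynomial g \<Longrightarrow> star_polynomial (\<lambda>z. f z * g z)"

lemma star_polynomial_off_disk: "star_polynomial p \<Longrightarrow> z \<notin> disk \<Longrightarrow> p z = 0"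
  by (induction rule: star_polynomial.induct) (auto simp: Hinf_off_disk)

lemma star_polynomial_cmult:
  assumes "star_polynomial p"
  shows "star_polynomial (\<lambda>z. c * p z)"
proof -
  have "(\<lambda>z. c * p z) = (\<lambda>z. disk_indicator c z * p z)"
    using star_polynomial_off_disk[OF assms] by (auto simp: disk_indicator_def fun_eq_iff)
  then show ?thesis
    using star_polynomial.mult[OF star_polynomial.Hinf[OF disk_indicator_Hinf] assms] by simp
qed

text \<open>The Schwarz-Pick estimate for the generators, propagated through conjugates, sums and
  products. One constant serves as bound and as Lipschitz constant.\<close>

lemma star_polynomial_bounded_Lipschitz:
  assumes "star_polynomial p"
  shows "\<exists>C>0. (\<forall>z. cmod (p z) \<le> C) \<and> (\<forall>z w. cmod z < 1 \<longrightarrow> cmod w < 1 \<longrightarrow> cmod (p z - p w) \<le> C * rho w z)"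
  using assms
proof induction
  case (Hinf f)
  obtain C where C: "0 < C" "\<And>z. cmod (f z) \<le> C" using Hinf_bound[OF Hinf] by metis
  have "cmod (f z - f w) \<le> 2 * C * rho w z" if "cmod z < 1" "cmod w < 1" for z w
    by (rule Schwarz_Pick_Lipschitz[OF Hinf_holomorphic[OF Hinf] C(2) that(2,1)])
  moreover have "cmod (f z) \<le> 2 * C" for z using C(2)[of z] C(1) by linarith
  ultimately show ?case using C(1) by (intro exI[of _ "2 * C"]) auto
next
  case (cnj f)
  then show ?case by (metis complex_cnj_diff complex_mod_cnj)
next
  case (add f g)
  then obtain C D where C: "C > 0" "\<And>z. cmod (f z) \<le> C" "\<And>z w. cmod z < 1 \<Longrightarrow> cmod w < 1 \<Longrightarrow> cmod (f z - f w) \<le> C * rho w z"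
    and D: "D > 0" "\<And>z. cmod (g z) \<le> D" "\<And>z w. cmod z < 1 \<Longrightarrow> cmod w < 1 \<Longrightarrow> cmod (g z - g w) \<le> D * rho w z"
    by blast
  show ?case
  proof (intro exI[of _ "C + D"] conjI allI impI)
    show "cmod (f z + g z) \<le> C + D" for z by (intro norm_triangle_mono C D)
    fix z w :: complex assume "cmod z < 1" "cmod w < 1"
    then have "cmod ((f z - f w) + (g z - g w)) \<le> C * rho w z + D * rho w z"
      by (intro norm_triangle_mono C D)
    then show "cmod (f z + g z - (f w + g w)) \<le> (C + D) * rho w z" by (simp add: algebra_simps)
  qed (use C D in auto)
next
  case (mult f g)
  then obtain C D where C: "C > 0" "\<And>z. cmod (f z) \<le> C" "\<And>z w. cmod z < 1 \<Longrightarrow> cmod w < 1 \<Longrightarrow> cmod (f z - f w) \<le> C * rho w z"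
    and D: "D > 0" "\<And>z. cmod (g z) \<le> D" "\<And>z w. cmod z < 1 \<Longrightarrow> cmod w < 1 \<Longrightarrow> cmod (g z - g w) \<le> D * rho w z"
    by blast
  have b: "cmod (f z * g z) \<le> C * D" for z unfolding norm_mult using C D by (intro mult_mono) auto
  show ?case
  proof (intro exI[of _ "2 * (C * D)"] conjI allI impI)
    show "0 < 2 * (C * D)" using C D by simp
    show "cmod (f z * g z) \<le> 2 * (C * D)" for z using b[of z] order_trans[OF norm_ge_zero b[of z]] by linarith
    fix z w :: complex assume zw: "cmod z < 1" "cmod w < 1"
    have "cmod (f z * (g z - g w) + (f z - f w) * g w) \<le> C * (D * rho w z) + C * rho w z * D"
      using C D zw by (intro norm_triangle_mono) (auto simp: norm_mult intro!: mult_mono)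
    then show "cmod (f z * g z - f w * g w) \<le> 2 * (C * D) * rho w z" by (simp add: algebra_simps)
  qed
qed

lemma star_polynomial_tendsto:
  assumes "star_polynomial p" "m \<in> maxideals"
  shows "\<exists>l. (p \<longlongrightarrow> l) (disk_to m)"
  using assms
  by induction (blast intro: tendsto_disk_to tendsto_cnj tendsto_add tendsto_mult)+

lemma star_polynomial_continuous: "star_polynomial p \<Longrightarrow> continuous_on disk p"
proof (induction rule: star_polynomial.induct)
  case (Hinf f)
  then show ?case by (intro holomorphic_on_imp_continuous_on Hinf_holomorphic)
qed (intro continuous_on_cnj continuous_on_add continuous_on_mult; assumption)+

text \<open>Approximation at every point of the disk. It turns out to be exactly membership in
  \<open>algU\<close>; see \<open>algU_imp_star_approximable\<close> and
  \<open>star_approximable_imp_algU\<close>.\<close>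

definition star_approximable :: "(complex \<Rightarrow> complex) \<Rightarrow> bool" where
  "star_approximable u \<longleftrightarrow> (\<forall>e>0. \<exists>p. star_polynomial p \<and> (\<forall>z\<in>disk. cmod (u z - p z) \<le> e))"

text \<open>The Stone--Weierstrass theorem on the closure \<open>S\<close> of the graph \<open>z \<mapsto> (point_eval z, q z)\<close>. By the
  hypothesis \<open>S\<close> is still a graph, so that bounded analytic functions separate its points. Working
  with \<open>S\<close> instead of the whole maximal ideal space avoids the corona theorem.\<close>

theorem star_approximable_criterion:
  assumes bdd: "bounded (q ` disk)"
    and lim: "\<And>m. m \<in> maxideals \<Longrightarrow> \<exists>l. (q \<longlongrightarrow> l) (disk_to m)"
  shows "star_approximable q"
proof -
  define E where "E z = (point_eval z, q z)" for z
  define S where "S = closure (E ` disk)"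
  have cK: "compact (Hinf_box \<times> closure (q ` disk))"
    using bdd by (intro compact_Times compact_Hinf_box) (simp add: compact_closure)
  have "E ` disk \<subseteq> Hinf_box \<times> closure (q ` disk)"
    using closure_subset[of "q ` disk"] by (auto simp: E_def point_eval_Hinf_box)
  then have SK: "S \<subseteq> Hinf_box \<times> closure (q ` disk)"
    unfolding S_def using compact_imp_closed[OF cK] by (rule closure_minimal)
  have "closed S" by (simp add: S_def)
  from compact_Int_closed[OF cK this] SK have cS: "compact S" by (simp only: Int_absorb1)
  have "E ` disk \<subseteq> S" unfolding S_def by (rule closure_subset)
  then have ES: "E z \<in> S" if "z \<in> disk" for z using that by (rule subsetD[OF _ imageI])
  have pt: "k \<in> maxideals \<and> s = Lim (disk_to k) q" if "(k, s) \<in> S" for k s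
  proof -
    \<comment> \<open>The filter of points \<open>z\<close> of the disk with \<open>E z\<close>
      close to \<open>(k, s)\<close>, proper because \<open>(k, s)\<close> lies in the closure of
      the graph. It refines \<open>disk_to k\<close>, so the hypothesis on \<open>q\<close>
      determines \<open>s\<close>.\<close>
    define F where "F = inf (principal disk) (filtercomap E (nhds (k, s)))"
    have F: "F \<noteq> bot"
    proof
      assume "F = bot"
      then have "eventually (\<lambda>_. False) F" by simp
      then obtain Q where Q: "eventually Q (filtercomap E (nhds (k, s)))" "\<And>z. z \<in> disk \<Longrightarrow> Q z \<Longrightarrow> False"
        unfolding F_def eventually_inf eventually_principal by blast
      then obtain U where U: "open U" "(k, s) \<in> U" "\<And>z. E z \<in> U \<Longrightarrow> Q z"
        unfolding eventually_filtercomap eventually_nhds by blast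
      then have "U \<inter> E ` disk = {}" using Q(2) by blast
      then have "U \<inter> S = {}" unfolding S_def using U(1) open_Int_closure_eq_empty by blast
      then show False using that U(2) by blast
    qed
    have Fd: "eventually (\<lambda>z. z \<in> disk) F"
      unfolding F_def by (rule filter_leD[OF inf_le1]) (simp add: eventually_principal)
    have E: "(E \<longlongrightarrow> (k, s)) F" unfolding F_def filterlim_iff_le_filtercomap by simp
    have k1: "(point_eval \<longlongrightarrow> k) F" and s1: "(q \<longlongrightarrow> s) F"
      using tendsto_fst[OF E] tendsto_snd[OF E] by (simp_all add: E_def)
    have lk: "(f \<longlongrightarrow> k f) F" if "f \<in> Hinf" for f
      using filterlim_compose[OF tendsto_coordinate[of f k] k1] that by simp
    have "k \<in> Hinf_box" using SK that by auto
    then have m: "k \<in> maxideals" by (intro character_limit[OF F Fd _ lk] Hinf_box_extensional)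
    have le: "F \<le> disk_to k" using le_disk_to[OF m] Fd lk by blast
    obtain l where l: "(q \<longlongrightarrow> l) (disk_to k)" using lim[OF m] by blast
    have nb: "disk_to k \<noteq> bot" using le F by (metis bot.extremum_uniqueI)
    have "s = l" using tendsto_unique[OF F s1 tendsto_mono[OF le l]] .
    then show ?thesis using m tendsto_Lim[OF nb l] by simp
  qed
  \<comment> \<open>Real-valued functions, since the approximation theorem is real; the real and
    imaginary parts of \<open>q\<close> are approximated separately at the end.\<close>
  define R where "R = {r :: ((complex \<Rightarrow> complex) \<Rightarrow> complex) \<times> complex \<Rightarrow> real. continuous_on S r \<and>
    (\<exists>p. star_polynomial p \<and> (\<forall>z\<in>disk. of_real (r (E z)) = p z))}"
  have coord: "continuous_on S (\<lambda>x. fst x f)" for f :: "complex \<Rightarrow> complex"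
    by (rule continuous_on_compose2[OF continuous_on_product_coordinates[of f] continuous_on_fst[OF continuous_on_id]]) simp
  have RI: "(\<lambda>x. Re (fst x f)) \<in> R" "(\<lambda>x. Im (fst x f)) \<in> R" if f: "f \<in> Hinf" for f
  proof -
    have sp: "star_polynomial (\<lambda>z. c * f z + d * cnj (f z))" for c d
      by (intro star_polynomial.add star_polynomial_cmult star_polynomial.cnj star_polynomial.Hinf f)
    have "complex_of_real (Re w) = (1/2) * w + (1/2) * cnj w" for w by (simp add: complex_eq_iff)
    moreover have "complex_of_real (Im w) = (-\<i>/2) * w + (\<i>/2) * cnj w" for w by (simp add: complex_eq_iff)
    ultimately show "(\<lambda>x. Re (fst x f)) \<in> R" "(\<lambda>x. Im (fst x f)) \<in> R"
      using sp[of "1/2" "1/2"] sp[of "-\<i>/2" "\<i>/2"] f coord[of f] unfolding R_def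
      by (auto simp: E_def intro!: continuous_intros)
  qed
  interpret function_ring_on R S
  proof
    show "compact S" by (rule cS)
    show "continuous_on S f" if "f \<in> R" for f using that by (simp add: R_def)
    show "(\<lambda>x. f x + g x) \<in> R" if fg: "f \<in> R" "g \<in> R" for f g
    proof -
      obtain p1 p2 where "star_polynomial p1" "star_polynomial p2" "\<forall>z\<in>disk. of_real (f (E z)) = p1 z" "\<forall>z\<in>disk. of_real (g (E z)) = p2 z"
        using fg unfolding R_def by blast
      then have "star_polynomial (\<lambda>z. p1 z + p2 z)" "\<forall>z\<in>disk. of_real (f (E z) + g (E z)) = p1 z + p2 z"
        by (auto intro: star_polynomial.add)
      then show ?thesis using fg unfolding R_def by (auto intro!: continuous_intros)
    qed
    show "(\<lambda>x. f x * g x) \<in> R" if fg: "f \<in> R" "g \<in> R" for f g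
    proof -
      obtain p1 p2 where "star_polynomial p1" "star_polynomial p2" "\<forall>z\<in>disk. of_real (f (E z)) = p1 z" "\<forall>z\<in>disk. of_real (g (E z)) = p2 z"
        using fg unfolding R_def by blast
      then have "star_polynomial (\<lambda>z. p1 z * p2 z)" "\<forall>z\<in>disk. of_real (f (E z) * g (E z)) = p1 z * p2 z"
        by (auto intro: star_polynomial.mult)
      then show ?thesis using fg unfolding R_def by (auto intro!: continuous_intros)
    qed
    show "(\<lambda>_. c) \<in> R" for c
    proof -
      have "\<forall>z\<in>disk. of_real c = disk_indicator (of_real c) z" by (simp add: disk_indicator_def)
      then show ?thesis unfolding R_def
        using star_polynomial.Hinf[OF disk_indicator_Hinf[of "of_real c"]] by auto
    qed
    \<comment> \<open>Distinct points of \<open>S\<close> have distinct first components by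
      \<open>pt\<close>, and distinct characters differ at some \<open>f\<close> in
      \<open>Hinf\<close>.\<close>
    show "\<exists>f\<in>R. f x \<noteq> f y" if xy: "x \<in> S" "y \<in> S" "x \<noteq> y" for x y
    proof -
      obtain k s k' s' where e: "x = (k, s)" "y = (k', s')" by (metis surj_pair)
      have ks: "k \<in> maxideals" "s = Lim (disk_to k) q" "k' \<in> maxideals" "s' = Lim (disk_to k') q"
        using pt xy e by auto
      then have "k \<noteq> k'" using xy e by auto
      then obtain f where f: "f \<in> Hinf" "k f \<noteq> k' f" using maxideals_ext ks by blast
      then have "Re (k f) \<noteq> Re (k' f) \<or> Im (k f) \<noteq> Im (k' f)" by (simp add: complex_eq_iff)
      then show ?thesis using RI[OF f(1)] e by (metis fst_conv)
    qed
  qed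
  show ?thesis unfolding star_approximable_def
  proof (intro allI impI)
    fix e :: real assume "e > 0"
    then have e2: "e / 2 > 0" by simp
    have "continuous_on S (\<lambda>x. Re (snd x))" "continuous_on S (\<lambda>x. Im (snd x))"
      by (intro continuous_intros)+
    then obtain r1 r2 where r: "r1 \<in> R" "r2 \<in> R" "\<And>x. x \<in> S \<Longrightarrow> \<bar>Re (snd x) - r1 x\<bar> < e / 2"
      "\<And>x. x \<in> S \<Longrightarrow> \<bar>Im (snd x) - r2 x\<bar> < e / 2"
      using Stone_Weierstrass_basic e2 by metis
    then obtain p1 p2 where p: "star_polynomial p1" "star_polynomial p2" "\<forall>z\<in>disk. of_real (r1 (E z)) = p1 z"
      "\<forall>z\<in>disk. of_real (r2 (E z)) = p2 z"
      by (auto simp: R_def)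
    have "cmod (q z - (p1 z + \<i> * p2 z)) \<le> e" if z: "z \<in> disk" for z
    proof -
      have p12: "p1 z = of_real (r1 (E z))" "p2 z = of_real (r2 (E z))" using p(3,4) z by auto
      have "q z - (p1 z + \<i> * p2 z) = Complex (Re (q z) - r1 (E z)) (Im (q z) - r2 (E z))"
        by (simp add: p12 complex_eq_iff)
      also have "cmod \<dots> \<le> \<bar>Re (q z) - r1 (E z)\<bar> + \<bar>Im (q z) - r2 (E z)\<bar>"
        using cmod_le[of "Complex (Re (q z) - r1 (E z)) (Im (q z) - r2 (E z))"] by simp
      also have "\<dots> \<le> e" using r(3,4)[OF ES[OF z]] by (simp add: E_def)
      finally show ?thesis .
    qed
    moreover have "star_polynomial (\<lambda>z. p1 z + \<i> * p2 z)"
      by (intro star_polynomial.add star_polynomial_cmult p)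
    ultimately show "\<exists>p. star_polynomial p \<and> (\<forall>z\<in>disk. cmod (q z - p z) \<le> e)" by blast
  qed
qed

lemma star_approximable_bounded:
  assumes "star_approximable u"
  shows "bounded (u ` disk)"
proof -
  obtain p where p: "star_polynomial p" "\<forall>z\<in>disk. cmod (u z - p z) \<le> 1"
    using assms unfolding star_approximable_def by (meson zero_less_one)
  obtain C where "\<forall>z. cmod (p z) \<le> C" using star_polynomial_bounded_Lipschitz[OF p(1)] by blast
  then have "cmod (u z) \<le> C + 1" if "z \<in> disk" for z
    using p(2) that norm_triangle_sub[of "u z" "p z"] by (smt (verit))
  then have "\<forall>x\<in>u ` disk. cmod x \<le> C + 1" by blast
  then show ?thesis unfolding bounded_iff by blast
qed

text \<open>A uniform limit of \<open>rho\<close>-Lipschitz functions. As \<open>phi z\<close>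
  preserves \<open>rho\<close>, this makes the functions \<open>u o phi z\<close> equicontinuous,
  the tool for all limits on parts.\<close>

lemma star_approximable_uniformly_continuous:
  assumes "star_approximable u" "0 < e"
  shows "\<exists>d>0. \<forall>z w. cmod z < 1 \<longrightarrow> cmod w < 1 \<longrightarrow> rho z w < d \<longrightarrow> cmod (u z - u w) < e"
proof -
  obtain p where p: "star_polynomial p" "\<And>z. z \<in> disk \<Longrightarrow> cmod (u z - p z) \<le> e / 4"
    using assms unfolding star_approximable_def by (meson divide_pos_pos zero_less_numeral)
  obtain C where C: "C > 0" "\<And>z w. cmod z < 1 \<Longrightarrow> cmod w < 1 \<Longrightarrow> cmod (p z - p w) \<le> C * rho w z"
    using star_polynomial_bounded_Lipschitz[OF p(1)] by blast
  show ?thesis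
  proof (intro exI[of _ "e / (4 * C)"] conjI allI impI)
    show "0 < e / (4 * C)" using assms C by simp
    fix z w :: complex assume zw: "cmod z < 1" "cmod w < 1" "rho z w < e / (4 * C)"
    have "cmod (p z - p w) \<le> C * rho z w" using C(2)[OF zw(1,2)] by (simp add: rho_commute)
    also have "\<dots> \<le> e / 4" using zw(3) C(1) by (simp add: field_simps)
    finally have "cmod (p z - p w) \<le> e / 4" .
    moreover have "cmod (u z - p z) \<le> e / 4" "cmod (u w - p w) \<le> e / 4" using p(2) zw by auto
    moreover have "cmod (u z - u w) \<le> cmod (u z - p z) + cmod (p z - p w) + cmod (u w - p w)"
      using norm_triangle_ineq4[of "u z - p z + (p z - p w)" "u w - p w"] norm_triangle_ineq[of "u z - p z" "p z - p w"]
      by (simp add: algebra_simps)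
    ultimately show "cmod (u z - u w) < e" using assms(2) by linarith
  qed
qed

lemma rho_less_eventually:
  assumes "cmod z < 1" "0 < d"
  shows "\<forall>\<^sub>F w in nhds z. rho z w < d"
proof -
  have "isCont (phi z) z"
    using has_field_derivative_phi[OF assms(1) assms(1)] by (rule DERIV_isCont)
  then have "isCont (\<lambda>w. rho z w) z" unfolding rho_def by (intro continuous_intros)
  then have "((\<lambda>w. rho z w) \<longlongrightarrow> rho z z) (nhds z)"
    using tendsto_at_iff_tendsto_nhds[of "rho z" z] by (simp add: isCont_def)
  then show ?thesis using assms(2) by (intro order_tendstoD[of _ 0]) auto
qed

lemma star_approximable_continuous:
  assumes "star_approximable u"
  shows "continuous_on disk u"
  unfolding continuous_on_def
proof (intro ballI tendstoI)
  fix z :: complex and e :: real assume z: "z \<in> disk" and "0 < e"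
  then obtain d where d: "d > 0" "\<forall>z w. cmod z < 1 \<longrightarrow> cmod w < 1 \<longrightarrow> rho z w < d \<longrightarrow> cmod (u z - u w) < e"
    using star_approximable_uniformly_continuous[OF assms] by blast
  have "\<forall>\<^sub>F w in at z within disk. rho z w < d"
    using rho_less_eventually[of z d] z d by (auto simp: eventually_at_filter elim: eventually_mono)
  moreover have "\<forall>\<^sub>F w in at z within disk. w \<in> disk" by (simp add: eventually_at_filter)
  ultimately show "\<forall>\<^sub>F w in at z within disk. dist (u w) (u z) < e"
    by eventually_elim (use d z in \<open>auto simp: dist_norm norm_minus_commute\<close>)
qed

lemma star_approximable_measurable: "star_approximable u \<Longrightarrow> bounded_measurable u"
  by (simp add: bounded_measurable_continuous star_approximable_continuous star_approximable_bounded)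

text \<open>Star-polynomials converge along \<open>disk_to m\<close>, so a uniform limit of them has
  a Cauchy image filter. This is the converse of \<open>star_approximable_criterion\<close>.\<close>

lemma star_approximable_tendsto:
  assumes u: "star_approximable u" and m: "m \<in> maxideals"
  shows "\<exists>l. (u \<longlongrightarrow> l) (disk_to m)"
proof (cases "disk_to m = bot")
  case False
  have "cauchy_filter (filtermap u (disk_to m))"
    unfolding cauchy_filter_metric_filtermap
  proof (intro allI impI)
    fix e :: real assume e: "e > 0"
    then obtain p where p: "star_polynomial p" "\<And>z. z \<in> disk \<Longrightarrow> cmod (u z - p z) \<le> e / 4"
      using u unfolding star_approximable_def by (meson divide_pos_pos zero_less_numeral)
    obtain l where "(p \<longlongrightarrow> l) (disk_to m)" using star_polynomial_tendsto[OF p(1) m] by blast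
    then have "\<forall>\<^sub>F z in disk_to m. dist (p z) l < e / 4" using e by (intro tendstoD) auto
    then have "\<forall>\<^sub>F z in disk_to m. dist (p z) l < e / 4 \<and> z \<in> disk"
      using eventually_disk_to[OF m] by eventually_elim simp
    moreover have "dist (u z) (u w) < e" if "dist (p z) l < e / 4 \<and> z \<in> disk" "dist (p w) l < e / 4 \<and> w \<in> disk" for z w
    proof -
      have "dist (u z) (p z) \<le> e / 4" "dist (u w) (p w) \<le> e / 4" using p(2) that by (auto simp: dist_norm)
      moreover have "dist (u z) (u w) \<le> dist (u z) (p z) + dist (p z) l + (dist (p w) l + dist (u w) (p w))"
        using dist_triangle[of "u z" "u w" l] dist_triangle[of "u z" l "p z"] dist_triangle[of "u w" l "p w"]
        by (simp add: dist_commute)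
      ultimately show ?thesis using that by linarith
    qed
    ultimately show "\<exists>P. eventually P (disk_to m) \<and> (\<forall>x y. P x \<and> P y \<longrightarrow> dist (u x) (u y) < e)"
      by (intro exI[of _ "\<lambda>z. dist (p z) l < e / 4 \<and> z \<in> disk"]) blast
  qed
  then have "\<exists>l. filtermap u (disk_to m) \<le> nhds l"
    using complete_UNIV False unfolding complete_uniform
    by (metis UNIV_I filtermap_bot_iff principal_UNIV top_greatest)
  then show ?thesis by (simp add: filterlim_def)
qed simp

section \<open>Existence of the Hoffman maps\<close>


text \<open>A limit of counterexamples would have a zero on every circle of radius less than \<open>r1\<close>.\<close>

lemma holomorphic_annulus_lower_bound:
  assumes \<beta>: "0 < \<beta>" and w: "cmod w < 1" and r1: "0 < r1" "r1 < 1"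
  shows "\<exists>c>0. \<forall>g. g holomorphic_on disk \<longrightarrow> (\<forall>z\<in>disk. cmod (g z) \<le> 1) \<longrightarrow> \<beta> \<le> cmod (g w) \<longrightarrow>
    (\<exists>r. c \<le> r \<and> r + c \<le> r1 \<and> (\<forall>\<zeta>. r \<le> cmod \<zeta> \<longrightarrow> cmod \<zeta> \<le> r + c \<longrightarrow> c \<le> cmod (g \<zeta>)))" (is ?claim)
proof (rule ccontr)
  define H where "H = {g. g holomorphic_on disk \<and> (\<forall>z\<in>disk. cmod (g z) \<le> 1)}"
  define P where "P c g \<longleftrightarrow> (\<exists>r. c \<le> r \<and> r + c \<le> r1 \<and>
    (\<forall>\<zeta>. r \<le> cmod \<zeta> \<longrightarrow> cmod \<zeta> \<le> r + c \<longrightarrow> c \<le> cmod (g \<zeta>)))" for c and g :: "complex \<Rightarrow> complex"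
  assume neg: "\<not> ?claim"
  have "\<not> (\<exists>c>0. \<forall>g. g \<in> H \<longrightarrow> \<beta> \<le> cmod (g w) \<longrightarrow> P c g)"
  proof
    assume "\<exists>c>0. \<forall>g. g \<in> H \<longrightarrow> \<beta> \<le> cmod (g w) \<longrightarrow> P c g"
    then obtain c where c: "c > 0" "\<And>g. g \<in> H \<Longrightarrow> \<beta> \<le> cmod (g w) \<Longrightarrow> P c g" by blast
    have ?claim
    proof (rule exI[of _ c], intro conjI allI impI c(1))
      fix g assume "g holomorphic_on disk" "\<forall>z\<in>disk. cmod (g z) \<le> 1" "\<beta> \<le> cmod (g w)"
      then have "P c g" by (intro c(2)) (simp_all add: H_def)
      then show "\<exists>r. c \<le> r \<and> r + c \<le> r1 \<and> (\<forall>\<zeta>. r \<le> cmod \<zeta> \<longrightarrow> cmod \<zeta> \<le> r + c \<longrightarrow> c \<le> cmod (g \<zeta>))"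
        unfolding P_def .
    qed
    with neg show False by contradiction
  qed
  then have "\<exists>g. g \<in> H \<and> \<beta> \<le> cmod (g w) \<and> \<not> P c g" if "c > 0" for c using that by blast
  then have "\<exists>g. g \<in> H \<and> \<beta> \<le> cmod (g w) \<and> (\<forall>r. c \<le> r \<longrightarrow> r + c \<le> r1 \<longrightarrow> (\<exists>\<zeta>. r \<le> cmod \<zeta> \<and> cmod \<zeta> \<le> r + c \<and> cmod (g \<zeta>) < c))"
    if "c > 0" for c
    using that unfolding P_def by (metis not_le)
  then have "\<forall>n. \<exists>g. g \<in> H \<and> \<beta> \<le> cmod (g w) \<and> (\<forall>r. inverse (Suc n) \<le> r \<longrightarrow> r + inverse (Suc n) \<le> r1 \<longrightarrow>
     (\<exists>\<zeta>. r \<le> cmod \<zeta> \<and> cmod \<zeta> \<le> r + inverse (Suc n) \<and> cmod (g \<zeta>) < inverse (Suc n)))"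
    by simp
  then obtain g where gn: "\<And>n. g n \<in> H" "\<And>n. \<beta> \<le> cmod (g n w)"
    and gz: "\<And>n r. inverse (Suc n) \<le> r \<Longrightarrow> r + inverse (Suc n) \<le> r1 \<Longrightarrow>
     (\<exists>\<zeta>. r \<le> cmod \<zeta> \<and> cmod \<zeta> \<le> r + inverse (Suc n) \<and> cmod (g n \<zeta>) < inverse (Suc n))"
    by metis
  \<comment> \<open>Montel's theorem for the common bound 1; the lower bound at \<open>w\<close>
    survives in the limit and excludes the zero function.\<close>
  obtain G k where G: "G holomorphic_on disk" "strict_mono (k :: nat \<Rightarrow> nat)"
    "\<And>x. x \<in> disk \<Longrightarrow> (\<lambda>n. g (k n) x) \<longlonglongrightarrow> G x"
    "\<And>K. compact K \<Longrightarrow> K \<subseteq> disk \<Longrightarrow> uniform_limit K (g \<circ> k) G sequentially"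
  proof (rule Montel[of disk H g])
    show "\<exists>B. \<forall>h\<in>H. \<forall>z\<in>K. cmod (h z) \<le> B" if "K \<subseteq> disk" for K
      using that by (intro exI[of _ 1]) (auto simp: H_def)
  qed (use gn in \<open>auto simp: H_def\<close>)
  have Gw: "\<beta> \<le> cmod (G w)"
    by (rule tendsto_lowerbound[OF tendsto_norm[OF G(3)]]) (use gn w in auto)
  have invk: "(\<lambda>n. inverse (real (Suc (k n)))) \<longlonglongrightarrow> 0"
    using LIMSEQ_subseq_LIMSEQ[OF LIMSEQ_inverse_real_of_nat G(2)] by (simp add: o_def)
  \<comment> \<open>The n-th function is smaller than 1/(n+1) somewhere in the annulus from r to r +
    1/(n+1). Along a subsequence such points converge to a point of modulus r, and local uniform
    convergence makes it a zero of \<open>G\<close>.\<close>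
  have zero: "\<exists>\<zeta>. cmod \<zeta> = r \<and> G \<zeta> = 0" if r: "0 < r" "r < r1" for r
  proof -
    have "\<forall>\<^sub>F n in sequentially. inverse (real (Suc (k n))) < min r (r1 - r)"
      using invk r by (intro order_tendstoD) auto
    then obtain N where N: "\<And>n. n \<ge> N \<Longrightarrow> inverse (real (Suc (k n))) < min r (r1 - r)"
      unfolding eventually_sequentially by blast
    have "\<exists>\<zeta>. r \<le> cmod \<zeta> \<and> cmod \<zeta> \<le> r + inverse (Suc (k (n + N))) \<and> cmod (g (k (n + N)) \<zeta>) < inverse (Suc (k (n + N)))" for n
      using N[of "n + N"] by (intro gz) auto
    then obtain \<zeta> where z: "\<And>n. r \<le> cmod (\<zeta> n)" "\<And>n. cmod (\<zeta> n) \<le> r + inverse (Suc (k (n + N)))"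
       "\<And>n. cmod (g (k (n + N)) (\<zeta> n)) < inverse (Suc (k (n + N)))" by metis
    have zr1: "\<zeta> n \<in> cball 0 r1" for n
      using order_trans[OF z(2)[of n], of r1] N[of "n + N"] by simp
    have "seq_compact (cball (0::complex) r1)" by (simp add: compact_imp_seq_compact)
    then have "\<exists>z0\<in>cball 0 r1. \<exists>s. strict_mono (s :: nat \<Rightarrow> nat) \<and> (\<zeta> \<circ> s) \<longlonglongrightarrow> z0"
      unfolding seq_compact_def using zr1 by (elim allE[of _ \<zeta>]) simp
    then obtain z0 s where s: "z0 \<in> cball 0 r1" "strict_mono (s :: nat \<Rightarrow> nat)" "(\<zeta> \<circ> s) \<longlonglongrightarrow> z0"
      by blast
    have inv2: "(\<lambda>n. inverse (real (Suc (k (s n + N))))) \<longlonglongrightarrow> 0"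
      using LIMSEQ_subseq_LIMSEQ[OF LIMSEQ_ignore_initial_segment[OF invk, of N] s(2)] by (simp add: o_def)
    have nz: "(\<lambda>n. cmod (\<zeta> (s n))) \<longlonglongrightarrow> cmod z0" using tendsto_norm[OF s(3)] by (simp add: o_def)
    have "(\<lambda>n. r + inverse (real (Suc (k (s n + N))))) \<longlonglongrightarrow> r + 0" by (intro tendsto_intros inv2)
    then have "cmod z0 \<le> r" using nz z(2) by (intro LIMSEQ_le[of _ _ _ r]) auto
    moreover have "r \<le> cmod z0" by (rule LIMSEQ_le_const[OF nz]) (use z in auto)
    ultimately have n0: "cmod z0 = r" by simp
    have "continuous_on disk G" using G(1) by (rule holomorphic_on_imp_continuous_on)
    then have ic: "isCont G z0" using n0 r r1 by (simp add: continuous_on_eq_continuous_at)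
    have lim1: "(\<lambda>n. G (\<zeta> (s n))) \<longlonglongrightarrow> G z0"
      by (rule isCont_tendsto_compose[OF ic s(3)[unfolded o_def]])
    have "(\<lambda>n. G (\<zeta> (s n))) \<longlonglongrightarrow> 0"
    proof (rule LIMSEQ_I)
      fix e :: real assume e: "e > 0"
      have ul: "uniform_limit (cball 0 r1) (g \<circ> k) G sequentially" using r1 by (intro G) auto
      have "0 < e / 2" using e by simp
      from uniform_limitD[OF ul this] have "\<forall>\<^sub>F n in sequentially. \<forall>x\<in>cball 0 r1. dist ((g \<circ> k) n x) (G x) < e / 2" .
      then obtain N1 where N1: "\<And>n x. n \<ge> N1 \<Longrightarrow> x \<in> cball 0 r1 \<Longrightarrow> dist (g (k n) x) (G x) < e / 2"
        unfolding eventually_sequentially o_def by blast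
      obtain N2 where N2: "\<And>n. n \<ge> N2 \<Longrightarrow> inverse (real (Suc (k (s n + N)))) < e / 2"
        using order_tendstoD(2)[OF inv2, of "e / 2"] e unfolding eventually_sequentially by auto
      have "norm (G (\<zeta> (s n)) - 0) < e" if n: "n \<ge> max N1 N2" for n
      proof -
        have "s n \<ge> n" by (rule seq_suble[OF s(2)])
        then have 1: "dist (g (k (s n + N)) (\<zeta> (s n))) (G (\<zeta> (s n))) < e / 2" using n by (intro N1 zr1) auto
        have 2: "cmod (g (k (s n + N)) (\<zeta> (s n))) < e / 2" using less_trans[OF z(3)[of "s n"] N2[of n]] n by simp
        have "cmod (G (\<zeta> (s n))) \<le> dist (g (k (s n + N)) (\<zeta> (s n))) (G (\<zeta> (s n))) + cmod (g (k (s n + N)) (\<zeta> (s n)))"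
          using norm_triangle_sub[of "G (\<zeta> (s n))" "g (k (s n + N)) (\<zeta> (s n))"]
          by (simp add: dist_norm norm_minus_commute)
        then show ?thesis using 1 2 by simp
      qed
      then show "\<exists>no. \<forall>n\<ge>no. norm (G (\<zeta> (s n)) - 0) < e" by blast
    qed
    then have "G z0 = 0" by (rule LIMSEQ_unique[OF lim1])
    then show ?thesis using n0 by blast
  qed
  have "\<not> G constant_on disk"
  proof
    assume "G constant_on disk"
    then obtain c where c: "\<And>x. x \<in> disk \<Longrightarrow> G x = c" by (auto simp: constant_on_def)
    obtain \<zeta> where "cmod \<zeta> = r1 / 2" "G \<zeta> = 0" using zero[of "r1 / 2"] r1 by auto
    then have "c = 0" using c[of \<zeta>] r1 by simp
    then show False using c[of w] w Gw \<beta> by simp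
  qed
  then have "finite {z \<in> cball 0 r1. G z = 0}"
    using r1 by (intro holomorphic_compact_finite_zeros[OF G(1)]) auto
  then have "finite (cmod ` {z \<in> cball 0 r1. G z = 0})" by simp
  moreover have "{0<..<r1} \<subseteq> cmod ` {z \<in> cball 0 r1. G z = 0}"
  proof
    fix r assume "r \<in> {0<..<r1}"
    then obtain \<zeta> where "cmod \<zeta> = r" "G \<zeta> = 0" using zero[of r] by auto
    then show "r \<in> cmod ` {z \<in> cball 0 r1. G z = 0}"
      using \<open>r \<in> {0<..<r1}\<close> by (intro image_eqI[of _ _ \<zeta>]) auto
  qed
  ultimately have "finite {0<..<r1}" by (rule finite_subset[rotated])
  then show False using r1 infinite_Ioo by blast
qed

section \<open>Blaschke products\<close>

lemma phi_denominator_nonzero: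
  assumes "cmod a < 1" "cmod z \<le> 1"
  shows "1 - cnj a * z \<noteq> 0"
proof
  assume "1 - cnj a * z = 0"
  then have "cnj (1 - cnj a * z) = 0" by simp
  then have "1 - cnj z * a = 0" by (simp add: mult.commute)
  then show False using one_minus_cnj_mult_nonzero[OF assms(2,1)] by contradiction
qed

lemma phi_eq_0_iff: "cmod a < 1 \<Longrightarrow> cmod z \<le> 1 \<Longrightarrow> phi a z = 0 \<longleftrightarrow> z = a"
  using phi_denominator_nonzero[of a z] by (auto simp: disk_involution_def)

text \<open>Each zero is split off with \<open>Schwarz_factor\<close>; the quotient still vanishes
  at the remaining zeros and is bounded by 1, so the induction has to range over all
  \<open>f\<close>.\<close>

lemma finite_Blaschke_bound:
  assumes "finite Z" "Z \<subseteq> disk" "f holomorphic_on disk" "\<And>z. cmod z < 1 \<Longrightarrow> cmod (f z) \<le> 1"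
    "\<And>a. a \<in> Z \<Longrightarrow> f a = 0" "cmod z < 1"
  shows "cmod (f z) \<le> cmod (\<Prod>a\<in>Z. phi a z)"
  using assms
proof (induction Z arbitrary: f rule: finite_induct)
  case (insert a Z)
  have a: "cmod a < 1" using insert by auto
  show ?case
  proof (rule Schwarz_factor[OF insert.prems(2,3) a insert.prems(4)])
    fix g assume g: "g holomorphic_on disk" "\<And>z. cmod z < 1 \<Longrightarrow> f z = phi a z * g z"
      "\<And>z. cmod z < 1 \<Longrightarrow> cmod (g z) \<le> 1"
    have "g b = 0" if "b \<in> Z" for b
    proof -
      have b: "b \<in> disk" "f b = 0" "b \<noteq> a" using that insert by auto
      then show ?thesis using g(2)[of b] phi_eq_0_iff[OF a, of b] by auto
    qed
    then have "cmod (g z) \<le> cmod (\<Prod>a\<in>Z. phi a z)"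
      using insert.prems g by (intro insert.IH) auto
    then show "cmod (f z) \<le> cmod (\<Prod>a\<in>insert a Z. phi a z)"
      using g(2)[OF insert.prems(5)] insert.hyps by (simp add: norm_mult mult_left_mono)
  qed auto
qed simp

lemma phi_norm_le_1:
  assumes "cmod a < 1" "cmod z \<le> 1"
  shows "cmod (phi a z) \<le> 1" "cmod z = 1 \<Longrightarrow> cmod (phi a z) = 1"
proof -
  have nz: "1 - cnj z * a \<noteq> 0" using one_minus_cnj_mult_nonzero[of z a] assms by simp
  have e: "rho z a = cmod (phi a z)" using rho_commute[of z a] by (simp add: rho_def)
  have "1 - (cmod (phi a z))\<^sup>2 = (1 - (cmod z)\<^sup>2) * (1 - (cmod a)\<^sup>2) / (cmod (1 - cnj z * a))\<^sup>2"
    using one_minus_phi_norm[OF assms(2,1)] e by (simp add: rho_def)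
  moreover have "0 \<le> (1 - (cmod z)\<^sup>2) * (1 - (cmod a)\<^sup>2) / (cmod (1 - cnj z * a))\<^sup>2"
    using assms by (intro divide_nonneg_nonneg mult_nonneg_nonneg) (auto simp: power_le_one)
  ultimately have "(cmod (phi a z))\<^sup>2 \<le> 1" "cmod z = 1 \<Longrightarrow> (cmod (phi a z))\<^sup>2 = 1" by auto
  then show "cmod (phi a z) \<le> 1" "cmod z = 1 \<Longrightarrow> cmod (phi a z) = 1"
    using norm_ge_zero[of "phi a z"] by (auto simp: abs_square_le_1 power2_eq_1_iff simp del: norm_ge_zero)
qed

lemma holomorphic_phi_cball: "cmod a < 1 \<Longrightarrow> continuous_on (cball 0 1) (phi a)"
  unfolding disk_involution_def
  by (intro continuous_intros ballI phi_denominator_nonzero) auto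

text \<open>An exhaustion by closed disks, from which the zeros of a nonconstant holomorphic
  function are seen to be countable.\<close>

lemma fsigma_disk: "fsigma disk"
proof -
  have "disk = (\<Union>n. cball (0::complex) (1 - inverse (real (Suc n))))"
  proof (intro equalityI subsetI)
    fix z :: complex assume "z \<in> disk"
    then obtain n where "inverse (real (Suc n)) < 1 - cmod z" using reals_Archimedean[of "1 - cmod z"] by auto
    then show "z \<in> (\<Union>n. cball 0 (1 - inverse (real (Suc n))))" by (intro UN_I[of n]) auto
  next
    fix z :: complex assume "z \<in> (\<Union>n. cball 0 (1 - inverse (real (Suc n))))"
    then obtain n where "cmod z \<le> 1 - inverse (real (Suc n))" by auto
    moreover have "inverse (real (Suc n)) > 0" by simp
    ultimately show "z \<in> disk" by (simp only: mem_ball_0)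
  qed
  then show ?thesis using fsigma.intros[of "\<lambda>n. cball 0 (1 - inverse (real (Suc n)))"] by simp
qed

text \<open>\<open>B\<close> is a limit of finite products of the factors \<open>phi a\<close> over the zeros \<open>a\<close> of \<open>f\<close> in \<open>N\<close>. Such a
  product has modulus 1 on the unit circle and at least \<open>cmod f \<ge> c\<close> on the boundary of \<open>N\<close>; the minimum
  principle carries the bound to \<open>disk - N\<close>.\<close>

lemma exists_Blaschke:
  assumes hol: "f holomorphic_on disk" and le1: "\<And>z. cmod z < 1 \<Longrightarrow> cmod (f z) \<le> 1"
    and nz: "cmod b < 1" "f b \<noteq> 0" and N: "open N" "N \<subseteq> disk" and c: "0 < c" "c \<le> 1"
    and fr: "\<And>p. p \<in> disk \<Longrightarrow> p \<in> closure N \<Longrightarrow> p \<notin> N \<Longrightarrow> c \<le> cmod (f p)"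
  shows "\<exists>B\<in>Hinf. (\<forall>z\<in>disk. cmod (B z) \<le> 1) \<and> (\<forall>z\<in>N. f z = 0 \<longrightarrow> B z = 0) \<and> (\<forall>z\<in>disk - N. c \<le> cmod (B z))"
proof -
  define Z where "Z = {z \<in> N. f z = 0}"
  show ?thesis
  proof (cases "Z = {}")
    case True
    then show ?thesis using c
      by (intro bexI[of _ "disk_indicator 1"] disk_indicator_Hinf) (auto simp: disk_indicator_def Z_def)
  next
    case False
    have "countable Z"
    proof (cases "f constant_on disk")
      case True
      then show ?thesis using nz N(2) False unfolding Z_def constant_on_def by force
    next
      case False
      have "countable {z \<in> disk. f z = 0}"
        using hol False by (intro holomorphic_countable_zeros fsigma_disk) auto
      then show ?thesis by (rule countable_subset[rotated]) (use N in \<open>auto simp: Z_def\<close>)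
    qed
    define e where "e = from_nat_into Z"
    have e: "range e = Z" unfolding e_def using False \<open>countable Z\<close> by (rule range_from_nat_into)
    \<comment> \<open>The product runs over a set, so repetitions in the enumeration
      \<open>e\<close> count once. The factors carry no unimodular constants; convergence comes from
      a subsequence by Montel's theorem.\<close>
    define Bn where "Bn n z = (\<Prod>a\<in>e ` {..<n}. phi a z)" for n :: nat and z
    have eZ: "e ` {..<n} \<subseteq> Z" for n using e by blast
    have ZN: "Z \<subseteq> N" by (auto simp: Z_def)
    have en: "cmod a < 1" if "a \<in> e ` {..<n}" for a n
    proof -
      have "a \<in> disk" using that eZ[of n] ZN N(2) by blast
      then show ?thesis by simp
    qed
    have Bn_le: "cmod (Bn n z) \<le> 1" if "cmod z \<le> 1" for n z
      unfolding Bn_def prod_norm[symmetric] using phi_norm_le_1(1) en that by (intro prod_le_1) auto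
    have Bn_1: "cmod (Bn n z) = 1" if "cmod z = 1" for n z
      unfolding Bn_def prod_norm[symmetric] using phi_norm_le_1(2) en that by (intro prod.neutral) auto
    have Bn_hol: "Bn n holomorphic_on disk" for n
      unfolding Bn_def[abs_def] by (intro holomorphic_on_prod holomorphic_phi en)
    have Bn_cont: "continuous_on (cball 0 1) (Bn n)" for n
      unfolding Bn_def[abs_def] by (intro continuous_on_prod holomorphic_phi_cball en)
    have Bn_nz: "Bn n z \<noteq> 0" if "cmod z \<le> 1" "z \<notin> N" for n z
      unfolding Bn_def using that en[of _ n] eZ[of n] ZN phi_eq_0_iff by (subst prod_zero_iff) auto
    have f_Bn: "cmod (f z) \<le> cmod (Bn n z)" if "cmod z < 1" for n z
      unfolding Bn_def using that eZ[of n] ZN N(2) hol le1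
      by (intro finite_Blaschke_bound) (auto simp: Z_def)
    have Bn_ge: "c \<le> cmod (Bn n z)" if z: "z \<in> disk - N" for n z
    proof -
      define S where "S = disk - N"
      have clS: "closure S \<subseteq> cball 0 1 - N"
      proof -
        have "closure S \<subseteq> cball 0 1" unfolding S_def
          by (rule order_trans[OF closure_mono[of _ disk]]) auto
        moreover have "closure S \<inter> N = {}"
          using N(1) open_Int_closure_eq_empty[of N S] by (auto simp: S_def Int_commute)
        ultimately show ?thesis by blast
      qed
      have "cmod (inverse (Bn n z)) \<le> inverse c"
      proof (rule maximum_modulus_frontier[of "\<lambda>z. inverse (Bn n z)" S])
        show "(\<lambda>z. inverse (Bn n z)) holomorphic_on interior S"
          using interior_subset[of S] Bn_nz
          by (intro holomorphic_intros holomorphic_on_subset[OF Bn_hol]) (auto simp: S_def)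
        show "continuous_on (closure S) (\<lambda>z. inverse (Bn n z))"
          using clS Bn_nz by (intro continuous_intros continuous_on_subset[OF Bn_cont]) auto
        show "bounded S" by (rule bounded_subset[of disk]) (auto simp: S_def)
        show "z \<in> S" using z by (simp add: S_def)
        fix p assume p: "p \<in> frontier S"
        then have p1: "cmod p \<le> 1" "p \<notin> N" using clS by (auto simp: frontier_def)
        have "c \<le> cmod (Bn n p)"
        proof (cases "cmod p = 1")
          case True
          then show ?thesis using Bn_1 c by simp
        next
          case False
          then have pd: "p \<in> disk" using p1 by simp
          have "p \<in> closure N"
          proof (rule ccontr)
            assume "p \<notin> closure N"
            then have "p \<in> disk - closure N" using pd by simp
            moreover have "open (disk - closure N)" by (intro open_Diff) auto
            moreover have "disk - closure N \<subseteq> S" using closure_subset[of N] by (auto simp: S_def)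
            ultimately have "p \<in> interior S" by (meson interiorI)
            then show False using p by (simp add: frontier_def)
          qed
          then show ?thesis using fr[OF pd _ p1(2)] f_Bn[of p n] pd by simp
        qed
        then show "cmod (inverse (Bn n p)) \<le> inverse c"
          using c by (simp add: norm_inverse le_imp_inverse_le)
      qed
      then show ?thesis using c Bn_nz[of z n] z by (simp add: norm_inverse)
    qed
    obtain G k where G: "G holomorphic_on disk" "strict_mono (k :: nat \<Rightarrow> nat)"
      "\<And>x. x \<in> disk \<Longrightarrow> (\<lambda>n. Bn (k n) x) \<longlonglongrightarrow> G x"
    proof (rule Montel[of disk "range Bn" Bn])
      show "\<exists>B. \<forall>h\<in>range Bn. \<forall>z\<in>K. cmod (h z) \<le> B" if "K \<subseteq> disk" for K
      proof (intro exI[of _ 1] ballI)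
        fix h z assume "h \<in> range Bn" "z \<in> K"
        then show "cmod (h z) \<le> 1" using that Bn_le[of z] by force
      qed
    qed (use Bn_hol in auto)
    have Gle: "cmod (G z) \<le> 1" if "z \<in> disk" for z
      by (rule tendsto_upperbound[OF tendsto_norm[OF G(3)[OF that]]]) (use Bn_le that in auto)
    have Gge: "c \<le> cmod (G z)" if "z \<in> disk - N" for z
      by (rule tendsto_lowerbound[OF tendsto_norm[OF G(3)]]) (use Bn_ge that in auto)
    have G0: "G z = 0" if zZ: "z \<in> Z" for z
    proof -
      obtain j where j: "z = e j" using e zZ by blast
      have zd: "z \<in> disk" using zZ ZN N(2) by blast
      have "Bn (k n) z = 0" if n: "n \<ge> Suc j" for n
      proof -
        have "n \<le> k n" by (rule seq_suble[OF G(2)])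
        then have "j < k n" using n by simp
        then have "z \<in> e ` {..<k n}" unfolding j by (intro imageI) simp
        then show ?thesis unfolding Bn_def by (intro prod_zero bexI[of _ z]) simp_all
      qed
      then have "\<forall>\<^sub>F n in sequentially. Bn (k n) z = 0" unfolding eventually_sequentially by blast
      then have "(\<lambda>n. Bn (k n) z) \<longlonglongrightarrow> 0" by (rule tendsto_eventually)
      then show ?thesis by (rule LIMSEQ_unique[OF G(3)[OF zd]])
    qed
    show ?thesis
    proof (intro bexI conjI ballI impI)
      show "(\<lambda>z. if z \<in> disk then G z else 0) \<in> Hinf"
        using Gle by (intro Hinf_restrict G boundedI[of _ 1]) auto
    qed (use Gle Gge G0 N(2) in \<open>auto simp: Z_def\<close>)
  qed
qed

text \<open>A Lipschitz estimate in the parameter \<open>z\<close> for fixed \<open>w\<close>. With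
  |z - z0| = rho |1 - cnj z z0|, the numerator of the quotient is at most (1 + 1 + 2) |z - z0|, and
  the denominator is at least |1 - cnj z z0| (1 - |w|^2) minus (2 + 2) |z - z0|.\<close>

lemma rho_phi_param:
  assumes "cmod z < 1" "cmod z0 < 1" "cmod w < 1" and small: "4 * rho z z0 < 1 - (cmod w)\<^sup>2"
  shows "rho (phi z w) (phi z0 w) \<le> 4 * rho z z0 / (1 - (cmod w)\<^sup>2 - 4 * rho z z0)"
proof -
  let ?P = "1 - cnj z * w" and ?Q = "1 - cnj z0 * w" and ?R = "1 - cnj z * z0"
  have nz: "?P \<noteq> 0" "?Q \<noteq> 0" "?R \<noteq> 0" "1 - z * cnj w \<noteq> 0"
    using one_minus_cnj_mult_nonzero one_minus_mult_cnj_nonzero assms by auto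
  have w1: "(cmod w)\<^sup>2 \<le> cmod w" "cmod w \<le> 1" using assms(3) by (auto simp: power2_eq_square mult_left_le)
  have d: "cmod (z - z0) = rho z z0 * cmod ?R"
    using nz by (simp add: rho_def disk_involution_def norm_divide)
  have z1: "cmod z \<le> 1" using assms by simp
  have skew: "cmod (z0 * cnj z - z * cnj z0) \<le> 2 * cmod (z - z0)"
  proof -
    have "z0 * cnj z - z * cnj z0 = (z0 - z) * cnj z + z * cnj (z - z0)" by (simp add: algebra_simps)
    also have "cmod \<dots> \<le> cmod (z - z0) * 1 + 1 * cmod (z - z0)"
      using z1 by (intro norm_triangle_mono) (auto simp: norm_mult norm_minus_commute mult_left_le mult_left_le_one_le simp del: complex_cnj_diff)
    finally show ?thesis by simp
  qed
  have num: "phi z w - phi z0 w = ((z - z0) - w\<^sup>2 * cnj (z - z0) + w * (z0 * cnj z - z * cnj z0)) / (?P * ?Q)"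
  proof -
    have "phi z w - phi z0 w = ((z - w) * ?Q - (z0 - w) * ?P) / (?P * ?Q)"
      using nz by (simp add: disk_involution_def diff_frac_eq)
    also have "(z - w) * ?Q - (z0 - w) * ?P = (z - z0) - w\<^sup>2 * cnj (z - z0) + w * (z0 * cnj z - z * cnj z0)"
      by (simp add: algebra_simps power2_eq_square)
    finally show ?thesis .
  qed
  have numle: "cmod ((z - z0) - w\<^sup>2 * cnj (z - z0) + w * (z0 * cnj z - z * cnj z0)) \<le> 4 * cmod (z - z0)"
  proof -
    have "cmod ((z - z0) - w\<^sup>2 * cnj (z - z0) + w * (z0 * cnj z - z * cnj z0))
      \<le> cmod (z - z0) + cmod (w\<^sup>2 * cnj (z - z0)) + cmod (w * (z0 * cnj z - z * cnj z0))"
      by (meson norm_triangle_ineq norm_triangle_ineq4 add_right_mono order_trans)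
    also have "cmod (w\<^sup>2 * cnj (z - z0)) \<le> 1 * cmod (z - z0)"
      unfolding norm_mult norm_power complex_mod_cnj using w1 by (intro mult_right_mono) auto
    also have "cmod (w * (z0 * cnj z - z * cnj z0)) \<le> 1 * (2 * cmod (z - z0))"
      unfolding norm_mult using w1 skew by (intro mult_mono) auto
    finally show ?thesis by simp
  qed
  have den: "1 - cnj (phi z w) * phi z0 w = (?R * (1 - w * cnj w) + (w * cnj w) * (z * cnj z0 - z0 * cnj z)
       + (w * cnj (z - z0) - cnj w * (z - z0))) / ((1 - z * cnj w) * ?Q)"
  proof -
    have "1 - cnj (phi z w) * phi z0 w = ((1 - z * cnj w) * ?Q - (cnj z - cnj w) * (z0 - w)) / ((1 - z * cnj w) * ?Q)"
      using nz by (simp add: disk_involution_def diff_divide_distrib[symmetric] divide_simps)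
    also have "(1 - z * cnj w) * ?Q - (cnj z - cnj w) * (z0 - w) = ?R * (1 - w * cnj w) + (w * cnj w) * (z * cnj z0 - z0 * cnj z)
       + (w * cnj (z - z0) - cnj w * (z - z0))"
      by (simp add: algebra_simps)
    finally show ?thesis .
  qed
  have denge: "cmod ?R * (1 - (cmod w)\<^sup>2 - 4 * rho z z0) \<le> cmod (?R * (1 - w * cnj w) + (w * cnj w) * (z * cnj z0 - z0 * cnj z)
       + (w * cnj (z - z0) - cnj w * (z - z0)))"
  proof -
    have 1: "cmod (?R * (1 - w * cnj w)) = cmod ?R * (1 - (cmod w)\<^sup>2)"
      using one_minus_square_pos[OF assms(3)]
      by (simp add: norm_mult one_minus_square_complex[symmetric] del: of_real_diff)
    have 2: "cmod ((w * cnj w) * (z * cnj z0 - z0 * cnj z)) \<le> 1 * (2 * cmod (z - z0))"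
      unfolding norm_mult complex_mod_cnj using w1 skew
      by (intro mult_mono) (auto simp: norm_minus_commute power2_eq_square)
    have 3: "cmod (w * cnj (z - z0) - cnj w * (z - z0)) \<le> 2 * cmod (z - z0)"
    proof -
      have "cmod (w * cnj (z - z0) - cnj w * (z - z0)) \<le> cmod (w * cnj (z - z0)) + cmod (cnj w * (z - z0))"
        by (rule norm_triangle_ineq4)
      also have "\<dots> \<le> 1 * cmod (z - z0) + 1 * cmod (z - z0)"
        unfolding norm_mult complex_mod_cnj using w1 by (intro add_mono mult_right_mono) auto
      finally show ?thesis by simp
    qed
    let ?a = "?R * (1 - w * cnj w)" and ?b = "(w * cnj w) * (z * cnj z0 - z0 * cnj z)" and ?c = "w * cnj (z - z0) - cnj w * (z - z0)"
    have "cmod ?a \<le> cmod (?a + ?b + ?c) + cmod ?b + cmod ?c"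
      using norm_triangle_ineq4[of "?a + ?b + ?c" "?b + ?c"] norm_triangle_ineq[of ?b ?c] by (simp add: algebra_simps)
    then show ?thesis using 1 2 3 d by (simp add: algebra_simps)
  qed
  have PQ: "cmod ((1 - z * cnj w) * ?Q) = cmod (?P * ?Q)"
  proof -
    have "cmod (1 - z * cnj w) = cmod ?P"
      by (metis complex_cnj_cnj complex_cnj_diff complex_cnj_mult complex_cnj_one complex_mod_cnj)
    then show ?thesis by (simp add: norm_mult)
  qed
  have posR: "0 < cmod ?R * (1 - (cmod w)\<^sup>2 - 4 * rho z z0)" using nz small by simp
  define X Y where "X = (z - z0) - w\<^sup>2 * cnj (z - z0) + w * (z0 * cnj z - z * cnj z0)"
    and "Y = ?R * (1 - w * cnj w) + (w * cnj w) * (z * cnj z0 - z0 * cnj z) + (w * cnj (z - z0) - cnj w * (z - z0))"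
  have "rho (phi z w) (phi z0 w) = cmod (phi z w - phi z0 w) / cmod (1 - cnj (phi z w) * phi z0 w)"
    by (simp add: rho_def disk_involution_def[of "phi z w"] norm_divide)
  also have "\<dots> = cmod X / cmod Y"
    unfolding num den X_def[symmetric] Y_def[symmetric] norm_divide PQ using nz by simp
  also have "\<dots> \<le> (4 * cmod (z - z0)) / (cmod ?R * (1 - (cmod w)\<^sup>2 - 4 * rho z z0))"
    using numle denge posR unfolding X_def[symmetric] Y_def[symmetric] by (intro frac_le) auto
  also have "\<dots> = 4 * rho z z0 / (1 - (cmod w)\<^sup>2 - 4 * rho z z0)"
    unfolding d using nz by simp
  finally show ?thesis .
qed


text \<open>The Blaschke product \<open>B\<close> formed by the zeros of \<open>f\<close> near the points \<open>z\<close> with \<open>f (phi z w) \<approx> a\<close>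
  tends to 0 along \<open>disk_to m\<close>, because \<open>f\<close> has zeros arbitrarily close to those points. As \<open>B\<close> is
  bounded below away from them, all \<open>z\<close> close to \<open>m\<close> are hyperbolically close to such points.\<close>

lemma hoffman_cluster_unique:
  assumes m: "m \<in> maxideals" and f: "f \<in> Hinf" and le1: "\<And>z. cmod (f z) \<le> 1" and w: "cmod w < 1"
    and f0: "(f \<longlongrightarrow> 0) (disk_to m)" and a: "0 < cmod a" "cmod a \<le> 1" and e: "0 < e" "e \<le> cmod a / 2"
    and freq: "\<exists>\<^sub>F z in disk_to m. cmod (f (phi z w) - a) < e"
  shows "\<forall>\<^sub>F z in disk_to m. cmod (f (phi z w) - a) < 2 * e"
proof -
  have hol: "f holomorphic_on disk" by (rule Hinf_holomorphic[OF f])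
  define A where "A = {z \<in> disk. cmod (f (phi z w) - a) < e}"
  have freqA: "\<exists>\<^sub>F z in disk_to m. z \<in> A"
    using frequently_eventually_frequently[OF freq eventually_disk_to[OF m]]
    by (rule frequently_elim1) (simp add: A_def)
  define \<beta> where "\<beta> = cmod a / 2"
  have \<beta>: "0 < \<beta>" using a by (simp add: \<beta>_def)
  have fA: "\<beta> \<le> cmod (f (phi z w))" if "z \<in> A" for z
    using that e norm_triangle_sub[of a "f (phi z w)"] by (simp add: A_def \<beta>_def norm_minus_commute)
  have hol_phi: "(\<lambda>\<zeta>. f (phi z \<zeta>)) holomorphic_on disk" if "z \<in> disk" for z
  proof -
    have z: "cmod z < 1" using that by simp
    have "(f \<circ> phi z) holomorphic_on disk"
      by (rule holomorphic_on_compose_gen[OF holomorphic_phi[OF z] hol]) (simp add: phi_image[OF z])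
    then show ?thesis by (simp add: o_def)
  qed
  define q where "q = 1 - (cmod w)\<^sup>2"
  have q: "0 < q" "q \<le> 1" using one_minus_square_pos[OF w] by (auto simp: q_def)
  have e1: "e \<le> 1/2" using e a by simp
  \<comment> \<open>Chosen so that 4 r1 / (q - 4 r1) = (e/4) / (1 - e/4), which is below e/2; with
    the Lipschitz constant 2 of \<open>f\<close> this makes \<open>f (phi z w)\<close> vary by less
    than \<open>e\<close> when \<open>z\<close> moves by less than \<open>r1\<close>.\<close>
  define r1 where "r1 = q * e / 16"
  have r1: "0 < r1" "r1 < 1" "4 * r1 < q"
  proof -
    show "0 < r1" using q e by (simp add: r1_def)
    have "e \<le> 1" using e1 by linarith
    then have "q * e \<le> q * 1" using q by (intro mult_left_mono) auto
    then show "r1 < 1" "4 * r1 < q" using q unfolding r1_def by linarith+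
  qed
  have close: "cmod (f (phi z w) - f (phi z0 w)) < e" if "cmod z < 1" "cmod z0 < 1" "rho z0 z < r1" for z z0
  proof -
    have s: "4 * rho z0 z < q" using that r1 by simp
    have "rho (phi z0 w) (phi z w) \<le> 4 * rho z0 z / (q - 4 * rho z0 z)"
      using rho_phi_param[OF that(2,1) w] s by (simp add: q_def)
    also have "\<dots> \<le> 4 * r1 / (q - 4 * r1)" using that r1 by (intro frac_le) auto
    also have "\<dots> = (q * (e / 4)) / (q * (1 - e / 4))"
      by (intro arg_cong2[where f = "(/)"]) (simp_all add: r1_def algebra_simps)
    also have "\<dots> = (e / 4) / (1 - e / 4)" using q by (intro mult_divide_mult_cancel_left) simp
    also have "\<dots> < e / 2" using e e1 by (simp add: field_simps)
    finally have "2 * 1 * rho (phi z0 w) (phi z w) < e" by simp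
    moreover have "cmod (f (phi z w) - f (phi z0 w)) \<le> 2 * 1 * rho (phi z0 w) (phi z w)"
      using that w by (intro Schwarz_Pick_Lipschitz[OF hol le1]) auto
    ultimately show ?thesis by simp
  qed
  \<comment> \<open>Applied to the functions \<open>f o phi z\<close> with \<open>z\<close> in
    \<open>A\<close>, which are at least \<beta> in modulus at \<open>w\<close>. Around every point
    of \<open>A\<close> it yields an annulus of one common width \<open>c\<close> on which |f| is at
    least \<open>c\<close>.\<close>
  obtain c where c: "0 < c" and annulus: "\<And>g. g holomorphic_on disk \<Longrightarrow> (\<forall>z\<in>disk. cmod (g z) \<le> 1) \<Longrightarrow> \<beta> \<le> cmod (g w) \<Longrightarrow>
    (\<exists>r. c \<le> r \<and> r + c \<le> r1 \<and> (\<forall>\<zeta>. r \<le> cmod \<zeta> \<longrightarrow> cmod \<zeta> \<le> r + c \<longrightarrow> c \<le> cmod (g \<zeta>)))"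
    using holomorphic_annulus_lower_bound[OF \<beta> w r1(1,2)] by blast
  have "\<forall>z\<in>A. \<exists>r. c \<le> r \<and> r + c \<le> r1 \<and> (\<forall>\<zeta>. r \<le> cmod \<zeta> \<longrightarrow> cmod \<zeta> \<le> r + c \<longrightarrow> c \<le> cmod (f (phi z \<zeta>)))"
  proof
    fix z assume "z \<in> A"
    then show "\<exists>r. c \<le> r \<and> r + c \<le> r1 \<and> (\<forall>\<zeta>. r \<le> cmod \<zeta> \<longrightarrow> cmod \<zeta> \<le> r + c \<longrightarrow> c \<le> cmod (f (phi z \<zeta>)))"
      using fA le1 hol_phi[of z] by (intro annulus) (auto simp: A_def)
  qed
  from bchoice[OF this] obtain r where r':
    "\<forall>z\<in>A. c \<le> r z \<and> r z + c \<le> r1 \<and> (\<forall>\<zeta>. r z \<le> cmod \<zeta> \<longrightarrow> cmod \<zeta> \<le> r z + c \<longrightarrow> c \<le> cmod (f (phi z \<zeta>)))"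
    by (rule exE)
  have r: "c \<le> r z" "r z + c \<le> r1"
    "\<And>\<zeta>. r z \<le> cmod \<zeta> \<Longrightarrow> cmod \<zeta> \<le> r z + c \<Longrightarrow> c \<le> cmod (f (phi z \<zeta>))" if "z \<in> A" for z
    using bspec[OF r' that] by blast+
  define N where "N = (\<Union>z\<in>A. {p \<in> disk. rho z p < r z})"
  have N_disk: "N \<subseteq> disk" by (auto simp: N_def)
  have N_open: "open N" unfolding N_def
  proof (intro open_UN ballI)
    fix z assume "z \<in> A"
    then have "continuous_on disk (phi z)"
      by (intro holomorphic_on_imp_continuous_on holomorphic_phi) (simp add: A_def)
    then have "continuous_on disk (rho z)" unfolding rho_def[abs_def] by (rule continuous_on_norm)
    from continuous_open_preimage[OF this open_ball open_lessThan[of "r z"]]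
    have "open (disk \<inter> rho z -` {..<r z})" .
    moreover have "disk \<inter> rho z -` {..<r z} = {p \<in> disk. rho z p < r z}" by auto
    ultimately show "open {p \<in> disk. rho z p < r z}" by simp
  qed
  \<comment> \<open>A boundary point of this possibly infinite union need not lie on the boundary of
    any single disk. But it is outside all the disks and within \<open>c\<close> of one of them,
    hence in the annulus of that disk; this is where the common width matters.\<close>
  have fr: "c \<le> cmod (f p)" if p: "p \<in> disk" "p \<in> closure N" "p \<notin> N" for p
  proof -
    have "\<forall>\<^sub>F x in nhds p. rho p x < c" using p(1) c by (intro rho_less_eventually) auto
    then obtain U where U: "open U" "p \<in> U" "\<forall>x\<in>U. rho p x < c"
      unfolding eventually_nhds by blast
    have "p \<in> U \<inter> closure N" using p(2) U(2) by simp
    then have "U \<inter> closure N \<noteq> {}" by (metis empty_iff)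
    then have "U \<inter> N \<noteq> {}" using open_Int_closure_eq_empty[OF U(1)] by simp
    then obtain x where x: "x \<in> U" "x \<in> N" by blast
    then obtain z where z: "z \<in> A" "x \<in> disk" "rho z x < r z" by (auto simp: N_def)
    have zd: "cmod z < 1" using z by (simp add: A_def)
    have "r z \<le> rho z p" using p z by (auto simp: N_def)
    moreover have "rho z p \<le> r z + c"
      using rho_triangle[of z x p] zd z p bspec[OF U(3) x(1)] by (simp add: rho_commute[of x p])
    ultimately have "c \<le> cmod (f (phi z (phi z p)))" using z(1) by (intro r(3)) (auto simp: rho_def)
    then show ?thesis using zd p by simp
  qed
  obtain z1 where z1: "z1 \<in> A" using freqA by (rule frequentlyE)
  have c1: "c \<le> 1" using r(1,2)[OF z1] r1 c by linarith
  obtain B where B: "B \<in> Hinf" "\<forall>z\<in>disk. cmod (B z) \<le> 1" "\<forall>z\<in>N. f z = 0 \<longrightarrow> B z = 0" "\<forall>z\<in>disk - N. c \<le> cmod (B z)"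
  proof -
    have "cmod (phi z1 w) < 1" using z1 w by (intro phi_in_disk) (simp_all add: A_def)
    moreover have "f (phi z1 w) \<noteq> 0" using fA[OF z1] \<beta> by auto
    ultimately have "\<exists>B\<in>Hinf. (\<forall>z\<in>disk. cmod (B z) \<le> 1) \<and> (\<forall>z\<in>N. f z = 0 \<longrightarrow> B z = 0) \<and> (\<forall>z\<in>disk - N. c \<le> cmod (B z))"
      by (intro exists_Blaschke[OF hol le1 _ _ N_open N_disk c c1 fr])
    then show ?thesis by (elim bexE conjE) (rule that)
  qed
  \<comment> \<open>Near \<open>m\<close> the value f z of \<open>f o phi z\<close> at 0 is below
    the bound \<open>c'\<close> valid on a circle of radius less than \<kappa>, so the minimum
    principle forces a zero of \<open>f\<close> within \<kappa> of \<open>z\<close>. This zero lies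
    in \<open>N\<close>, hence \<open>B\<close> vanishes there, and the Schwarz lemma bounds
    \<open>B z\<close>.\<close>
  have small: "\<forall>\<^sub>F z in disk_to m. z \<in> A \<longrightarrow> cmod (B z) < \<kappa>" if \<kappa>: "0 < \<kappa>" "\<kappa> \<le> c" for \<kappa>
  proof -
    have k1: "0 < \<kappa> / 2" "\<kappa> / 2 < 1" using \<kappa> c1 by auto
    obtain c' where c': "0 < c'" and ann': "\<And>g. g holomorphic_on disk \<Longrightarrow> (\<forall>z\<in>disk. cmod (g z) \<le> 1) \<Longrightarrow> \<beta> \<le> cmod (g w) \<Longrightarrow>
      (\<exists>r. c' \<le> r \<and> r + c' \<le> \<kappa> / 2 \<and> (\<forall>\<zeta>. r \<le> cmod \<zeta> \<longrightarrow> cmod \<zeta> \<le> r + c' \<longrightarrow> c' \<le> cmod (g \<zeta>)))"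
      using holomorphic_annulus_lower_bound[OF \<beta> w k1] by blast
    have "\<forall>\<^sub>F z in disk_to m. cmod (f z) < c'"
      using order_tendstoD(2)[OF tendsto_norm[OF f0], of c'] c' by simp
    then show ?thesis
    proof (rule eventually_mono, intro impI)
      fix z assume fz: "cmod (f z) < c'" and zA: "z \<in> A"
      have zd: "cmod z < 1" using zA by (simp add: A_def)
      define g where "g \<zeta> = f (phi z \<zeta>)" for \<zeta>
      have holg: "g holomorphic_on disk" unfolding g_def using zd by (intro hol_phi) simp
      have "\<exists>r. c' \<le> r \<and> r + c' \<le> \<kappa> / 2 \<and> (\<forall>\<zeta>. r \<le> cmod \<zeta> \<longrightarrow> cmod \<zeta> \<le> r + c' \<longrightarrow> c' \<le> cmod (g \<zeta>))"
        using fA[OF zA] le1 by (intro ann' holg) (auto simp: g_def)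
      then obtain s where s: "c' \<le> s" "s + c' \<le> \<kappa> / 2" "\<And>\<zeta>. cmod \<zeta> = s \<Longrightarrow> c' \<le> cmod (g \<zeta>)"
        using c' by (metis add_increasing2 less_eq_real_def order_refl)
      have s0: "0 < s" "s < 1" using s c' k1 by auto
      have "\<exists>\<zeta>\<in>cball 0 s. g \<zeta> = 0"
      proof (rule ccontr)
        assume "\<not> ?thesis"
        then have nz: "g \<zeta> \<noteq> 0" if "\<zeta> \<in> cball 0 s" for \<zeta> using that by blast
        have "cmod (inverse (g 0)) \<le> inverse c'"
        proof (rule maximum_modulus_frontier[of "\<lambda>\<zeta>. inverse (g \<zeta>)" "ball 0 s"])
          show "(\<lambda>\<zeta>. inverse (g \<zeta>)) holomorphic_on interior (ball 0 s)"
            using nz s0 by (intro holomorphic_intros holomorphic_on_subset[OF holg]) auto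
          show "continuous_on (closure (ball 0 s)) (\<lambda>\<zeta>. inverse (g \<zeta>))"
            using nz s0 by (intro continuous_intros continuous_on_subset[OF holomorphic_on_imp_continuous_on[OF holg]]) auto
          show "cmod (inverse (g \<zeta>)) \<le> inverse c'" if "\<zeta> \<in> frontier (ball 0 s)" for \<zeta>
            using s(3)[of \<zeta>] that s0 c' by (auto simp: norm_inverse intro!: le_imp_inverse_le)
        qed (use s0 in auto)
        moreover have "cmod (g 0) < c'" "g 0 \<noteq> 0" using fz nz[of 0] s0 by (auto simp: g_def)
        ultimately show False using c' by (simp add: norm_inverse)
      qed
      then obtain \<zeta> where z0: "cmod \<zeta> \<le> s" "g \<zeta> = 0" by auto
      define p where "p = phi z \<zeta>"
      have zt: "cmod \<zeta> < 1" using z0 s0 by simp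
      have p: "cmod p < 1" "rho z p = cmod \<zeta>" using zd zt by (auto simp: p_def rho_def)
      have "cmod \<zeta> < \<kappa>" using z0 s c' \<kappa> by linarith
      then have "p \<in> N" using p zA r(1)[OF zA] \<kappa> unfolding N_def by (intro UN_I[of z]) auto
      then have Bp: "B p = 0" using B(3) z0 by (simp add: g_def p_def)
      have "cmod (B z) \<le> rho p z"
        by (rule Schwarz_zero[OF Hinf_holomorphic[OF B(1)] _ p(1) Bp zd]) (use B(2) in simp)
      then show "cmod (B z) < \<kappa>" using p(2) \<open>cmod \<zeta> < \<kappa>\<close> by (simp add: rho_commute)
    qed
  qed
  have limB: "((\<lambda>z. cmod (B z)) \<longlongrightarrow> cmod (m B)) (disk_to m)"
    by (intro tendsto_norm tendsto_disk_to m B)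
  \<comment> \<open>\<open>A\<close> is met frequently along \<open>disk_to m\<close> and
    \<open>B\<close> is arbitrarily small on it near \<open>m\<close>, while \<open>B\<close> has a
    limit there as a member of \<open>Hinf\<close>.\<close>
  have "m B = 0"
  proof (rule ccontr)
    assume "m B \<noteq> 0"
    define \<kappa> where "\<kappa> = min c (cmod (m B) / 2)"
    have k: "0 < \<kappa>" "\<kappa> \<le> c" "\<kappa> < cmod (m B)" using c \<open>m B \<noteq> 0\<close> by (auto simp: \<kappa>_def min_def)
    have "\<forall>\<^sub>F z in disk_to m. \<kappa> < cmod (B z)" using limB k(3) by (rule order_tendstoD)
    with small[OF k(1,2)] have "\<forall>\<^sub>F z in disk_to m. z \<notin> A" by eventually_elim auto
    then show False using freqA by (simp add: frequently_def)
  qed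
  then have "\<forall>\<^sub>F z in disk_to m. cmod (B z) < c" using limB c by (intro order_tendstoD) auto
  then show ?thesis using eventually_disk_to[OF m]
  proof eventually_elim
    case (elim z)
    then have "z \<in> N" using B(4) by force
    then obtain z0 where z0: "z0 \<in> A" "rho z0 z < r z0" by (auto simp: N_def)
    have "rho z0 z < r1" using z0 r(2)[OF z0(1)] c by linarith
    then have "cmod (f (phi z w) - f (phi z0 w)) < e" using elim z0 by (intro close) (auto simp: A_def)
    moreover have "cmod (f (phi z0 w) - a) < e" using z0 by (simp add: A_def)
    ultimately show "cmod (f (phi z w) - a) < 2 * e"
      using norm_triangle_ineq[of "f (phi z w) - f (phi z0 w)" "f (phi z0 w) - a"] by simp
  qed
qed

text \<open>By compactness of the range, either the limit is 0 or there is a nonzero cluster value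
  \<open>a\<close>; in the second case \<open>hoffman_cluster_unique\<close> turns frequent
  closeness to \<open>a\<close> into eventual closeness.\<close>

lemma hoffman_limit_normalized:
  assumes m: "m \<in> maxideals" and f: "f \<in> Hinf" and le1: "\<And>z. cmod (f z) \<le> 1" and w: "cmod w < 1"
    and f0: "(f \<longlongrightarrow> 0) (disk_to m)"
  shows "\<exists>l. ((\<lambda>z. f (phi z w)) \<longlongrightarrow> l) (disk_to m)"
proof (cases "((\<lambda>z. f (phi z w)) \<longlongrightarrow> 0) (disk_to m)")
  case False
  then obtain e0 where e0: "e0 > 0" "\<not> (\<forall>\<^sub>F z in disk_to m. dist (f (phi z w)) 0 < e0)"
    unfolding tendsto_iff by blast
  define F where "F = inf (disk_to m) (principal {z. e0 \<le> cmod (f (phi z w))})"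
  have F: "F \<noteq> bot"
  proof
    assume "F = bot"
    then have "eventually (\<lambda>_. False) F" by simp
    then have "\<forall>\<^sub>F z in disk_to m. \<not> e0 \<le> cmod (f (phi z w))" unfolding F_def eventually_inf_principal by simp
    then have "\<forall>\<^sub>F z in disk_to m. dist (f (phi z w)) 0 < e0" by eventually_elim simp
    then show False using e0(2) by contradiction
  qed
  have comp: "compact (cball 0 1 \<inter> {x::complex. e0 \<le> cmod x})"
    by (intro compact_Int_closed compact_cball closed_Collect_le continuous_intros)
  have "\<forall>\<^sub>F z in F. f (phi z w) \<in> cball 0 1 \<inter> {x. e0 \<le> cmod x}"
    unfolding F_def eventually_inf_principal by (intro always_eventually allI impI) (use le1 in auto)
  then have "eventually (\<lambda>x. x \<in> cball 0 1 \<inter> {x. e0 \<le> cmod x}) (filtermap (\<lambda>z. f (phi z w)) F)"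
    unfolding eventually_filtermap .
  moreover have "filtermap (\<lambda>z. f (phi z w)) F \<noteq> bot" using F by (simp add: filtermap_bot_iff)
  ultimately obtain a where a: "a \<in> cball 0 1 \<inter> {x. e0 \<le> cmod x}" "inf (nhds a) (filtermap (\<lambda>z. f (phi z w)) F) \<noteq> bot"
    using comp unfolding compact_filter by blast
  have freq: "\<exists>\<^sub>F z in disk_to m. cmod (f (phi z w) - a) < e" if e: "e > 0" for e
  proof (rule ccontr)
    assume "\<not> ?thesis"
    then have "\<forall>\<^sub>F z in disk_to m. \<not> cmod (f (phi z w) - a) < e" by (simp add: frequently_def)
    then have "\<forall>\<^sub>F z in F. \<not> cmod (f (phi z w) - a) < e" unfolding F_def by (rule filter_leD[OF inf_le1])
    then have "eventually (\<lambda>x. \<not> cmod (x - a) < e) (filtermap (\<lambda>z. f (phi z w)) F)" by (simp add: eventually_filtermap)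
    moreover have "eventually (\<lambda>x. cmod (x - a) < e) (nhds a)"
      using eventually_nhds_metric[of "\<lambda>x. cmod (x - a) < e" a] e by (auto simp: dist_norm)
    ultimately have "eventually (\<lambda>_. False) (inf (nhds a) (filtermap (\<lambda>z. f (phi z w)) F))"
      unfolding eventually_inf by blast
    then show False using a(2) by (simp add: eventually_False)
  qed
  have a1: "0 < cmod a" "cmod a \<le> 1" using a(1) e0(1) by auto
  have "((\<lambda>z. f (phi z w)) \<longlongrightarrow> a) (disk_to m)"
  proof (rule tendstoI)
    fix e :: real assume e: "e > 0"
    define d where "d = min (e / 2) (cmod a / 2)"
    have d: "0 < d" "d \<le> cmod a / 2" "2 * d \<le> e" using e a1 by (auto simp: d_def)
    have "\<forall>\<^sub>F z in disk_to m. cmod (f (phi z w) - a) < 2 * d"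
      by (rule hoffman_cluster_unique[OF m f le1 w f0 a1 d(1,2) freq[OF d(1)]])
    then show "\<forall>\<^sub>F z in disk_to m. dist (f (phi z w)) a < e"
      by eventually_elim (use d in \<open>simp add: dist_norm\<close>)
  qed
  then show ?thesis by blast
qed blast

text \<open>Reduction to the normalized case: \<open>f\<close> minus its value at \<open>m\<close>
  tends to 0 along \<open>disk_to m\<close>, and division by a bound makes it at most 1.\<close>

theorem hoffman_limit:
  assumes m: "m \<in> maxideals" and f: "f \<in> Hinf" and w: "cmod w < 1"
  shows "\<exists>l. ((\<lambda>z. f (phi z w)) \<longlongrightarrow> l) (disk_to m)"
proof -
  obtain C where C: "0 < C" "\<And>z. cmod (f z) \<le> C" using Hinf_bound[OF f] by metis
  define D where "D = C + cmod (m f)"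
  have D: "D > 0" using C(1) by (simp add: D_def add_pos_nonneg)
  define g where "g z = inverse (of_real D) * (f z + disk_indicator (- m f) z)" for z
  have g: "g \<in> Hinf" unfolding g_def by (intro Hinf_cmult Hinf_add f disk_indicator_Hinf)
  have gle: "cmod (g z) \<le> 1" for z
  proof -
    have le: "cmod (f z + disk_indicator (- m f) z) \<le> D" unfolding D_def
      by (rule order_trans[OF norm_triangle_ineq add_mono[OF C(2)]]) (simp add: disk_indicator_def)
    have "cmod (g z) = inverse D * cmod (f z + disk_indicator (- m f) z)"
      unfolding g_def norm_mult norm_inverse using D by simp
    also have "\<dots> \<le> inverse D * D" using D by (intro mult_left_mono le) simp
    finally have "cmod (g z) \<le> inverse D * D" .
    then show ?thesis using D by simp
  qed
  have "((\<lambda>z. inverse (of_real D) * (f z + disk_indicator (- m f) z)) \<longlongrightarrow> inverse (of_real D) * (m f + (- m f))) (disk_to m)"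
  proof (intro tendsto_intros tendsto_disk_to m f)
    show "(disk_indicator (- m f) \<longlongrightarrow> - m f) (disk_to m)"
      by (rule tendsto_eventually, rule eventually_mono[OF eventually_disk_to[OF m]]) (simp add: disk_indicator_def)
  qed
  then have "(g \<longlongrightarrow> 0) (disk_to m)" by (simp add: g_def[abs_def])
  from hoffman_limit_normalized[OF m g gle w this]
  obtain l where l: "((\<lambda>z. g (phi z w)) \<longlongrightarrow> l) (disk_to m)" by blast
  have "((\<lambda>z. of_real D * g (phi z w) + m f) \<longlongrightarrow> of_real D * l + m f) (disk_to m)"
    by (intro tendsto_intros l)
  moreover have "\<forall>\<^sub>F z in disk_to m. of_real D * g (phi z w) + m f = f (phi z w)"
    using eventually_disk_to[OF m]
  proof eventually_elim
    case (elim z)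
    then have "phi z w \<in> disk" using w by simp
    then have "g (phi z w) = (f (phi z w) - m f) / of_real D"
      unfolding g_def disk_indicator_def by (simp add: divide_inverse_commute)
    then show ?case using D by simp
  qed
  ultimately have "((\<lambda>z. f (phi z w)) \<longlongrightarrow> of_real D * l + m f) (disk_to m)"
    by (rule Lim_transform_eventually)
  then show ?thesis by blast
qed

text \<open>The limits of \<open>f (phi z w)\<close> form a character by
  \<open>character_limit\<close>. As the filter is proper it is the only limit, so the definite
  description in \<open>hoffman\<close> denotes it.\<close>

lemma hoffman_in_maxideals:
  assumes m: "m \<in> maxideals" and nb: "disk_to m \<noteq> bot" and w: "cmod w < 1"
  shows "hoffman m w \<in> maxideals" "filterlim (\<lambda>z. phi z w) (disk_to (hoffman m w)) (disk_to m)"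
    "disk_to (hoffman m w) \<noteq> bot"
proof -
  define k where "k = (\<lambda>f\<in>Hinf. Lim (disk_to m) (\<lambda>z. f (phi z w)))"
  have lim: "((\<lambda>z. f (phi z w)) \<longlongrightarrow> k f) (disk_to m)" if f: "f \<in> Hinf" for f
  proof -
    obtain l where l: "((\<lambda>z. f (phi z w)) \<longlongrightarrow> l) (disk_to m)" using hoffman_limit[OF m f w] by (rule exE)
    have "k f = l" using tendsto_Lim[OF nb l] f by (simp add: k_def)
    then show ?thesis using l by simp
  qed
  have ev: "\<forall>\<^sub>F z in disk_to m. phi z w \<in> disk"
    using eventually_disk_to[OF m] by eventually_elim (use w in simp)
  have k: "k \<in> maxideals"
  proof (rule character_limit[of "filtermap (\<lambda>z. phi z w) (disk_to m)"])
    show "filtermap (\<lambda>z. phi z w) (disk_to m) \<noteq> bot" using nb by (simp add: filtermap_bot_iff)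
    show "eventually (\<lambda>z. z \<in> disk) (filtermap (\<lambda>z. phi z w) (disk_to m))" using ev by (simp add: eventually_filtermap)
    show "(f \<longlongrightarrow> k f) (filtermap (\<lambda>z. phi z w) (disk_to m))" if "f \<in> Hinf" for f
      using lim[OF that] unfolding filterlim_def filtermap_filtermap .
  qed (simp add: k_def)
  have ev2: "\<forall>\<^sub>F z in disk_to m. point_eval (phi z w) \<in> maxideals"
    using ev by eventually_elim (rule point_eval_maxideals)
  have iff: "limitin weak_star (\<lambda>z. point_eval (phi z w)) p (disk_to m) \<longleftrightarrow> p = k" for p
  proof
    assume L: "limitin weak_star (\<lambda>z. point_eval (phi z w)) p (disk_to m)"
    then have p: "p \<in> maxideals" unfolding topspace_weak_star[symmetric] by (rule limitin_topspace)
    show "p = k"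
    proof (rule maxideals_ext[OF p k])
      fix f assume f: "f \<in> Hinf"
      then have "((\<lambda>z. f (phi z w)) \<longlongrightarrow> p f) (disk_to m)"
        using bspec[OF L[unfolded limitin_weak_star[OF p ev2]], of f] f by simp
      then show "p f = k f" using lim[OF f] by (rule tendsto_unique[OF nb])
    qed
  next
    assume "p = k"
    then show "limitin weak_star (\<lambda>z. point_eval (phi z w)) p (disk_to m)"
      unfolding \<open>p = k\<close> limitin_weak_star[OF k ev2]
    proof (intro ballI)
      fix f assume f: "f \<in> Hinf"
      then show "((\<lambda>z. point_eval (phi z w) f) \<longlongrightarrow> k f) (disk_to m)" using lim[OF f] by simp
    qed
  qed
  have h: "hoffman m w = k" unfolding hoffman_def iff by simp
  then show "hoffman m w \<in> maxideals" using k by simp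
  show fl: "filterlim (\<lambda>z. phi z w) (disk_to (hoffman m w)) (disk_to m)"
    unfolding h filterlim_disk_to[OF k] by (intro conjI ballI ev lim)
  show "disk_to (hoffman m w) \<noteq> bot"
  proof
    assume "disk_to (hoffman m w) = bot"
    then have "filtermap (\<lambda>z. phi z w) (disk_to m) = bot" using fl unfolding filterlim_def by (simp add: bot_unique)
    then show False using nb by (simp add: filtermap_bot_iff)
  qed
qed

section \<open>Identification of \<open>algU\<close> with the uniformly approximable
  functions\<close>

lemma Linf_iff: "u \<in> Linf \<longleftrightarrow> u \<in> borel_measurable dA \<and> (\<exists>C. AE z in dA. cmod (u z) \<le> C)"
proof
  assume u: "u \<in> Linf"
  then have m: "u \<in> borel_measurable dA" and f: "esssup dA (\<lambda>z. ereal (cmod (u z))) < \<infinity>" by (auto simp: Linf_def)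
  have ae: "AE z in dA. ereal (cmod (u z)) \<le> esssup dA (\<lambda>z. ereal (cmod (u z)))" by (rule esssup_AE)
  show "u \<in> borel_measurable dA \<and> (\<exists>C. AE z in dA. cmod (u z) \<le> C)"
  proof (intro conjI m)
    show "\<exists>C. AE z in dA. cmod (u z) \<le> C"
    proof (cases "esssup dA (\<lambda>z. ereal (cmod (u z)))")
      case (real r)
      then show ?thesis using ae by auto
    next
      case MInf
      then have "AE z in dA. cmod (u z) \<le> 0" using ae by auto
      then show ?thesis by blast
    qed (use f in auto)
  qed
next
  assume u: "u \<in> borel_measurable dA \<and> (\<exists>C. AE z in dA. cmod (u z) \<le> C)"
  then obtain C where C: "AE z in dA. cmod (u z) \<le> C" by blast
  have [measurable]: "u \<in> borel_measurable dA" using u by simp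
  have "esssup dA (\<lambda>z. ereal (cmod (u z))) \<le> ereal C"
    by (rule esssup_I) (use C in auto)
  then show "u \<in> Linf" using u by (auto simp: Linf_def less_top[symmetric])
qed

lemma star_polynomial_measurable: "star_polynomial p \<Longrightarrow> p \<in> borel_measurable dA"
  by (intro borel_measurable_dA_continuous star_polynomial_continuous)

text \<open>Provides an upper bound for \<open>cstar_generated Hinf\<close>, which lies in every
  such subalgebra containing \<open>Hinf\<close>.\<close>

lemma cstar_subalgebra_approximable:
  "cstar_subalgebra {u \<in> Linf. \<forall>e>0. \<exists>p. star_polynomial p \<and> (AE z in dA. cmod (u z - p z) \<le> e)}"
    (is "cstar_subalgebra ?A")
  unfolding cstar_subalgebra_def
proof (intro conjI ballI allI impI)
  show "?A \<subseteq> Linf" by blast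
next
  fix f g assume fg: "f \<in> ?A" "g \<in> ?A"
  then obtain C D where CD: "AE z in dA. cmod (f z) \<le> C" "AE z in dA. cmod (g z) \<le> D"
    and [measurable]: "f \<in> borel_measurable dA" "g \<in> borel_measurable dA" by (auto simp: Linf_iff)
  have "AE z in dA. cmod (f z + g z) \<le> C + D"
    using CD by eventually_elim (rule norm_triangle_mono)
  moreover have "\<exists>p. star_polynomial p \<and> (AE z in dA. cmod (f z + g z - p z) \<le> e)" if "e > 0" for e
  proof -
    obtain p q where pq: "star_polynomial p" "AE z in dA. cmod (f z - p z) \<le> e / 2" "star_polynomial q" "AE z in dA. cmod (g z - q z) \<le> e / 2"
      using fg \<open>e > 0\<close> by (auto dest!: spec[of _ "e / 2"])
    have "AE z in dA. cmod (f z + g z - (p z + q z)) \<le> e"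
      using pq(2,4)
    proof eventually_elim
      case (elim z)
      then show ?case using norm_triangle_ineq[of "f z - p z" "g z - q z"] by (simp add: algebra_simps)
    qed
    then show ?thesis using star_polynomial.add[OF pq(1,3)] by blast
  qed
  ultimately show "(\<lambda>z. f z + g z) \<in> ?A" by (auto simp: Linf_iff)
  have "AE z in dA. cmod (f z * g z) \<le> \<bar>C\<bar> * \<bar>D\<bar>"
    using CD
  proof eventually_elim
    case (elim z)
    then show ?case unfolding norm_mult by (intro mult_mono) auto
  qed
  moreover have "\<exists>p. star_polynomial p \<and> (AE z in dA. cmod (f z * g z - p z) \<le> e)" if e: "e > 0" for e
  proof -
    \<comment> \<open>From f g - p q = (f - p) g + p (g - q), where d <= 1 gives |p| <= |C| + 1; the
      error is at most d (|C| + |D| + 1).\<close>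
    define d where "d = min 1 (e / (\<bar>C\<bar> + \<bar>D\<bar> + 2))"
    have d: "0 < d" "d \<le> 1" "d * (\<bar>C\<bar> + \<bar>D\<bar> + 2) \<le> e"
    proof -
      have pos: "0 < \<bar>C\<bar> + \<bar>D\<bar> + 2" by simp
      show "0 < d" "d \<le> 1" using e pos by (auto simp: d_def)
      have "d * (\<bar>C\<bar> + \<bar>D\<bar> + 2) \<le> e / (\<bar>C\<bar> + \<bar>D\<bar> + 2) * (\<bar>C\<bar> + \<bar>D\<bar> + 2)"
        unfolding d_def using pos by (intro mult_right_mono) auto
      then show "d * (\<bar>C\<bar> + \<bar>D\<bar> + 2) \<le> e" using pos by simp
    qed
    obtain p q where pq: "star_polynomial p" "AE z in dA. cmod (f z - p z) \<le> d" "star_polynomial q" "AE z in dA. cmod (g z - q z) \<le> d"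
      using fg d(1) by blast
    have "AE z in dA. cmod (f z * g z - p z * q z) \<le> e"
      using pq(2,4) CD
    proof eventually_elim
      case (elim z)
      have "cmod (p z) \<le> \<bar>C\<bar> + 1" using elim(1,3) d(2) norm_triangle_sub[of "p z" "f z"] by (simp add: norm_minus_commute)
      then have "cmod ((f z - p z) * g z + p z * (g z - q z)) \<le> d * \<bar>D\<bar> + (\<bar>C\<bar> + 1) * d"
        using elim d by (intro norm_triangle_mono) (auto simp: norm_mult intro!: mult_mono)
      then show ?case using d by (simp add: algebra_simps)
    qed
    then show ?thesis using star_polynomial.mult[OF pq(1,3)] by blast
  qed
  ultimately show "(\<lambda>z. f z * g z) \<in> ?A" by (auto simp: Linf_iff)
next
  fix c f assume f: "f \<in> ?A"
  then obtain C where C: "AE z in dA. cmod (f z) \<le> C" and [measurable]: "f \<in> borel_measurable dA" by (auto simp: Linf_iff)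
  have "AE z in dA. cmod (c * f z) \<le> cmod c * C"
    using C by eventually_elim (simp add: norm_mult mult_left_mono)
  moreover have "\<exists>p. star_polynomial p \<and> (AE z in dA. cmod (c * f z - p z) \<le> e)" if e: "e > 0" for e
  proof -
    have "e / (cmod c + 1) > 0" using e by (simp add: add_nonneg_pos)
    then obtain p where p: "star_polynomial p" "AE z in dA. cmod (f z - p z) \<le> e / (cmod c + 1)"
      using f by blast
    have "AE z in dA. cmod (c * f z - c * p z) \<le> e"
      using p(2)
    proof eventually_elim
      case (elim z)
      have "cmod (c * f z - c * p z) = cmod c * cmod (f z - p z)" by (simp add: norm_mult flip: right_diff_distrib)
      also have "\<dots> \<le> (cmod c + 1) * (e / (cmod c + 1))" using elim by (intro mult_mono) auto
      also have "\<dots> = e" using norm_ge_zero[of c] by (simp add: add_nonneg_eq_0_iff del: norm_ge_zero)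
      finally show ?case .
    qed
    then show ?thesis using star_polynomial_cmult[OF p(1)] by blast
  qed
  ultimately show "(\<lambda>z. c * f z) \<in> ?A" by (auto simp: Linf_iff)
next
  fix f assume f: "f \<in> ?A"
  then have [measurable]: "f \<in> borel_measurable dA" by (auto simp: Linf_iff)
  have "\<exists>p. star_polynomial p \<and> (AE z in dA. cmod (cnj (f z) - p z) \<le> e)" if e: "e > 0" for e
  proof -
    obtain p where p: "star_polynomial p" "AE z in dA. cmod (f z - p z) \<le> e" using f e by blast
    have "AE z in dA. cmod (cnj (f z) - cnj (p z)) \<le> e"
      using p(2) by eventually_elim (metis complex_cnj_diff complex_mod_cnj)
    then show ?thesis using star_polynomial.cnj[OF p(1)] by blast
  qed
  then show "(\<lambda>z. cnj (f z)) \<in> ?A" using f by (auto simp: Linf_iff)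
next
  fix f :: "nat \<Rightarrow> complex \<Rightarrow> complex" and u
  assume *: "(\<forall>n. f n \<in> ?A) \<and> u \<in> Linf \<and> (\<lambda>n. esssup dA (\<lambda>z. ereal (cmod (f n z - u z)))) \<longlonglongrightarrow> 0"
  have "\<exists>p. star_polynomial p \<and> (AE z in dA. cmod (u z - p z) \<le> e)" if e: "e > 0" for e
  proof -
    have "\<forall>\<^sub>F n in sequentially. esssup dA (\<lambda>z. ereal (cmod (f n z - u z))) < ereal (e / 2)"
      using * e by (intro order_tendstoD(2)[of _ 0]) auto
    then obtain n where n: "esssup dA (\<lambda>z. ereal (cmod (f n z - u z))) < ereal (e / 2)"
      by (auto simp: eventually_sequentially)
    have 1: "AE z in dA. cmod (f n z - u z) \<le> e / 2"
      using esssup_AE[of "\<lambda>z. ereal (cmod (f n z - u z))" dA]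
      by eventually_elim (use n in \<open>metis ereal_less_eq(3) less_imp_le order_trans\<close>)
    obtain p where p: "star_polynomial p" "AE z in dA. cmod (f n z - p z) \<le> e / 2" using * e by (auto dest!: spec[of _ "e/2"] spec[of _ n])
    have "AE z in dA. cmod (u z - p z) \<le> e"
      using 1 p(2)
    proof eventually_elim
      case (elim z)
      then show ?case using norm_triangle_ineq4[of "f n z - p z" "f n z - u z"] by simp
    qed
    then show ?thesis using p(1) by blast
  qed
  then show "u \<in> ?A" using * by blast
qed

text \<open>Continuity of the chosen representative upgrades approximation almost everywhere to
  approximation at every point.\<close>

lemma algU_imp_star_approximable:
  assumes u: "u \<in> algU"
  shows "star_approximable u"
  unfolding star_approximable_def
proof (intro allI impI)
  fix e :: real assume e: "e > 0"
  let ?A = "{u \<in> Linf. \<forall>e>0. \<exists>p. star_polynomial p \<and> (AE z in dA. cmod (u z - p z) \<le> e)}"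
  have "Hinf \<subseteq> ?A"
  proof
    fix f assume f: "f \<in> Hinf"
    obtain C where "\<And>z. cmod (f z) \<le> C" using Hinf_bound[OF f] by metis
    then show "f \<in> ?A" using star_polynomial.Hinf[OF f] star_polynomial_measurable[OF star_polynomial.Hinf[OF f]]
      by (auto simp: Linf_iff intro!: exI[of _ C] exI[of _ f])
  qed
  then have "u \<in> ?A" using u cstar_subalgebra_approximable unfolding algU_def cstar_generated_def by blast
  then obtain p where p: "star_polynomial p" "AE z in dA. cmod (u z - p z) \<le> e" using e by blast
  have "u z - p z \<in> cball 0 e" if "z \<in> disk" for z
  proof (rule AE_dA_continuous[of "\<lambda>z. u z - p z"])
    show "continuous_on disk (\<lambda>z. u z - p z)"
      using u star_polynomial_continuous[OF p(1)] by (intro continuous_intros) (auto simp: algU_def)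
    show "AE z in dA. u z - p z \<in> cball 0 e" using p(2) by eventually_elim simp
  qed (use that in auto)
  then show "\<exists>p. star_polynomial p \<and> (\<forall>z\<in>disk. cmod (u z - p z) \<le> e)" using p(1) by (intro exI[of _ p]) auto
qed

text \<open>Star-polynomials lie in every admissible subalgebra, and approximation with error
  1/(n+1) is convergence in the essential supremum norm.\<close>

lemma star_approximable_imp_algU:
  assumes u: "star_approximable u"
  shows "u \<in> algU"
proof -
  have bm: "bounded_measurable u" by (rule star_approximable_measurable[OF u])
  then have [measurable]: "u \<in> borel_measurable dA" by measurable
  obtain C where "\<And>z. cmod z < 1 \<Longrightarrow> cmod (u z) \<le> C" using bounded_measurableE[OF bm] by metis
  then have Linf: "u \<in> Linf" unfolding Linf_iff by (auto intro!: exI[of _ C])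
  have "u \<in> A" if A: "cstar_subalgebra A" "Hinf \<subseteq> A" for A
  proof -
    have sp: "p \<in> A" if "star_polynomial p" for p
      using that
    proof induction
      case (Hinf f) then show ?case using A by blast
    next
      case (cnj f) then show ?case using A unfolding cstar_subalgebra_def by blast
    next
      case (add f g) then show ?case using A unfolding cstar_subalgebra_def by blast
    next
      case (mult f g) then show ?case using A unfolding cstar_subalgebra_def by blast
    qed
    have "\<exists>p. star_polynomial p \<and> (\<forall>z\<in>disk. cmod (u z - p z) \<le> inverse (real (Suc n)))" for n
      using u unfolding star_approximable_def by simp
    then obtain p where p: "\<And>n. star_polynomial (p n)" "\<And>n z. z \<in> disk \<Longrightarrow> cmod (u z - p n z) \<le> inverse (real (Suc n))"
      by metis
    have [measurable]: "p n \<in> borel_measurable dA" for n by (rule star_polynomial_measurable[OF p(1)])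
    have "(\<lambda>n. esssup dA (\<lambda>z. ereal (cmod (p n z - u z)))) \<longlonglongrightarrow> 0"
    proof (rule tendsto_sandwich)
      show "\<forall>\<^sub>F n in sequentially. 0 \<le> esssup dA (\<lambda>z. ereal (cmod (p n z - u z)))"
      proof (intro always_eventually allI)
        fix n
        have "AE z in dA. 0 \<le> esssup dA (\<lambda>z. ereal (cmod (p n z - u z)))"
          using esssup_AE[of "\<lambda>z. ereal (cmod (p n z - u z))" dA]
        proof eventually_elim
          case (elim z)
          have "0 \<le> ereal (cmod (p n z - u z))" by simp
          then show ?case using elim by (rule order_trans)
        qed
        then show "0 \<le> esssup dA (\<lambda>z. ereal (cmod (p n z - u z)))" by simp
      qed
      show "\<forall>\<^sub>F n in sequentially. esssup dA (\<lambda>z. ereal (cmod (p n z - u z))) \<le> ereal (inverse (real (Suc n)))"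
      proof (intro always_eventually allI)
        fix n
        have "AE z in dA. ereal (cmod (p n z - u z)) \<le> ereal (inverse (real (Suc n)))"
          using p(2)[of _ n] by (intro AE_I2) (simp add: norm_minus_commute)
        then show "esssup dA (\<lambda>z. ereal (cmod (p n z - u z))) \<le> ereal (inverse (real (Suc n)))"
          by (intro esssup_I) measurable
      qed
      show "(\<lambda>n. ereal (inverse (real (Suc n)))) \<longlonglongrightarrow> 0"
        using LIMSEQ_inverse_real_of_nat by (simp add: zero_ereal_def)
    qed simp
    then show ?thesis using A(1) sp[OF p(1)] Linf unfolding cstar_subalgebra_def by blast
  qed
  then show ?thesis using star_approximable_continuous[OF u] by (auto simp: algU_def cstar_generated_def)
qed

section \<open>Restriction to analytic parts\<close>


text \<open>Defined by limits of \<open>u o phi z\<close>, the form in which integrals pass to the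
  limit; \<open>on_part_tendsto\<close> identifies it with \<open>u\<close> composed with the
  Hoffman map.\<close>

definition on_part :: "(complex \<Rightarrow> complex) \<Rightarrow> ((complex \<Rightarrow> complex) \<Rightarrow> complex) \<Rightarrow> complex \<Rightarrow> complex" where
  "on_part u m w = Lim (disk_to m) (\<lambda>z. u (phi z w))"

context
  fixes m :: "(complex \<Rightarrow> complex) \<Rightarrow> complex"
  assumes m: "m \<in> maxideals" and nb: "disk_to m \<noteq> bot"
begin

lemma on_part_tendsto:
  assumes u: "star_approximable u" and w: "cmod w < 1"
  shows "((\<lambda>z. u (phi z w)) \<longlongrightarrow> on_part u m w) (disk_to m)"
    and "extend u (hoffman m w) = on_part u m w"
proof -
  note h = hoffman_in_maxideals[OF m nb w]
  obtain l where l: "(u \<longlongrightarrow> l) (disk_to (hoffman m w))" using star_approximable_tendsto[OF u h(1)] by (rule exE)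
  have lim: "((\<lambda>z. u (phi z w)) \<longlongrightarrow> l) (disk_to m)" by (rule filterlim_compose[OF l h(2)])
  have eq: "on_part u m w = l" unfolding on_part_def by (rule tendsto_Lim[OF nb lim])
  show "((\<lambda>z. u (phi z w)) \<longlongrightarrow> on_part u m w) (disk_to m)" using lim unfolding eq .
  show "extend u (hoffman m w) = on_part u m w" unfolding extend_def eq by (rule tendsto_Lim[OF h(3) l])
qed

lemma on_part_eqI:
  "((\<lambda>z. u (phi z w)) \<longlongrightarrow> l) (disk_to m) \<Longrightarrow> on_part u m w = l"
  unfolding on_part_def by (rule tendsto_Lim[OF nb])

lemma on_part_bound:
  assumes u: "star_approximable u" and w: "cmod w < 1" and C: "\<And>z. cmod z < 1 \<Longrightarrow> cmod (u z) \<le> C"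
  shows "cmod (on_part u m w) \<le> C"
proof (rule tendsto_upperbound[OF tendsto_norm[OF on_part_tendsto(1)[OF u w]] _ nb])
  show "\<forall>\<^sub>F z in disk_to m. cmod (u (phi z w)) \<le> C"
    using eventually_disk_to[OF m] by eventually_elim (use C w in simp)
qed

text \<open>The functions \<open>u o phi z\<close> are equicontinuous because \<open>phi z\<close>
  preserves \<open>rho\<close>, and a bound on differences survives the limit.\<close>

lemma on_part_continuous:
  assumes u: "star_approximable u"
  shows "continuous_on disk (on_part u m)"
  unfolding continuous_on_def
proof (intro ballI tendstoI)
  fix w :: complex and e :: real assume w: "w \<in> disk" and e: "0 < e"
  obtain d where d: "d > 0" "\<forall>z w. cmod z < 1 \<longrightarrow> cmod w < 1 \<longrightarrow> rho z w < d \<longrightarrow> cmod (u z - u w) < e / 2"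
    using star_approximable_uniformly_continuous[OF u, of "e / 2"] e by auto
  have "\<forall>\<^sub>F w' in at w within disk. rho w w' < d"
    using rho_less_eventually[of w d] w d(1) by (simp add: eventually_at_filter eventually_mono)
  moreover have "\<forall>\<^sub>F w' in at w within disk. w' \<in> disk" by (simp add: eventually_at_filter)
  ultimately show "\<forall>\<^sub>F w' in at w within disk. dist (on_part u m w') (on_part u m w) < e"
  proof eventually_elim
    case (elim w')
    have lim: "((\<lambda>z. cmod (u (phi z w) - u (phi z w'))) \<longlongrightarrow> cmod (on_part u m w - on_part u m w')) (disk_to m)"
      using w elim by (intro tendsto_norm tendsto_diff on_part_tendsto u) auto
    have "cmod (on_part u m w - on_part u m w') \<le> e / 2"
    proof (rule tendsto_upperbound[OF lim _ nb])
      show "\<forall>\<^sub>F z in disk_to m. cmod (u (phi z w) - u (phi z w')) \<le> e / 2"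
        using eventually_disk_to[OF m]
      proof eventually_elim
        case (elim z)
        have "rho (phi z w) (phi z w') < d" using elim w \<open>rho w w' < d\<close> \<open>w' \<in> disk\<close> by (simp add: rho_invariant)
        then show ?case using d(2) elim w \<open>w' \<in> disk\<close> by (intro less_imp_le) auto
      qed
    qed
    then show ?case using e by (simp add: dist_norm norm_minus_commute)
  qed
qed

lemma on_part_bounded_measurable:
  assumes u: "star_approximable u"
  shows "bounded_measurable (on_part u m)"
proof (rule bounded_measurable_continuous[OF on_part_continuous[OF u]])
  obtain C where C: "\<And>z. cmod z < 1 \<Longrightarrow> cmod (u z) \<le> C"
    using bounded_measurableE[OF star_approximable_measurable[OF u]] by metis
  have "cmod (on_part u m w) \<le> C" if "w \<in> disk" for w
    using that by (intro on_part_bound[OF u _ C]) auto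
  then show "bounded (on_part u m ` disk)" unfolding bounded_iff by blast
qed

text \<open>Dominated convergence fails for filters without a countable base. Equicontinuity allows to
  pass to a sequence: convergence on a countable dense set is enough.\<close>

lemma on_part_integral_tendsto:
  assumes u: "star_approximable u" and k: "integrable dA k"
  shows "((\<lambda>z. LINT w|dA. u (phi z w) * k w) \<longlongrightarrow> (LINT w|dA. on_part u m w * k w)) (disk_to m)"
proof (rule tendstoI)
  fix e :: real assume e: "0 < e"
  let ?I = "\<lambda>z. LINT w|dA. u (phi z w) * k w"
  let ?J = "LINT w|dA. on_part u m w * k w"
  show "\<forall>\<^sub>F z in disk_to m. dist (?I z) ?J < e"
  proof (rule ccontr)
    assume "\<not> ?thesis"
    then have freq: "\<exists>\<^sub>F z in disk_to m. \<not> dist (?I z) ?J < e" by (simp add: frequently_def)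
    obtain Q :: "complex set" where Q: "countable Q" "\<And>X. open X \<Longrightarrow> X \<noteq> {} \<Longrightarrow> \<exists>d\<in>Q. d \<in> X"
      using countable_dense_setE by blast
    have "Q \<noteq> {}" using Q(2)[of UNIV] by auto
    define q where "q = from_nat_into Q"
    have q: "range q = Q" unfolding q_def by (rule range_from_nat_into[OF \<open>Q \<noteq> {}\<close> Q(1)])
    \<comment> \<open>Bad points \<open>z\<close> occur frequently, so one of them is also accurate
      to 1/(n+1) at those of the first \<open>n\<close> points of the dense set that lie in the
      disk.\<close>
    have "\<exists>z. \<not> dist (?I z) ?J < e \<and> z \<in> disk \<and>
      (\<forall>i<n. q i \<in> disk \<longrightarrow> dist (u (phi z (q i))) (on_part u m (q i)) < inverse (real (Suc n)))" for n
    proof -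
      have "\<forall>\<^sub>F z in disk_to m. \<forall>i\<in>{..<n}. q i \<in> disk \<longrightarrow> dist (u (phi z (q i))) (on_part u m (q i)) < inverse (real (Suc n))"
      proof (intro eventually_ball_finite ballI)
        fix i
        show "\<forall>\<^sub>F z in disk_to m. q i \<in> disk \<longrightarrow> dist (u (phi z (q i))) (on_part u m (q i)) < inverse (real (Suc n))"
        proof (cases "q i \<in> disk")
          case True
          then have "((\<lambda>z. u (phi z (q i))) \<longlongrightarrow> on_part u m (q i)) (disk_to m)" by (intro on_part_tendsto u) simp
          from tendstoD[OF this, of "inverse (real (Suc n))"]
          have "\<forall>\<^sub>F z in disk_to m. dist (u (phi z (q i))) (on_part u m (q i)) < inverse (real (Suc n))"
            by (simp del: of_nat_Suc)
          then show ?thesis by (rule eventually_mono) (rule impI)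
        qed simp
      qed simp
      then have "\<forall>\<^sub>F z in disk_to m. z \<in> disk \<and>
          (\<forall>i<n. q i \<in> disk \<longrightarrow> dist (u (phi z (q i))) (on_part u m (q i)) < inverse (real (Suc n)))"
        using eventually_disk_to[OF m] by eventually_elim auto
      from frequently_eventually_frequently[OF freq this] show ?thesis by (rule frequentlyE) blast
    qed
    from choice[OF allI[OF this]] obtain Z where Z': "\<forall>n. \<not> dist (?I (Z n)) ?J < e \<and> Z n \<in> disk \<and>
      (\<forall>i<n. q i \<in> disk \<longrightarrow> dist (u (phi (Z n) (q i))) (on_part u m (q i)) < inverse (real (Suc n)))"
      by (rule exE)
    have Z: "\<And>n. \<not> dist (?I (Z n)) ?J < e" "\<And>n. Z n \<in> disk"
      "\<And>n i. i < n \<Longrightarrow> q i \<in> disk \<Longrightarrow> dist (u (phi (Z n) (q i))) (on_part u m (q i)) < inverse (real (Suc n))"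
      using spec[OF Z'] by (simp_all del: of_nat_Suc)
    have Zd: "cmod (Z n) < 1" for n using Z(2)[of n] by simp
    \<comment> \<open>Three-epsilon argument: \<open>w\<close> is \<open>rho\<close>-close to a
      dense point \<open>q i\<close>, which controls all \<open>u o phi (Z n)\<close> at once, and
      at \<open>q i\<close> the sequence converges by construction.\<close>
    have conv: "(\<lambda>n. u (phi (Z n) w)) \<longlonglongrightarrow> on_part u m w" if w: "w \<in> disk" for w
    proof (rule tendstoI)
      fix r :: real assume r: "0 < r"
      obtain d where d: "d > 0" "\<forall>z w. cmod z < 1 \<longrightarrow> cmod w < 1 \<longrightarrow> rho z w < d \<longrightarrow> cmod (u z - u w) < r / 3"
        using star_approximable_uniformly_continuous[OF u, of "r / 3"] r by auto
      have "\<forall>\<^sub>F w' in nhds w. rho w w' < d" using w d(1) by (intro rho_less_eventually) auto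
      moreover have "\<forall>\<^sub>F w' in nhds w. dist (on_part u m w') (on_part u m w) < r / 3"
      proof -
        have "isCont (on_part u m) w"
          using on_part_continuous[OF u] w continuous_on_eq_continuous_at[OF open_ball] by blast
        then have "(on_part u m \<longlongrightarrow> on_part u m w) (nhds w)" by (simp only: isCont_def tendsto_at_iff_tendsto_nhds)
        from tendstoD[OF this, of "r / 3"] r show ?thesis by simp
      qed
      moreover have "\<forall>\<^sub>F w' in nhds w. w' \<in> disk" using w by (intro eventually_nhds_in_open) auto
      ultimately have "\<forall>\<^sub>F w' in nhds w. rho w w' < d \<and> dist (on_part u m w') (on_part u m w) < r / 3 \<and> w' \<in> disk"
        by eventually_elim simp
      then obtain X where X: "open X" "w \<in> X" "\<forall>w'\<in>X. rho w w' < d \<and> dist (on_part u m w') (on_part u m w) < r / 3 \<and> w' \<in> disk"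
        unfolding eventually_nhds by (elim exE conjE)
      have "X \<noteq> {}" using X(2) by (rule ex_in_conv[THEN iffD1, OF exI])
      from Q(2)[OF X(1) this] obtain p where p: "p \<in> Q" "p \<in> X" by (rule bexE)
      from p(1) obtain i where i': "p = q i" unfolding q[symmetric] by (rule rangeE)
      have "q i \<in> X" using p(2) i' by simp
      then have i: "rho w (q i) < d" "dist (on_part u m (q i)) (on_part u m w) < r / 3" "q i \<in> disk" using X(3) by auto
      have "\<forall>\<^sub>F n in sequentially. inverse (real (Suc n)) < r / 3"
        using order_tendstoD(2)[OF LIMSEQ_inverse_real_of_nat, of "r / 3"] r by simp
      then show "\<forall>\<^sub>F n in sequentially. dist (u (phi (Z n) w)) (on_part u m w) < r"
        using eventually_gt_at_top[of i]
      proof eventually_elim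
        case (elim n)
        have "rho (phi (Z n) w) (phi (Z n) (q i)) < d" using i w Zd by (simp add: rho_invariant)
        then have "dist (u (phi (Z n) w)) (u (phi (Z n) (q i))) < r / 3"
          unfolding dist_norm using d(2) i w Zd by auto
        moreover have "dist (u (phi (Z n) (q i))) (on_part u m (q i)) < r / 3"
          using Z(3)[OF elim(2) i(3)] elim(1) by linarith
        ultimately show ?case
          using i(2) dist_triangle[of "u (phi (Z n) w)" "on_part u m w" "u (phi (Z n) (q i))"]
            dist_triangle[of "u (phi (Z n) (q i))" "on_part u m w" "on_part u m (q i)"] by linarith
      qed
    qed
    obtain C where C': "\<forall>z\<in>disk. cmod (u z) \<le> C"
      using star_approximable_bounded[OF u] unfolding bounded_iff by auto
    have C: "cmod (u z) \<le> C" if "cmod z < 1" for z using C' that by simp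
    have [measurable]: "k \<in> borel_measurable dA" using k by (rule borel_measurable_integrable)
    have [measurable]: "on_part u m \<in> borel_measurable dA"
      using on_part_bounded_measurable[OF u] by (rule bounded_measurable_imp_measurable)
    have [measurable]: "(\<lambda>w. u (phi (Z n) w)) \<in> borel_measurable dA" for n
      using bounded_measurable_phi[OF star_approximable_measurable[OF u] Zd] by (rule bounded_measurable_imp_measurable)
    have "(\<lambda>n. ?I (Z n)) \<longlonglongrightarrow> ?J"
    proof (rule integral_dominated_convergence)
      show "integrable dA (\<lambda>w. C * cmod (k w))" using k by simp
      show "AE w in dA. (\<lambda>n. u (phi (Z n) w) * k w) \<longlonglongrightarrow> on_part u m w * k w"
        by (intro AE_I2 tendsto_mult_right conv) simp
      show "AE w in dA. cmod (u (phi (Z n) w) * k w) \<le> C * cmod (k w)" for n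
        by (intro AE_I2) (auto simp: norm_mult intro!: mult_right_mono C phi_in_disk Zd)
    qed measurable
    from tendstoD[OF this e] show False using Z(1) by simp
  qed
qed

text \<open>By invariance the value at \<open>phi z w\<close> is an integral of
  \<open>u o phi z\<close> against a kernel independent of \<open>z\<close>, so the limit may be
  taken inside.\<close>

lemma on_part_radial_op:
  assumes u: "star_approximable u" and k [measurable]: "\<kappa> \<in> borel_measurable borel"
    and M: "\<And>r. 0 \<le> r \<Longrightarrow> r < 1 \<Longrightarrow> \<bar>\<kappa> r\<bar> \<le> M" and w: "cmod w < 1"
  shows "((\<lambda>z. radial_op \<kappa> u (phi z w)) \<longlongrightarrow> radial_op \<kappa> (on_part u m) w) (disk_to m)"
    and "on_part (radial_op \<kappa> u) m w = radial_op \<kappa> (on_part u m) w"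
proof -
  have [measurable]: "u \<in> borel_measurable dA"
    using star_approximable_measurable[OF u] by (rule bounded_measurable_imp_measurable)
  have "integrable dA (\<lambda>x. 1 * complex_of_real (\<kappa> (rho w x) * berezin_kernel w x))"
    by (rule radial_op_integrable[OF k bounded_measurable_const w M])
  then have "((\<lambda>z. radial_op \<kappa> (\<lambda>x. u (phi z x)) w) \<longlongrightarrow> radial_op \<kappa> (on_part u m) w) (disk_to m)"
    unfolding radial_op_def by (intro on_part_integral_tendsto u) simp
  moreover have "\<forall>\<^sub>F z in disk_to m. radial_op \<kappa> (\<lambda>x. u (phi z x)) w = radial_op \<kappa> u (phi z w)"
    using eventually_disk_to[OF m] by eventually_elim (rule radial_op_phi, use w in auto)
  ultimately show lim: "((\<lambda>z. radial_op \<kappa> u (phi z w)) \<longlongrightarrow> radial_op \<kappa> (on_part u m) w) (disk_to m)"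
    by (rule Lim_transform_eventually)
  show "on_part (radial_op \<kappa> u) m w = radial_op \<kappa> (on_part u m) w" by (rule on_part_eqI[OF lim])
qed

lemma on_part_diff:
  assumes "star_approximable f" "star_approximable g" "cmod w < 1"
  shows "on_part (\<lambda>z. f z - g z) m w = on_part f m w - on_part g m w"
  by (intro on_part_eqI tendsto_diff on_part_tendsto assms)

lemma on_part_harmonic_iff:
  assumes u: "star_approximable u"
  shows "harmonic_on_disk (\<lambda>w. extend u (hoffman m w)) \<longleftrightarrow> harmonic_on_disk (on_part u m)"
  using harmonic_on_disk_cong[of _ "on_part u m"] harmonic_on_disk_cong[of "on_part u m"] on_part_tendsto(2)[OF u] by metis

end

text \<open>The limits along \<open>disk_to m\<close> are the case w = 0 of
  \<open>on_part_radial_op\<close>, as \<open>phi z 0 = z\<close>. In particular the Berezin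
  transform preserves \<open>algU\<close>.\<close>

lemma star_approximable_radial_op:
  assumes u: "star_approximable u" and k: "\<kappa> \<in> borel_measurable borel"
    and M: "\<And>r. 0 \<le> r \<Longrightarrow> r < 1 \<Longrightarrow> \<bar>\<kappa> r\<bar> \<le> M"
  shows "star_approximable (radial_op \<kappa> u)"
proof (rule star_approximable_criterion)
  show "bounded (radial_op \<kappa> u ` disk)"
    using bounded_measurable_radial_op[OF k star_approximable_measurable[OF u] M] by (simp add: bounded_measurable_def)
  fix m assume m: "m \<in> maxideals"
  show "\<exists>l. (radial_op \<kappa> u \<longlongrightarrow> l) (disk_to m)"
  proof (cases "disk_to m = bot")
    case False
    from on_part_radial_op(1)[OF m False u k M, of 0] have "(radial_op \<kappa> u \<longlongrightarrow> radial_op \<kappa> (on_part u m) 0) (disk_to m)" by simp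
    then show ?thesis by (rule exI)
  qed simp
qed

lemma star_approximable_berezin: "star_approximable u \<Longrightarrow> star_approximable (berezin u)"
  unfolding berezin_eq_radial_op by (rule star_approximable_radial_op[of _ _ 1]) auto

lemma star_approximable_laplace_op: "star_approximable u \<Longrightarrow> star_approximable (laplace_op u)"
  unfolding laplace_op_def by (rule star_approximable_radial_op[of _ _ 1]) (auto simp: laplace_kappa)

lemma on_part_berezin:
  assumes "m \<in> maxideals" "disk_to m \<noteq> bot" "star_approximable u" "cmod w < 1"
  shows "on_part (berezin u) m w = berezin (on_part u m) w"
  unfolding berezin_eq_radial_op by (rule on_part_radial_op(2)[of _ _ _ 1]) (use assms in auto)

lemma on_part_laplace_op:
  assumes "m \<in> maxideals" "disk_to m \<noteq> bot" "star_approximable u" "cmod w < 1"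
  shows "on_part (laplace_op u) m w = laplace_op (on_part u m) w"
  unfolding laplace_op_def by (rule on_part_radial_op(2)[of _ _ _ 1]) (use assms in \<open>auto simp: laplace_kappa\<close>)

lemma star_approximable_diff:
  assumes f: "star_approximable f" and g: "star_approximable g"
  shows "star_approximable (\<lambda>z. f z - g z)"
proof (rule star_approximable_criterion)
  show "bounded ((\<lambda>z. f z - g z) ` disk)"
    by (rule bounded_minus_comp[OF star_approximable_bounded[OF f] star_approximable_bounded[OF g]])
  fix m assume m: "m \<in> maxideals"
  obtain a where a: "(f \<longlongrightarrow> a) (disk_to m)" using star_approximable_tendsto[OF f m] by (rule exE)
  obtain b where b: "(g \<longlongrightarrow> b) (disk_to m)" using star_approximable_tendsto[OF g m] by (rule exE)
  show "\<exists>l. ((\<lambda>z. f z - g z) \<longlongrightarrow> l) (disk_to m)" using tendsto_diff[OF a b] by (rule exI)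
qed

lemma eventually_to_boundary: "\<forall>\<^sub>F z in to_boundary. z \<in> disk"
  using le_to_boundary[of to_boundary] by simp

text \<open>For fixed \<open>w\<close>, 1 - |phi z w|^2 is at most a constant times 1 -
  |z|^2.\<close>

lemma phi_tendsto_boundary:
  assumes F: "F \<le> to_boundary" and w: "cmod w < 1"
  shows "filterlim (\<lambda>z. phi z w) to_boundary F"
proof -
  have Fd: "eventually (\<lambda>z. z \<in> disk) F" and F1: "((\<lambda>z. cmod z) \<longlongrightarrow> 1) F" using F by (auto simp: le_to_boundary)
  define h where "h z = (1 - (cmod z)\<^sup>2) * (1 - (cmod w)\<^sup>2) / (1 - cmod w)\<^sup>2" for z
  have "((\<lambda>z. (cmod (phi z w))\<^sup>2) \<longlongrightarrow> 1) F"
  proof (rule tendsto_sandwich)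
    show "((\<lambda>z. 1 - h z) \<longlongrightarrow> 1) F"
    proof -
      have "((\<lambda>z. 1 - h z) \<longlongrightarrow> 1 - (1 - 1\<^sup>2) * (1 - (cmod w)\<^sup>2) / (1 - cmod w)\<^sup>2) F"
        unfolding h_def using w by (intro tendsto_intros F1) auto
      then show ?thesis by simp
    qed
    show "\<forall>\<^sub>F z in F. 1 - h z \<le> (cmod (phi z w))\<^sup>2"
      using Fd
    proof eventually_elim
      case (elim z)
      then have z: "cmod z < 1" by simp
      have "(1 - cmod w)\<^sup>2 \<le> (cmod (1 - cnj z * w))\<^sup>2" using cmod_one_minus_ge(2)[of z w] z w by (intro power_mono) auto
      then have "1 - (cmod (phi z w))\<^sup>2 \<le> h z"
        unfolding h_def one_minus_phi_norm[OF less_imp_le[OF z] w]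
        using one_minus_square_pos[OF z] one_minus_square_pos[OF w] w
        by (intro divide_left_mono mult_nonneg_nonneg mult_pos_pos) auto
      then show ?case by simp
    qed
    show "\<forall>\<^sub>F z in F. (cmod (phi z w))\<^sup>2 \<le> 1"
      using Fd by eventually_elim (use w in \<open>simp add: abs_square_le_1 less_imp_le\<close>)
  qed simp
  from tendsto_real_sqrt[OF this] have "((\<lambda>z. cmod (phi z w)) \<longlongrightarrow> 1) F" by simp
  moreover have "\<forall>\<^sub>F z in F. phi z w \<in> disk" using Fd by eventually_elim (use w in simp)
  ultimately show ?thesis
    unfolding filterlim_def[of "\<lambda>z. phi z w"] le_to_boundary eventually_filtermap
    by (simp add: filterlim_def filtermap_filtermap)
qed

definition boundary_maxideals :: "((complex \<Rightarrow> complex) \<Rightarrow> complex) set" where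
  "boundary_maxideals = {m \<in> maxideals - point_eval ` disk. disk_to m \<noteq> bot}"

lemma boundary_maxidealsD:
  assumes "m \<in> boundary_maxideals"
  shows "m \<in> maxideals" "disk_to m \<noteq> bot" "disk_to m \<le> to_boundary"
  using assms disk_to_le_boundary by (auto simp: boundary_maxideals_def)

lemma tendsto_boundary_0D:
  assumes lim: "(e \<longlongrightarrow> 0) to_boundary" and m: "m \<in> boundary_maxideals" and w: "cmod w < 1"
  shows "on_part e m w = 0"
  by (rule on_part_eqI[OF boundary_maxidealsD(1,2)[OF m]],
      rule filterlim_compose[OF lim phi_tendsto_boundary[OF boundary_maxidealsD(3)[OF m] w]])

text \<open>If the limit failed, the points with large values would give a proper filter at the
  boundary; by \<open>exists_boundary_cluster\<close> it meets some \<open>disk_to m\<close>, along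
  which the values tend to 0.\<close>

lemma tendsto_boundary_0I:
  fixes e :: "complex \<Rightarrow> complex"
  assumes lim: "\<And>m. m \<in> boundary_maxideals \<Longrightarrow> (e \<longlongrightarrow> 0) (disk_to m)"
  shows "(e \<longlongrightarrow> 0) to_boundary"
proof (rule tendstoI, rule ccontr)
  fix r :: real assume r: "0 < r" and neg: "\<not> (\<forall>\<^sub>F z in to_boundary. dist (e z) 0 < r)"
  define F where "F = inf to_boundary (principal {z. \<not> dist (e z) 0 < r})"
  have "F \<noteq> bot"
  proof
    assume "F = bot"
    then have "eventually (\<lambda>_. False) F" by simp
    then show False using neg unfolding F_def eventually_inf_principal by simp
  qed
  then obtain m where m: "m \<in> maxideals - point_eval ` disk" "inf F (disk_to m) \<noteq> bot"
    using exists_boundary_cluster[of F] unfolding F_def by (metis inf_le1)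
  have nb: "disk_to m \<noteq> bot" using m(2) by auto
  have "(e \<longlongrightarrow> 0) (disk_to m)" using m(1) nb by (intro lim) (simp add: boundary_maxideals_def)
  then have "\<forall>\<^sub>F z in disk_to m. dist (e z) 0 < r" using r by (rule tendstoD)
  then have "\<forall>\<^sub>F z in inf F (disk_to m). dist (e z) 0 < r" by (rule filter_leD[OF inf_le2])
  moreover have "\<forall>\<^sub>F z in F. \<not> dist (e z) 0 < r" unfolding F_def eventually_inf_principal by simp
  then have "\<forall>\<^sub>F z in inf F (disk_to m). \<not> dist (e z) 0 < r" by (rule filter_leD[OF inf_le1])
  ultimately have "\<forall>\<^sub>F z in inf F (disk_to m). False" by eventually_elim simp
  then show False using m(2) by (simp add: eventually_False)
qed

text \<open>The value at w = 0 is the limit at \<open>m\<close> itself, since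
  \<open>phi z 0 = z\<close>; vanishing there for all \<open>m\<close> is as strong as vanishing on
  all parts.\<close>

lemma tendsto_boundary_0_on_partI:
  assumes e: "star_approximable e" and 0: "\<And>m. m \<in> boundary_maxideals \<Longrightarrow> on_part e m 0 = 0"
  shows "(e \<longlongrightarrow> 0) to_boundary"
proof (rule tendsto_boundary_0I)
  fix m assume m: "m \<in> boundary_maxideals"
  from on_part_tendsto(1)[OF boundary_maxidealsD(1,2)[OF m] e, of 0] show "(e \<longlongrightarrow> 0) (disk_to m)" by (simp add: 0[OF m])
qed

lemma tendsto_boundary_0_iff:
  assumes "star_approximable e"
  shows "(e \<longlongrightarrow> 0) to_boundary \<longleftrightarrow> (\<forall>m\<in>boundary_maxideals. \<forall>w. cmod w < 1 \<longrightarrow> on_part e m w = 0)"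
  using tendsto_boundary_0D[of e] tendsto_boundary_0_on_partI[OF assms] by auto

text \<open>If \<open>disk_to m\<close> were trivial, every \<open>p\<close> would be a limit along it, so that \<open>extend\<close> and \<open>hoffman\<close>
  would not depend on their remaining arguments.\<close>

lemma extend_bot: "disk_to m = bot \<Longrightarrow> extend u m = extend v m"
  by (simp add: extend_def Topological_Spaces.Lim_def)

lemma hoffman_bot: "disk_to m = bot \<Longrightarrow> hoffman m w = hoffman m 0"
  by (simp add: hoffman_def limitin_def)

lemma harmonic_const: "harmonic_on_disk (\<lambda>_. c)"
  by (rule harmonic_on_disk_cong[OF harmonic_berezin[of "\<lambda>_. c"]]) (auto simp: laplace_op_const berezin_const)

text \<open>Characters with trivial filter contribute only constant, hence harmonic,
  functions.\<close>

lemma HOP_iff: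
  assumes "star_approximable u"
  shows "u \<in> HOP \<longleftrightarrow> (\<forall>m\<in>boundary_maxideals. harmonic_on_disk (on_part u m))"
proof -
  have bot: "harmonic_on_disk (\<lambda>w. extend u (hoffman m w))" if "disk_to m = bot" for m
  proof -
    have "(\<lambda>w. extend u (hoffman m w)) = (\<lambda>_. extend u (hoffman m 0))"
      by (intro ext arg_cong[where f = "extend u"] hoffman_bot that)
    then show ?thesis using harmonic_const[of "extend u (hoffman m 0)"] by simp
  qed
  have "harmonic_on_disk (\<lambda>w. extend u (hoffman m w)) \<longleftrightarrow> (disk_to m \<noteq> bot \<longrightarrow> harmonic_on_disk (on_part u m))"
    if "m \<in> maxideals" for m
    using on_part_harmonic_iff[OF that _ assms] bot[of m] by blast
  then show ?thesis
    using star_approximable_imp_algU[OF assms] unfolding HOP_def boundary_maxideals_def by blast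
qed

section \<open>Equivalences on a single part and their transfer to the boundary\<close>

lemma berezin_diff:
  assumes "bounded_measurable f" "bounded_measurable g" "cmod z < 1"
  shows "berezin (\<lambda>w. f w - g w) z = berezin f z - berezin g z"
proof -
  have "integrable dA (\<lambda>w. f w * of_real (1 * berezin_kernel z w))" if "bounded_measurable f" for f
    using radial_op_integrable[of "\<lambda>_. 1" f z 1] that assms by simp
  then show ?thesis unfolding berezin_eq_radial_op radial_op_def
    by (simp add: left_diff_distrib assms)
qed

lemma berezin_continuous: "bounded_measurable v \<Longrightarrow> continuous_on disk (berezin v)"
  by (intro kernel_polynomial_continuous kernel_polynomial_berezin)

lemma bounded_measurable_berezin: "bounded_measurable v \<Longrightarrow> bounded_measurable (berezin v)"
  unfolding berezin_eq_radial_op by (rule bounded_measurable_radial_op[of _ _ 1]) auto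

text \<open>Brings conditions on \<open>B v\<close> back to \<open>v\<close>: injectivity is applied
  to \<open>B v - v\<close>.\<close>

lemma berezin_twice_imp_fixed:
  assumes v: "bounded_measurable v" "continuous_on disk v"
    and B: "\<And>z. cmod z < 1 \<Longrightarrow> berezin (\<lambda>w. berezin v w - v w) z = 0" and z: "cmod z < 1"
  shows "berezin v z = v z"
proof -
  have "berezin v z - v z = 0"
    by (rule berezin_injective[OF _ _ B z])
      (intro bounded_measurable_diff bounded_measurable_berezin continuous_on_diff berezin_continuous v)+
  then show ?thesis by simp
qed

text \<open>One direction is the mean value property, the other the theorem on bounded fixed points;
  on parts this links (a) with (c).\<close>

lemma harmonic_iff_berezin_fixed:
  assumes v: "bounded_measurable v"
  shows "harmonic_on_disk v \<longleftrightarrow> (\<forall>z. cmod z < 1 \<longrightarrow> berezin v z = v z)"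
  using berezin_fixed_imp_harmonic[OF v] berezin_harmonic[of v] v
  by (auto simp: bounded_harmonic_def bounded_measurable_def)

lemma harmonic_berezin_iff_berezin_fixed:
  assumes v: "bounded_measurable v" "continuous_on disk v"
  shows "harmonic_on_disk (berezin v) \<longleftrightarrow> (\<forall>z. cmod z < 1 \<longrightarrow> berezin v z = v z)"
proof
  assume "harmonic_on_disk (berezin v)"
  then have "\<forall>z. cmod z < 1 \<longrightarrow> berezin (berezin v) z = berezin v z"
    using harmonic_iff_berezin_fixed[OF bounded_measurable_berezin[OF v(1)]] by blast
  then have "berezin (\<lambda>w. berezin v w - v w) z = 0" if "cmod z < 1" for z
    using berezin_diff[OF bounded_measurable_berezin[OF v(1)] v(1) that] that by simp
  from berezin_twice_imp_fixed[OF v this] show "\<forall>z. cmod z < 1 \<longrightarrow> berezin v z = v z" by simp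
next
  assume "\<forall>z. cmod z < 1 \<longrightarrow> berezin v z = v z"
  then have *: "harmonic_on_disk v" "\<And>z. cmod z < 1 \<Longrightarrow> v z = berezin v z"
    using harmonic_iff_berezin_fixed[OF v(1)] by auto
  show "harmonic_on_disk (berezin v)" by (rule harmonic_on_disk_cong[OF *])
qed

text \<open>From left to right, \<open>B v\<close> is harmonic by \<open>laplacian_berezin\<close>,
  hence fixed by \<open>B\<close>, and injectivity gives \<open>B v = v\<close>.\<close>

lemma laplace_op_0_iff_berezin_fixed:
  assumes v: "bounded_measurable v" "continuous_on disk v"
  shows "(\<forall>z. cmod z < 1 \<longrightarrow> laplace_op v z = 0) \<longleftrightarrow> (\<forall>z. cmod z < 1 \<longrightarrow> berezin v z = v z)"
  using berezin_fixed_imp_laplace_op_0[OF v(1)] harmonic_berezin[OF v(1)] harmonic_berezin_iff_berezin_fixed[OF v]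
  by blast

context
  fixes u assumes u: "star_approximable u"
begin

lemma berezin_limit_iff_parts:
  "((\<lambda>z. berezin u z - u z) \<longlongrightarrow> 0) to_boundary \<longleftrightarrow>
    (\<forall>m\<in>boundary_maxideals. \<forall>w. cmod w < 1 \<longrightarrow> berezin (on_part u m) w = on_part u m w)"
  unfolding tendsto_boundary_0_iff[OF star_approximable_diff[OF star_approximable_berezin[OF u] u]]
  by (simp add: on_part_diff boundary_maxidealsD star_approximable_berezin u on_part_berezin)

lemma part_properties:
  assumes "m \<in> boundary_maxideals"
  shows "bounded_measurable (on_part u m)" "continuous_on disk (on_part u m)"
  using boundary_maxidealsD[OF assms] u by (auto intro: on_part_bounded_measurable on_part_continuous)

theorem berezin_limit_iff_extend:
  "((\<lambda>z. berezin u z - u z) \<longlongrightarrow> 0) to_boundary \<longleftrightarrow>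
    (\<forall>m \<in> maxideals - point_eval ` disk. extend (berezin u) m = extend u m)"
proof
  assume lim: "((\<lambda>z. berezin u z - u z) \<longlongrightarrow> 0) to_boundary"
  show "\<forall>m \<in> maxideals - point_eval ` disk. extend (berezin u) m = extend u m"
  proof
    fix m assume m: "m \<in> maxideals - point_eval ` disk"
    show "extend (berezin u) m = extend u m"
    proof (cases "disk_to m = bot")
      case True then show ?thesis by (rule extend_bot)
    next
      case False
      then have b: "m \<in> boundary_maxideals" using m by (simp add: boundary_maxideals_def)
      then have "berezin (on_part u m) 0 = on_part u m 0" using lim unfolding berezin_limit_iff_parts by simp
      then show ?thesis using on_part_berezin[OF boundary_maxidealsD(1,2)[OF b] u, of 0]
        by (simp add: extend_def on_part_def)
    qed
  qed
next
  assume eq: "\<forall>m \<in> maxideals - point_eval ` disk. extend (berezin u) m = extend u m"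
  show "((\<lambda>z. berezin u z - u z) \<longlongrightarrow> 0) to_boundary"
  proof (rule tendsto_boundary_0_on_partI[OF star_approximable_diff[OF star_approximable_berezin[OF u] u]])
    fix m assume b: "m \<in> boundary_maxideals"
    then have "extend (berezin u) m = extend u m" using eq by (auto simp: boundary_maxideals_def)
    then show "on_part (\<lambda>z. berezin u z - u z) m 0 = 0"
      using on_part_diff[OF boundary_maxidealsD(1,2)[OF b] star_approximable_berezin[OF u] u, of 0]
      by (simp add: extend_def on_part_def)
  qed
qed

theorem berezin_limit_iff_HOP:
  "((\<lambda>z. berezin u z - u z) \<longlongrightarrow> 0) to_boundary \<longleftrightarrow> u \<in> HOP"
  unfolding berezin_limit_iff_parts HOP_iff[OF u]
  by (intro ball_cong refl harmonic_iff_berezin_fixed[symmetric] part_properties)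

theorem berezin_limit_iff_berezin_HOP:
  "((\<lambda>z. berezin u z - u z) \<longlongrightarrow> 0) to_boundary \<longleftrightarrow> berezin u \<in> HOP"
  unfolding berezin_limit_iff_parts HOP_iff[OF star_approximable_berezin[OF u]]
proof (intro ball_cong refl)
  fix m assume b: "m \<in> boundary_maxideals"
  have *: "on_part (berezin u) m w = berezin (on_part u m) w" if "cmod w < 1" for w
    by (rule on_part_berezin[OF boundary_maxidealsD(1,2)[OF b] u that])
  have "harmonic_on_disk (on_part (berezin u) m) \<longleftrightarrow> harmonic_on_disk (berezin (on_part u m))"
    using harmonic_on_disk_cong[of "on_part (berezin u) m" "berezin (on_part u m)", OF _ *]
      harmonic_on_disk_cong[of "berezin (on_part u m)" "on_part (berezin u) m", OF _ *[symmetric]] by (rule iffI)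
  then show "(\<forall>w. cmod w < 1 \<longrightarrow> berezin (on_part u m) w = on_part u m w) \<longleftrightarrow> harmonic_on_disk (on_part (berezin u) m)"
    using harmonic_berezin_iff_berezin_fixed[OF part_properties[OF b]] by simp
qed

lemma berezin_limit_iff_laplace_op:
  "((\<lambda>z. berezin u z - u z) \<longlongrightarrow> 0) to_boundary \<longleftrightarrow> (laplace_op u \<longlongrightarrow> 0) to_boundary"
  unfolding berezin_limit_iff_parts tendsto_boundary_0_iff[OF star_approximable_laplace_op[OF u]]
proof (intro ball_cong refl)
  fix m assume b: "m \<in> boundary_maxideals"
  show "(\<forall>w. cmod w < 1 \<longrightarrow> berezin (on_part u m) w = on_part u m w) \<longleftrightarrow>
    (\<forall>w. cmod w < 1 \<longrightarrow> on_part (laplace_op u) m w = 0)"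
    using laplace_op_0_iff_berezin_fixed[OF part_properties[OF b]]
      on_part_laplace_op[OF boundary_maxidealsD(1,2)[OF b] u] by simp
qed

text \<open>Prepares (e): compactness controls only the Berezin transform of the symbol
  \<open>B u - u\<close>, and injectivity on each part recovers the symbol itself.\<close>

lemma berezin_limit_iff_berezin_diff:
  "((\<lambda>z. berezin u z - u z) \<longlongrightarrow> 0) to_boundary \<longleftrightarrow> (berezin (\<lambda>z. berezin u z - u z) \<longlongrightarrow> 0) to_boundary"
proof -
  define v where "v z = berezin u z - u z" for z
  have v: "star_approximable v" unfolding v_def[abs_def] by (intro star_approximable_diff star_approximable_berezin u)
  have "(v \<longlongrightarrow> 0) to_boundary \<longleftrightarrow> (berezin v \<longlongrightarrow> 0) to_boundary"
    unfolding tendsto_boundary_0_iff[OF v] tendsto_boundary_0_iff[OF star_approximable_berezin[OF v]]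
  proof (intro ball_cong refl)
    fix m assume b: "m \<in> boundary_maxideals"
    note m = boundary_maxidealsD(1,2)[OF b]
    have Bv: "on_part (berezin v) m w = berezin (on_part v m) w" if "cmod w < 1" for w
      by (rule on_part_berezin[OF m v that])
    show "(\<forall>w. cmod w < 1 \<longrightarrow> on_part v m w = 0) \<longleftrightarrow> (\<forall>w. cmod w < 1 \<longrightarrow> on_part (berezin v) m w = 0)"
    proof
      assume "\<forall>w. cmod w < 1 \<longrightarrow> on_part v m w = 0"
      then have "berezin (on_part v m) w = berezin (\<lambda>_. 0) w" for w by (intro berezin_cong) simp
      then show "\<forall>w. cmod w < 1 \<longrightarrow> on_part (berezin v) m w = 0" using Bv berezin_const by simp
    next
      assume "\<forall>w. cmod w < 1 \<longrightarrow> on_part (berezin v) m w = 0"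
      then have "berezin (on_part v m) w = 0" if "cmod w < 1" for w using that Bv by simp
      from berezin_injective[OF on_part_bounded_measurable[OF m v] on_part_continuous[OF m v] this]
      show "\<forall>w. cmod w < 1 \<longrightarrow> on_part v m w = 0" by simp
    qed
  qed
  then show ?thesis unfolding v_def[abs_def] .
qed

theorem berezin_limit_iff_integral:
  "((\<lambda>z. berezin u z - u z) \<longlongrightarrow> 0) to_boundary \<longleftrightarrow>
    ((\<lambda>z. LINT w|dA. u (phi z w) * complex_of_real (2 * (cmod w)\<^sup>2 - 1)) \<longlongrightarrow> 0) to_boundary"
  unfolding berezin_limit_iff_laplace_op
proof (rule filterlim_cong[OF refl refl], rule eventually_mono[OF eventually_to_boundary])
  fix z :: complex assume "z \<in> disk"
  then show "laplace_op u z = (LINT w|dA. u (phi z w) * complex_of_real (2 * (cmod w)\<^sup>2 - 1))"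
    unfolding laplace_op_def using bounded_measurable_imp_measurable[OF star_approximable_measurable[OF u]]
    by (intro radial_op_eq) auto
qed

theorem berezin_limit_iff_laplacian_berezin:
  "((\<lambda>z. berezin u z - u z) \<longlongrightarrow> 0) to_boundary \<longleftrightarrow>
    ((\<lambda>z. complex_of_real ((1 - (cmod z)\<^sup>2)\<^sup>2) * laplacian (berezin u) z) \<longlongrightarrow> 0) to_boundary"
proof -
  have "((\<lambda>z. complex_of_real ((1 - (cmod z)\<^sup>2)\<^sup>2) * laplacian (berezin u) z) \<longlongrightarrow> 0) to_boundary \<longleftrightarrow>
    ((\<lambda>z. 8 * laplace_op u z) \<longlongrightarrow> 0) to_boundary"
    by (rule filterlim_cong[OF refl refl], rule eventually_mono[OF eventually_to_boundary],
      rule laplacian_berezin[OF star_approximable_measurable[OF u]]) simp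
  also have "\<dots> \<longleftrightarrow> (laplace_op u \<longlongrightarrow> 0) to_boundary"
    using tendsto_mult_left[of "\<lambda>z. 8 * laplace_op u z" 0 to_boundary "1/8"]
      tendsto_mult_left[of "laplace_op u" 0 to_boundary 8] by (simp add: mult.assoc[symmetric]) blast
  finally show ?thesis unfolding berezin_limit_iff_laplace_op by simp
qed

end

section \<open>Bergman projection and compactness\<close>


definition square_integrable :: "(complex \<Rightarrow> complex) \<Rightarrow> bool" where
  "square_integrable f \<longleftrightarrow> f \<in> borel_measurable dA \<and> integrable dA (\<lambda>z. (cmod (f z))\<^sup>2)"

text \<open>Squared norms keep the estimates free of roots; crude factors 2 take the place of the
  triangle inequality.\<close>

definition L2_square :: "(complex \<Rightarrow> complex) \<Rightarrow> real" where
  "L2_square f = (LINT z|dA. (cmod (f z))\<^sup>2)"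

lemma L2_norm_eq: "L2_norm f = sqrt (L2_square f)"
  by (simp add: L2_norm_def L2_square_def)

lemma L2_square_nonneg [simp]: "0 \<le> L2_square f"
  unfolding L2_square_def by (intro integral_nonneg_AE) auto

lemma square_integrable_measurable [measurable_dest]: "square_integrable f \<Longrightarrow> f \<in> borel_measurable dA"
  by (simp add: square_integrable_def)

lemma cmod_add_square_le: "(cmod (a + b))\<^sup>2 \<le> 2 * (cmod a)\<^sup>2 + 2 * (cmod b)\<^sup>2"
proof -
  have "(cmod (a + b))\<^sup>2 \<le> (cmod a + cmod b)\<^sup>2" by (intro power_mono norm_triangle_ineq) simp
  also have "\<dots> \<le> 2 * (cmod a)\<^sup>2 + 2 * (cmod b)\<^sup>2"
    using zero_le_power2[of "cmod a - cmod b"] by (simp add: power2_eq_square algebra_simps)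
  finally show ?thesis .
qed

lemma square_integrableI:
  assumes "f \<in> borel_measurable dA" "integrable dA h" "\<And>z. cmod z < 1 \<Longrightarrow> (cmod (f z))\<^sup>2 \<le> h z"
  shows "square_integrable f" "L2_square f \<le> (LINT z|dA. h z)"
proof -
  have [measurable]: "f \<in> borel_measurable dA" by (rule assms)
  have "integrable dA (\<lambda>z. (cmod (f z))\<^sup>2)"
    by (rule Bochner_Integration.integrable_bound[OF assms(2)]) (use assms(3) in \<open>auto intro!: AE_I2 order_trans[OF _ abs_ge_self]\<close>)
  then show "square_integrable f" "L2_square f \<le> (LINT z|dA. h z)"
    using assms unfolding square_integrable_def L2_square_def by (auto intro!: integral_mono)
qed

lemma square_integrable_add:
  assumes "square_integrable f" "square_integrable g"
  shows "square_integrable (\<lambda>z. f z + g z)" "L2_square (\<lambda>z. f z + g z) \<le> 2 * L2_square f + 2 * L2_square g"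
proof -
  have [measurable]: "f \<in> borel_measurable dA" "g \<in> borel_measurable dA" using assms by measurable
  have *: "integrable dA (\<lambda>z. 2 * (cmod (f z))\<^sup>2 + 2 * (cmod (g z))\<^sup>2)" using assms by (simp add: square_integrable_def)
  note I = square_integrableI[of "\<lambda>z. f z + g z", OF _ * cmod_add_square_le]
  show "square_integrable (\<lambda>z. f z + g z)" by (rule I(1)) measurable
  have "L2_square (\<lambda>z. f z + g z) \<le> (LINT z|dA. 2 * (cmod (f z))\<^sup>2 + 2 * (cmod (g z))\<^sup>2)" by (rule I(2)) measurable
  also have "\<dots> = 2 * L2_square f + 2 * L2_square g" using assms by (simp add: square_integrable_def L2_square_def)
  finally show "L2_square (\<lambda>z. f z + g z) \<le> 2 * L2_square f + 2 * L2_square g" .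
qed

lemma square_integrable_cmult:
  assumes "square_integrable f"
  shows "square_integrable (\<lambda>z. c * f z)" "L2_square (\<lambda>z. c * f z) = (cmod c)\<^sup>2 * L2_square f"
  using assms by (auto simp: square_integrable_def L2_square_def norm_mult power_mult_distrib)

lemma square_integrable_diff:
  assumes "square_integrable f" "square_integrable g"
  shows "square_integrable (\<lambda>z. f z - g z)" "L2_square (\<lambda>z. f z - g z) \<le> 2 * L2_square f + 2 * L2_square g"
  using square_integrable_add[OF assms(1) square_integrable_cmult(1)[OF assms(2), of "-1"]]
    square_integrable_cmult(2)[OF assms(2), of "-1"] by simp_all

lemma bounded_mult_square_integrable:
  assumes v: "bounded_measurable v" and f: "square_integrable f"
  shows "square_integrable (\<lambda>z. v z * f z)"
proof -
  obtain C where C: "0 \<le> C" "\<And>z. cmod z < 1 \<Longrightarrow> cmod (v z) \<le> C" using bounded_measurableE[OF v] by metis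
  have [measurable]: "v \<in> borel_measurable dA" using v by measurable
  have [measurable]: "f \<in> borel_measurable dA" using f by measurable
  show ?thesis
  proof (rule square_integrableI(1))
    show "integrable dA (\<lambda>z. C\<^sup>2 * (cmod (f z))\<^sup>2)" using f by (simp add: square_integrable_def)
    show "(cmod (v z * f z))\<^sup>2 \<le> C\<^sup>2 * (cmod (f z))\<^sup>2" if "cmod z < 1" for z
      unfolding norm_mult power_mult_distrib using C that by (intro mult_right_mono power_mono) auto
  qed measurable
qed

lemma bounded_square_integrable: "bounded_measurable f \<Longrightarrow> square_integrable f"
  using bounded_mult_square_integrable[of f "\<lambda>_. 1"] by (simp add: square_integrable_def)

lemma norm_integral_le:
  fixes f :: "complex \<Rightarrow> complex"
  assumes f: "integrable dA f" and h: "integrable dA h" and le: "\<And>z. cmod z < 1 \<Longrightarrow> cmod (f z) \<le> h z"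
  shows "cmod (LINT z|dA. f z) \<le> (LINT z|dA. h z)"
proof -
  have "cmod (LINT z|dA. f z) \<le> (LINT z|dA. cmod (f z))" by (rule integral_norm_bound)
  also have "\<dots> \<le> (LINT z|dA. h z)" using le by (intro integral_mono integrable_norm f h) auto
  finally show ?thesis .
qed

text \<open>The arithmetic-geometric mean inequality with a free weight \<open>t\<close> stands in
  for Cauchy-Schwarz: when \<open>f\<close> is small in norm, a suitable small \<open>t\<close>
  makes the bound small.\<close>

lemma L2_inner_integrable:
  assumes f: "square_integrable f" and g: "square_integrable g"
  shows "integrable dA (\<lambda>z. f z * cnj (g z))"
    and "0 < t \<Longrightarrow> cmod (L2_inner f g) \<le> (L2_square f / t + t * L2_square g) / 2"
proof -
  have [measurable]: "f \<in> borel_measurable dA" "g \<in> borel_measurable dA" using f g by measurable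
  have le: "cmod (f z * cnj (g z)) \<le> ((cmod (f z))\<^sup>2 / t + t * (cmod (g z))\<^sup>2) / 2" if "0 < t" for t z
  proof -
    have "0 \<le> (cmod (f z) - t * cmod (g z))\<^sup>2 / t" using that by simp
    also have "\<dots> = (cmod (f z))\<^sup>2 / t + t * (cmod (g z))\<^sup>2 - 2 * (cmod (f z) * cmod (g z))"
      using that by (simp add: power2_eq_square field_simps)
    finally show ?thesis by (simp add: norm_mult)
  qed
  have int: "integrable dA (\<lambda>z. ((cmod (f z))\<^sup>2 / t + t * (cmod (g z))\<^sup>2) / 2)" for t
    using f g by (simp add: square_integrable_def)
  show I: "integrable dA (\<lambda>z. f z * cnj (g z))"
    by (rule Bochner_Integration.integrable_bound[OF int[of 1]])
      (use le[of 1] in \<open>auto intro!: AE_I2 order_trans[OF _ abs_ge_self]\<close>)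
  assume t: "0 < t"
  have "cmod (L2_inner f g) \<le> (LINT z|dA. ((cmod (f z))\<^sup>2 / t + t * (cmod (g z))\<^sup>2) / 2)"
    unfolding L2_inner_def by (rule norm_integral_le[OF I int le[OF t]])
  also have "\<dots> = (L2_square f / t + t * L2_square g) / 2"
    using f g by (simp add: square_integrable_def L2_square_def)
  finally show "cmod (L2_inner f g) \<le> (L2_square f / t + t * L2_square g) / 2" .
qed

lemma L2_inner_diff_left:
  assumes "square_integrable f" "square_integrable g" "square_integrable h"
  shows "L2_inner (\<lambda>z. f z - g z) h = L2_inner f h - L2_inner g h"
  unfolding L2_inner_def left_diff_distrib
  by (intro Bochner_Integration.integral_diff L2_inner_integrable assms)

lemma L2_square_diff_cmult:
  assumes f: "square_integrable f" and g: "square_integrable g"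
  shows "L2_square (\<lambda>z. f z - c * g z) = L2_square f - 2 * Re (cnj c * L2_inner f g) + (cmod c)\<^sup>2 * L2_square g"
proof -
  have i: "integrable dA (\<lambda>z. cnj c * (f z * cnj (g z)))" using L2_inner_integrable(1)[OF f g] by simp
  have "(cmod (f z - c * g z))\<^sup>2 = (cmod (f z))\<^sup>2 - 2 * Re (cnj c * (f z * cnj (g z))) + (cmod c)\<^sup>2 * (cmod (g z))\<^sup>2" for z
    unfolding cmod_power2 by (simp add: power2_eq_square algebra_simps)
  then have "L2_square (\<lambda>z. f z - c * g z) =
    (LINT z|dA. (cmod (f z))\<^sup>2 - 2 * Re (cnj c * (f z * cnj (g z))) + (cmod c)\<^sup>2 * (cmod (g z))\<^sup>2)"
    by (simp add: L2_square_def)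
  also have "\<dots> = L2_square f - 2 * (LINT z|dA. Re (cnj c * (f z * cnj (g z)))) + (cmod c)\<^sup>2 * L2_square g"
    using f g integrable_Re[OF i] by (simp add: square_integrable_def L2_square_def del: times_complex.sel)
  also have "(LINT z|dA. Re (cnj c * (f z * cnj (g z)))) = Re (cnj c * L2_inner f g)"
    unfolding integral_Re[OF i] L2_inner_def by simp
  finally show ?thesis .
qed

text \<open>Adapted to minimizing sequences: the bounds \<open>B n\<close> may vary as long as they
  converge.\<close>

lemma L2_square_Fatou:
  assumes F: "\<And>n. square_integrable (F n)" and lim: "\<And>z. cmod z < 1 \<Longrightarrow> (\<lambda>n. F n z) \<longlonglongrightarrow> G z"
    and le: "\<And>n. L2_square (F n) \<le> B n" and B: "B \<longlonglongrightarrow> L"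
  shows "square_integrable G" "L2_square G \<le> L"
proof -
  have [measurable]: "F n \<in> borel_measurable dA" for n using F by measurable
  have G [measurable]: "G \<in> borel_measurable dA"
    by (rule borel_measurable_LIMSEQ_metric[where f = F]) (use lim in auto)
  have L: "0 \<le> L" by (rule tendsto_lowerbound[OF B]) (auto intro!: always_eventually order_trans[OF L2_square_nonneg le])
  have "(\<integral>\<^sup>+z. ennreal ((cmod (G z))\<^sup>2) \<partial>dA) = (\<integral>\<^sup>+z. liminf (\<lambda>n. ennreal ((cmod (F n z))\<^sup>2)) \<partial>dA)"
  proof (rule nn_integral_cong)
    fix z assume "z \<in> space dA"
    then have "(\<lambda>n. ennreal ((cmod (F n z))\<^sup>2)) \<longlonglongrightarrow> ennreal ((cmod (G z))\<^sup>2)"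
      by (intro tendsto_ennrealI tendsto_intros lim) simp
    then show "ennreal ((cmod (G z))\<^sup>2) = liminf (\<lambda>n. ennreal ((cmod (F n z))\<^sup>2))"
      by (intro lim_imp_Liminf[symmetric]) auto
  qed
  also have "\<dots> \<le> liminf (\<lambda>n. \<integral>\<^sup>+z. ennreal ((cmod (F n z))\<^sup>2) \<partial>dA)" by (rule nn_integral_liminf) measurable
  also have "\<dots> \<le> liminf (\<lambda>n. ennreal (B n))"
  proof (intro Liminf_mono always_eventually allI)
    fix n
    have "(\<integral>\<^sup>+z. ennreal ((cmod (F n z))\<^sup>2) \<partial>dA) = ennreal (L2_square (F n))"
      unfolding L2_square_def using F[of n] by (intro nn_integral_eq_integral) (auto simp: square_integrable_def)
    then show "(\<integral>\<^sup>+z. ennreal ((cmod (F n z))\<^sup>2) \<partial>dA) \<le> ennreal (B n)" using le[of n] by (simp add: ennreal_leI)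
  qed
  also have "\<dots> = ennreal L" using B by (intro lim_imp_Liminf tendsto_ennrealI) auto
  finally have *: "(\<integral>\<^sup>+z. ennreal ((cmod (G z))\<^sup>2) \<partial>dA) \<le> ennreal L" .
  have "integrable dA (\<lambda>z. (cmod (G z))\<^sup>2)"
    by (rule integrableI_bounded) (use * in \<open>auto simp: le_less_trans\<close>)
  then show "square_integrable G" using G by (simp add: square_integrable_def)
  have "ennreal (L2_square G) \<le> ennreal L"
    unfolding L2_square_def using * nn_integral_eq_integral[OF \<open>integrable dA (\<lambda>z. (cmod (G z))\<^sup>2)\<close>] by simp
  then show "L2_square G \<le> L" using L by (simp add: ennreal_le_iff)
qed

section \<open>The Bergman space: point evaluations, normal families and projection\<close>

lemma bergman_space_square_integrable: "f \<in> bergman_space \<Longrightarrow> square_integrable f"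
  by (auto simp: bergman_space_def square_integrable_def intro!: borel_measurable_dA_continuous holomorphic_on_imp_continuous_on)

lemma bergman_space_holomorphic: "f \<in> bergman_space \<Longrightarrow> f holomorphic_on disk"
  by (simp add: bergman_space_def)

lemma bergman_spaceI:
  "f holomorphic_on disk \<Longrightarrow> square_integrable f \<Longrightarrow> (\<And>z. z \<notin> disk \<Longrightarrow> f z = 0) \<Longrightarrow> f \<in> bergman_space"
  by (simp add: bergman_space_def square_integrable_def)

lemma bergman_space_add_cmult:
  assumes "f \<in> bergman_space" "g \<in> bergman_space"
  shows "(\<lambda>z. f z + c * g z) \<in> bergman_space"
proof (rule bergman_spaceI)
  show "(\<lambda>z. f z + c * g z) holomorphic_on disk"
    using assms by (intro holomorphic_intros bergman_space_holomorphic)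
  show "square_integrable (\<lambda>z. f z + c * g z)"
    by (intro square_integrable_add square_integrable_cmult bergman_space_square_integrable assms)
qed (use assms in \<open>auto simp: bergman_space_def\<close>)

lemma bergman_space_diff: "f \<in> bergman_space \<Longrightarrow> g \<in> bergman_space \<Longrightarrow> (\<lambda>z. f z - g z) \<in> bergman_space"
  using bergman_space_add_cmult[of f g "-1"] by simp

lemma bergman_space_0: "(\<lambda>_. 0) \<in> bergman_space"
  by (simp add: bergman_space_def)

lemma bergman_space_eqI:
  assumes f: "f \<in> bergman_space" and g: "g \<in> bergman_space" and 0: "L2_square (\<lambda>z. f z - g z) = 0"
  shows "f = g"
proof
  fix z
  note d = bergman_space_diff[OF f g]
  have "AE z in dA. (cmod (f z - g z))\<^sup>2 = 0"
    using 0 bergman_space_square_integrable[OF d] unfolding L2_square_def square_integrable_def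
    by (subst (asm) integral_nonneg_eq_0_iff_AE) auto
  then have ae: "AE z in dA. f z - g z \<in> {0}" by eventually_elim simp
  show "f z = g z"
  proof (cases "cmod z < 1")
    case True
    have "f z - g z \<in> {0}"
      by (rule AE_dA_continuous[OF holomorphic_on_imp_continuous_on[OF bergman_space_holomorphic[OF d]] _ ae True]) simp
    then show ?thesis by simp
  next
    case False
    then show ?thesis using f g by (simp add: bergman_space_def)
  qed
qed

text \<open>The mean value over the disk of radius 1/2 recovers \<open>f 0\<close>, and
  \<open>f\<close> is bounded there. The constant \<open>c\<close> is the normalized area of that
  disk; |f| <= 1 + |f|^2 avoids a root on the right.\<close>

lemma evaluation_at_0_bound:
  "\<exists>c>0. \<forall>f. f holomorphic_on disk \<longrightarrow> square_integrable f \<longrightarrow> c * cmod (f 0) \<le> 1 + L2_square f"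
proof -
  define \<kappa> :: "real \<Rightarrow> real" where "\<kappa> r = (if r \<le> 1/2 then 1 else 0)" for r
  have [measurable]: "\<kappa> \<in> borel_measurable borel" unfolding \<kappa>_def[abs_def] by measurable
  define c where "c = (LINT w|dA. \<kappa> (cmod w))"
  have k: "0 \<le> \<kappa> r" "\<kappa> r \<le> 1" for r by (auto simp: \<kappa>_def)
  have ki: "integrable dA (\<lambda>w. \<kappa> (cmod w))" by (rule integrable_dA_bounded[of _ 1]) (auto simp: k abs_of_nonneg)
  have c: "0 < c"
  proof (rule ccontr)
    assume "\<not> ?thesis"
    moreover have "0 \<le> c" unfolding c_def by (intro integral_nonneg_AE) (auto simp: k)
    ultimately have "(LINT w|dA. \<kappa> (cmod w)) = 0" by (simp add: c_def)
    then have "AE w in dA. \<kappa> (cmod w) = 0" using integral_nonneg_eq_0_iff_AE[OF ki] k by simp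
    then have "AE w in dA. cmod w \<in> {1/2..}" by eventually_elim (auto simp: \<kappa>_def split: if_splits)
    then have "AE w in dA. w \<in> cmod -` {1/2..}" by simp
    from AE_dA_continuous[of "\<lambda>w. w" "cmod -` {1/2..}" 0, OF _ _ this]
    show False by (simp add: continuous_closed_vimage continuous_on_id)
  qed
  have "c * cmod (f 0) \<le> 1 + L2_square f" if hol: "f holomorphic_on disk" and f: "square_integrable f" for f
  proof -
    have cont: "continuous_on disk f" by (rule holomorphic_on_imp_continuous_on[OF hol])
    have "compact (cball (0::complex) (1/2))" "cball (0::complex) (1/2) \<subseteq> disk" by auto
    then have "bounded (f ` cball 0 (1/2))"
      by (intro compact_imp_bounded compact_continuous_image continuous_on_subset[OF cont])
    then obtain C where C': "\<forall>x\<in>f ` cball 0 (1/2). cmod x \<le> C" unfolding bounded_iff by (rule exE)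
    have C: "cmod (f w) \<le> C" if "cmod w \<le> 1/2" for w using C' that by simp
    have C0: "0 \<le> C" using order_trans[OF norm_ge_zero C[of 0]] by simp
    have [measurable]: "f \<in> borel_measurable dA" using f by measurable
    have bm: "bounded_measurable (\<lambda>w. f w * of_real (\<kappa> (cmod w)))"
      by (rule bounded_measurableI[of _ C]) (auto simp: norm_mult \<kappa>_def C C0)
    have "c * cmod (f 0) = cmod (LINT w|dA. f 0 * of_real (\<kappa> (cmod w)))"
      using c by (simp add: norm_mult c_def)
    also have "\<dots> = cmod (LINT w|dA. f w * of_real (\<kappa> (cmod w)))"
      by (subst mean_value_radial[OF hol holomorphic_on_const[of 0] _ _ bm]) auto
    also have "\<dots> \<le> (LINT w|dA. 1 + (cmod (f w))\<^sup>2)"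
    proof (rule norm_integral_le[OF bounded_measurable_integrable[OF bm]])
      show "integrable dA (\<lambda>w. 1 + (cmod (f w))\<^sup>2)" using f by (simp add: square_integrable_def)
      fix w
      have "cmod (f w) \<le> 1 + (cmod (f w))\<^sup>2"
      proof -
        have "2 * cmod (f w) \<le> 1 + (cmod (f w))\<^sup>2"
          using zero_le_power2[of "cmod (f w) - 1"] by (simp add: power2_eq_square algebra_simps)
        then show ?thesis using norm_ge_zero[of "f w"] by linarith
      qed
      then show "cmod (f w * of_real (\<kappa> (cmod w))) \<le> 1 + (cmod (f w))\<^sup>2"
        by (auto simp: \<kappa>_def norm_mult add_nonneg_nonneg)
    qed
    also have "\<dots> = 1 + L2_square f" using f by (simp add: L2_square_def square_integrable_def)
    finally show ?thesis .
  qed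
  then show ?thesis by (intro exI[of _ c] conjI allI impI c)
qed

lemma holomorphic_bergman_kernel: "cmod z < 1 \<Longrightarrow> bergman_kernel z holomorphic_on disk"
  unfolding bergman_kernel_def[abs_def] using one_minus_cnj_mult_nonzero[of z] by (intro holomorphic_intros) auto

lemma bounded_measurable_bergman_kernel:
  assumes z: "cmod z < 1"
  shows "bounded_measurable (bergman_kernel z)"
proof (rule bounded_measurableI)
  show "bergman_kernel z \<in> borel_measurable dA"
    by (intro borel_measurable_dA_continuous holomorphic_on_imp_continuous_on holomorphic_bergman_kernel z)
  fix w assume w: "cmod w < 1"
  have "(cmod (bergman_kernel z w))\<^sup>2 \<le> (1 - (cmod z)\<^sup>2)\<^sup>2 / (1 - cmod z) ^ 4"
    unfolding cmod_bergman_kernel by (rule berezin_kernel_bounded[OF z w])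
  then have "sqrt ((cmod (bergman_kernel z w))\<^sup>2) \<le> sqrt ((1 - (cmod z)\<^sup>2)\<^sup>2 / (1 - cmod z) ^ 4)" by (rule real_sqrt_le_mono)
  then show "cmod (bergman_kernel z w) \<le> sqrt ((1 - (cmod z)\<^sup>2)\<^sup>2 / (1 - cmod z) ^ 4)" by simp
qed

text \<open>Passing from \<open>f\<close> to the product of \<open>f o phi z\<close> with the kernel
  k_z preserves the norm and moves \<open>z\<close> to 0, where the new function has modulus (1 -
  |z|^2) |f z|.\<close>

lemma evaluation_bound:
  "\<exists>c>0. \<forall>f z. f \<in> bergman_space \<longrightarrow> cmod z < 1 \<longrightarrow> c * ((1 - (cmod z)\<^sup>2) * cmod (f z)) \<le> 1 + L2_square f"
proof -
  obtain c where c: "0 < c" "\<And>f. f holomorphic_on disk \<Longrightarrow> square_integrable f \<Longrightarrow> c * cmod (f 0) \<le> 1 + L2_square f"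
  proof -
    from evaluation_at_0_bound obtain c where "0 < c \<and> (\<forall>f. f holomorphic_on disk \<longrightarrow> square_integrable f \<longrightarrow> c * cmod (f 0) \<le> 1 + L2_square f)"
      by (rule exE)
    then show ?thesis by (intro that) auto
  qed
  have "c * ((1 - (cmod z)\<^sup>2) * cmod (f z)) \<le> 1 + L2_square f" if f: "f \<in> bergman_space" and z: "cmod z < 1" for f z
  proof -
    define g where "g w = f (phi z w) * bergman_kernel z w" for w
    have fs: "square_integrable f" by (rule bergman_space_square_integrable[OF f])
    have "(f \<circ> phi z) holomorphic_on disk"
      by (rule holomorphic_on_compose_gen[OF holomorphic_phi[OF z] bergman_space_holomorphic[OF f]]) (simp add: phi_image[OF z])
    then have hol: "g holomorphic_on disk"
      unfolding g_def[abs_def] o_def by (intro holomorphic_on_mult holomorphic_bergman_kernel z)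
    have eq: "complex_of_real ((cmod (g w))\<^sup>2) = of_real ((cmod (f (phi z w)))\<^sup>2) * of_real (berezin_kernel z w)" for w
      by (simp add: g_def norm_mult power_mult_distrib flip: cmod_bergman_kernel)
    have [measurable]: "f \<in> borel_measurable dA" using fs by measurable
    have fm: "(\<lambda>w. complex_of_real ((cmod (f w))\<^sup>2)) \<in> borel_measurable dA" by measurable
    have "integrable dA (\<lambda>w. complex_of_real ((cmod (g w))\<^sup>2))"
      unfolding eq using integrable_phi_kernel[OF z fm] fs by (simp add: square_integrable_def del: of_real_power)
    then have "integrable dA (\<lambda>w. (cmod (g w))\<^sup>2)" unfolding complex_of_real_integrable_eq .
    then have gs: "square_integrable g"
      using hol by (auto simp: square_integrable_def intro!: borel_measurable_dA_continuous holomorphic_on_imp_continuous_on)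
    have "complex_of_real (L2_square g) = (LINT w|dA. complex_of_real ((cmod (g w))\<^sup>2))"
      by (simp add: L2_square_def del: of_real_power)
    also have "\<dots> = complex_of_real (L2_square f)"
      unfolding eq integral_phi_kernel[OF z fm] by (simp add: L2_square_def del: of_real_power)
    finally have "L2_square g = L2_square f" by simp
    moreover have "cmod (g 0) = (1 - (cmod z)\<^sup>2) * cmod (f z)"
      using one_minus_square_pos[OF z] unfolding g_def bergman_kernel_def norm_mult norm_divide norm_of_real by simp
    ultimately show ?thesis using c(2)[OF hol gs] by simp
  qed
  then show ?thesis by (intro exI[of _ c] conjI allI impI c(1))
qed

text \<open>By \<open>evaluation_bound\<close> a norm-bounded sequence is uniformly bounded on
  compact sets, so Montel's theorem applies; Fatou's lemma keeps the limit in the space.\<close>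

lemma bergman_Montel:
  assumes f: "\<And>n. f n \<in> bergman_space" and C: "\<And>n. L2_square (f n) \<le> C"
  shows "\<exists>r g. strict_mono (r :: nat \<Rightarrow> nat) \<and> g \<in> bergman_space \<and> L2_square g \<le> C \<and>
    (\<forall>z. (\<lambda>n. f (r n) z) \<longlonglongrightarrow> g z) \<and> (\<forall>R<1. uniform_limit (cball 0 R) (\<lambda>n. f (r n)) g sequentially)"
proof -
  obtain c where c: "0 < c" "\<And>f z. f \<in> bergman_space \<Longrightarrow> cmod z < 1 \<Longrightarrow> c * ((1 - (cmod z)\<^sup>2) * cmod (f z)) \<le> 1 + L2_square f"
  proof -
    from evaluation_bound obtain c where "0 < c \<and> (\<forall>f z. f \<in> bergman_space \<longrightarrow> cmod z < 1 \<longrightarrow> c * ((1 - (cmod z)\<^sup>2) * cmod (f z)) \<le> 1 + L2_square f)"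
      by (rule exE)
    then show ?thesis by (intro that) auto
  qed
  obtain g r where g: "g holomorphic_on disk" "strict_mono (r :: nat \<Rightarrow> nat)" "\<And>x. x \<in> disk \<Longrightarrow> (\<lambda>n. f (r n) x) \<longlonglongrightarrow> g x"
    "\<And>K. compact K \<Longrightarrow> K \<subseteq> disk \<Longrightarrow> uniform_limit K (f \<circ> r) g sequentially"
  proof (rule Montel[of disk "range f" f])
    fix K :: "complex set" assume K: "compact K" "K \<subseteq> disk"
    have "\<exists>m>0. \<forall>z\<in>K. m \<le> 1 - (cmod z)\<^sup>2"
    proof (cases "K = {}")
      case False
      have "continuous_on K (\<lambda>z. 1 - (cmod z)\<^sup>2)" by (intro continuous_intros)
      from continuous_attains_inf[OF K(1) False this] obtain a where a: "a \<in> K" "\<forall>z\<in>K. 1 - (cmod a)\<^sup>2 \<le> 1 - (cmod z)\<^sup>2" by blast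
      have "cmod a < 1" using a(1) K(2) by auto
      from one_minus_square_pos[OF this] a(2) show ?thesis by (intro exI[of _ "1 - (cmod a)\<^sup>2"] conjI)
    qed (auto intro: exI[of _ 1])
    then obtain m where m: "0 < m" "\<And>z. z \<in> K \<Longrightarrow> m \<le> 1 - (cmod z)\<^sup>2" by blast
    show "\<exists>B. \<forall>h\<in>range f. \<forall>z\<in>K. cmod (h z) \<le> B"
    proof (intro exI ballI)
      fix h z assume h: "h \<in> range f" and z: "z \<in> K"
      have "h \<in> bergman_space" "L2_square h \<le> C" using h f C by auto
      moreover have "cmod z < 1" using z K(2) by auto
      ultimately have "c * ((1 - (cmod z)\<^sup>2) * cmod (h z)) \<le> 1 + C" using c(2)[of h z] by linarith
      moreover have "c * (m * cmod (h z)) \<le> c * ((1 - (cmod z)\<^sup>2) * cmod (h z))"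
        using c(1) m(2)[OF z] by (intro mult_left_mono mult_right_mono) auto
      ultimately have "(c * m) * cmod (h z) \<le> 1 + C" by (simp only: mult.assoc)
      then show "cmod (h z) \<le> (1 + C) / (c * m)" using c(1) m(1) by (simp add: pos_le_divide_eq mult.commute)
    qed
  qed (use f bergman_space_holomorphic in auto)
  define g0 where "g0 z = (if z \<in> disk then g z else 0)" for z
  have lim: "(\<lambda>n. f (r n) z) \<longlonglongrightarrow> g0 z" for z
  proof (cases "z \<in> disk")
    case False
    then have "f n z = 0" for n using f[of n] by (simp add: bergman_space_def)
    then show ?thesis using False by (simp add: g0_def)
  qed (use g(3) in \<open>simp add: g0_def\<close>)
  have F: "square_integrable g0" "L2_square g0 \<le> C"
    by (rule L2_square_Fatou[of "\<lambda>n. f (r n)" g0 "\<lambda>_. C" C];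
        use f C lim in \<open>simp add: bergman_space_square_integrable\<close>)+
  have hol: "g0 holomorphic_on disk" using g(1) by (rule holomorphic_transform) (simp add: g0_def)
  have bs: "g0 \<in> bergman_space" by (rule bergman_spaceI[OF hol F(1)]) (simp add: g0_def)
  have ul: "uniform_limit (cball 0 R) (\<lambda>n. f (r n)) g0 sequentially" if "R < 1" for R
  proof -
    have "cball 0 R \<subseteq> disk" using that by auto
    from g(4)[OF compact_cball this] show ?thesis
      by (rule uniform_limit_cong[THEN iffD1, rotated -1]) (use that in \<open>auto simp: g0_def\<close>)
  qed
  show ?thesis by (intro exI[of _ r] exI[of _ g0] conjI allI impI g(2) bs F(2) lim ul)
qed

text \<open>A minimizing sequence has a locally uniform limit by Montel's theorem, and by Fatou's lemma the
  limit attains the minimum; completeness of the Bergman space is not needed.\<close>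

lemma bergman_proj_exists:
  assumes g: "square_integrable g"
  shows "\<exists>h\<in>bergman_space. \<forall>f\<in>bergman_space. L2_inner (\<lambda>z. g z - h z) f = 0"
proof -
  define d where "d = Inf ((\<lambda>h. L2_square (\<lambda>z. g z - h z)) ` bergman_space)"
  have ne: "(\<lambda>h. L2_square (\<lambda>z. g z - h z)) ` bergman_space \<noteq> {}" using bergman_space_0 by blast
  have bb: "bdd_below ((\<lambda>h. L2_square (\<lambda>z. g z - h z)) ` bergman_space)" by (intro bdd_belowI[of _ 0]) auto
  have "\<exists>h\<in>bergman_space. L2_square (\<lambda>z. g z - h z) < d + inverse (real (Suc n))" for n
  proof -
    have "\<exists>x\<in>(\<lambda>h. L2_square (\<lambda>z. g z - h z)) ` bergman_space. x < d + inverse (real (Suc n))"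
      unfolding d_def by (rule cInf_lessD[OF ne]) (simp del: of_nat_Suc)
    then show ?thesis by (auto simp del: of_nat_Suc)
  qed
  then have "\<forall>n. \<exists>h. h \<in> bergman_space \<and> L2_square (\<lambda>z. g z - h z) < d + inverse (real (Suc n))" by blast
  from choice[OF this] obtain h where h': "\<forall>n. h n \<in> bergman_space \<and> L2_square (\<lambda>z. g z - h n z) < d + inverse (real (Suc n))"
    by (rule exE)
  then have h: "h n \<in> bergman_space" "L2_square (\<lambda>z. g z - h n z) \<le> d + inverse (real (Suc n))" for n
    by (simp_all add: less_imp_le del: of_nat_Suc)
  have "L2_square (h n) \<le> 2 * L2_square g + 2 * (d + 1)" for n
  proof -
    have hs: "square_integrable (h n)" by (rule bergman_space_square_integrable[OF h(1)])
    have "L2_square (\<lambda>z. g z - (g z - h n z)) \<le> 2 * L2_square g + 2 * L2_square (\<lambda>z. g z - h n z)"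
      by (rule square_integrable_diff(2)[OF g square_integrable_diff(1)[OF g hs]])
    moreover have "inverse (real (Suc n)) \<le> 1" by (simp add: inverse_le_1_iff)
    ultimately show ?thesis using h(2)[of n] by simp
  qed
  from bergman_Montel[where f = h, OF h(1) this] obtain r k where r: "strict_mono (r :: nat \<Rightarrow> nat)" and k: "k \<in> bergman_space"
    and lim': "\<forall>z. (\<lambda>n. h (r n) z) \<longlonglongrightarrow> k z" by (elim exE conjE)
  have lim: "(\<lambda>n. h (r n) z) \<longlonglongrightarrow> k z" for z using lim' by (rule spec)
  have ks: "square_integrable k" by (rule bergman_space_square_integrable[OF k])
  have "(\<lambda>n. d + inverse (real (Suc (r n)))) \<longlonglongrightarrow> d + 0"
    using LIMSEQ_subseq_LIMSEQ[OF LIMSEQ_inverse_real_of_nat r] by (intro tendsto_intros) (simp add: o_def)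
  then have dlim: "(\<lambda>n. d + inverse (real (Suc (r n)))) \<longlonglongrightarrow> d" by simp
  have min: "L2_square (\<lambda>z. g z - k z) \<le> d"
  proof (rule L2_square_Fatou(2)[where F = "\<lambda>n z. g z - h (r n) z", OF _ _ h(2) dlim])
    show "square_integrable (\<lambda>z. g z - h (r n) z)" for n
      by (rule square_integrable_diff(1)[OF g bergman_space_square_integrable[OF h(1)]])
    show "(\<lambda>n. g z - h (r n) z) \<longlonglongrightarrow> g z - k z" for z by (intro tendsto_diff tendsto_const lim)
  qed
  have "L2_inner (\<lambda>z. g z - k z) f = 0" if f: "f \<in> bergman_space" for f
  proof -
    have fs: "square_integrable f" by (rule bergman_space_square_integrable[OF f])
    define I where "I = L2_inner (\<lambda>z. g z - k z) f"
    \<comment> \<open>Step length of the variation \<open>k + s I f\<close> of the minimizer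
      \<open>k\<close>; since s times the squared norm of \<open>f\<close> is below 1, the gain 2 s
      |I|^2 outweighs the quadratic term unless I = 0.\<close>
    define s where "s = inverse (L2_square f + 1)"
    have s: "0 < s" "s * L2_square f < 1"
    proof -
      have "0 < L2_square f + 1" using L2_square_nonneg[of f] by linarith
      then show "0 < s" "s * L2_square f < 1" by (simp_all add: s_def field_simps)
    qed
    have "(\<lambda>z. k z + of_real s * I * f z) \<in> bergman_space" by (rule bergman_space_add_cmult[OF k f])
    from imageI[OF this, of "\<lambda>h. L2_square (\<lambda>z. g z - h z)"]
    have "d \<le> L2_square (\<lambda>z. g z - (k z + of_real s * I * f z))" unfolding d_def by (rule cInf_lower[OF _ bb])
    also have "\<dots> = L2_square (\<lambda>z. (g z - k z) - (of_real s * I) * f z)" by (simp only: diff_diff_eq)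
    also have "\<dots> = L2_square (\<lambda>z. g z - k z) - 2 * Re (cnj (of_real s * I) * I) + (cmod (of_real s * I))\<^sup>2 * L2_square f"
      unfolding I_def by (rule L2_square_diff_cmult[OF square_integrable_diff(1)[OF g ks] fs])
    also have "Re (cnj (of_real s * I) * I) = s * (cmod I)\<^sup>2" unfolding cmod_power2 by (simp add: power2_eq_square algebra_simps)
    also have "(cmod (of_real s * I))\<^sup>2 * L2_square f = s * (cmod I)\<^sup>2 * (s * L2_square f)"
      by (simp add: norm_mult power_mult_distrib power2_eq_square)
    finally have "0 \<le> s * (cmod I)\<^sup>2 * (s * L2_square f) - 2 * (s * (cmod I)\<^sup>2)" using min by linarith
    moreover have "s * (cmod I)\<^sup>2 * (s * L2_square f) \<le> s * (cmod I)\<^sup>2 * 1" using s by (intro mult_left_mono) auto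
    ultimately have "s * (cmod I)\<^sup>2 \<le> 0" by linarith
    then have "(cmod I)\<^sup>2 \<le> 0" using s(1) by (simp add: mult_le_0_iff)
    then show ?thesis by (simp add: I_def)
  qed
  then show ?thesis using k by blast
qed

text \<open>Two candidates differ by an element of the Bergman space orthogonal to itself, so the
  definite description is unambiguous.\<close>

lemma bergman_proj_eqI:
  assumes g: "square_integrable g" and h: "h \<in> bergman_space" "\<And>f. f \<in> bergman_space \<Longrightarrow> L2_inner (\<lambda>z. g z - h z) f = 0"
  shows "bergman_proj g = h"
  unfolding bergman_proj_def
proof (rule the_equality)
  show "h \<in> bergman_space \<and> (\<forall>f\<in>bergman_space. L2_inner (\<lambda>z. g z - h z) f = 0)" using h by blast
  fix k assume k: "k \<in> bergman_space \<and> (\<forall>f\<in>bergman_space. L2_inner (\<lambda>z. g z - k z) f = 0)"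
  note hs = bergman_space_square_integrable[OF h(1)]
  have ks: "square_integrable k" using k bergman_space_square_integrable by blast
  define f where "f z = k z - h z" for z
  have f: "f \<in> bergman_space" unfolding f_def[abs_def] using k h(1) by (intro bergman_space_diff) auto
  have "L2_inner (\<lambda>z. (g z - h z) - (g z - k z)) f = 0"
    using L2_inner_diff_left[OF square_integrable_diff(1)[OF g hs] square_integrable_diff(1)[OF g ks] bergman_space_square_integrable[OF f]]
      h(2)[OF f] k f by simp
  moreover have "(\<lambda>z. (g z - h z) - (g z - k z)) = f" by (simp add: f_def fun_eq_iff)
  ultimately have "L2_inner f f = 0" by simp
  moreover have "L2_inner f f = of_real (L2_square f)"
    unfolding L2_inner_def L2_square_def complex_norm_square[symmetric] by (rule integral_complex_of_real)
  ultimately have "L2_square f = 0" by simp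
  then show "k = h" using k h(1) unfolding f_def[abs_def] by (intro bergman_space_eqI) auto
qed

lemma bergman_proj:
  assumes "square_integrable g"
  shows "bergman_proj g \<in> bergman_space" "f \<in> bergman_space \<Longrightarrow> L2_inner (\<lambda>z. g z - bergman_proj g z) f = 0"
proof -
  obtain h where h: "h \<in> bergman_space" "\<forall>f\<in>bergman_space. L2_inner (\<lambda>z. g z - h z) f = 0"
    using bergman_proj_exists[OF assms] by (elim bexE)
  have eq: "bergman_proj g = h" by (rule bergman_proj_eqI[OF assms h(1)]) (use h(2) in blast)
  show "bergman_proj g \<in> bergman_space" "f \<in> bergman_space \<Longrightarrow> L2_inner (\<lambda>z. g z - bergman_proj g z) f = 0"
    unfolding eq using h by auto
qed

lemma bergman_proj_diff:
  assumes f: "square_integrable f" and g: "square_integrable g"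
  shows "bergman_proj (\<lambda>z. f z - g z) = (\<lambda>z. bergman_proj f z - bergman_proj g z)"
proof (rule bergman_proj_eqI)
  show "square_integrable (\<lambda>z. f z - g z)" by (rule square_integrable_diff(1)[OF f g])
  show "(\<lambda>z. bergman_proj f z - bergman_proj g z) \<in> bergman_space"
    by (intro bergman_space_diff bergman_proj f g)
  fix k assume k: "k \<in> bergman_space"
  have "L2_inner (\<lambda>z. (f z - bergman_proj f z) - (g z - bergman_proj g z)) k = 0"
    using bergman_proj(2)[OF f k] bergman_proj(2)[OF g k]
    by (subst L2_inner_diff_left)
      (simp_all add: f g k square_integrable_diff bergman_space_square_integrable bergman_proj)
  then show "L2_inner (\<lambda>z. f z - g z - (bergman_proj f z - bergman_proj g z)) k = 0"
    by (simp only: diff_diff_eq2 diff_diff_eq add_diff_eq diff_add_eq add_ac diff_right_commute)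
qed

text \<open>Pythagoras for the orthogonal summands \<open>g - bergman_proj g\<close> and
  \<open>bergman_proj g\<close>.\<close>

lemma bergman_proj_L2_square_le:
  assumes g: "square_integrable g"
  shows "L2_square (bergman_proj g) \<le> L2_square g"
proof -
  note P = bergman_proj(1)[OF g]
  note Ps = bergman_space_square_integrable[OF P]
  have "L2_square (\<lambda>z. (g z - bergman_proj g z) - (-1) * bergman_proj g z) =
    L2_square (\<lambda>z. g z - bergman_proj g z) + L2_square (bergman_proj g)"
    using L2_square_diff_cmult[OF square_integrable_diff(1)[OF g Ps] Ps, of "-1"] bergman_proj(2)[OF g P] by simp
  then show ?thesis using L2_square_nonneg[of "\<lambda>z. g z - bergman_proj g z"] by simp
qed

section \<open>Compact Toeplitz operators\<close>

lemma eventually_to_boundary_iff: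
  "eventually P to_boundary \<longleftrightarrow> (\<exists>R<1. \<forall>z. R < cmod z \<longrightarrow> cmod z < 1 \<longrightarrow> P z)"
proof
  assume "eventually P to_boundary"
  then obtain Q where Q: "eventually Q (nhds 1)" "\<And>z. z \<in> disk \<Longrightarrow> Q (cmod z) \<Longrightarrow> P z"
    unfolding to_boundary_def going_to_within_def eventually_inf_principal eventually_filtercomap by blast
  obtain d where d: "d > 0" "\<And>x::real. dist x 1 < d \<Longrightarrow> Q x" using Q(1) unfolding eventually_nhds_metric by blast
  have "P z" if "1 - d < cmod z" "cmod z < 1" for z
    using that by (intro Q(2) d(2)) (auto simp: dist_real_def)
  then show "\<exists>R<1. \<forall>z. R < cmod z \<longrightarrow> cmod z < 1 \<longrightarrow> P z" using d(1) by (intro exI[of _ "1 - d"]) auto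
next
  assume "\<exists>R<1. \<forall>z. R < cmod z \<longrightarrow> cmod z < 1 \<longrightarrow> P z"
  then obtain R where R: "R < 1" "\<And>z. R < cmod z \<Longrightarrow> cmod z < 1 \<Longrightarrow> P z" by blast
  have "((\<lambda>z. cmod z) \<longlongrightarrow> 1) to_boundary" using le_to_boundary[of to_boundary] by simp
  then have "\<forall>\<^sub>F z in to_boundary. R < cmod z" using R(1) by (rule order_tendstoD)
  with eventually_to_boundary show "eventually P to_boundary" by eventually_elim (use R in auto)
qed

text \<open>On a compact subset of the disk Montel's theorem gives uniform convergence; near the boundary
  \<open>v\<close> is small.\<close>

theorem vanishing_symbol_imp_compact:
  assumes v: "bounded_measurable v" and lim: "(v \<longlongrightarrow> 0) to_boundary"
  shows "compact_on_bergman (\<lambda>f. bergman_proj (\<lambda>z. v z * f z))"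
  unfolding compact_on_bergman_def
proof (intro allI impI)
  fix f :: "nat \<Rightarrow> complex \<Rightarrow> complex"
  assume fC: "(\<forall>n. f n \<in> bergman_space) \<and> (\<exists>C. \<forall>n. L2_norm (f n) \<le> C)"
  then have f: "f n \<in> bergman_space" for n by blast
  obtain C where C: "\<And>n. L2_norm (f n) \<le> C" using fC by blast
  have "L2_square (f n) \<le> C\<^sup>2" for n
    using power_mono[OF C[of n], of 2] by (simp add: L2_norm_eq)
  from bergman_Montel[where f = f, OF f this] obtain r g where r: "strict_mono (r :: nat \<Rightarrow> nat)"
    and g: "g \<in> bergman_space" and unif: "\<forall>R<1. uniform_limit (cball 0 R) (\<lambda>n. f (r n)) g sequentially"
    by (elim exE conjE)
  obtain V where V: "0 \<le> V" "\<And>z. cmod z < 1 \<Longrightarrow> cmod (v z) \<le> V" using bounded_measurableE[OF v] by metis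
  define h where "h n z = f (r n) z - g z" for n z
  have h: "h n \<in> bergman_space" for n unfolding h_def[abs_def] by (intro bergman_space_diff f g)
  have hs: "square_integrable (h n)" for n by (rule bergman_space_square_integrable[OF h])
  have vs: "square_integrable (\<lambda>z. v z * k z)" if "k \<in> bergman_space" for k
    by (intro bounded_mult_square_integrable v bergman_space_square_integrable that)
  define K where "K = 2 * C\<^sup>2 + 2 * L2_square g"
  have hK: "L2_square (h n) \<le> K" for n
    using square_integrable_diff(2)[OF bergman_space_square_integrable[OF f] bergman_space_square_integrable[OF g], of "r n"]
      \<open>L2_square (f (r n)) \<le> C\<^sup>2\<close> unfolding h_def K_def by linarith
  have K: "0 \<le> K" using L2_square_nonneg[of g] by (simp add: K_def)
  have small: "\<forall>\<^sub>F n in sequentially. L2_square (\<lambda>z. v z * h n z) \<le> e\<^sup>2 * (V\<^sup>2 + K)" if e: "e > 0" for e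
  proof -
    have "\<forall>\<^sub>F z in to_boundary. cmod (v z) < e" using tendstoD[OF lim e] by simp
    then obtain R where R: "R < 1" "\<And>z. R < cmod z \<Longrightarrow> cmod z < 1 \<Longrightarrow> cmod (v z) < e"
      unfolding eventually_to_boundary_iff by blast
    have "\<forall>\<^sub>F n in sequentially. \<forall>z\<in>cball 0 R. dist (f (r n) z) (g z) < e"
      using unif R(1) e unfolding uniform_limit_iff by blast
    then show ?thesis
    proof eventually_elim
      case (elim n)
      have [measurable]: "v \<in> borel_measurable dA" "h n \<in> borel_measurable dA" using v hs by measurable
      have "L2_square (\<lambda>z. v z * h n z) \<le> (LINT z|dA. V\<^sup>2 * e\<^sup>2 + e\<^sup>2 * (cmod (h n z))\<^sup>2)"
      proof (rule square_integrableI(2))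
        show "integrable dA (\<lambda>z. V\<^sup>2 * e\<^sup>2 + e\<^sup>2 * (cmod (h n z))\<^sup>2)" using hs by (simp add: square_integrable_def)
        fix z :: complex assume z: "cmod z < 1"
        show "(cmod (v z * h n z))\<^sup>2 \<le> V\<^sup>2 * e\<^sup>2 + e\<^sup>2 * (cmod (h n z))\<^sup>2"
        proof (cases "cmod z \<le> R")
          case True
          then have "cmod (h n z) \<le> e" using elim by (simp add: h_def dist_norm less_imp_le)
          then have "(cmod (v z))\<^sup>2 * (cmod (h n z))\<^sup>2 \<le> V\<^sup>2 * e\<^sup>2" using V z by (intro mult_mono power_mono) auto
          moreover have "0 \<le> e\<^sup>2 * (cmod (h n z))\<^sup>2" by simp
          ultimately show ?thesis unfolding norm_mult power_mult_distrib by linarith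
        next
          case False
          then have "(cmod (v z))\<^sup>2 * (cmod (h n z))\<^sup>2 \<le> e\<^sup>2 * (cmod (h n z))\<^sup>2"
            using R(2)[of z] z by (intro mult_right_mono power_mono) auto
          moreover have "0 \<le> V\<^sup>2 * e\<^sup>2" by simp
          ultimately show ?thesis unfolding norm_mult power_mult_distrib by linarith
        qed
      qed measurable
      also have "\<dots> = V\<^sup>2 * e\<^sup>2 + e\<^sup>2 * L2_square (h n)" using hs by (simp add: square_integrable_def L2_square_def)
      also have "\<dots> \<le> V\<^sup>2 * e\<^sup>2 + e\<^sup>2 * K" using hK by (intro add_left_mono mult_left_mono) auto
      finally show ?case by (simp add: algebra_simps)
    qed
  qed
  have "(\<lambda>n. L2_square (\<lambda>z. v z * h n z)) \<longlonglongrightarrow> 0"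
  proof (rule tendstoI)
    fix e :: real assume e: "0 < e"
    have VK: "0 < V\<^sup>2 + K + 1" using K by (simp add: add_nonneg_pos)
    \<comment> \<open>The summand 1 keeps the denominator positive and makes the final inequality
      strict.\<close>
    define d where "d = sqrt (e / (V\<^sup>2 + K + 1))"
    have d: "0 < d" "d\<^sup>2 = e / (V\<^sup>2 + K + 1)" using e VK by (auto simp: d_def)
    have "d\<^sup>2 * (V\<^sup>2 + K) < d\<^sup>2 * (V\<^sup>2 + K + 1)" using d(1) by (intro mult_strict_left_mono) auto
    also have "\<dots> = e" using VK by (simp add: d(2))
    finally have lt: "d\<^sup>2 * (V\<^sup>2 + K) < e" .
    show "\<forall>\<^sub>F n in sequentially. dist (L2_square (\<lambda>z. v z * h n z)) 0 < e"
      by (rule eventually_mono[OF small[OF d(1)]]) (use lt in \<open>simp add: dist_real_def\<close>)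
  qed
  then have vh: "(\<lambda>n. sqrt (L2_square (\<lambda>z. v z * h n z))) \<longlonglongrightarrow> 0" using tendsto_real_sqrt by fastforce
  have eq: "(\<lambda>z. bergman_proj (\<lambda>z. v z * f (r n) z) z - bergman_proj (\<lambda>z. v z * g z) z) = bergman_proj (\<lambda>z. v z * h n z)" for n
    using bergman_proj_diff[OF vs[OF f] vs[OF g], of "r n"] by (simp add: h_def right_diff_distrib)
  have "(\<lambda>n. L2_norm (\<lambda>z. bergman_proj (\<lambda>z. v z * f (r n) z) z - bergman_proj (\<lambda>z. v z * g z) z)) \<longlonglongrightarrow> 0"
    unfolding eq L2_norm_eq
  proof (rule tendsto_sandwich[OF _ _ tendsto_const vh])
    show "\<forall>\<^sub>F n in sequentially. sqrt (L2_square (bergman_proj (\<lambda>z. v z * h n z))) \<le> sqrt (L2_square (\<lambda>z. v z * h n z))"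
      by (intro always_eventually allI real_sqrt_le_mono bergman_proj_L2_square_le vs h)
  qed simp
  then show "\<exists>r g. strict_mono r \<and> g \<in> bergman_space \<and>
      (\<lambda>n. L2_norm (\<lambda>z. bergman_proj (\<lambda>z. v z * f (r n) z) z - g z)) \<longlonglongrightarrow> 0"
    by (intro exI[of _ r] exI[of _ "bergman_proj (\<lambda>z. v z * g z)"] conjI r bergman_proj(1) vs g)
qed

text \<open>The kernel is cut off because members of \<open>bergman_space\<close> vanish off the
  disk.\<close>

definition normalized_kernel :: "complex \<Rightarrow> complex \<Rightarrow> complex" where
  "normalized_kernel z w = (if w \<in> disk then bergman_kernel z w else 0)"

lemma bounded_measurable_cong:
  assumes "bounded_measurable f" "\<And>z. cmod z < 1 \<Longrightarrow> f z = g z"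
  shows "bounded_measurable g"
proof -
  obtain C where C: "0 \<le> C" "\<And>z. cmod z < 1 \<Longrightarrow> cmod (f z) \<le> C" using bounded_measurableE[OF assms(1)] by metis
  have "g \<in> borel_measurable dA \<longleftrightarrow> f \<in> borel_measurable dA" by (rule measurable_cong) (simp add: assms(2))
  then show ?thesis
    using bounded_measurable_imp_measurable[OF assms(1)] C(2) assms(2) by (intro bounded_measurableI[of _ C]) auto
qed

lemma normalized_kernel:
  assumes z: "cmod z < 1"
  shows "normalized_kernel z \<in> bergman_space" "L2_square (normalized_kernel z) = 1"
    and "bounded_measurable v \<Longrightarrow> L2_inner (\<lambda>w. v w * normalized_kernel z w) (normalized_kernel z) = berezin v z"
proof -
  have hol: "normalized_kernel z holomorphic_on disk"
    by (rule holomorphic_transform[OF holomorphic_bergman_kernel[OF z]]) (simp add: normalized_kernel_def)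
  have bm: "bounded_measurable (normalized_kernel z)"
    by (rule bounded_measurable_cong[OF bounded_measurable_bergman_kernel[OF z]]) (simp add: normalized_kernel_def)
  show "normalized_kernel z \<in> bergman_space"
    by (rule bergman_spaceI[OF hol bounded_square_integrable[OF bm]]) (simp add: normalized_kernel_def)
  have "L2_square (normalized_kernel z) = (LINT w|dA. berezin_kernel z w)"
    unfolding L2_square_def by (intro Bochner_Integration.integral_cong) (auto simp: normalized_kernel_def cmod_bergman_kernel)
  then show "L2_square (normalized_kernel z) = 1" using integral_berezin_kernel[OF z] by simp
  show "L2_inner (\<lambda>w. v w * normalized_kernel z w) (normalized_kernel z) = berezin v z"
    unfolding L2_inner_def berezin_def mult.assoc complex_norm_square[symmetric]
    by (intro Bochner_Integration.integral_cong) (auto simp: normalized_kernel_def)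
qed

text \<open>The part of \<open>g\<close> near the boundary is small in norm and is paired with unit
  vectors; on a smaller disk the kernels tend to 0 uniformly, at the rate 1 - |z|^2.\<close>

lemma normalized_kernel_weakly_null:
  assumes g: "square_integrable g" and z: "\<And>n. cmod (z n) < 1" "(\<lambda>n. cmod (z n)) \<longlonglongrightarrow> 1"
  shows "(\<lambda>n. L2_inner g (normalized_kernel (z n))) \<longlonglongrightarrow> 0"
proof (rule tendstoI)
  fix e :: real assume e: "0 < e"
  have [measurable]: "g \<in> borel_measurable dA" using g by measurable
  define R where "R N = 1 - inverse (real (Suc N))" for N
  define G where "G N w = (if R N < cmod w then g w else 0)" for N w
  have G [measurable]: "G N \<in> borel_measurable dA" for N unfolding G_def[abs_def] by measurable
  have R1: "R N < 1" for N by (simp add: R_def del: of_nat_Suc)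
  have Rlim: "R \<longlonglongrightarrow> 1" unfolding R_def[abs_def] using tendsto_diff[OF tendsto_const[of 1] LIMSEQ_inverse_real_of_nat] by simp
  have gi: "integrable dA (\<lambda>w. (cmod (g w))\<^sup>2)" using g by (simp add: square_integrable_def)
  have Gs: "square_integrable (G N)" for N by (rule square_integrableI(1)[OF G gi]) (simp add: G_def)
  have "(\<lambda>N. L2_square (G N)) \<longlonglongrightarrow> (LINT w|dA. (0::real))"
    unfolding L2_square_def
  proof (rule integral_dominated_convergence[OF _ _ gi])
    show "AE w in dA. (\<lambda>N. (cmod (G N w))\<^sup>2) \<longlonglongrightarrow> 0"
    proof (rule AE_I2, rule tendsto_eventually)
      fix w assume "w \<in> space dA"
      then have "\<forall>\<^sub>F N in sequentially. cmod w < R N" by (intro order_tendstoD[OF Rlim]) simp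
      then show "\<forall>\<^sub>F N in sequentially. (cmod (G N w))\<^sup>2 = 0" by eventually_elim (simp add: G_def)
    qed
    show "AE w in dA. norm ((cmod (G N w))\<^sup>2) \<le> (cmod (g w))\<^sup>2" for N by (intro AE_I2) (simp add: G_def)
  qed measurable
  then have "\<forall>\<^sub>F N in sequentially. L2_square (G N) < (e / 2)\<^sup>2" using e by (intro order_tendstoD) auto
  then obtain N where N: "L2_square (G N) < (e / 2)\<^sup>2" by (auto simp: eventually_sequentially)
  define H where "H w = g w - G N w" for w
  have Hs: "square_integrable H" unfolding H_def[abs_def] by (rule square_integrable_diff(1)[OF g Gs])
  define b where "b n = (1 + L2_square g) * ((1 - (cmod (z n))\<^sup>2) / (1 - R N)\<^sup>2)" for n
  have "(\<lambda>n. b n) \<longlonglongrightarrow> (1 + L2_square g) * ((1 - 1\<^sup>2) / (1 - R N)\<^sup>2)"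
    unfolding b_def using R1[of N] by (intro tendsto_intros z(2)) auto
  then have "\<forall>\<^sub>F n in sequentially. b n < e / 2" using e by (intro order_tendstoD) auto
  then show "\<forall>\<^sub>F n in sequentially. dist (L2_inner g (normalized_kernel (z n))) 0 < e"
  proof eventually_elim
    case (elim n)
    note k = normalized_kernel[OF z(1)[of n]]
    note ks = bergman_space_square_integrable[OF k(1)]
    \<comment> \<open>The weight t = e/2 is matched to a squared norm below (e/2)^2 and the unit
      norm of the kernel.\<close>
    have "cmod (L2_inner (G N) (normalized_kernel (z n))) \<le> (L2_square (G N) / (e / 2) + e / 2 * L2_square (normalized_kernel (z n))) / 2"
      using e by (intro L2_inner_integrable(2) Gs ks) simp
    also have "\<dots> < ((e / 2)\<^sup>2 / (e / 2) + e / 2 * 1) / 2" using N e k(2) by (simp add: divide_strict_right_mono)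
    also have "\<dots> = e / 2" using e by (simp add: power2_eq_square)
    finally have 1: "cmod (L2_inner (G N) (normalized_kernel (z n))) < e / 2" .
    have "cmod (L2_inner H (normalized_kernel (z n))) \<le> (LINT w|dA. (1 + (cmod (g w))\<^sup>2) * ((1 - (cmod (z n))\<^sup>2) / (1 - R N)\<^sup>2))"
      unfolding L2_inner_def
    proof (rule norm_integral_le[OF L2_inner_integrable(1)[OF Hs ks]])
      show "integrable dA (\<lambda>w. (1 + (cmod (g w))\<^sup>2) * ((1 - (cmod (z n))\<^sup>2) / (1 - R N)\<^sup>2))" using gi by simp
      fix w :: complex assume w: "cmod w < 1"
      have pos: "0 \<le> (1 - (cmod (z n))\<^sup>2) / (1 - R N)\<^sup>2" using one_minus_square_pos[OF z(1)[of n]] by simp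
      show "cmod (H w * cnj (normalized_kernel (z n) w)) \<le> (1 + (cmod (g w))\<^sup>2) * ((1 - (cmod (z n))\<^sup>2) / (1 - R N)\<^sup>2)"
      proof (cases "R N < cmod w")
        case True
        then have "H w = 0" by (simp add: H_def G_def)
        moreover have "0 \<le> (1 + (cmod (g w))\<^sup>2) * ((1 - (cmod (z n))\<^sup>2) / (1 - R N)\<^sup>2)"
          using pos by (rule mult_nonneg_nonneg[rotated]) (simp add: add_nonneg_nonneg)
        ultimately show ?thesis by simp
      next
        case False
        have "1 - R N \<le> cmod (1 - cnj (z n) * w)" 
          using cmod_one_minus_ge(2)[OF less_imp_le[OF z(1)[of n]] w] False by linarith
        then have "(1 - R N)\<^sup>2 \<le> (cmod (1 - cnj (z n) * w))\<^sup>2" using R1[of N] by (intro power_mono) auto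
        then have "(1 - (cmod (z n))\<^sup>2) / (cmod (1 - cnj (z n) * w))\<^sup>2 \<le> (1 - (cmod (z n))\<^sup>2) / (1 - R N)\<^sup>2"
          using one_minus_square_pos[OF z(1)[of n]] R1[of N] by (intro divide_left_mono mult_pos_pos) auto
        moreover have "cmod (normalized_kernel (z n) w) = (1 - (cmod (z n))\<^sup>2) / (cmod (1 - cnj (z n) * w))\<^sup>2"
          using w one_minus_square_pos[OF z(1)[of n]]
          unfolding normalized_kernel_def bergman_kernel_def by (simp add: norm_divide norm_power del: of_real_diff of_real_power)
        ultimately have k: "cmod (normalized_kernel (z n) w) \<le> (1 - (cmod (z n))\<^sup>2) / (1 - R N)\<^sup>2" by simp
        have "2 * cmod (g w) \<le> 1 + (cmod (g w))\<^sup>2"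
          using zero_le_power2[of "cmod (g w) - 1"] by (simp add: power2_eq_square algebra_simps)
        then have "cmod (g w) \<le> 1 + (cmod (g w))\<^sup>2" using norm_ge_zero[of "g w"] by linarith
        then have "cmod (g w) * cmod (normalized_kernel (z n) w) \<le> (1 + (cmod (g w))\<^sup>2) * ((1 - (cmod (z n))\<^sup>2) / (1 - R N)\<^sup>2)"
          using k by (intro mult_mono) auto
        moreover have "H w = g w" using False by (simp add: H_def G_def)
        ultimately show ?thesis by (simp only: norm_mult complex_mod_cnj)
      qed
    qed
    also have "\<dots> = b n" using gi by (simp add: b_def L2_square_def)
    finally have 2: "cmod (L2_inner H (normalized_kernel (z n))) < e / 2" using elim by simp
    have "L2_inner H (normalized_kernel (z n)) = L2_inner g (normalized_kernel (z n)) - L2_inner (G N) (normalized_kernel (z n))"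
      unfolding H_def by (rule L2_inner_diff_left[OF g Gs ks])
    then have "cmod (L2_inner g (normalized_kernel (z n))) \<le> cmod (L2_inner H (normalized_kernel (z n))) + cmod (L2_inner (G N) (normalized_kernel (z n)))"
      using norm_triangle_ineq[of "L2_inner H (normalized_kernel (z n))" "L2_inner (G N) (normalized_kernel (z n))"] by simp
    then show ?case using 1 2 by simp
  qed
qed

text \<open>Compact operators map the weakly null normalized kernels to norm-null sequences, and the
  Berezin transform of \<open>v\<close> is the quadratic form of the Toeplitz operator on them.\<close>

theorem compact_imp_vanishing_berezin:
  assumes v: "bounded_measurable v" and comp: "compact_on_bergman (\<lambda>f. bergman_proj (\<lambda>z. v z * f z))"
  shows "(berezin v \<longlongrightarrow> 0) to_boundary"
proof (rule tendstoI, rule ccontr)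
  fix e :: real assume e: "0 < e" and not_ev: "\<not> (\<forall>\<^sub>F z in to_boundary. dist (berezin v z) 0 < e)"
  have neg: "\<exists>z. R < cmod z \<and> cmod z < 1 \<and> e \<le> cmod (berezin v z)" if R: "R < 1" for R
  proof (rule ccontr)
    assume "\<not> ?thesis"
    then have "\<forall>z. R < cmod z \<longrightarrow> cmod z < 1 \<longrightarrow> dist (berezin v z) 0 < e" by (auto simp: not_le)
    with R have "\<forall>\<^sub>F z in to_boundary. dist (berezin v z) 0 < e"
      unfolding eventually_to_boundary_iff by (intro exI conjI)
    then show False using not_ev by contradiction
  qed
  have "\<forall>n. \<exists>z. 1 - inverse (real (Suc n)) < cmod z \<and> cmod z < 1 \<and> e \<le> cmod (berezin v z)"
    by (intro allI neg) (simp del: of_nat_Suc)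
  from choice[OF this] obtain Z where Z': "\<forall>n. 1 - inverse (real (Suc n)) < cmod (Z n) \<and> cmod (Z n) < 1 \<and> e \<le> cmod (berezin v (Z n))"
    by (rule exE)
  have Z: "1 - inverse (real (Suc n)) \<le> cmod (Z n)" "cmod (Z n) < 1" "e \<le> cmod (berezin v (Z n))" for n
    using spec[OF Z', of n] by (simp_all add: less_imp_le del: of_nat_Suc)
  have Zlim: "(\<lambda>n. cmod (Z n)) \<longlonglongrightarrow> 1"
  proof (rule tendsto_sandwich)
    show "(\<lambda>n. 1 - inverse (real (Suc n))) \<longlonglongrightarrow> 1"
      using tendsto_diff[OF tendsto_const[of 1] LIMSEQ_inverse_real_of_nat] by simp
  qed (use Z in \<open>auto intro!: always_eventually less_imp_le simp del: of_nat_Suc\<close>)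
  define T where "T f = bergman_proj (\<lambda>z. v z * f z)" for f
  define k where "k n = normalized_kernel (Z n)" for n
  have k: "k n \<in> bergman_space" "L2_square (k n) = 1" "L2_inner (\<lambda>w. v w * k n w) (k n) = berezin v (Z n)" for n
    unfolding k_def by (intro normalized_kernel Z v)+
  have ks: "square_integrable (k n)" for n by (rule bergman_space_square_integrable[OF k(1)])
  have vk: "square_integrable (\<lambda>w. v w * k n w)" for n by (rule bounded_mult_square_integrable[OF v ks])
  have "(\<forall>n. k n \<in> bergman_space) \<and> (\<exists>C. \<forall>n. L2_norm (k n) \<le> C)"
    using k by (auto simp: L2_norm_eq intro: exI[of _ 1])
  with comp[unfolded compact_on_bergman_def, rule_format, of k]
  obtain r g where r: "strict_mono (r :: nat \<Rightarrow> nat)" and g: "g \<in> bergman_space"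
    and lim: "(\<lambda>n. L2_norm (\<lambda>z. T (k (r n)) z - g z)) \<longlonglongrightarrow> 0" unfolding T_def by (elim exE conjE impE) auto
  have gs: "square_integrable g" by (rule bergman_space_square_integrable[OF g])
  define a where "a n z = T (k (r n)) z - g z" for n z
  have Tk: "T (k n) \<in> bergman_space" for n unfolding T_def by (rule bergman_proj(1)[OF vk])
  have Tks: "square_integrable (T (k n))" for n by (rule bergman_space_square_integrable[OF Tk])
  have as: "square_integrable (a n)" for n unfolding a_def[abs_def] by (rule square_integrable_diff(1)[OF Tks gs])
  have "(\<lambda>n. (L2_norm (a n))\<^sup>2) \<longlonglongrightarrow> 0\<^sup>2" unfolding a_def by (intro tendsto_power lim)
  then have a0: "(\<lambda>n. L2_square (a n)) \<longlonglongrightarrow> 0" by (simp add: L2_norm_eq)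
  \<comment> \<open>The kernel lies in the Bergman space, so the projection may be dropped in its
    inner product with the Toeplitz image.\<close>
  have eq: "berezin v (Z (r n)) = L2_inner (a n) (k (r n)) + L2_inner g (k (r n))" for n
  proof -
    have "L2_inner (\<lambda>w. v w * k (r n) w) (k (r n)) - L2_inner (T (k (r n))) (k (r n)) = 0"
      using bergman_proj(2)[OF vk k(1), of "r n" "r n"] L2_inner_diff_left[OF vk Tks ks, of "r n" "r n" "r n"]
      unfolding T_def by simp
    moreover have "L2_inner (a n) (k (r n)) = L2_inner (T (k (r n))) (k (r n)) - L2_inner g (k (r n))"
      unfolding a_def by (rule L2_inner_diff_left[OF Tks gs ks])
    ultimately show ?thesis using k(3)[of "r n"] by simp
  qed
  have g0: "(\<lambda>n. L2_inner g (k (r n))) \<longlonglongrightarrow> 0"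
    unfolding k_def
    by (rule normalized_kernel_weakly_null[OF gs Z(2)]) (use LIMSEQ_subseq_LIMSEQ[OF Zlim r] in \<open>simp add: o_def\<close>)
  have "\<forall>\<^sub>F n in sequentially. cmod (L2_inner g (k (r n))) < e / 2"
    using tendstoD[OF g0, of "e / 2"] e by simp
  moreover have "\<forall>\<^sub>F n in sequentially. L2_square (a n) < (e / 2)\<^sup>2" using a0 e by (intro order_tendstoD) auto
  ultimately have "\<forall>\<^sub>F n in sequentially. False"
  proof eventually_elim
    case (elim n)
    have "cmod (L2_inner (a n) (k (r n))) \<le> (L2_square (a n) / (e / 2) + e / 2 * L2_square (k (r n))) / 2"
      using e by (intro L2_inner_integrable(2) as ks) simp
    also have "\<dots> < ((e / 2)\<^sup>2 / (e / 2) + e / 2 * 1) / 2" using elim e k(2)[of "r n"] by (simp add: divide_strict_right_mono)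
    also have "\<dots> = e / 2" using e by (simp add: power2_eq_square)
    finally have "cmod (L2_inner (a n) (k (r n))) < e / 2" .
    then have "cmod (berezin v (Z (r n))) < e"
      unfolding eq using elim(1) norm_triangle_ineq[of "L2_inner (a n) (k (r n))" "L2_inner g (k (r n))"] by linarith
    then show False using Z(3)[of "r n"] by simp
  qed
  then show False by simp
qed

lemma toeplitz_diff:
  assumes "bounded_measurable u" "bounded_measurable v" "f \<in> bergman_space"
  shows "(\<lambda>z. toeplitz u f z - toeplitz v f z) = bergman_proj (\<lambda>z. (u z - v z) * f z)"
proof -
  have "square_integrable (\<lambda>z. w z * f z)" if "bounded_measurable w" for w
    by (intro bounded_mult_square_integrable bergman_space_square_integrable that assms)
  from bergman_proj_diff[OF this[OF assms(1)] this[OF assms(2)]] show ?thesis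
    by (simp add: toeplitz_def left_diff_distrib)
qed

lemma compact_on_bergman_cong:
  assumes "\<And>f. f \<in> bergman_space \<Longrightarrow> S f = T f"
  shows "compact_on_bergman S \<longleftrightarrow> compact_on_bergman T"
proof -
  have "(\<lambda>n. L2_norm (\<lambda>z. S (f (r n)) z - g z)) = (\<lambda>n. L2_norm (\<lambda>z. T (f (r n)) z - g z))"
    if "\<forall>n. f n \<in> bergman_space" for f :: "nat \<Rightarrow> complex \<Rightarrow> complex" and r :: "nat \<Rightarrow> nat" and g
    using assms that by simp
  then show ?thesis unfolding compact_on_bergman_def by (simp cong: conj_cong)
qed

text \<open>With v = B u - u, a vanishing symbol gives compactness, compactness gives vanishing of
  \<open>B v\<close>, and \<open>berezin_limit_iff_berezin_diff\<close> closes the circle.\<close>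

theorem berezin_limit_iff_compact:
  assumes u: "star_approximable u"
  shows "((\<lambda>z. berezin u z - u z) \<longlongrightarrow> 0) to_boundary \<longleftrightarrow>
    compact_on_bergman (\<lambda>f z. toeplitz (berezin u) f z - toeplitz u f z)"
proof -
  define v where "v z = berezin u z - u z" for z
  have bu: "bounded_measurable u" "bounded_measurable (berezin u)"
    using u by (auto intro: star_approximable_measurable star_approximable_berezin)
  have v: "bounded_measurable v" unfolding v_def[abs_def] by (intro bounded_measurable_diff bu)
  have "compact_on_bergman (\<lambda>f z. toeplitz (berezin u) f z - toeplitz u f z) \<longleftrightarrow>
      compact_on_bergman (\<lambda>f. bergman_proj (\<lambda>z. v z * f z))"
    unfolding v_def by (rule compact_on_bergman_cong) (rule toeplitz_diff[OF bu(2,1)])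
  moreover have "(v \<longlongrightarrow> 0) to_boundary \<longleftrightarrow> (berezin v \<longlongrightarrow> 0) to_boundary"
    using berezin_limit_iff_berezin_diff[OF u] unfolding v_def[abs_def] .
  ultimately have "(v \<longlongrightarrow> 0) to_boundary \<longleftrightarrow> compact_on_bergman (\<lambda>f z. toeplitz (berezin u) f z - toeplitz u f z)"
    using vanishing_symbol_imp_compact[OF v] compact_imp_vanishing_berezin[OF v] by blast
  then show ?thesis unfolding v_def[abs_def] .
qed

section \<open>Products of bounded harmonic functions\<close>


text \<open>Bounded harmonic functions lie in the algebra: \<open>Re F\<close> is the logarithm of \<open>\<bar>exp F\<bar>\<close>, and
  \<open>exp F\<close> is bounded and bounded away from 0.\<close>

lemma bounded_Re_tendsto:
  assumes F: "F holomorphic_on disk" and C: "\<And>z. cmod z < 1 \<Longrightarrow> \<bar>Re (F z)\<bar> \<le> C" and m: "m \<in> maxideals"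
  shows "\<exists>l. ((\<lambda>z. Re (F z)) \<longlongrightarrow> l) (disk_to m)"
proof (cases "disk_to m = bot")
  case False
  define E where "E z = (if z \<in> disk then exp (F z) else 0)" for z
  have bounds: "exp (- C) \<le> cmod (exp (F z))" "cmod (exp (F z)) \<le> exp C" if "cmod z < 1" for z
    using C[OF that] by (simp_all add: abs_le_iff)
  have E: "E \<in> Hinf" unfolding E_def[abs_def]
  proof (rule Hinf_restrict)
    show "(\<lambda>z. exp (F z)) holomorphic_on disk" by (intro holomorphic_intros F)
    show "bounded ((\<lambda>z. exp (F z)) ` disk)" unfolding bounded_iff using bounds(2) by (intro exI[of _ "exp C"]) auto
  qed
  have lim: "((\<lambda>z. cmod (E z)) \<longlongrightarrow> cmod (m E)) (disk_to m)" by (intro tendsto_norm tendsto_disk_to m E)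
  have "exp (- C) \<le> cmod (m E)"
    by (rule tendsto_lowerbound[OF lim _ False], rule eventually_mono[OF eventually_disk_to[OF m]])
      (use bounds(1) in \<open>simp add: E_def\<close>)
  then have "cmod (m E) \<noteq> 0" using exp_gt_zero[of "- C"] by linarith
  from tendsto_ln[OF lim this] have "((\<lambda>z. ln (cmod (E z))) \<longlongrightarrow> ln (cmod (m E))) (disk_to m)" .
  moreover have "\<forall>\<^sub>F z in disk_to m. ln (cmod (E z)) = Re (F z)"
    using eventually_disk_to[OF m] by eventually_elim (simp add: E_def)
  ultimately have "((\<lambda>z. Re (F z)) \<longlongrightarrow> ln (cmod (m E))) (disk_to m)" by (rule Lim_transform_eventually)
  then show ?thesis by (rule exI)
qed simp

lemma bounded_harmonic_star_approximable:
  assumes v: "bounded_harmonic v"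
  shows "star_approximable v"
proof (rule star_approximable_criterion)
  show bdd: "bounded (v ` disk)" using v by (simp add: bounded_harmonic_def)
  obtain G H where G: "G holomorphic_on disk" and H: "H holomorphic_on disk" and eq: "\<And>z. cmod z < 1 \<Longrightarrow> v z = G z + cnj (H z)"
    using harmonic_decomposition v unfolding bounded_harmonic_def by metis
  obtain C where C: "\<forall>z\<in>disk. cmod (v z) \<le> C" using bdd unfolding bounded_iff by auto
  fix m assume m: "m \<in> maxideals"
  \<comment> \<open>Both parts of \<open>v\<close> are real parts of holomorphic functions and are
    bounded, although \<open>G\<close> and \<open>H\<close> separately may be unbounded.\<close>
  have Re: "Re (v z) = Re (G z + H z)" and Im: "Im (v z) = Re (- \<i> * (G z - H z))" if "cmod z < 1" for z
    using eq[OF that] by simp_all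
  have le: "\<bar>Re (G z + H z)\<bar> \<le> C" "\<bar>Re (- \<i> * (G z - H z))\<bar> \<le> C" if z: "cmod z < 1" for z
  proof -
    have "cmod (v z) \<le> C" using C z by simp
    then show "\<bar>Re (G z + H z)\<bar> \<le> C" "\<bar>Re (- \<i> * (G z - H z))\<bar> \<le> C"
      unfolding Re[OF z, symmetric] Im[OF z, symmetric]
      using abs_Re_le_cmod[of "v z"] abs_Im_le_cmod[of "v z"] by linarith+
  qed
  have "\<exists>l. ((\<lambda>z. Re (G z + H z)) \<longlongrightarrow> l) (disk_to m)"
    by (rule bounded_Re_tendsto[OF _ le(1) m]) (intro holomorphic_intros G H)
  then obtain a where a: "((\<lambda>z. Re (G z + H z)) \<longlongrightarrow> a) (disk_to m)" by (rule exE)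
  have "\<exists>l. ((\<lambda>z. Re (- \<i> * (G z - H z))) \<longlongrightarrow> l) (disk_to m)"
    by (rule bounded_Re_tendsto[OF _ le(2) m]) (intro holomorphic_intros G H)
  then obtain b where b: "((\<lambda>z. Re (- \<i> * (G z - H z))) \<longlongrightarrow> b) (disk_to m)" by (rule exE)
  have "((\<lambda>z. Complex (Re (G z + H z)) (Re (- \<i> * (G z - H z)))) \<longlongrightarrow> Complex a b) (disk_to m)"
    by (intro tendsto_Complex a b)
  moreover have "\<forall>\<^sub>F z in disk_to m. Complex (Re (G z + H z)) (Re (- \<i> * (G z - H z))) = v z"
    using eventually_disk_to[OF m]
  proof eventually_elim
    case (elim z)
    then have z: "cmod z < 1" by simp
    show ?case unfolding Re[OF z, symmetric] Im[OF z, symmetric] by simp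
  qed
  ultimately have "(v \<longlongrightarrow> Complex a b) (disk_to m)" by (rule Lim_transform_eventually)
  then show "\<exists>l. (v \<longlongrightarrow> l) (disk_to m)" by (rule exI)
qed

text \<open>Families of functions, built from weakly convergent families by kernel integrals, sums and
  products, all of whose derivatives converge pointwise.\<close>

inductive convergent_family :: "complex filter \<Rightarrow> (complex \<Rightarrow> complex \<Rightarrow> complex) \<Rightarrow> (complex \<Rightarrow> complex) \<Rightarrow> bool"
  for F where
  id: "convergent_family F (\<lambda>z w. w) (\<lambda>w. w)"
| cnj: "convergent_family F (\<lambda>z w. cnj w) (\<lambda>w. cnj w)"
| const: "convergent_family F (\<lambda>z w. c) (\<lambda>w. c)"
| kernel: "(\<forall>z\<in>disk. bounded_measurable (U z)) \<Longrightarrow> bounded_measurable V \<Longrightarrow>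
    (\<forall>k. integrable dA k \<longrightarrow> ((\<lambda>z. LINT w|dA. U z w * k w) \<longlongrightarrow> (LINT w|dA. V w * k w)) F) \<Longrightarrow>
    convergent_family F (\<lambda>z. kernel_integral (U z) p q) (kernel_integral V p q)"
| add: "convergent_family F f g \<Longrightarrow> convergent_family F f' g' \<Longrightarrow>
    convergent_family F (\<lambda>z w. f z w + f' z w) (\<lambda>w. g w + g' w)"
| mult: "convergent_family F f g \<Longrightarrow> convergent_family F f' g' \<Longrightarrow>
    convergent_family F (\<lambda>z w. f z w * f' z w) (\<lambda>w. g w * g' w)"

lemma convergent_family_kernel_polynomial:
  assumes "convergent_family F f g"
  shows "kernel_polynomial g" "z \<in> disk \<Longrightarrow> kernel_polynomial (f z)"
  using assms by (induction; auto intro: kernel_polynomial.intros)+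

lemma convergent_family_tendsto:
  assumes "convergent_family F f g" and w: "cmod w < 1"
  shows "((\<lambda>z. f z w) \<longlongrightarrow> g w) F"
  using assms(1)
proof induction
  case (kernel U V p q)
  have "integrable dA (\<lambda>x. 1 * power_kernel p q w x)" by (rule integrable_power_kernel[OF bounded_measurable_const w])
  then have "integrable dA (power_kernel p q w)" by simp
  then show ?case unfolding kernel_integral_def using kernel(3) by blast
qed (auto intro: tendsto_add tendsto_mult)

lemma integrable_bounded_mult:
  fixes k :: "complex \<Rightarrow> complex"
  assumes b: "bounded_measurable b" and k: "integrable dA k"
  shows "integrable dA (\<lambda>w. b w * k w)"
proof -
  obtain C where C: "0 \<le> C" "\<And>z. cmod z < 1 \<Longrightarrow> cmod (b z) \<le> C" using bounded_measurableE[OF b] by metis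
  have [measurable]: "b \<in> borel_measurable dA" "k \<in> borel_measurable dA"
    using bounded_measurable_imp_measurable[OF b] borel_measurable_integrable[OF k] by auto
  show ?thesis
  proof (rule Bochner_Integration.integrable_bound)
    show "integrable dA (\<lambda>w. C * cmod (k w))" using k by simp
    show "AE w in dA. norm (b w * k w) \<le> norm (C * cmod (k w))"
      using C by (intro AE_I2) (auto simp: norm_mult intro!: mult_right_mono)
  qed measurable
qed

lemma convergent_family_has_wirtinger:
  assumes "convergent_family F f g"
  shows "\<exists>a a' b b'. convergent_family F a a' \<and> convergent_family F b b' \<and>
    (\<forall>z\<in>disk. \<forall>w\<in>disk. has_wirtinger (f z) (a z w) (b z w) w) \<and> (\<forall>w\<in>disk. has_wirtinger g (a' w) (b' w) w)"
  using assms
proof induction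
  case id
  show ?case
    by (rule exI[of _ "\<lambda>_ _. 1"], rule exI[of _ "\<lambda>_. 1"], rule exI[of _ "\<lambda>_ _. 0"], rule exI[of _ "\<lambda>_. 0"])
      (auto intro: convergent_family.intros)
next
  case cnj
  have "has_wirtinger cnj 0 1 z" for z
    using has_wirtinger_cnj[OF has_wirtinger_id, of z] by simp
  then show ?case
    by (intro exI[of _ "\<lambda>_ _. 0"] exI[of _ "\<lambda>_ _. 1"] exI[of _ "\<lambda>_. 0"] exI[of _ "\<lambda>_. 1"])
      (auto intro: convergent_family.intros)
next
  case (const c)
  show ?case
    by (rule exI[of _ "\<lambda>_ _. 0"], rule exI[of _ "\<lambda>_. 0"], rule exI[of _ "\<lambda>_ _. 0"], rule exI[of _ "\<lambda>_. 0"])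
      (auto intro: convergent_family.intros)
next
  case (kernel U V p q)
  \<comment> \<open>Weak convergence is tested against all integrable \<open>k\<close>, so a bounded
    factor \<open>b\<close> can be moved to \<open>k\<close>; this keeps the kernel case closed
    under differentiation.\<close>
  have times: "convergent_family F (\<lambda>z. kernel_integral (\<lambda>w. U z w * b w) p' q') (kernel_integral (\<lambda>w. V w * b w) p' q')"
    if b: "bounded_measurable b" for b p' q'
  proof (rule convergent_family.kernel[where U = "\<lambda>z w. U z w * b w"])
    show "\<forall>z\<in>disk. bounded_measurable (\<lambda>w. U z w * b w)"
      using kernel(1) b by (intro ballI bounded_measurable_mult) auto
    show "bounded_measurable (\<lambda>w. V w * b w)" by (rule bounded_measurable_mult[OF kernel(2) b])
    show "\<forall>k. integrable dA k \<longrightarrow> ((\<lambda>z. LINT w|dA. U z w * b w * k w) \<longlongrightarrow> (LINT w|dA. V w * b w * k w)) F"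
    proof (intro allI impI)
      fix k :: "complex \<Rightarrow> complex" assume k: "integrable dA k"
      from kernel(3)[rule_format, OF integrable_bounded_mult[OF b k]]
      show "((\<lambda>z. LINT w|dA. U z w * b w * k w) \<longlongrightarrow> (LINT w|dA. V w * b w * k w)) F" by (simp only: mult.assoc)
    qed
  qed
  show ?case
  proof (intro exI conjI ballI)
    show "has_wirtinger (kernel_integral (U z) p q)
      (of_nat q * kernel_integral (\<lambda>w. U z w * cnj w) p (Suc q) w)
      (of_nat p * kernel_integral (\<lambda>w. U z w * w) (Suc p) q w) w" if "z \<in> disk" "w \<in> disk" for z w
      using kernel(1) that by (intro has_wirtinger_kernel_integral) auto
    show "has_wirtinger (kernel_integral V p q)
      (of_nat q * kernel_integral (\<lambda>w. V w * cnj w) p (Suc q) w)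
      (of_nat p * kernel_integral (\<lambda>w. V w * w) (Suc p) q w) w" if "w \<in> disk" for w
      using kernel(2) that by (intro has_wirtinger_kernel_integral) auto
  qed (intro convergent_family.mult convergent_family.const times bounded_measurable_cnj bounded_measurable_id)+
next
  case (add f g f' g')
  then obtain a aa b bb where h: "convergent_family F a aa" "convergent_family F b bb"
     "\<forall>z\<in>disk. \<forall>w\<in>disk. has_wirtinger (f z) (a z w) (b z w) w" "\<forall>w\<in>disk. has_wirtinger g (aa w) (bb w) w" by (elim exE conjE)
  from add obtain a' aa' b' bb' where h': "convergent_family F a' aa'" "convergent_family F b' bb'"
     "\<forall>z\<in>disk. \<forall>w\<in>disk. has_wirtinger (f' z) (a' z w) (b' z w) w" "\<forall>w\<in>disk. has_wirtinger g' (aa' w) (bb' w) w" by (elim exE conjE)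
  show ?case
  proof (intro exI conjI ballI)
    show "has_wirtinger (\<lambda>w. f z w + f' z w) (a z w + a' z w) (b z w + b' z w) w" if "z \<in> disk" "w \<in> disk" for z w
      using h h' that by (intro has_wirtinger_add) auto
    show "has_wirtinger (\<lambda>w. g w + g' w) (aa w + aa' w) (bb w + bb' w) w" if "w \<in> disk" for w
      using h h' that by (intro has_wirtinger_add) auto
  qed (intro convergent_family.add h h')+
next
  case (mult f g f' g')
  then obtain a aa b bb where h: "convergent_family F a aa" "convergent_family F b bb"
     "\<forall>z\<in>disk. \<forall>w\<in>disk. has_wirtinger (f z) (a z w) (b z w) w" "\<forall>w\<in>disk. has_wirtinger g (aa w) (bb w) w" by (elim exE conjE)
  from mult obtain a' aa' b' bb' where h': "convergent_family F a' aa'" "convergent_family F b' bb'"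
     "\<forall>z\<in>disk. \<forall>w\<in>disk. has_wirtinger (f' z) (a' z w) (b' z w) w" "\<forall>w\<in>disk. has_wirtinger g' (aa' w) (bb' w) w" by (elim exE conjE)
  show ?case
  proof (intro exI conjI ballI)
    show "has_wirtinger (\<lambda>w. f z w * f' z w) (f z w * a' z w + a z w * f' z w) (f z w * b' z w + b z w * f' z w) w" if "z \<in> disk" "w \<in> disk" for z w
      using h h' that by (intro has_wirtinger_mult) auto
    show "has_wirtinger (\<lambda>w. g w * g' w) (g w * aa' w + aa w * g' w) (g w * bb' w + bb w * g' w) w" if "w \<in> disk" for w
      using h h' that by (intro has_wirtinger_mult) auto
  qed (intro convergent_family.add convergent_family.mult h h' mult)+
qed

text \<open>The d-bar derivatives form a convergent family again, and so do their d-derivatives,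
  which are a quarter of the Laplacians.\<close>

lemma convergent_family_laplacian:
  assumes f: "convergent_family F f g" and F: "\<forall>\<^sub>F z in F. z \<in> disk" and w: "w \<in> disk"
  shows "((\<lambda>z. laplacian (f z) w) \<longlongrightarrow> laplacian g w) F"
proof -
  obtain a a' b b' where b: "convergent_family F b b'"
    and d: "\<forall>z\<in>disk. \<forall>w\<in>disk. has_wirtinger (f z) (a z w) (b z w) w" "\<forall>w\<in>disk. has_wirtinger g (a' w) (b' w) w"
    using convergent_family_has_wirtinger[OF f] by (elim exE conjE)
  obtain c c' e e' where c: "convergent_family F c c'"
    and d2: "\<forall>z\<in>disk. \<forall>w\<in>disk. has_wirtinger (b z) (c z w) (e z w) w" "\<forall>w\<in>disk. has_wirtinger b' (c' w) (e' w) w"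
    using convergent_family_has_wirtinger[OF b] by (elim exE conjE)
  have eq: "laplacian (f z) w = 4 * c z w" if "z \<in> disk" for z
    by (rule laplacian_eq[of disk w "f z" "a z" "b z" _ "e z w"]) (use d d2 that w in auto)
  have eq': "laplacian g w = 4 * c' w"
    by (rule laplacian_eq[of disk w g a' b' _ "e' w"]) (use d d2 w in auto)
  have "((\<lambda>z. 4 * c z w) \<longlongrightarrow> 4 * c' w) F"
    using convergent_family_tendsto[OF c, of w] w by (intro tendsto_mult tendsto_const) simp
  then have "((\<lambda>z. 4 * c z w) \<longlongrightarrow> laplacian g w) F" unfolding eq' .
  moreover have "\<forall>\<^sub>F z in F. 4 * c z w = laplacian (f z) w" using F by eventually_elim (simp add: eq)
  ultimately show ?thesis by (rule Lim_transform_eventually)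
qed

lemma convergent_family_berezin:
  assumes "\<forall>z\<in>disk. bounded_measurable (U z)" "bounded_measurable V"
    "\<forall>k. integrable dA k \<longrightarrow> ((\<lambda>z. LINT w|dA. U z w * k w) \<longlongrightarrow> (LINT w|dA. V w * k w)) F"
  shows "convergent_family F (\<lambda>z. berezin (U z)) (berezin V)"
proof -
  have "convergent_family F (\<lambda>z w. ((1 + (-1) * (w * cnj w)) * (1 + (-1) * (w * cnj w))) * kernel_integral (U z) 2 2 w)
    (\<lambda>w. ((1 + (-1) * (w * cnj w)) * (1 + (-1) * (w * cnj w))) * kernel_integral V 2 2 w)"
    by (intro convergent_family.mult convergent_family.add convergent_family.const convergent_family.id
        convergent_family.cnj convergent_family.kernel assms)
  then show ?thesis by (simp add: berezin_eq_kernel_integral power2_eq_square)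
qed

lemma convergent_family_sum_list:
  "(\<And>x. x \<in> set xs \<Longrightarrow> convergent_family F (f x) (g x)) \<Longrightarrow>
    convergent_family F (\<lambda>z w. \<Sum>x\<leftarrow>xs. f x z w) (\<lambda>w. \<Sum>x\<leftarrow>xs. g x w)"
  by (induction xs) (auto intro: convergent_family.const convergent_family.add)

lemma convergent_family_prod_list:
  "(\<And>x. x \<in> set xs \<Longrightarrow> convergent_family F (f x) (g x)) \<Longrightarrow>
    convergent_family F (\<lambda>z w. \<Prod>x\<leftarrow>xs. f x z w) (\<lambda>w. \<Prod>x\<leftarrow>xs. g x w)"
  by (induction xs) (auto intro: convergent_family.const convergent_family.mult)

text \<open>Moebius invariance of (1 - |z|^2)^2 times the Laplacian: a holomorphic substitution
  multiplies the Laplacian by |p w|^2, where \<open>p\<close> is the derivative of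
  \<open>phi z\<close>, and (1 - |w|^2) |p w| = 1 - |phi z w|^2.\<close>

lemma laplacian_phi:
  assumes f: "kernel_polynomial f" and z: "cmod z < 1" and w: "cmod w < 1"
  shows "of_real ((1 - (cmod w)\<^sup>2)\<^sup>2) * laplacian (\<lambda>x. f (phi z x)) w
    = of_real ((1 - (cmod (phi z w))\<^sup>2)\<^sup>2) * laplacian f (phi z w)"
proof -
  obtain a b where b: "kernel_polynomial b" and d: "\<forall>x\<in>disk. has_wirtinger f (a x) (b x) x"
    using kernel_polynomial_has_wirtinger[OF f] by blast
  obtain c e where d2: "\<forall>x\<in>disk. has_wirtinger b (c x) (e x) x"
    using kernel_polynomial_has_wirtinger[OF b] by blast
  define p where "p x = - (1 - (cmod z)\<^sup>2) / (1 - cnj z * x)\<^sup>2" for x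
  have p: "(phi z has_field_derivative p x) (at x)" if "x \<in> disk" for x
    unfolding p_def using has_field_derivative_phi[OF z, of x] that by simp
  have hol: "p holomorphic_on disk"
    unfolding p_def[abs_def] using one_minus_cnj_mult_nonzero[of z] z by (intro holomorphic_intros) auto
  have ph: "phi z x \<in> disk" if "x \<in> disk" for x using that z by simp
  have wd: "w \<in> disk" using w by simp
  have 1: "has_wirtinger (\<lambda>x. f (phi z x)) (a (phi z x) * p x) (b (phi z x) * cnj (p x)) x" if "x \<in> disk" for x
    by (rule has_wirtinger_compose[OF _ p[OF that]]) (use d ph that in blast)
  have 2: "has_wirtinger (\<lambda>x. b (phi z x)) (c (phi z w) * p w) (e (phi z w) * cnj (p w)) w"
    by (rule has_wirtinger_compose[OF _ p[OF wd]]) (use d2 ph wd in blast)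
  have 3: "has_wirtinger (\<lambda>x. cnj (p x)) (cnj 0) (cnj (deriv p w)) w"
    by (intro has_wirtinger_cnj has_wirtinger_field_derivative holomorphic_derivI[OF hol]) (use w in auto)
  have "laplacian (\<lambda>x. f (phi z x)) w = 4 * (b (phi z w) * cnj 0 + c (phi z w) * p w * cnj (p w))"
    by (rule laplacian_eq[OF open_ball wd 1 has_wirtinger_mult[OF 2 3]])
  also have "\<dots> = 4 * c (phi z w) * of_real ((cmod (p w))\<^sup>2)" by (simp add: complex_norm_square del: of_real_power)
  also have "4 * c (phi z w) = laplacian f (phi z w)"
    by (rule laplacian_eq[symmetric, of disk _ f a b _ "e (phi z w)"]) (use d d2 ph wd in auto)
  finally have L: "laplacian (\<lambda>x. f (phi z x)) w = laplacian f (phi z w) * of_real ((cmod (p w))\<^sup>2)" .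
  have "cmod (p w) = (1 - (cmod z)\<^sup>2) / (cmod (1 - cnj z * w))\<^sup>2"
  proof -
    have "p w = of_real (- (1 - (cmod z)\<^sup>2)) / (1 - cnj z * w)\<^sup>2" by (simp add: p_def)
    then have "cmod (p w) = \<bar>- (1 - (cmod z)\<^sup>2)\<bar> / (cmod (1 - cnj z * w))\<^sup>2"
      by (simp only: norm_divide norm_of_real norm_power)
    then show ?thesis using one_minus_square_pos[OF z] by simp
  qed
  then have "(1 - (cmod w)\<^sup>2) * cmod (p w) = 1 - (cmod (phi z w))\<^sup>2"
    unfolding one_minus_phi_norm[OF less_imp_le[OF z] w] by simp
  then have "(1 - (cmod (phi z w))\<^sup>2)\<^sup>2 = (1 - (cmod w)\<^sup>2)\<^sup>2 * (cmod (p w))\<^sup>2" by (simp only: power_mult_distrib[symmetric])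
  then show ?thesis unfolding L by (simp only: of_real_mult mult_ac)
qed

text \<open>Every harmonic factor equals its own Berezin transform, so \<open>u o phi z\<close>
  becomes a polynomial in kernel integrals of the factors composed with \<open>phi z\<close>. Such
  families converge together with their derivatives, which pointwise convergence of
  \<open>u o phi z\<close> alone would not give.\<close>

lemma part_laplacian:
  assumes u: "star_approximable u" and sp: "sum_of_products_of_bounded_harmonic u" and m: "m \<in> boundary_maxideals"
  shows "C2_on (on_part u m) disk"
    and "w \<in> disk \<Longrightarrow> ((\<lambda>z. complex_of_real ((1 - (cmod (phi z w))\<^sup>2)\<^sup>2) * laplacian u (phi z w)) \<longlongrightarrow>
      complex_of_real ((1 - (cmod w)\<^sup>2)\<^sup>2) * laplacian (on_part u m) w) (disk_to m)"
proof -
  note mm = boundary_maxidealsD(1,2)[OF m]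
  obtain vss where vss: "\<And>vs v. vs \<in> set vss \<Longrightarrow> v \<in> set vs \<Longrightarrow> bounded_harmonic v"
    and ueq: "\<And>z. z \<in> disk \<Longrightarrow> u z = (\<Sum>vs\<leftarrow>vss. \<Prod>v\<leftarrow>vs. v z)"
    using sp unfolding sum_of_products_of_bounded_harmonic_def by blast
  define f where "f z w = (\<Sum>vs\<leftarrow>vss. \<Prod>v\<leftarrow>vs. berezin (\<lambda>x. v (phi z x)) w)" for z w
  define g where "g w = (\<Sum>vs\<leftarrow>vss. \<Prod>v\<leftarrow>vs. berezin (on_part v m) w)" for w
  \<comment> \<open>Agrees with \<open>u\<close> on the disk, but is a
    \<open>kernel_polynomial\<close>, so that \<open>laplacian_phi\<close> applies to it.\<close>
  define P where "P w = (\<Sum>vs\<leftarrow>vss. \<Prod>v\<leftarrow>vs. berezin v w)" for w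
  have fam: "convergent_family (disk_to m) f g"
    unfolding f_def[abs_def] g_def[abs_def]
  proof (intro convergent_family_sum_list convergent_family_prod_list convergent_family_berezin ballI allI impI)
    fix vs v assume "vs \<in> set vss" "v \<in> set vs"
    then have s: "star_approximable v" by (intro bounded_harmonic_star_approximable vss)
    show "bounded_measurable (\<lambda>x. v (phi z x))" if "z \<in> disk" for z
      using that by (intro bounded_measurable_phi star_approximable_measurable s) simp
    show "bounded_measurable (on_part v m)" by (rule on_part_bounded_measurable[OF mm s])
    show "((\<lambda>z. LINT w|dA. v (phi z w) * k w) \<longlongrightarrow> (LINT w|dA. on_part v m w * k w)) (disk_to m)" if "integrable dA k" for k
      by (rule on_part_integral_tendsto[OF mm s that])
  qed
  have Pid: "convergent_family F (\<lambda>_. P) P" for F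
    unfolding P_def[abs_def]
    by (intro convergent_family_sum_list convergent_family_prod_list convergent_family_berezin ballI allI impI tendsto_const)
      (auto intro: bounded_harmonic_measurable vss)
  have kP: "kernel_polynomial P" by (rule convergent_family_kernel_polynomial(1)[OF Pid])
  have P: "P z = u z" if "z \<in> disk" for z
    unfolding P_def ueq[OF that]
    by (intro arg_cong[where f = sum_list] arg_cong[where f = prod_list] map_cong refl berezin_harmonic vss) (use that in auto)
  have f: "f z w = P (phi z w)" if z: "z \<in> disk" and w: "w \<in> disk" for z w
    unfolding f_def P_def
  proof (intro arg_cong[where f = sum_list] arg_cong[where f = prod_list] map_cong refl)
    fix vs v assume "vs \<in> set vss" "v \<in> set vs"
    then have "bounded_measurable v" by (intro bounded_harmonic_measurable vss)
    then show "berezin (\<lambda>x. v (phi z x)) w = berezin v (phi z w)"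
      unfolding berezin_eq_radial_op using z w by (intro radial_op_phi) (auto intro: bounded_measurable_imp_measurable)
  qed
  have ug: "on_part u m w = g w" if w: "w \<in> disk" for w
  proof (rule on_part_eqI[OF mm])
    have lim: "((\<lambda>z. f z w) \<longlongrightarrow> g w) (disk_to m)" by (rule convergent_family_tendsto[OF fam]) (use w in simp)
    have "\<forall>\<^sub>F z in disk_to m. f z w = u (phi z w)"
      using eventually_disk_to[OF mm(1)] by eventually_elim (use w in \<open>simp add: f P\<close>)
    with lim show "((\<lambda>z. u (phi z w)) \<longlongrightarrow> g w) (disk_to m)" by (rule Lim_transform_eventually)
  qed
  have kg: "kernel_polynomial g" by (rule convergent_family_kernel_polynomial(1)[OF fam])
  have lap: "laplacian h x = laplacian k x" if k: "kernel_polynomial k" and hk: "\<And>y. y \<in> disk \<Longrightarrow> h y = k y" and x: "x \<in> disk" for h k x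
  proof -
    obtain a b where b: "kernel_polynomial b" and d: "\<forall>x\<in>disk. has_wirtinger k (a x) (b x) x"
      using kernel_polynomial_has_wirtinger[OF k] by blast
    obtain c e where d2: "\<forall>x\<in>disk. has_wirtinger b (c x) (e x) x"
      using kernel_polynomial_has_wirtinger[OF b] by blast
    show ?thesis by (rule laplacian_cong[of disk x h k a b "c x" "e x"]) (use hk d d2 x in auto)
  qed
  show "C2_on (on_part u m) disk" by (rule C2_on_cong[OF open_ball kernel_polynomial_C2[OF kg] ug[symmetric]])
  assume w: "w \<in> disk"
  have "((\<lambda>z. of_real ((1 - (cmod w)\<^sup>2)\<^sup>2) * laplacian (f z) w) \<longlongrightarrow> of_real ((1 - (cmod w)\<^sup>2)\<^sup>2) * laplacian g w) (disk_to m)"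
    by (intro tendsto_mult tendsto_const convergent_family_laplacian[OF fam eventually_disk_to[OF mm(1)] w])
  moreover have "laplacian g w = laplacian (on_part u m) w" by (rule lap[OF kg ug w, symmetric])
  moreover have "\<forall>\<^sub>F z in disk_to m. of_real ((1 - (cmod w)\<^sup>2)\<^sup>2) * laplacian (f z) w
      = complex_of_real ((1 - (cmod (phi z w))\<^sup>2)\<^sup>2) * laplacian u (phi z w)"
    using eventually_disk_to[OF mm(1)]
  proof eventually_elim
    case (elim z)
    have z: "cmod z < 1" "cmod w < 1" using elim w by auto
    have "laplacian (\<lambda>x. P (phi z x)) w = laplacian (f z) w"
      by (rule lap[OF convergent_family_kernel_polynomial(2)[OF fam elim] f[OF elim, symmetric] w])
    moreover have "laplacian u (phi z w) = laplacian P (phi z w)" by (rule lap[OF kP]) (use P z in auto)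
    ultimately show ?case using laplacian_phi[OF kP z] by simp
  qed
  ultimately show "((\<lambda>z. complex_of_real ((1 - (cmod (phi z w))\<^sup>2)\<^sup>2) * laplacian u (phi z w)) \<longlongrightarrow>
      complex_of_real ((1 - (cmod w)\<^sup>2)\<^sup>2) * laplacian (on_part u m) w) (disk_to m)"
    by (simp add: Lim_transform_eventually)
qed

text \<open>Along \<open>phi z w\<close> the expression in (h) tends to the invariant Laplacian of
  \<open>u\<close> on the part at \<open>w\<close>. Its vanishing at w = 0 for all \<open>m\<close>
  is the boundary limit, its vanishing at all \<open>w\<close> is harmonicity, and
  \<open>berezin_limit_iff_HOP\<close> connects the latter with (a).\<close>

theorem berezin_limit_iff_laplacian:
  assumes u: "star_approximable u" and sp: "sum_of_products_of_bounded_harmonic u"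
  shows "((\<lambda>z. berezin u z - u z) \<longlongrightarrow> 0) to_boundary \<longleftrightarrow>
    ((\<lambda>z. complex_of_real ((1 - (cmod z)\<^sup>2)\<^sup>2) * laplacian u z) \<longlongrightarrow> 0) to_boundary"
proof -
  define L where "L z = complex_of_real ((1 - (cmod z)\<^sup>2)\<^sup>2) * laplacian u z" for z
  have lim: "((\<lambda>z. L (phi z w)) \<longlongrightarrow> complex_of_real ((1 - (cmod w)\<^sup>2)\<^sup>2) * laplacian (on_part u m) w) (disk_to m)"
    if "m \<in> boundary_maxideals" "w \<in> disk" for m w
    unfolding L_def by (rule part_laplacian(2)[OF u sp that])
  have "u \<in> HOP \<longleftrightarrow> (L \<longlongrightarrow> 0) to_boundary"
    unfolding HOP_iff[OF u]
  proof
    assume h: "\<forall>m\<in>boundary_maxideals. harmonic_on_disk (on_part u m)"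
    show "(L \<longlongrightarrow> 0) to_boundary"
    proof (rule tendsto_boundary_0I)
      fix m assume m: "m \<in> boundary_maxideals"
      have "laplacian (on_part u m) 0 = 0" using h m by (simp add: harmonic_on_disk_def)
      then show "(L \<longlongrightarrow> 0) (disk_to m)" using lim[OF m, of 0] by simp
    qed
  next
    assume L: "(L \<longlongrightarrow> 0) to_boundary"
    show "\<forall>m\<in>boundary_maxideals. harmonic_on_disk (on_part u m)"
      unfolding harmonic_on_disk_def
    proof (intro ballI conjI)
      fix m assume m: "m \<in> boundary_maxideals"
      show "C2_on (on_part u m) disk" by (rule part_laplacian(1)[OF u sp m])
      fix w :: complex assume w: "w \<in> disk"
      then have w1: "cmod w < 1" by simp
      have "complex_of_real ((1 - (cmod w)\<^sup>2)\<^sup>2) * laplacian (on_part u m) w = 0"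
        using on_part_eqI[OF boundary_maxidealsD(1,2)[OF m] lim[OF m w]] tendsto_boundary_0D[OF L m w1] by simp
      moreover have "(1 - (cmod w)\<^sup>2)\<^sup>2 \<noteq> 0" using one_minus_square_pos[OF w1] by simp
      ultimately show "laplacian (on_part u m) w = 0" by (simp del: of_real_power of_real_diff)
    qed
  qed
  then show ?thesis using berezin_limit_iff_HOP[OF u] unfolding L_def[abs_def] by simp
qed

theorem theorem3p10:
  fixes u :: "complex \<Rightarrow> complex"
  assumes "u \<in> algU"
  shows
    "(((\<lambda>z. berezin u z - u z) \<longlongrightarrow> 0) to_boundary \<longleftrightarrow>
        (\<forall>m \<in> maxideals - point_eval ` disk. extend (berezin u) m = extend u m)) \<and>
     (((\<lambda>z. berezin u z - u z) \<longlongrightarrow> 0) to_boundary \<longleftrightarrow>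
        u \<in> HOP) \<and>
     (((\<lambda>z. berezin u z - u z) \<longlongrightarrow> 0) to_boundary \<longleftrightarrow>
        berezin u \<in> HOP) \<and>
     (((\<lambda>z. berezin u z - u z) \<longlongrightarrow> 0) to_boundary \<longleftrightarrow>
        compact_on_bergman (\<lambda>f z. toeplitz (berezin u) f z - toeplitz u f z)) \<and>
     (((\<lambda>z. berezin u z - u z) \<longlongrightarrow> 0) to_boundary \<longleftrightarrow>
        ((\<lambda>z. LINT w|dA. u (disk_involution z w) * complex_of_real (2 * (cmod w)\<^sup>2 - 1)) \<longlongrightarrow> 0) to_boundary) \<and>
     (((\<lambda>z. berezin u z - u z) \<longlongrightarrow> 0) to_boundary \<longleftrightarrow>
        ((\<lambda>z. complex_of_real ((1 - (cmod z)\<^sup>2)\<^sup>2) * laplacian (berezin u) z) \<longlongrightarrow> 0) to_boundary) \<and>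
     (sum_of_products_of_bounded_harmonic u \<longrightarrow>
       (((\<lambda>z. berezin u z - u z) \<longlongrightarrow> 0) to_boundary \<longleftrightarrow>
        ((\<lambda>z. complex_of_real ((1 - (cmod z)\<^sup>2)\<^sup>2) * laplacian u z) \<longlongrightarrow> 0) to_boundary))"
proof -
  have u: "star_approximable u" by (rule algU_imp_star_approximable[OF assms])
  show ?thesis
    by (intro conjI impI berezin_limit_iff_extend berezin_limit_iff_HOP berezin_limit_iff_berezin_HOP
        berezin_limit_iff_compact berezin_limit_iff_integral berezin_limit_iff_laplacian_berezin
        berezin_limit_iff_laplacian u)
qed

end
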